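(* Suppose the quiver is of finite type (the symmetric Cartan matrix $C$ is of finite type), let $d,v\in\mathbb N^n$ and suppose that $d-v$ is a regular weight, i.e. $\langle d-v,\alpha_i^\vee\rangle=d_i-\sum_jc_{ij}v_j>0$ for all $i\in I$. Then the smooth quiver variety $M(d,v)=M_{m,0}(d,v)$, with $m=(1,\dots,1)$, is connected, and the variety $M_0(d,v)=M_{0,0}(d,v)$ is normal.
   Context: **Quiver.** $I=\{1,\dots,n\}$ vertices, $H$ a finite set of arrows with source and target maps $h\mapsto h_0,h_1$, $h_0\ne h_1$; a fixed-point-free involution $h\mapsto\bar h$ with $\bar h_0=h_1$, $\bar h_1=h_0$; $\varepsilon:H\to\{\pm1\}$ with $\varepsilon(\bar h)=-\varepsilon(h)$. $a_{ij}=\#\{h:h_0=i,h_1=j\}$, $C=(c_{ij})=2\,\mathrm{Id}-(a_{ij})$. Here $d=\sum d_i\omega_i$ and $v=\sum v_i\alpha_i$, with $\alpha_i$ simple roots, $\alpha_i^\vee$ simple coroots, $\langle\alpha_i,\alpha_j^\vee\rangle=c_{ij}$, $\langle\omega_i,\alpha_j^\vee\rangle=\delta_{ij}$. **Quiver varieties.** Fix complex vector spaces $D_i,V_i$ of dimensions $d_i,v_i$; $S(d,v)=\bigoplus_i\mathrm{Hom}(D_i,V_i)\oplus\bigoplus_i\mathrm{Hom}(V_i,D_i)\oplus\bigoplus_h\mathrm{Hom}(V_{h_0},V_{h_1})\ni(B,\gamma,\delta)$; $G_v=\prod GL(V_i)$ acts by $g(B_h,\gamma_i,\delta_i)=(g_{h_1}B_hg_{h_0}^{-1},g_i\gamma_i,\delta_ig_i^{-1})$.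 $\mu_i(s)=\sum_{h_1=i}\varepsilon(h)B_hB_{\bar h}+\gamma_i\delta_i$ and $\Lambda_0(d,v)=\{s:\mu_i(s)=0\ \forall i\}$. For $m\in\mathbb Z^n$ let $\chi_m=\prod\det_{GL(V_i)}^{m_i}$; $s\in\Lambda_0$ is $\chi_m$-semistable if there are $k>0$ and a regular function $f$ on $\Lambda_0$ with $f(gx)=\chi_m(g)^kf(x)$ for all $g,x$ and $f(s)\neq0$. $\Lambda_{m,0}(d,v)$ is the set of $\chi_m$-semistable points of $\Lambda_0(d,v)$ and $M_{m,0}(d,v)=\Lambda_{m,0}(d,v)/\!/G_v$ (good quotient); for $m=0$, $M_{0,0}(d,v)=\mathrm{Spec}\,\mathbb C[\Lambda_0(d,v)]^{G_v}$. *)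

theory Defs
  imports
    "HOL-Analysis.Abstract_Topology"
    "HOL-Algebra.Ideal"
    "Jordan_Normal_Form.Determinant"
begin

section \<open>Complex varieties as spaces with functions\<close>

text \<open>
  Varieties are classical (reduced, closed points only): a space with functions is a topological
  space with, for each open set U, a set of complex valued functions on U, represented by
  functions that are extensional outside U.
\<close>

inductive_set polyfuns :: "('p \<Rightarrow> complex) set \<Rightarrow> ('p \<Rightarrow> complex) set"
  for K :: "('p \<Rightarrow> complex) set"
where
  const: "(\<lambda>_. c) \<in> polyfuns K"
| coord: "f \<in> K \<Longrightarrow> f \<in> polyfuns K"
| add: "f \<in> polyfuns K \<Longrightarrow> g \<in> polyfuns K \<Longrightarrow> (\<lambda>x. f x + g x) \<in> polyfuns K"
| mult: "f \<in> polyfuns K \<Longrightarrow> g \<in> polyfuns K \<Longrightarrow> (\<lambda>x. f x * g x) \<in> polyfuns K"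

text \<open>The principal open sets below are stable under finite intersection, so they are a basis.\<close>

definition zariski :: "('p \<Rightarrow> complex) set \<Rightarrow> 'p set \<Rightarrow> 'p topology" where
  "zariski K X = topology_generated_by {{x \<in> X. f x \<noteq> 0} |f. f \<in> polyfuns K}"

definition regular_functions :: "('p \<Rightarrow> complex) set \<Rightarrow> 'p set \<Rightarrow> 'p set \<Rightarrow> ('p \<Rightarrow> complex) set" where
  "regular_functions K X U =
     {f \<in> extensional U. \<forall>x\<in>U. \<exists>W. openin (zariski K X) W \<and> x \<in> W \<and> W \<subseteq> U \<and>
        (\<exists>p\<in>polyfuns K. \<exists>q\<in>polyfuns K. \<forall>y\<in>W. q y \<noteq> 0 \<and> f y = p y / q y)}"

record 'p fspace =
  ftop :: "'p topology"
  reg :: "'p set \<Rightarrow> ('p \<Rightarrow> complex) set"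

text \<open>A locally closed subset X of an affine space with set of coordinate functions K.\<close>

definition embedded :: "('p \<Rightarrow> complex) set \<Rightarrow> 'p set \<Rightarrow> 'p fspace" where
  "embedded K X = \<lparr>ftop = zariski K X, reg = regular_functions K X\<rparr>"

definition open_subspace :: "'p fspace \<Rightarrow> 'p set \<Rightarrow> 'p fspace" where
  "open_subspace X U = \<lparr>ftop = subtopology (ftop X) U, reg = reg X\<rparr>"

definition preimage :: "'p fspace \<Rightarrow> ('p \<Rightarrow> 'q) \<Rightarrow> 'q set \<Rightarrow> 'p set" where
  "preimage X \<phi> U = {x \<in> topspace (ftop X). \<phi> x \<in> U}"

definition pullback :: "'p fspace \<Rightarrow> ('p \<Rightarrow> 'q) \<Rightarrow> 'q set \<Rightarrow> ('q \<Rightarrow> complex) \<Rightarrow> ('p \<Rightarrow> complex)" where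
  "pullback X \<phi> U f = restrict (f \<circ> \<phi>) (preimage X \<phi> U)"

definition fspace_iso :: "'p fspace \<Rightarrow> 'q fspace \<Rightarrow> ('p \<Rightarrow> 'q) \<Rightarrow> bool" where
  "fspace_iso X Y \<phi> \<longleftrightarrow>
     homeomorphic_map (ftop X) (ftop Y) \<phi> \<and>
     (\<forall>U. openin (ftop Y) U \<longrightarrow> bij_betw (pullback X \<phi> U) (reg Y U) (reg X (preimage X \<phi> U)))"

definition affine_coords :: "nat \<Rightarrow> ((nat \<Rightarrow> complex) \<Rightarrow> complex) set" where
  "affine_coords N = {\<lambda>x. x i |i. i < N}"

definition affine_algebraic_set :: "nat \<Rightarrow> ((nat \<Rightarrow> complex) \<Rightarrow> complex) set \<Rightarrow> (nat \<Rightarrow> complex) set" where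
  "affine_algebraic_set N F = {x \<in> {..<N} \<rightarrow>\<^sub>E UNIV. \<forall>f\<in>F. f x = 0}"

definition affine_variety :: "'p fspace \<Rightarrow> bool" where
  "affine_variety X \<longleftrightarrow>
     (\<exists>N F \<phi>. F \<subseteq> polyfuns (affine_coords N) \<and>
        fspace_iso (embedded (affine_coords N) (affine_algebraic_set N F)) X \<phi>)"

definition sheaf_of_functions :: "'p fspace \<Rightarrow> bool" where
  "sheaf_of_functions X \<longleftrightarrow>
     (\<forall>U. openin (ftop X) U \<longrightarrow>
        reg X U = {f \<in> extensional U. \<forall>x\<in>U. \<exists>W. openin (ftop X) W \<and> x \<in> W \<and> W \<subseteq> U \<and>
                     restrict f W \<in> reg X W})"

definition open_affine :: "'p fspace \<Rightarrow> 'p set \<Rightarrow> bool" where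
  "open_affine X U \<longleftrightarrow> openin (ftop X) U \<and> affine_variety (open_subspace X U)"

definition prevariety :: "'p fspace \<Rightarrow> bool" where
  "prevariety X \<longleftrightarrow> sheaf_of_functions X \<and>
     (\<exists>C. finite C \<and> (\<forall>U\<in>C. open_affine X U) \<and> \<Union>C = topspace (ftop X))"

definition affine_morphism :: "'p fspace \<Rightarrow> 'q fspace \<Rightarrow> ('p \<Rightarrow> 'q) \<Rightarrow> bool" where
  "affine_morphism X Y \<phi> \<longleftrightarrow> (\<forall>U. open_affine Y U \<longrightarrow> open_affine X (preimage X \<phi> U))"

definition invariant_functions ::
    "'g set \<Rightarrow> ('g \<Rightarrow> 'p \<Rightarrow> 'p) \<Rightarrow> 'p set \<Rightarrow> ('p \<Rightarrow> complex) set \<Rightarrow> ('p \<Rightarrow> complex) set" where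
  "invariant_functions G act X A = {f \<in> A. \<forall>g\<in>G. \<forall>x\<in>X. f (act g x) = f x}"

definition closed_invariant :: "'g set \<Rightarrow> ('g \<Rightarrow> 'p \<Rightarrow> 'p) \<Rightarrow> 'p fspace \<Rightarrow> 'p set \<Rightarrow> bool" where
  "closed_invariant G act X W \<longleftrightarrow> closedin (ftop X) W \<and> (\<forall>g\<in>G. act g ` W \<subseteq> W)"

text \<open>Good quotients in the sense of Seshadri.\<close>

definition good_quotient ::
    "'g set \<Rightarrow> ('g \<Rightarrow> 'p \<Rightarrow> 'p) \<Rightarrow> 'p fspace \<Rightarrow> 'y fspace \<Rightarrow> ('p \<Rightarrow> 'y) \<Rightarrow> bool" where
  "good_quotient G act X Y \<pi> \<longleftrightarrow>
     prevariety Y \<and>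
     continuous_map (ftop X) (ftop Y) \<pi> \<and>
     \<pi> ` topspace (ftop X) = topspace (ftop Y) \<and>
     (\<forall>g\<in>G. \<forall>x\<in>topspace (ftop X). \<pi> (act g x) = \<pi> x) \<and>
     affine_morphism X Y \<pi> \<and>
     (\<forall>U. openin (ftop Y) U \<longrightarrow>
        bij_betw (pullback X \<pi> U) (reg Y U)
          (invariant_functions G act (preimage X \<pi> U) (reg X (preimage X \<pi> U)))) \<and>
     (\<forall>W. closed_invariant G act X W \<longrightarrow> closedin (ftop Y) (\<pi> ` W)) \<and>
     (\<forall>W W'. closed_invariant G act X W \<and> closed_invariant G act X W' \<and> W \<inter> W' = {} \<longrightarrow>
        \<pi> ` W \<inter> \<pi> ` W' = {})"

section \<open>Normality of the spectrum of a ring\<close>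

text \<open>The fraction a/s in the localization of R at the multiplicative set S, as a class of pairs.\<close>

definition fraction :: "('a, 'b) ring_scheme \<Rightarrow> 'a set \<Rightarrow> 'a \<Rightarrow> 'a \<Rightarrow> ('a \<times> 'a) set" where
  "fraction R S a s =
     {(b, t). b \<in> carrier R \<and> t \<in> S \<and>
        (\<exists>u\<in>S. u \<otimes>\<^bsub>R\<^esub> (a \<otimes>\<^bsub>R\<^esub> t \<ominus>\<^bsub>R\<^esub> b \<otimes>\<^bsub>R\<^esub> s) = \<zero>\<^bsub>R\<^esub>)}"

definition localization :: "('a, 'b) ring_scheme \<Rightarrow> 'a set \<Rightarrow> ('a \<times> 'a) set ring" where
  "localization R S =
     \<lparr>carrier = {fraction R S a s |a s. a \<in> carrier R \<and> s \<in> S},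
      Group.monoid.mult = (\<lambda>X Y. \<Union>(a, s)\<in>X. \<Union>(b, t)\<in>Y. fraction R S (a \<otimes>\<^bsub>R\<^esub> b) (s \<otimes>\<^bsub>R\<^esub> t)),
      one = fraction R S \<one>\<^bsub>R\<^esub> \<one>\<^bsub>R\<^esub>,
      zero = fraction R S \<zero>\<^bsub>R\<^esub> \<one>\<^bsub>R\<^esub>,
      add = (\<lambda>X Y. \<Union>(a, s)\<in>X. \<Union>(b, t)\<in>Y.
               fraction R S (a \<otimes>\<^bsub>R\<^esub> t \<oplus>\<^bsub>R\<^esub> b \<otimes>\<^bsub>R\<^esub> s) (s \<otimes>\<^bsub>R\<^esub> t))\<rparr>"

definition integral_over :: "('a, 'b) ring_scheme \<Rightarrow> 'a set \<Rightarrow> 'a \<Rightarrow> bool" where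
  "integral_over R A x \<longleftrightarrow>
     (\<exists>(n::nat) a. a \<in> {..<n} \<rightarrow> A \<and>
        x [^]\<^bsub>R\<^esub> n \<oplus>\<^bsub>R\<^esub> (\<Oplus>\<^bsub>R\<^esub>i\<in>{..<n}. a i \<otimes>\<^bsub>R\<^esub> x [^]\<^bsub>R\<^esub> i) = \<zero>\<^bsub>R\<^esub>)"

definition integrally_closed_domain :: "('a, 'b) ring_scheme \<Rightarrow> bool" where
  "integrally_closed_domain R \<longleftrightarrow> domain R \<and>
     (let S = carrier R - {\<zero>\<^bsub>R\<^esub>}; K = localization R S; A = (\<lambda>r. fraction R S r \<one>\<^bsub>R\<^esub>) ` carrier R
      in \<forall>x\<in>carrier K. integral_over K A x \<longrightarrow> x \<in> A)"

text \<open>Normality of Spec R: all its local rings are integrally closed domains.\<close>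

definition normal_spec :: "('a, 'b) ring_scheme \<Rightarrow> bool" where
  "normal_spec R \<longleftrightarrow>
     (\<forall>P. primeideal P R \<longrightarrow> integrally_closed_domain (localization R (carrier R - P)))"

section \<open>Quivers\<close>

record 'h dquiver =
  nverts :: nat
  arrows :: "'h set"
  src :: "'h \<Rightarrow> nat"
  tgt :: "'h \<Rightarrow> nat"
  bar :: "'h \<Rightarrow> 'h"
  eps :: "'h \<Rightarrow> int"

definition verts :: "'h dquiver \<Rightarrow> nat set" where
  "verts Q = {1..nverts Q}"

definition double_quiver :: "'h dquiver \<Rightarrow> bool" where
  "double_quiver Q \<longleftrightarrow> finite (arrows Q) \<and>
     (\<forall>h\<in>arrows Q. src Q h \<in> verts Q \<and> tgt Q h \<in> verts Q \<and> src Q h \<noteq> tgt Q h \<and>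
        bar Q h \<in> arrows Q \<and> bar Q h \<noteq> h \<and> bar Q (bar Q h) = h \<and>
        src Q (bar Q h) = tgt Q h \<and> tgt Q (bar Q h) = src Q h \<and>
        eps Q h \<in> {1, -1} \<and> eps Q (bar Q h) = - eps Q h)"

definition cartan :: "'h dquiver \<Rightarrow> nat \<Rightarrow> nat \<Rightarrow> int" where
  "cartan Q i j =
     (if i = j then 2 else 0) - int (card {h \<in> arrows Q. src Q h = i \<and> tgt Q h = j})"

text \<open>
  A symmetric generalized Cartan matrix, not necessarily indecomposable, is of finite type if it
  is positive definite.
\<close>

definition finite_type :: "'h dquiver \<Rightarrow> bool" where
  "finite_type Q \<longleftrightarrow>
     (\<forall>x::nat \<Rightarrow> real. (\<exists>i\<in>verts Q. x i \<noteq> 0) \<longrightarrow>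
        (\<Sum>i\<in>verts Q. \<Sum>j\<in>verts Q. of_int (cartan Q i j) * x i * x j) > 0)"

text \<open>The pairing of d - v, where d is a combination of fundamental weights and v of simple roots,
  with the i-th simple coroot.\<close>

definition weight_pairing :: "'h dquiver \<Rightarrow> (nat \<Rightarrow> nat) \<Rightarrow> (nat \<Rightarrow> nat) \<Rightarrow> nat \<Rightarrow> int" where
  "weight_pairing Q d v i = int (d i) - (\<Sum>j\<in>verts Q. cartan Q i j * int (v j))"

section \<open>Quiver varieties\<close>

text \<open>The spaces D(i) and V(i) are the standard ones of dimension d i and v i, so linear maps between
  them are matrices.\<close>

type_synonym 'h qpoint =
  "('h \<Rightarrow> complex mat) \<times> (nat \<Rightarrow> complex mat) \<times> (nat \<Rightarrow> complex mat)"

definition rep_space :: "'h dquiver \<Rightarrow> (nat \<Rightarrow> nat) \<Rightarrow> (nat \<Rightarrow> nat) \<Rightarrow> 'h qpoint set" where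
  "rep_space Q d v =
     (\<Pi>\<^sub>E h\<in>arrows Q. carrier_mat (v (tgt Q h)) (v (src Q h))) \<times>
     (\<Pi>\<^sub>E i\<in>verts Q. carrier_mat (v i) (d i)) \<times>
     (\<Pi>\<^sub>E i\<in>verts Q. carrier_mat (d i) (v i))"

definition rep_coords :: "'h dquiver \<Rightarrow> (nat \<Rightarrow> nat) \<Rightarrow> (nat \<Rightarrow> nat) \<Rightarrow> ('h qpoint \<Rightarrow> complex) set" where
  "rep_coords Q d v =
     {\<lambda>(B, \<gamma>, \<delta>). B h $$ (r, c) |h r c. h \<in> arrows Q \<and> r < v (tgt Q h) \<and> c < v (src Q h)} \<union>
     {\<lambda>(B, \<gamma>, \<delta>). \<gamma> i $$ (r, c) |i r c. i \<in> verts Q \<and> r < v i \<and> c < d i} \<union>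
     {\<lambda>(B, \<gamma>, \<delta>). \<delta> i $$ (r, c) |i r c. i \<in> verts Q \<and> r < d i \<and> c < v i}"

definition GL :: "nat \<Rightarrow> complex mat monoid" where
  "GL k = units_of (ring_mat TYPE(complex) k ())"

definition gauge_group :: "'h dquiver \<Rightarrow> (nat \<Rightarrow> nat) \<Rightarrow> (nat \<Rightarrow> complex mat) set" where
  "gauge_group Q v = (\<Pi>\<^sub>E i\<in>verts Q. carrier (GL (v i)))"

definition gauge_act ::
    "'h dquiver \<Rightarrow> (nat \<Rightarrow> nat) \<Rightarrow> (nat \<Rightarrow> complex mat) \<Rightarrow> 'h qpoint \<Rightarrow> 'h qpoint" where
  "gauge_act Q v g = (\<lambda>(B, \<gamma>, \<delta>).
     (\<lambda>h\<in>arrows Q. g (tgt Q h) * B h * inv\<^bsub>GL (v (src Q h))\<^esub> g (src Q h),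
      \<lambda>i\<in>verts Q. g i * \<gamma> i,
      \<lambda>i\<in>verts Q. \<delta> i * inv\<^bsub>GL (v i)\<^esub> g i))"

definition moment :: "'h dquiver \<Rightarrow> (nat \<Rightarrow> nat) \<Rightarrow> 'h qpoint \<Rightarrow> nat \<Rightarrow> complex mat" where
  "moment Q v = (\<lambda>(B, \<gamma>, \<delta>) i.
     (\<Oplus>\<^bsub>ring_mat TYPE(complex) (v i) ()\<^esub>h\<in>{h \<in> arrows Q. tgt Q h = i}.
        of_int (eps Q h) \<cdot>\<^sub>m (B h * B (bar Q h))) + \<gamma> i * \<delta> i)"

definition Lambda0 :: "'h dquiver \<Rightarrow> (nat \<Rightarrow> nat) \<Rightarrow> (nat \<Rightarrow> nat) \<Rightarrow> 'h qpoint set" where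
  "Lambda0 Q d v = {s \<in> rep_space Q d v. \<forall>i\<in>verts Q. moment Q v s i = 0\<^sub>m (v i) (v i)}"

definition Lambda0_functions ::
    "'h dquiver \<Rightarrow> (nat \<Rightarrow> nat) \<Rightarrow> (nat \<Rightarrow> nat) \<Rightarrow> ('h qpoint \<Rightarrow> complex) set" where
  "Lambda0_functions Q d v = (\<lambda>f. restrict f (Lambda0 Q d v)) ` polyfuns (rep_coords Q d v)"

definition character :: "'h dquiver \<Rightarrow> (nat \<Rightarrow> int) \<Rightarrow> (nat \<Rightarrow> complex mat) \<Rightarrow> complex" where
  "character Q m g = (\<Prod>i\<in>verts Q. det (g i) powi m i)"

definition semistable ::
    "'h dquiver \<Rightarrow> (nat \<Rightarrow> int) \<Rightarrow> (nat \<Rightarrow> nat) \<Rightarrow> (nat \<Rightarrow> nat) \<Rightarrow> 'h qpoint set" where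
  "semistable Q m d v =
     {s \<in> Lambda0 Q d v. \<exists>(k::nat)>0. \<exists>f\<in>Lambda0_functions Q d v.
        (\<forall>g\<in>gauge_group Q v. \<forall>x\<in>Lambda0 Q d v.
           f (gauge_act Q v g x) = character Q m g ^ k * f x) \<and>
        f s \<noteq> 0}"

text \<open>
  M is the quiver variety with stability parameter m, and pi the quotient map. A good quotient is
  unique up to unique isomorphism, so no particular model is chosen.
\<close>

definition is_quiver_variety ::
    "'h dquiver \<Rightarrow> (nat \<Rightarrow> int) \<Rightarrow> (nat \<Rightarrow> nat) \<Rightarrow> (nat \<Rightarrow> nat) \<Rightarrow>
     'y fspace \<Rightarrow> ('h qpoint \<Rightarrow> 'y) \<Rightarrow> bool" where
  "is_quiver_variety Q m d v M \<pi> \<longleftrightarrow>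
     good_quotient (gauge_group Q v) (gauge_act Q v)
       (embedded (rep_coords Q d v) (semistable Q m d v)) M \<pi>"

definition invariant_ring ::
    "'h dquiver \<Rightarrow> (nat \<Rightarrow> nat) \<Rightarrow> (nat \<Rightarrow> nat) \<Rightarrow> ('h qpoint \<Rightarrow> complex) ring" where
  "invariant_ring Q d v =
     \<lparr>carrier = invariant_functions (gauge_group Q v) (gauge_act Q v) (Lambda0 Q d v)
                  (Lambda0_functions Q d v),
      Group.monoid.mult = (\<lambda>f g. \<lambda>x\<in>Lambda0 Q d v. f x * g x),
      one = (\<lambda>x\<in>Lambda0 Q d v. 1),
      zero = (\<lambda>x\<in>Lambda0 Q d v. 0),
      add = (\<lambda>f g. \<lambda>x\<in>Lambda0 Q d v. f x + g x)\<rparr>"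

end

theory Submission
  imports
    Defs
    "HOL-Computational_Algebra.Fundamental_Theorem_Algebra"
    "HOL-Analysis.Continuum_Not_Denumerable"
    "Jordan_Normal_Form.Char_Poly"
begin

text \<open>
  Both claims concern the zero set \<Lambda> of the moment map: it is irreducible (Lambda0_domain), and its coordinate
  ring is integrally closed (Lambda0_integrally_closed). The semistable points form an open subset of \<Lambda>,
  which is therefore connected, and so is its image M. If a = b q on \<Lambda> with invariant a and b, and b does not
  vanish identically, then q is invariant by irreducibility; hence the ring of invariants is an integrally closed domain,
  and its localizations inherit this by clearing denominators (normal_spec_if_integrally_closed).

  To understand \<Lambda>, collect the B_h with eps h = 1 and the maps delta in b, and the other B_h and the maps gamma in y.
  The equations are linear in y, with a coefficient matrix L(b) that is linear in b. A linear relation between the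
  equations at b is a family xi of endomorphisms of the V_i that commutes with the B_h in b and satisfies
  delta xi = 0. The main estimate (growth_relations) says that the variety of pairs (b, xi) with nonzero xi has
  dimension at most dim b - 2. It is proved by stratifying by the ranks of the xi_i: a pair is determined by the
  commuting pair that it induces on the image of xi and by further parameters that can be counted. If u is the vector of ranks,
  then the dimension of the stratum stays below the bound by \<Sum> \<lambda>_i u_i + q(u) - 2, where \<lambda> = d - C v, with entries at least 1, and the Tits
  form q is positive because the quiver is of finite type. Without delta the analogous bound (growth_commuting)
  follows by induction from the same stratification of xi - c, with c an eigenvalue of xi.

  Hence L(b) has independent rows outside a set of codimension at least 2, and the equations, generic linear forms
  and two generic combinations of maximal minors of L form a homogeneous system of parameters. By the Cohen-Macaulay
  property (regular_family_of_forms), the two combinations are a regular sequence modulo the equations. Where a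
  maximal minor is invertible, Cramer's rule eliminates coordinates y, and the coordinate ring is a localized
  polynomial ring, an integrally closed domain. As in Serre's criterion, the regular sequence extends both
  properties from these charts to \<Lambda> (domain_on_X, integrally_closed_on_X).

  Dimensions are measured by the growth of functions: functions of degree n in given coordinates span a space of
  dimension O(n^s) on a set. This needs only linear algebra, and makes sense for arbitrary sets, in
  particular for strata and for points chosen without regard to algebraicity.
\<close>

section \<open>Growth of algebras of functions\<close>

inductive pdeg :: "('z \<Rightarrow> complex) set \<Rightarrow> nat \<Rightarrow> ('z \<Rightarrow> complex) \<Rightarrow> bool"
  for F where
  const: "pdeg F n (\<lambda>_. c)"
| coord_mult: "f \<in> F \<Longrightarrow> pdeg F n p \<Longrightarrow> pdeg F (Suc n) (\<lambda>z. f z * p z)"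
| add: "pdeg F n p \<Longrightarrow> pdeg F n q \<Longrightarrow> pdeg F n (\<lambda>z. p z + q z)"

lemma pdeg_Suc: "pdeg F n p \<Longrightarrow> pdeg F (Suc n) p"
  by (induction rule: pdeg.induct) (auto intro: pdeg.intros)

lemma pdeg_mono: "pdeg F n p \<Longrightarrow> n \<le> m \<Longrightarrow> pdeg F m p"
proof (induction m)
  case (Suc m)
  then show ?case using pdeg_Suc by (cases "n = Suc m") auto
qed simp

lemma pdeg_scale: "pdeg F n p \<Longrightarrow> pdeg F n (\<lambda>z. c * p z)"
proof (induction rule: pdeg.induct)
  case (coord_mult f n p)
  then have "pdeg F (Suc n) (\<lambda>z. f z * (c * p z))" by (auto intro: pdeg.intros)
  then show ?case by (simp add: mult.left_commute)
qed (auto simp: algebra_simps intro: pdeg.intros)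

lemma pdeg_mult: "pdeg F n p \<Longrightarrow> pdeg F m q \<Longrightarrow> pdeg F (n + m) (\<lambda>z. p z * q z)"
proof (induction rule: pdeg.induct)
  case (const n c)
  then show ?case using pdeg_scale pdeg_mono by (metis le_add2)
next
  case (coord_mult f n p)
  then have "pdeg F (Suc (n + m)) (\<lambda>z. f z * (p z * q z))" by (auto intro: pdeg.intros)
  then show ?case by (simp add: mult.assoc)
qed (auto simp: algebra_simps intro: pdeg.intros)

lemma pdeg_coord: "f \<in> F \<Longrightarrow> n \<ge> 1 \<Longrightarrow> pdeg F n f"
  using pdeg.coord_mult[of f F 0, OF _ pdeg.const[of F 0 1]] pdeg_mono[of F 1 f n] by simp

lemma pdeg_power: "pdeg F n p \<Longrightarrow> pdeg F (n * k) (\<lambda>z. p z ^ k)"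
proof (induction k)
  case (Suc k)
  then show ?case using pdeg_mult[of F n p "n * k" "\<lambda>z. p z ^ k"] by simp
qed (auto intro: pdeg.const)

lemma pdeg_sum: "(\<And>i. i \<in> I \<Longrightarrow> pdeg F n (p i)) \<Longrightarrow> pdeg F n (\<lambda>z. \<Sum>i\<in>I. p i z)"
proof (induction I rule: infinite_finite_induct)
  case (insert x I)
  then show ?case using pdeg.add[of F n "p x" "\<lambda>z. \<Sum>i\<in>I. p i z"] by simp
qed (auto intro: pdeg.const)

lemma pdeg_subset: "pdeg F n p \<Longrightarrow> F \<subseteq> F' \<Longrightarrow> pdeg F' n p"
  by (induction rule: pdeg.induct) (auto intro: pdeg.intros)

lemma pdeg_fibre: "pdeg F n p \<Longrightarrow> (\<forall>f\<in>F. f z = f z') \<Longrightarrow> p z = p z'"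
  by (induction rule: pdeg.induct) auto

lemma pdeg_insert:
  assumes "pdeg (insert h F) n p"
  shows "\<exists>P. (\<forall>j\<le>n. pdeg F n (P j)) \<and> p = (\<lambda>z. \<Sum>j\<le>n. P j z * h z ^ j)"
  using assms
proof (induction rule: pdeg.induct)
  case (const n c)
  have "(\<Sum>j\<le>n. (if j = 0 then c else 0) * h z ^ j) = c" for z
    by (subst sum.remove[of _ 0]) auto
  then show ?case
    by (intro exI[of _ "\<lambda>j _. if j = 0 then c else 0"]) (auto intro: pdeg.const)
next
  case (coord_mult f n p)
  then obtain P where P: "\<forall>j\<le>n. pdeg F n (P j)" "p = (\<lambda>z. \<Sum>j\<le>n. P j z * h z ^ j)" by auto
  show ?case
  proof (cases "f \<in> F")
    case True
    have "(\<Sum>j\<le>n. (if j \<le> n then f z * P j z else 0) * h z ^ j) = f z * p z" for z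
      unfolding P sum_distrib_left by (rule sum.cong) auto
    then have "(\<Sum>j\<le>Suc n. (\<lambda>z. if j \<le> n then f z * P j z else 0) z * h z ^ j) = f z * p z" for z
      by simp
    moreover have "pdeg F (Suc n) (\<lambda>z. if j \<le> n then f z * P j z else 0)" for j
      by (cases "j \<le> n") (use P True in \<open>auto intro: pdeg.intros\<close>)
    ultimately show ?thesis by (intro exI[of _ "\<lambda>j z. if j \<le> n then f z * P j z else 0"]) auto
  next
    case False
    then have f: "f = h" using coord_mult by auto
    define P' where "P' = (\<lambda>j. case j of 0 \<Rightarrow> (\<lambda>_. 0) | Suc i \<Rightarrow> P i)"
    have "(\<Sum>j\<le>Suc n. P' j z * h z ^ j) = f z * p z" for z
      unfolding sum.atMost_Suc_shift by (simp add: P'_def P f sum_distrib_left mult.left_commute)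
    moreover have "\<forall>j\<le>Suc n. pdeg F (Suc n) (P' j)"
      using P by (auto simp: P'_def split: nat.split intro: pdeg.const pdeg_Suc)
    ultimately show ?thesis by (intro exI[of _ P']) auto
  qed
next
  case (add n p q)
  then obtain P P' where P: "\<forall>j\<le>n. pdeg F n (P j)" "p = (\<lambda>z. \<Sum>j\<le>n. P j z * h z ^ j)"
    "\<forall>j\<le>n. pdeg F n (P' j)" "q = (\<lambda>z. \<Sum>j\<le>n. P' j z * h z ^ j)" by auto
  then show ?case
    by (intro exI[of _ "\<lambda>j z. P j z + P' j z"]) (auto simp: algebra_simps sum.distrib intro: pdeg.add)
qed

lemma polyfuns_imp_pdeg: "p \<in> polyfuns F \<Longrightarrow> \<exists>n. pdeg F n p"
proof (induction rule: polyfuns.induct)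
  case (coord f) then show ?case using pdeg_coord by blast
next
  case (add f g)
  then show ?case using pdeg.add pdeg_mono by (metis max.cobounded1 max.cobounded2)
qed (auto intro: pdeg.const pdeg_mult)

lemma polyfuns_sum: "(\<And>i. i \<in> I \<Longrightarrow> p i \<in> polyfuns F) \<Longrightarrow> (\<lambda>z. \<Sum>i\<in>I. p i z) \<in> polyfuns F"
proof (induction I rule: infinite_finite_induct)
  case (insert x I)
  then show ?case using polyfuns.add[of "p x" F "\<lambda>z. \<Sum>i\<in>I. p i z"] by simp
qed (auto intro: polyfuns.const)

lemma polyfuns_prod: "(\<And>i. i \<in> I \<Longrightarrow> p i \<in> polyfuns F) \<Longrightarrow> (\<lambda>z. \<Prod>i\<in>I. p i z) \<in> polyfuns F"
proof (induction I rule: infinite_finite_induct)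
  case (insert x I)
  then show ?case using polyfuns.mult[of "p x" F "\<lambda>z. \<Prod>i\<in>I. p i z"] by simp
qed (auto intro: polyfuns.const)

lemma polyfuns_power: "p \<in> polyfuns F \<Longrightarrow> (\<lambda>z. p z ^ n) \<in> polyfuns F"
  by (induction n) (auto intro: polyfuns.intros)

lemma polyfuns_scale: "p \<in> polyfuns F \<Longrightarrow> (\<lambda>z. c * p z) \<in> polyfuns F"
  using polyfuns.mult[OF polyfuns.const] by auto

lemma polyfuns_uminus: "p \<in> polyfuns F \<Longrightarrow> (\<lambda>z. - p z) \<in> polyfuns F"
  using polyfuns_scale[of p F "-1"] by simp

lemma polyfuns_diff: "p \<in> polyfuns F \<Longrightarrow> q \<in> polyfuns F \<Longrightarrow> (\<lambda>z. p z - q z) \<in> polyfuns F"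
  using polyfuns.add[OF _ polyfuns_uminus, of p F q] by simp

lemma polyfuns_mono: "p \<in> polyfuns F \<Longrightarrow> F \<subseteq> F' \<Longrightarrow> p \<in> polyfuns F'"
  by (induction rule: polyfuns.induct) (auto intro: polyfuns.intros)

lemmas polyfuns_intros = polyfuns.const polyfuns.add polyfuns.mult polyfuns_sum polyfuns_prod polyfuns_power polyfuns_uminus polyfuns_diff

lemma underdetermined_solution:
  fixes \<alpha> :: "'i \<Rightarrow> nat \<Rightarrow> complex"
  assumes "finite I" "m < card I"
  shows "\<exists>a. (\<exists>i\<in>I. a i \<noteq> 0) \<and> (\<forall>j<m. (\<Sum>i\<in>I. a i * \<alpha> i j) = 0)"
  using assms
proof (induction m arbitrary: I \<alpha>)
  case 0
  then obtain i where "i \<in> I" by fastforce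
  then show ?case by (intro exI[of _ "\<lambda>_. 1"]) auto
next
  case (Suc m)
  show ?case
  proof (cases "\<forall>i\<in>I. \<alpha> i m = 0")
    case True
    have "m < card I" using Suc.prems by simp
    from Suc.IH[OF Suc.prems(1) this, of \<alpha>] show ?thesis using True by (auto simp: less_Suc_eq)
  next
    case False
    then obtain k where k: "k \<in> I" "\<alpha> k m \<noteq> 0" by auto
    define \<beta> where "\<beta> = (\<lambda>i j. \<alpha> i j - \<alpha> i m / \<alpha> k m * \<alpha> k j)"
    have "m < card (I - {k})" using Suc.prems k by simp
    then obtain a where a: "\<exists>i\<in>I - {k}. a i \<noteq> 0" "\<forall>j<m. (\<Sum>i\<in>I - {k}. a i * \<beta> i j) = 0"
      using Suc.IH[of "I - {k}" \<beta>] Suc.prems by blast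
    define t where "t = - (\<Sum>i\<in>I - {k}. a i * \<alpha> i m / \<alpha> k m)"
    define a' where "a' = a(k := t)"
    have s: "(\<Sum>i\<in>I. a' i * \<alpha> i j) = (\<Sum>i\<in>I - {k}. a i * \<beta> i j)" for j
    proof -
      have "(\<Sum>i\<in>I. a' i * \<alpha> i j) = t * \<alpha> k j + (\<Sum>i\<in>I - {k}. a' i * \<alpha> i j)"
        using Suc.prems(1) k by (subst sum.remove[of _ k]) (auto simp: a'_def)
      also have "(\<Sum>i\<in>I - {k}. a' i * \<alpha> i j) = (\<Sum>i\<in>I - {k}. a i * \<alpha> i j)"
        by (rule sum.cong) (auto simp: a'_def)
      also have "t * \<alpha> k j + \<dots> = (\<Sum>i\<in>I - {k}. a i * \<beta> i j)"
        by (simp add: \<beta>_def t_def right_diff_distrib sum_subtractf sum_distrib_right mult.assoc)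
      finally show ?thesis .
    qed
    have z: "\<beta> i m = 0" for i using k by (simp add: \<beta>_def)
    have "\<forall>j<Suc m. (\<Sum>i\<in>I. a' i * \<alpha> i j) = 0"
      using a(2) unfolding s less_Suc_eq by (auto simp: z)
    moreover have "\<exists>i\<in>I. a' i \<noteq> 0" using a(1) by (auto simp: a'_def)
    ultimately show ?thesis by blast
  qed
qed

definition spanned :: "'z set \<Rightarrow> nat \<Rightarrow> (('z \<Rightarrow> complex) \<Rightarrow> bool) \<Rightarrow> bool" where
  "spanned Z m P \<longleftrightarrow> (\<exists>g. \<forall>p. P p \<longrightarrow> (\<exists>a. \<forall>z\<in>Z. p z = (\<Sum>i<m. a i * g i z)))"

lemma spannedI:
  fixes g :: "'i \<Rightarrow> 'z \<Rightarrow> complex"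
  assumes "finite I" "\<And>p. P p \<Longrightarrow> \<exists>a. \<forall>z\<in>Z. p z = (\<Sum>i\<in>I. a i * g i z)"
  shows "spanned Z (card I) P"
  unfolding spanned_def
proof -
  obtain b where b: "bij_betw b {..<card I} I"
    using ex_bij_betw_nat_finite[OF assms(1)] atLeast0LessThan by auto
  have "\<exists>a. \<forall>z\<in>Z. p z = (\<Sum>i<card I. a i * g (b i) z)" if p: "P p" for p
  proof -
    obtain a where a: "\<forall>z\<in>Z. p z = (\<Sum>i\<in>I. a i * g i z)" using assms(2) p by blast
    have "(\<Sum>i\<in>I. a i * g i z) = (\<Sum>i<card I. a (b i) * g (b i) z)" for z
      using sum.reindex_bij_betw[OF b, of "\<lambda>i. a i * g i z"] by simp
    then show ?thesis using a by (intro exI[of _ "\<lambda>i. a (b i)"]) simp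
  qed
  then show "\<exists>g. \<forall>p. P p \<longrightarrow> (\<exists>a. \<forall>z\<in>Z. p z = (\<Sum>i<card I. a i * g i z))"
    by (intro exI[of _ "\<lambda>i. g (b i)"]) blast
qed

text \<open>The algebra generated by F on Z has Gelfand-Kirillov dimension at most s. Negative exponents are allowed and force
  Z to be empty (growth_nonneg), so that dimension counts can prove emptiness.\<close>

definition growth :: "'z set \<Rightarrow> ('z \<Rightarrow> complex) set \<Rightarrow> int \<Rightarrow> bool" where
  "growth Z F s \<longleftrightarrow> (\<exists>c::real. \<forall>n\<ge>1. \<exists>m. real m \<le> c * real n powi s \<and> spanned Z m (pdeg F n))"

lemma growthI:
  "(\<And>n. n \<ge> 1 \<Longrightarrow> \<exists>m. real m \<le> c * real n powi s \<and> spanned Z m (pdeg F n)) \<Longrightarrow> growth Z F s"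
  unfolding growth_def by blast

lemma growth_pos:
  assumes "growth Z F s"
  obtains c where "c > 0"
    "\<And>n. n \<ge> 1 \<Longrightarrow> \<exists>m. real m \<le> c * real n powi s \<and> spanned Z m (pdeg F n)"
proof -
  obtain c where c: "\<And>n. n \<ge> 1 \<Longrightarrow> \<exists>m. real m \<le> c * real n powi s \<and> spanned Z m (pdeg F n)"
    using assms unfolding growth_def by blast
  have "\<exists>m. real m \<le> (\<bar>c\<bar> + 1) * real n powi s \<and> spanned Z m (pdeg F n)" if "n \<ge> 1" for n
  proof -
    obtain m where "real m \<le> c * real n powi s" "spanned Z m (pdeg F n)" using c \<open>n \<ge> 1\<close> by blast
    moreover have "c * real n powi s \<le> (\<bar>c\<bar> + 1) * real n powi s" by (intro mult_right_mono) auto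
    ultimately show ?thesis by force
  qed
  then show thesis using that[of "\<bar>c\<bar> + 1"] by auto
qed

lemma growth_mono:
  assumes "growth Z F s" "F' \<subseteq> F" "Z' \<subseteq> Z" "s \<le> s'"
  shows "growth Z' F' s'"
proof -
  obtain c where c: "c > 0" "\<And>n. n \<ge> 1 \<Longrightarrow> \<exists>m. real m \<le> c * real n powi s \<and> spanned Z m (pdeg F n)"
    using growth_pos[OF assms(1)] by blast
  show ?thesis
  proof (rule growthI)
    fix n :: nat assume n: "n \<ge> 1"
    then obtain m where m: "real m \<le> c * real n powi s" "spanned Z m (pdeg F n)" using c by blast
    have "c * real n powi s \<le> c * real n powi s'"
      using c(1) n assms(4) by (intro mult_left_mono power_int_increasing) auto
    moreover have "spanned Z' m (pdeg F' n)"
      using m(2) assms(2,3) pdeg_subset unfolding spanned_def by (meson subset_iff)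
    ultimately show "\<exists>m. real m \<le> c * real n powi s' \<and> spanned Z' m (pdeg F' n)" using m by force
  qed
qed

lemma growth_pullback:
  assumes "growth Z F s" "\<And>z. z \<in> Z' \<Longrightarrow> \<phi> z \<in> Z" "\<And>f. f \<in> F' \<Longrightarrow> \<exists>g\<in>F. \<forall>z\<in>Z'. f z = g (\<phi> z)"
  shows "growth Z' F' s"
proof -
  have pb: "\<exists>p'. pdeg F n p' \<and> (\<forall>z\<in>Z'. p z = p' (\<phi> z))" if "pdeg F' n p" for n p
    using that
  proof (induction rule: pdeg.induct)
    case (const n c) then show ?case by (intro exI[of _ "\<lambda>_. c"]) (auto intro: pdeg.const)
  next
    case (coord_mult f n p)
    then obtain p' where p': "pdeg F n p'" "\<forall>z\<in>Z'. p z = p' (\<phi> z)" by blast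
    obtain g where g: "g \<in> F" "\<forall>z\<in>Z'. f z = g (\<phi> z)" using assms(3)[OF coord_mult(1)] by blast
    show ?case by (rule exI[of _ "\<lambda>z. g z * p' z"]) (use p' g in \<open>auto intro: pdeg.coord_mult\<close>)
  next
    case (add n p q)
    then obtain p' q' where "pdeg F n p'" "\<forall>z\<in>Z'. p z = p' (\<phi> z)" "pdeg F n q'" "\<forall>z\<in>Z'. q z = q' (\<phi> z)" by blast
    then show ?case by (intro exI[of _ "\<lambda>z. p' z + q' z"]) (auto intro: pdeg.add)
  qed
  have "spanned Z' m (pdeg F' n)" if m: "spanned Z m (pdeg F n)" for m n
  proof -
    obtain g where g: "\<forall>p. pdeg F n p \<longrightarrow> (\<exists>a. \<forall>z\<in>Z. p z = (\<Sum>i<m. a i * g i z))"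
      using m unfolding spanned_def by blast
    have "\<exists>a. \<forall>z\<in>Z'. p z = (\<Sum>i<m. a i * g i (\<phi> z))" if p: "pdeg F' n p" for p
    proof -
      obtain p' where p': "pdeg F n p'" "\<forall>z\<in>Z'. p z = p' (\<phi> z)" using pb[OF p] by blast
      obtain a where "\<forall>z\<in>Z. p' z = (\<Sum>i<m. a i * g i z)" using g p'(1) by blast
      then show ?thesis using assms(2) p'(2) by (intro exI[of _ a]) auto
    qed
    then show ?thesis unfolding spanned_def by (intro exI[of _ "\<lambda>i z. g i (\<phi> z)"] allI impI)
  qed
  then show ?thesis using assms(1) unfolding growth_def by meson
qed

lemma growth_Un:
  assumes "growth Z F s" "growth Z' F s"
  shows "growth (Z \<union> Z') F s"
proof -
  obtain c where c: "c > 0" "\<And>n. n \<ge> 1 \<Longrightarrow> \<exists>m. real m \<le> c * real n powi s \<and> spanned Z m (pdeg F n)"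
    using growth_pos[OF assms(1)] by blast
  obtain c' where c': "c' > 0" "\<And>n. n \<ge> 1 \<Longrightarrow> \<exists>m. real m \<le> c' * real n powi s \<and> spanned Z' m (pdeg F n)"
    using growth_pos[OF assms(2)] by blast
  show ?thesis
  proof (rule growthI)
    fix n :: nat assume n: "n \<ge> 1"
    obtain m where m: "real m \<le> c * real n powi s" "spanned Z m (pdeg F n)" using c n by blast
    obtain m' where m': "real m' \<le> c' * real n powi s" "spanned Z' m' (pdeg F n)" using c' n by blast
    obtain g where g: "\<forall>p. pdeg F n p \<longrightarrow> (\<exists>a. \<forall>z\<in>Z. p z = (\<Sum>i<m. a i * g i z))"
      using m unfolding spanned_def by blast
    obtain g' where g': "\<forall>p. pdeg F n p \<longrightarrow> (\<exists>a. \<forall>z\<in>Z'. p z = (\<Sum>i<m'. a i * g' i z))"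
      using m' unfolding spanned_def by blast
    define h where "h = case_sum (\<lambda>i z. if z \<in> Z then g i z else 0) (\<lambda>i z. if z \<in> Z then 0 else g' i z)"
    have h: "(\<Sum>i\<in>{..<m} <+> {..<m'}. case_sum a a' i * h i z) =
      (if z \<in> Z then \<Sum>i<m. a i * g i z else \<Sum>i<m'. a' i * g' i z)" for a a' z
      by (simp add: sum.Plus h_def)
    have "spanned (Z \<union> Z') (card ({..<m} <+> {..<m'})) (pdeg F n)"
    proof (rule spannedI[where g = h])
      fix p assume p: "pdeg F n p"
      obtain a where a: "\<forall>z\<in>Z. p z = (\<Sum>i<m. a i * g i z)" using g p by blast
      obtain a' where a': "\<forall>z\<in>Z'. p z = (\<Sum>i<m'. a' i * g' i z)" using g' p by blast
      show "\<exists>a. \<forall>z\<in>Z \<union> Z'. p z = (\<Sum>i\<in>{..<m} <+> {..<m'}. a i * h i z)"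
        using a a' by (intro exI[of _ "case_sum a a'"]) (auto simp: h)
    qed auto
    then show "\<exists>m. real m \<le> (c + c') * real n powi s \<and> spanned (Z \<union> Z') m (pdeg F n)"
      using m m' by (intro exI[of _ "m + m'"]) (auto simp: algebra_simps card_Plus)
  qed
qed

lemma growth_nonneg: "growth Z F s \<Longrightarrow> s < 0 \<Longrightarrow> Z = {}"
proof -
  assume "growth Z F s" "s < 0"
  then obtain c where c: "c > 0" "\<And>n. n \<ge> 1 \<Longrightarrow> \<exists>m. real m \<le> c * real n powi s \<and> spanned Z m (pdeg F n)"
    using growth_pos by blast
  obtain n :: nat where n: "real n > c" "n \<ge> 1"
    by (metis less_le_trans linorder_not_le max.cobounded1 max.cobounded2 nle_le of_nat_mono real_nat_ceiling_ge reals_Archimedean2)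
  obtain m where m: "real m \<le> c * real n powi s" "spanned Z m (pdeg F n)" using c n by blast
  have "real n powi s \<le> real n powi (-1)" using n \<open>s < 0\<close> by (intro power_int_increasing) auto
  then have "c * real n powi s \<le> c * (1 / real n)" using c(1) by (intro mult_left_mono) (auto simp: power_int_minus divide_simps)
  also have "\<dots> < 1" using n c by (simp add: divide_simps)
  finally have "m = 0" using m(1) by linarith
  then show "Z = {}" using m(2) pdeg.const[of F n 1] unfolding spanned_def by fastforce
qed

lemma growth_empty: "Z = {} \<Longrightarrow> growth Z F s"
  unfolding growth_def spanned_def by (intro exI[of _ 0] allI impI exI[of _ "0::nat"]) auto

lemma growth_UN:
  assumes "finite I" "\<And>i. i \<in> I \<Longrightarrow> growth (Z i) F s" "Z' \<subseteq> (\<Union>i\<in>I. Z i)"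
  shows "growth Z' F s"
proof -
  have "growth (\<Union>i\<in>I. Z i) F s"
    using assms(1,2) by (induction I) (auto intro: growth_Un growth_empty)
  then show ?thesis using assms(3) growth_mono by blast
qed

lemma growth_no_functions: "growth Z {} 0"
proof (rule growthI[of 1])
  fix n :: nat
  have "\<exists>c. p = (\<lambda>_. c)" if "pdeg {} n p" for p :: "'a \<Rightarrow> complex"
    using that by (induction rule: pdeg.induct) auto
  then have "spanned Z (card {()}) (pdeg {} n)"
    by (intro spannedI[where g = "\<lambda>_ _. 1"]) force+
  then show "\<exists>m. real m \<le> 1 * real n powi 0 \<and> spanned Z m (pdeg {} n)" by (intro exI[of _ 1]) auto
qed

lemma growth_insert:
  assumes "growth Z F s"
  shows "growth Z (insert h F) (s + 1)"
proof -
  obtain c where c: "c > 0" "\<And>n. n \<ge> 1 \<Longrightarrow> \<exists>m. real m \<le> c * real n powi s \<and> spanned Z m (pdeg F n)"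
    using growth_pos[OF assms(1)] by blast
  show ?thesis
  proof (rule growthI[of "2 * c"])
    fix n :: nat assume n: "n \<ge> 1"
    obtain m where m: "real m \<le> c * real n powi s" "spanned Z m (pdeg F n)" using c n by blast
    obtain g where g: "\<forall>p. pdeg F n p \<longrightarrow> (\<exists>a. \<forall>z\<in>Z. p z = (\<Sum>i<m. a i * g i z))"
      using m unfolding spanned_def by blast
    have "spanned Z (card ({..<m} \<times> {..n})) (pdeg (insert h F) n)"
    proof (rule spannedI[where g = "\<lambda>(i, j) z. g i z * h z ^ j"])
      fix p assume p: "pdeg (insert h F) n p"
      obtain P where P: "\<forall>j\<le>n. pdeg F n (P j)" "p = (\<lambda>z. \<Sum>j\<le>n. P j z * h z ^ j)"
        using pdeg_insert[OF p] by blast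
      then have "\<forall>j. \<exists>a. j \<le> n \<longrightarrow> (\<forall>z\<in>Z. P j z = (\<Sum>i<m. a i * g i z))" using g by blast
      then obtain a where a: "\<And>j z. j \<le> n \<Longrightarrow> z \<in> Z \<Longrightarrow> P j z = (\<Sum>i<m. a j i * g i z)" by metis
      have "p z = (\<Sum>(i, j)\<in>{..<m} \<times> {..n}. a j i * (g i z * h z ^ j))" if "z \<in> Z" for z
      proof -
        have "p z = (\<Sum>j\<le>n. (\<Sum>i<m. a j i * (g i z * h z ^ j)))"
          unfolding P(2) using a that by (intro sum.cong) (auto simp: sum_distrib_right mult.assoc)
        also have "\<dots> = (\<Sum>(i, j)\<in>{..<m} \<times> {..n}. a j i * (g i z * h z ^ j))"
          by (subst sum.swap) (simp add: sum.cartesian_product)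
        finally show ?thesis .
      qed
      then show "\<exists>a. \<forall>z\<in>Z. p z = (\<Sum>x\<in>{..<m} \<times> {..n}. a x * (case x of (i, j) \<Rightarrow> \<lambda>z. g i z * h z ^ j) z)"
        by (intro exI[of _ "\<lambda>(i, j). a j i"]) (simp add: case_prod_unfold)
    qed auto
    moreover have "real (m * (n + 1)) \<le> 2 * c * real n powi (s + 1)"
    proof -
      have "real (m * (n + 1)) \<le> (c * real n powi s) * (2 * real n)"
        unfolding of_nat_mult using m(1) n c(1) by (intro mult_mono) auto
      then show ?thesis using n by (simp add: power_int_add_1 mult_ac)
    qed
    ultimately show "\<exists>m. real m \<le> 2 * c * real n powi (s + 1) \<and> spanned Z m (pdeg (insert h F) n)"
      by (intro exI[of _ "m * (n + 1)"]) simp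
  qed
qed

text \<open>A function of degree n in F and h becomes one of degree O(n) in F after multiplication with q^n, which vanishes
  nowhere on Z.\<close>

lemma growth_rational:
  assumes "growth Z F s" "p \<in> polyfuns F" "q \<in> polyfuns F"
    "\<And>z. z \<in> Z \<Longrightarrow> q z \<noteq> 0" "\<And>z. z \<in> Z \<Longrightarrow> h z * q z = p z"
  shows "growth Z (insert h F) s"
proof -
  obtain c where c: "c > 0" "\<And>n. n \<ge> 1 \<Longrightarrow> \<exists>m. real m \<le> c * real n powi s \<and> spanned Z m (pdeg F n)"
    using growth_pos[OF assms(1)] by blast
  obtain e where e: "pdeg F e p" "pdeg F e q"
    using polyfuns_imp_pdeg[OF assms(2)] polyfuns_imp_pdeg[OF assms(3)] pdeg_mono
    by (metis max.cobounded1 max.cobounded2)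
  show ?thesis
  proof (rule growthI[of "c * real (e + 1) powi s"])
    fix n :: nat assume n: "n \<ge> 1"
    define N where "N = (e + 1) * n"
    have N: "N \<ge> 1" using n by (simp add: N_def)
    obtain m where m: "real m \<le> c * real N powi s" "spanned Z m (pdeg F N)" using c N by blast
    obtain g where g: "\<forall>p. pdeg F N p \<longrightarrow> (\<exists>a. \<forall>z\<in>Z. p z = (\<Sum>i<m. a i * g i z))"
      using m unfolding spanned_def by blast
    have "\<exists>a. \<forall>z\<in>Z. u z = (\<Sum>i<m. a i * (g i z / q z ^ n))" if u: "pdeg (insert h F) n u" for u
    proof -
      obtain P where P: "\<forall>j\<le>n. pdeg F n (P j)" "u = (\<lambda>z. \<Sum>j\<le>n. P j z * h z ^ j)"
        using pdeg_insert[OF u] by blast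
      define w where "w = (\<lambda>z. \<Sum>j\<le>n. P j z * (p z ^ j * q z ^ (n - j)))"
      have "pdeg F N w" unfolding w_def
      proof (rule pdeg_sum)
        fix j assume j: "j \<in> {..n}"
        have "pdeg F (n + (e * j + e * (n - j))) (\<lambda>z. P j z * (p z ^ j * q z ^ (n - j)))"
          using P(1) j e by (intro pdeg_mult pdeg_power) auto
        moreover have "n + (e * j + e * (n - j)) = N"
          using j by (simp add: N_def add_mult_distrib2[symmetric])
        ultimately show "pdeg F N (\<lambda>z. P j z * (p z ^ j * q z ^ (n - j)))" by simp
      qed
      then obtain a where a: "\<forall>z\<in>Z. w z = (\<Sum>i<m. a i * g i z)" using g by blast
      have "u z = (\<Sum>i<m. a i * (g i z / q z ^ n))" if z: "z \<in> Z" for z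
      proof -
        have "w z = u z * q z ^ n" unfolding w_def P(2) sum_distrib_right
        proof (rule sum.cong)
          fix j assume j: "j \<in> {..n}"
          have "p z ^ j * q z ^ (n - j) = h z ^ j * q z ^ n"
            using j assms(5)[OF z, symmetric] by (simp add: power_mult_distrib mult.assoc power_add[symmetric])
          then show "P j z * (p z ^ j * q z ^ (n - j)) = P j z * h z ^ j * q z ^ n" by simp
        qed simp
        then have "u z = w z / q z ^ n" using assms(4)[OF z] by simp
        then show ?thesis using a z by (simp add: sum_divide_distrib)
      qed
      then show ?thesis by blast
    qed
    then have "spanned Z m (pdeg (insert h F) n)"
      unfolding spanned_def by (intro exI[of _ "\<lambda>i z. g i z / q z ^ n"]) blast
    moreover have "real m \<le> c * real (e + 1) powi s * real n powi s"
      using m(1) by (simp only: N_def of_nat_mult power_int_mult_distrib mult.assoc)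
    ultimately show "\<exists>m. real m \<le> c * real (e + 1) powi s * real n powi s \<and> spanned Z m (pdeg (insert h F) n)"
      by blast
  qed
qed

text \<open>On each fibre h takes infinitely many values, so functions of F that are independent on Z stay independent
  over the powers of h. Multiplying by the first n + 1 powers gains a factor n.\<close>

lemma growth_trade:
  assumes "growth Z (insert h F) s"
    and inf: "\<And>z. z \<in> Z \<Longrightarrow> infinite {h z' |z'. z' \<in> Z \<and> (\<forall>f\<in>F. f z' = f z)}"
  shows "growth Z F (s - 1)"
proof -
  obtain c where c: "c > 0" "\<And>n. n \<ge> 1 \<Longrightarrow> \<exists>m. real m \<le> c * real n powi s \<and> spanned Z m (pdeg (insert h F) n)"
    using growth_pos[OF assms(1)] by blast
  show ?thesis
  proof (rule growthI[of "c * 2 powi s"])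
    fix n :: nat assume n: "n \<ge> 1"
    have "2 * n \<ge> 1" using n by simp
    then obtain m where m: "real m \<le> c * real (2 * n) powi s" "spanned Z m (pdeg (insert h F) (2 * n))"
      using c by blast
    obtain g where g: "\<forall>p. pdeg (insert h F) (2 * n) p \<longrightarrow> (\<exists>a. \<forall>z\<in>Z. p z = (\<Sum>i<m. a i * g i z))"
      using m unfolding spanned_def by blast
    define indep where "indep = (\<lambda>k (B :: nat \<Rightarrow> 'a \<Rightarrow> complex). (\<forall>i<k. pdeg F n (B i)) \<and>
      (\<forall>a. (\<forall>z\<in>Z. (\<Sum>i<k. a i * B i z) = 0) \<longrightarrow> (\<forall>i<k. a i = 0)))"
    have bound: "k * (n + 1) \<le> m" if B: "indep k B" for k B
    proof (rule ccontr)
      assume less: "\<not> k * (n + 1) \<le> m"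
      define I where "I = {..<k} \<times> {..n}"
      have "\<exists>a. \<forall>z\<in>Z. B (fst x) z * h z ^ snd x = (\<Sum>i<m. a i * g i z)" if x: "x \<in> I" for x
      proof -
        have "pdeg (insert h F) n (B (fst x))"
        proof (rule pdeg_subset)
          have "fst x < k" using x by (auto simp: I_def)
          then show "pdeg F n (B (fst x))" using B unfolding indep_def by blast
        qed auto
        then have "pdeg (insert h F) (n + 1 * snd x) (\<lambda>z. B (fst x) z * h z ^ snd x)"
          by (rule pdeg_mult) (intro pdeg_power pdeg_coord, auto)
        then have "pdeg (insert h F) (2 * n) (\<lambda>z. B (fst x) z * h z ^ snd x)"
          using x by (elim pdeg_mono) (auto simp: I_def)
        then show ?thesis using g by blast
      qed
      then have "\<forall>x\<in>I. \<exists>a. \<forall>z\<in>Z. B (fst x) z * h z ^ snd x = (\<Sum>i<m. a i * g i z)" by blast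
      from bchoice[OF this] obtain \<alpha> where
        \<alpha>: "\<And>x z. x \<in> I \<Longrightarrow> z \<in> Z \<Longrightarrow> B (fst x) z * h z ^ snd x = (\<Sum>i<m. \<alpha> x i * g i z)"
        by blast
      have "m < card I" using less by (simp add: I_def)
      then obtain a where a: "\<exists>x\<in>I. a x \<noteq> 0" "\<forall>j<m. (\<Sum>x\<in>I. a x * \<alpha> x j) = 0"
        using underdetermined_solution[of I m \<alpha>] by (auto simp: I_def)
      have van: "(\<Sum>j\<le>n. (\<Sum>i<k. a (i, j) * B i z) * h z ^ j) = 0" if z: "z \<in> Z" for z
      proof -
        have "(\<Sum>j\<le>n. (\<Sum>i<k. a (i, j) * B i z) * h z ^ j) = (\<Sum>j\<le>n. \<Sum>i<k. a (i, j) * (B i z * h z ^ j))"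
          by (simp add: sum_distrib_right mult.assoc)
        also have "\<dots> = (\<Sum>x\<in>I. a x * (B (fst x) z * h z ^ snd x))"
          unfolding I_def by (subst sum.swap) (simp add: sum.cartesian_product case_prod_unfold)
        also have "\<dots> = (\<Sum>x\<in>I. \<Sum>i<m. a x * \<alpha> x i * g i z)"
          using \<alpha> z by (intro sum.cong) (auto simp: sum_distrib_left mult.assoc)
        also have "\<dots> = (\<Sum>i<m. (\<Sum>x\<in>I. a x * \<alpha> x i) * g i z)"
          by (subst sum.swap) (simp add: sum_distrib_right)
        also have "\<dots> = 0" using a(2) by simp
        finally show ?thesis .
      qed
      have co: "(\<Sum>i<k. a (i, j) * B i z) = 0" if z: "z \<in> Z" and j: "j \<le> n" for z j
      proof (rule ccontr)
        assume nz: "(\<Sum>i<k. a (i, j) * B i z) \<noteq> 0"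
        have "{h z' |z'. z' \<in> Z \<and> (\<forall>f\<in>F. f z' = f z)} \<subseteq> {w. (\<Sum>j\<le>n. (\<Sum>i<k. a (i, j) * B i z) * w ^ j) = 0}"
        proof safe
          fix z' assume z': "z' \<in> Z" "\<forall>f\<in>F. f z' = f z"
          then have "\<And>i. i < k \<Longrightarrow> B i z' = B i z" using B pdeg_fibre[of F n _ z' z] unfolding indep_def by blast
          then show "(\<Sum>j\<le>n. (\<Sum>i<k. a (i, j) * B i z) * h z' ^ j) = 0" using van[OF z'(1)] by simp
        qed
        moreover have "finite {w. (\<Sum>j\<le>n. (\<Sum>i<k. a (i, j) * B i z) * w ^ j) = 0}"
          using polyfun_roots_finite[of "\<lambda>j. \<Sum>i<k. a (i, j) * B i z", OF nz j] by simp
        ultimately show False using inf[OF z] finite_subset by blast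
      qed
      have "a (i, j) = 0" if "i < k" "j \<le> n" for i j
      proof -
        have "\<forall>z\<in>Z. (\<Sum>i<k. a (i, j) * B i z) = 0" using co that(2) by blast
        moreover have "(\<forall>z\<in>Z. (\<Sum>i<k. a' i * B i z) = 0) \<longrightarrow> (\<forall>i<k. a' i = 0)" for a'
          using B unfolding indep_def by blast
        from this[of "\<lambda>i. a (i, j)"] calculation show ?thesis using that(1) by simp
      qed
      then show False using a(1) by (auto simp: I_def)
    qed
    define k where "k = (GREATEST k. \<exists>B. indep k B)"
    have ex: "\<exists>B. indep 0 B" unfolding indep_def by auto
    have bd: "\<forall>k. (\<exists>B. indep k B) \<longrightarrow> k \<le> m" 
    proof (intro allI impI)
      fix k assume "\<exists>B. indep k B"
      then obtain B where "indep k B" by blast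
      from bound[OF this] show "k \<le> m" by (simp add: algebra_simps)
    qed
    obtain B where B: "indep k B" using GreatestI_nat[of "\<lambda>k. \<exists>B. indep k B", OF ex] bd unfolding k_def by blast
    have "spanned Z k (pdeg F n)" unfolding spanned_def
    proof (intro exI[of _ B] allI impI)
      fix p assume p: "pdeg F n p"
      have "\<not> indep (Suc k) (B(k := p))"
        using Greatest_le_nat[of "\<lambda>k. \<exists>B. indep k B" "Suc k" m] bd unfolding k_def by fastforce
      moreover have "\<forall>i<Suc k. pdeg F n ((B(k := p)) i)" using B p unfolding indep_def by auto
      ultimately obtain a where a: "\<forall>z\<in>Z. (\<Sum>i<Suc k. a i * (B(k := p)) i z) = 0" "\<exists>i<Suc k. a i \<noteq> 0"
        unfolding indep_def by auto
      have a1: "(\<Sum>i<k. a i * B i z) + a k * p z = 0" if "z \<in> Z" for z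
      proof -
        have "(\<Sum>i<k. a i * (B(k := p)) i z) = (\<Sum>i<k. a i * B i z)" by (rule sum.cong) auto
        then show ?thesis using a(1) that by (simp del: fun_upd_apply) simp
      qed
      have "a k \<noteq> 0"
      proof
        assume "a k = 0"
        then have "\<forall>i<k. a i = 0" using a1 B unfolding indep_def by auto
        then show False using a(2) \<open>a k = 0\<close> less_Suc_eq by auto
      qed
      have "p z = (\<Sum>i<k. (- a i / a k) * B i z)" if "z \<in> Z" for z
      proof -
        have "p z = - (\<Sum>i<k. a i * B i z) / a k"
          using a1[OF that] \<open>a k \<noteq> 0\<close> by (simp add: field_simps eq_neg_iff_add_eq_0)
        also have "\<dots> = (\<Sum>i<k. (- a i / a k) * B i z)"
          by (simp add: sum_divide_distrib sum_negf[symmetric])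
        finally show ?thesis .
      qed
      then show "\<exists>a. \<forall>z\<in>Z. p z = (\<Sum>i<k. a i * B i z)" by (intro exI[of _ "\<lambda>i. - a i / a k"]) blast
    qed
    moreover have "real k \<le> c * 2 powi s * real n powi (s - 1)"
    proof -
      have "real k * real n \<le> real (k * (n + 1))" by (simp add: algebra_simps)
      also have "\<dots> \<le> real m" using bound[OF B] by (simp only: of_nat_le_iff)
      also have "\<dots> \<le> c * 2 powi s * real n powi s" using m(1) by (simp add: power_int_mult_distrib mult.assoc)
      finally have "real k \<le> c * 2 powi s * real n powi s / real n" using n by (simp add: field_simps)
      then show ?thesis using n by (simp add: power_int_diff)
    qed
    ultimately show "\<exists>m. real m \<le> c * 2 powi s * real n powi (s - 1) \<and> spanned Z m (pdeg F n)" by blast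
  qed
qed

lemma growth_add_functions:
  assumes "growth Z F s" "finite K"
  shows "growth Z (F \<union> y ` K) (s + int (card K))"
  using assms(2)
proof (induction K)
  case (insert k K)
  then show ?case using growth_insert[of Z "F \<union> y ` K" "s + int (card K)" "y k"] by (simp add: algebra_simps)
qed (use assms in auto)

lemma growth_rational_functions:
  assumes "growth Z F s" "finite K"
    "\<And>k. k \<in> K \<Longrightarrow> \<exists>p\<in>polyfuns F. \<exists>q\<in>polyfuns F. \<forall>z\<in>Z. q z \<noteq> 0 \<and> y k z * q z = p z"
  shows "growth Z (F \<union> y ` K) s"
  using assms(2,3)
proof (induction K)
  case (insert k K)
  obtain p q where "p \<in> polyfuns F" "q \<in> polyfuns F" "\<forall>z\<in>Z. q z \<noteq> 0 \<and> y k z * q z = p z"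
    using insert.prems by blast
  then show ?case
    using growth_rational[of Z "F \<union> y ` K" s p q "y k"] insert polyfuns_mono[of _ F "F \<union> y ` K"] by simp
qed (use assms in auto)

lemma growth_poly_functions:
  assumes "growth Z F s" "finite K" "\<And>k. k \<in> K \<Longrightarrow> \<exists>p\<in>polyfuns F. \<forall>z\<in>Z. y k z = p z"
  shows "growth Z (F \<union> y ` K) s"
proof (rule growth_rational_functions[OF assms(1,2)])
  fix k assume "k \<in> K"
  then obtain p where "p \<in> polyfuns F" "\<forall>z\<in>Z. y k z = p z" using assms(3) by blast
  then show "\<exists>p\<in>polyfuns F. \<exists>q\<in>polyfuns F. \<forall>z\<in>Z. q z \<noteq> 0 \<and> y k z * q z = p z"
    by (intro bexI[of _ p] bexI[of _ "\<lambda>_. 1"]) (auto intro: polyfuns.const)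
qed

text \<open>Gaussian elimination of one equation: at each point one of its coefficients is nonzero by independence. On the
  piece where this is the coefficient of k, the unknown y k is a rational function of the rest.\<close>

lemma growth_linear_system:
  assumes "growth Z F s" "finite K" "finite E"
    "\<And>e k. e \<in> E \<Longrightarrow> k \<in> K \<Longrightarrow> A e k \<in> polyfuns F" "\<And>e. e \<in> E \<Longrightarrow> C e \<in> polyfuns F"
    "\<And>z e. z \<in> Z \<Longrightarrow> e \<in> E \<Longrightarrow> (\<Sum>k\<in>K. A e k z * y k z) = C e z"
    "\<And>z \<xi>. z \<in> Z \<Longrightarrow> (\<forall>k\<in>K. (\<Sum>e\<in>E. \<xi> e * A e k z) = 0) \<Longrightarrow> (\<forall>e\<in>E. \<xi> e = 0)"
  shows "growth Z (F \<union> y ` K) (s + int (card K) - int (card E))"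
  using assms(3,1,2,4-)
proof (induction E arbitrary: K A C Z rule: finite_induct)
  case empty
  then show ?case using growth_add_functions by simp
next
  case (insert e0 E)
  define Zk where "Zk = (\<lambda>k. {z \<in> Z. A e0 k z \<noteq> 0})"
  show ?case
  proof (rule growth_UN[of K Zk])
    show "Z \<subseteq> (\<Union>k\<in>K. Zk k)"
    proof
      fix z assume z: "z \<in> Z"
      have "\<exists>k\<in>K. A e0 k z \<noteq> 0"
      proof (rule ccontr)
        assume "\<not> (\<exists>k\<in>K. A e0 k z \<noteq> 0)"
        then have "\<forall>k\<in>K. (\<Sum>e\<in>insert e0 E. (if e = e0 then 1 else 0) * A e k z) = 0"
          using insert.hyps by (auto intro!: sum.neutral)
        from insert.prems(6)[OF z this] show False by auto
      qed
      then show "z \<in> (\<Union>k\<in>K. Zk k)" using z by (auto simp: Zk_def)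
    qed
  next
    fix k assume k: "k \<in> K"
    define A' where "A' = (\<lambda>e j z. A e j z * A e0 k z - A e k z * A e0 j z)"
    define C' where "C' = (\<lambda>e z. C e z * A e0 k z - A e k z * C e0 z)"
    have split: "(\<Sum>j\<in>K. g j) = g k + (\<Sum>j\<in>K - {k}. g j)" for g :: "_ \<Rightarrow> complex"
      using insert.prems(2) k by (simp add: sum.remove)
    have "growth (Zk k) (F \<union> y ` (K - {k})) (s + int (card (K - {k})) - int (card E))"
    proof (rule insert.IH[where A = A' and C = C'])
      show "growth (Zk k) F s" by (rule growth_mono[OF insert.prems(1)]) (auto simp: Zk_def)
    next
      fix z e assume z: "z \<in> Zk k" and e: "e \<in> E"
      then have zZ: "z \<in> Z" by (simp add: Zk_def)
      have 1: "(\<Sum>j\<in>K. A e j z * y j z) = C e z" "(\<Sum>j\<in>K. A e0 j z * y j z) = C e0 z"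
        using insert.prems(5)[OF zZ] e by auto
      have "(\<Sum>j\<in>K - {k}. A' e j z * y j z) = (\<Sum>j\<in>K. A' e j z * y j z)"
        unfolding split by (simp add: A'_def)
      also have "\<dots> = (\<Sum>j\<in>K. A e j z * y j z) * A e0 k z - A e k z * (\<Sum>j\<in>K. A e0 j z * y j z)"
        by (simp add: A'_def left_diff_distrib right_diff_distrib sum_subtractf sum_distrib_left sum_distrib_right mult_ac)
      finally show "(\<Sum>j\<in>K - {k}. A' e j z * y j z) = C' e z" unfolding 1 C'_def .
    next
      fix z \<xi> assume z: "z \<in> Zk k" and \<xi>: "\<forall>j\<in>K - {k}. (\<Sum>e\<in>E. \<xi> e * A' e j z) = 0"
      have nz: "A e0 k z \<noteq> 0" and zZ: "z \<in> Z" using z by (auto simp: Zk_def)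
      define \<zeta> where "\<zeta> = (\<lambda>e. if e = e0 then - (\<Sum>e\<in>E. \<xi> e * A e k z) else \<xi> e * A e0 k z)"
      have "(\<Sum>e\<in>insert e0 E. \<zeta> e * A e j z) = (\<Sum>e\<in>E. \<xi> e * A' e j z)" for j
      proof -
        have "(\<Sum>e\<in>E. \<zeta> e * A e j z) = (\<Sum>e\<in>E. \<xi> e * A e0 k z * A e j z)"
          using insert.hyps by (intro sum.cong) (auto simp: \<zeta>_def)
        moreover have "\<zeta> e0 * A e0 j z = - (\<Sum>e\<in>E. \<xi> e * A e k z * A e0 j z)"
          by (simp add: \<zeta>_def sum_distrib_right)
        ultimately show ?thesis using insert.hyps
          by (simp add: A'_def right_diff_distrib sum_subtractf mult_ac)
      qed
      moreover have "(\<Sum>e\<in>E. \<xi> e * A' e k z) = 0" by (simp add: A'_def)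
      ultimately have "\<forall>j\<in>K. (\<Sum>e\<in>insert e0 E. \<zeta> e * A e j z) = 0" using \<xi> by (metis Diff_iff singletonD)
      from insert.prems(6)[OF zZ this] show "\<forall>e\<in>E. \<xi> e = 0"
        using nz insert.hyps by (auto simp: \<zeta>_def split: if_splits)
    qed (use insert.prems k in \<open>auto simp: A'_def C'_def intro!: polyfuns_intros\<close>)
    then have "growth (Zk k) (insert (y k) (F \<union> y ` (K - {k}))) (s + int (card (K - {k})) - int (card E))"
    proof (rule growth_rational)
      let ?G = "F \<union> y ` (K - {k})"
      have C: "C e0 \<in> polyfuns ?G"
        by (rule polyfuns_mono[of _ F]) (simp_all add: insert.prems(4))
      have A: "A e0 j \<in> polyfuns ?G" if "j \<in> K" for j
        by (rule polyfuns_mono[of _ F]) (simp_all add: insert.prems(3) that)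
      have y: "y j \<in> polyfuns ?G" if "j \<in> K - {k}" for j
        by (rule polyfuns.coord) (use that in blast)
      show "(\<lambda>z. C e0 z - (\<Sum>j\<in>K - {k}. A e0 j z * y j z)) \<in> polyfuns ?G"
        by (intro polyfuns_diff polyfuns_sum polyfuns.mult C A y) auto
      show "A e0 k \<in> polyfuns ?G" by (rule A[OF k])
    next
      fix z assume z: "z \<in> Zk k"
      then show "y k z * A e0 k z = C e0 z - (\<Sum>j\<in>K - {k}. A e0 j z * y j z)"
        using insert.prems(5)[of z e0] unfolding split by (auto simp: Zk_def algebra_simps)
    qed (simp add: Zk_def)
    moreover have "insert (y k) (F \<union> y ` (K - {k})) = F \<union> y ` K" using k by auto
    moreover have "int (card (K - {k})) = int (card K) - 1"
      using card_Suc_Diff1[OF insert.prems(2) k] by linarith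
    ultimately show "growth (Zk k) (F \<union> y ` K) (s + int (card K) - int (card (insert e0 E)))"
      using insert.hyps by (simp add: algebra_simps)
  qed (use insert.prems in auto)
qed

section \<open>Homogeneous polynomial functions and ideals\<close>

definition crd :: "'k set \<Rightarrow> (('k \<Rightarrow> complex) \<Rightarrow> complex) set" where
  "crd K = (\<lambda>k x. x k) ` K"

abbreviation polys :: "'k set \<Rightarrow> (('k \<Rightarrow> complex) \<Rightarrow> complex) set" where
  "polys K \<equiv> polyfuns (crd K)"

lemma polys_coord: "k \<in> K \<Longrightarrow> (\<lambda>x. x k) \<in> polys K"
  by (rule polyfuns.coord) (auto simp: crd_def)

lemma polys_mono: "p \<in> polys K \<Longrightarrow> K \<subseteq> K' \<Longrightarrow> p \<in> polys K'"
  by (erule polyfuns_mono) (auto simp: crd_def)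

lemma pdeg_imp_polyfuns: "pdeg F n p \<Longrightarrow> p \<in> polyfuns F"
  by (induction rule: pdeg.induct) (auto intro: polyfuns.intros)

lemma polys_cong: "p \<in> polys K \<Longrightarrow> (\<And>k. k \<in> K \<Longrightarrow> x k = y k) \<Longrightarrow> p x = p y"
  by (induction rule: polyfuns.induct) (auto simp: crd_def)

lemma polys_subst:
  assumes "p \<in> polys K" "\<And>k. k \<in> K \<Longrightarrow> g k \<in> polyfuns F"
  shows "(\<lambda>z. p (\<lambda>k. g k z)) \<in> polyfuns F"
  using assms(1) by (induction rule: polyfuns.induct) (use assms(2) in \<open>auto simp: crd_def intro: polyfuns.intros\<close>)

text \<open>The homogeneous component of degree n at x is the coefficient of s^n in the restriction to the line of
  all s x. Working with functions, the component has to be recovered from values.\<close>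

definition line_poly :: "(('k \<Rightarrow> complex) \<Rightarrow> complex) \<Rightarrow> ('k \<Rightarrow> complex) \<Rightarrow> complex poly" where
  "line_poly p x = (THE q. \<forall>s. poly q s = p (\<lambda>k. s * x k))"

definition hc :: "nat \<Rightarrow> (('k \<Rightarrow> complex) \<Rightarrow> complex) \<Rightarrow> ('k \<Rightarrow> complex) \<Rightarrow> complex" where
  "hc n p x = coeff (line_poly p x) n"

lemma line_polyI: "(\<And>s. poly q s = p (\<lambda>k. s * x k)) \<Longrightarrow> line_poly p x = q"
  unfolding line_poly_def by (rule the_equality) (auto simp: poly_eq_poly_eq_iff[symmetric])

lemma poly_line_poly:
  assumes "p \<in> polys K"
  shows "poly (line_poly p x) s = p (\<lambda>k. s * x k)"
proof -
  have "\<exists>q. \<forall>s. poly q s = p (\<lambda>k. s * x k)"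
    using assms
  proof (induction rule: polyfuns.induct)
    case (const c) then show ?case by (intro exI[of _ "[:c:]"]) auto
  next
    case (coord f)
    then obtain k where "f = (\<lambda>x. x k)" by (auto simp: crd_def)
    then show ?case by (intro exI[of _ "[:0, x k:]"]) auto
  next
    case (add f g)
    then obtain q r where "\<forall>s. poly q s = f (\<lambda>k. s * x k)" "\<forall>s. poly r s = g (\<lambda>k. s * x k)" by blast
    then show ?case by (intro exI[of _ "q + r"]) auto
  next
    case (mult f g)
    then obtain q r where "\<forall>s. poly q s = f (\<lambda>k. s * x k)" "\<forall>s. poly r s = g (\<lambda>k. s * x k)" by blast
    then show ?case by (intro exI[of _ "q * r"]) auto
  qed
  then show ?thesis using line_polyI by metis
qed

lemma hc_const: "hc n (\<lambda>_. c) x = (if n = 0 then c else 0)"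
proof -
  have "line_poly (\<lambda>_. c) x = [:c:]" by (rule line_polyI) auto
  then show ?thesis by (cases n) (auto simp: hc_def)
qed

lemma hc_add:
  assumes "p \<in> polys K" "q \<in> polys K"
  shows "hc n (\<lambda>x. p x + q x) = (\<lambda>x. hc n p x + hc n q x)"
proof
  fix x
  have "line_poly (\<lambda>x. p x + q x) x = line_poly p x + line_poly q x"
    by (rule line_polyI) (simp add: poly_line_poly[OF assms(1)] poly_line_poly[OF assms(2)])
  then show "hc n (\<lambda>x. p x + q x) x = hc n p x + hc n q x" by (simp add: hc_def)
qed

lemma hc_mult:
  assumes "p \<in> polys K" "q \<in> polys K"
  shows "hc n (\<lambda>x. p x * q x) = (\<lambda>x. \<Sum>i\<le>n. hc i p x * hc (n - i) q x)"
proof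
  fix x
  have "line_poly (\<lambda>x. p x * q x) x = line_poly p x * line_poly q x"
    by (rule line_polyI) (simp add: poly_line_poly[OF assms(1)] poly_line_poly[OF assms(2)])
  then show "hc n (\<lambda>x. p x * q x) x = (\<Sum>i\<le>n. hc i p x * hc (n - i) q x)"
    by (simp add: hc_def coeff_mult)
qed

lemma pdeg_hc: "p \<in> polys K \<Longrightarrow> pdeg (crd K) n (hc n p)"
proof (induction arbitrary: n rule: polyfuns.induct)
  case (const c)
  show ?case by (cases "n = 0") (auto simp: hc_const[abs_def] intro: pdeg.const)
next
  case (coord f)
  then obtain k where k: "f = (\<lambda>x. x k)" "k \<in> K" by (auto simp: crd_def)
  have "line_poly f x = [:0, x k:]" for x by (rule line_polyI) (auto simp: k)
  then have "hc n f = (if n = 1 then f else (\<lambda>_. 0))"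
    by (auto simp: hc_def fun_eq_iff k coeff_pCons split: nat.split)
  then show ?case using coord pdeg_coord[of f "crd K" n] by (auto intro: pdeg.const)
next
  case (add f g)
  then show ?case by (subst hc_add) (auto intro: pdeg.add)
next
  case (mult f g)
  have "pdeg (crd K) (i + (n - i)) (\<lambda>x. hc i f x * hc (n - i) g x)" for i
    by (rule pdeg_mult) (use mult.IH in auto)
  then have "pdeg (crd K) n (\<lambda>x. \<Sum>i\<le>n. hc i f x * hc (n - i) g x)"
    by (intro pdeg_sum) (metis atMost_iff le_add_diff_inverse)
  then show ?case using mult.hyps by (subst hc_mult) auto
qed

lemma hc_polys: "p \<in> polys K \<Longrightarrow> hc n p \<in> polys K"
  by (rule pdeg_imp_polyfuns[OF pdeg_hc])

lemma hc_sum_eq: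
  assumes "p \<in> polys K"
  obtains d where "\<And>n. n > d \<Longrightarrow> hc n p = (\<lambda>_. 0)" "p = (\<lambda>x. \<Sum>n\<le>d. hc n p x)"
proof -
  have "\<exists>d. \<forall>n>d. hc n p = (\<lambda>_. 0)"
    using assms
  proof (induction rule: polyfuns.induct)
    case (const c)
    then show ?case by (intro exI[of _ 0]) (auto simp: hc_const[abs_def])
  next
    case (coord f)
    then obtain k where k: "f = (\<lambda>x. x k)" "k \<in> K" by (auto simp: crd_def)
    have "line_poly f x = [:0, x k:]" for x by (rule line_polyI) (auto simp: k)
    then show ?case by (intro exI[of _ 1]) (auto simp: hc_def fun_eq_iff coeff_pCons split: nat.split)
  next
    case (add f g)
    then obtain d d' where "\<forall>n>d. hc n f = (\<lambda>_. 0)" "\<forall>n>d'. hc n g = (\<lambda>_. 0)" by blast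
    then show ?case using add.hyps by (intro exI[of _ "max d d'"]) (auto simp: hc_add)
  next
    case (mult f g)
    then obtain d d' where d: "\<forall>n>d. hc n f = (\<lambda>_. 0)" "\<forall>n>d'. hc n g = (\<lambda>_. 0)" by blast
    have "hc i f x * hc (n - i) g x = 0" if "n > d + d'" for n i x
      using d that by (cases "i > d") auto
    then show ?case using mult.hyps by (intro exI[of _ "d + d'"]) (auto simp: hc_mult[of f K g] fun_eq_iff intro!: sum.neutral)
  qed
  then obtain d where d: "\<forall>n>d. hc n p = (\<lambda>_. 0)" by blast
  have "p x = (\<Sum>n\<le>d. hc n p x)" for x
  proof -
    have "degree (line_poly p x) \<le> d" using d by (intro degree_le) (auto simp: hc_def fun_eq_iff)
    then have "poly (line_poly p x) 1 = (\<Sum>n\<le>d. hc n p x)"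
      unfolding hc_def by (subst poly_altdef) (auto intro!: sum.mono_neutral_left simp: le_degree)
    then show ?thesis using poly_line_poly[OF assms, of x 1] by simp
  qed
  then have "p = (\<lambda>x. \<Sum>n\<le>d. hc n p x)" by (rule ext)
  with d show thesis using that by blast
qed

definition homog :: "'k set \<Rightarrow> nat \<Rightarrow> (('k \<Rightarrow> complex) \<Rightarrow> complex) \<Rightarrow> bool" where
  "homog K n p \<longleftrightarrow> p \<in> polys K \<and> (\<forall>s x. p (\<lambda>k. s * x k) = s ^ n * p x)"

lemma homog_polys: "homog K n p \<Longrightarrow> p \<in> polys K"
  by (simp add: homog_def)

lemma homog_hc:
  assumes "p \<in> polys K"
  shows "homog K n (hc n p)"
proof -
  have "line_poly p (\<lambda>k. s * x k) = pcompose (line_poly p x) [:0, s:]" for s x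
    by (rule line_polyI) (simp add: poly_pcompose poly_line_poly[OF assms] mult_ac)
  then show ?thesis using hc_polys[OF assms] by (simp add: homog_def hc_def coeff_pcompose_linear)
qed

lemma hc_homog:
  assumes "homog K n p"
  shows "hc m p = (if m = n then p else (\<lambda>_. 0))"
proof -
  have "line_poly p x = monom (p x) n" for x
    by (rule line_polyI) (use assms in \<open>simp add: homog_def poly_monom mult.commute\<close>)
  then show ?thesis by (auto simp: hc_def fun_eq_iff)
qed

lemma homog_imp_pdeg: "homog K n p \<Longrightarrow> pdeg (crd K) n p"
  using pdeg_hc[of p K n] hc_homog[of K n p n] homog_polys by fastforce

lemma hc_mult_homog:
  assumes "p \<in> polys K" "homog K e h"
  shows "hc n (\<lambda>x. p x * h x) = (if e \<le> n then (\<lambda>x. hc (n - e) p x * h x) else (\<lambda>_. 0))"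
proof -
  have "(\<Sum>i\<le>n. hc i p x * hc (n - i) h x) = (if e \<le> n then hc (n - e) p x * h x else 0)" for x
  proof -
    have "hc i p x * hc (n - i) h x = (if i = n - e \<and> e \<le> n then hc (n - e) p x * h x else 0)" if "i \<le> n" for i
      using that by (auto simp: hc_homog[OF assms(2)])
    then have "(\<Sum>i\<le>n. hc i p x * hc (n - i) h x) = (\<Sum>i\<le>n. if i = n - e \<and> e \<le> n then hc (n - e) p x * h x else 0)"
      by (intro sum.cong) auto
    also have "\<dots> = (if e \<le> n then hc (n - e) p x * h x else 0)"
      by (cases "e \<le> n") (auto simp: sum.delta)
    finally show ?thesis .
  qed
  then show ?thesis using hc_mult[OF assms(1) homog_polys[OF assms(2)], of n] by (auto simp: fun_eq_iff)
qed

lemma homog_mult: "homog K n p \<Longrightarrow> homog K m q \<Longrightarrow> homog K (n + m) (\<lambda>x. p x * q x)"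
  by (auto simp: homog_def power_add intro: polyfuns.mult)

lemma homog_power: "homog K n p \<Longrightarrow> homog K (n * m) (\<lambda>x. p x ^ m)"
  by (auto simp: homog_def power_mult power_mult_distrib intro: polyfuns_power)

lemma homog_prod: "finite I \<Longrightarrow> (\<And>i. i \<in> I \<Longrightarrow> homog K (n i) (p i)) \<Longrightarrow> homog K (\<Sum>i\<in>I. n i) (\<lambda>x. \<Prod>i\<in>I. p i x)"
proof (induction I rule: finite_induct)
  case empty
  then show ?case by (auto simp: homog_def intro: polyfuns.const)
next
  case (insert i I)
  then show ?case using homog_mult[of K "n i" "p i" "\<Sum>i\<in>I. n i" "\<lambda>x. \<Prod>i\<in>I. p i x"] by auto
qed

lemma homog_sum: "(\<And>i. i \<in> I \<Longrightarrow> homog K n (p i)) \<Longrightarrow> homog K n (\<lambda>x. \<Sum>i\<in>I. p i x)"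
  by (auto simp: homog_def sum_distrib_left intro!: polyfuns_sum sum.cong)

lemma homog_const_mult: "homog K n p \<Longrightarrow> homog K n (\<lambda>x. c * p x)"
  by (auto simp: homog_def intro: polyfuns_scale)

lemma homog_coord: "k \<in> K \<Longrightarrow> homog K 1 (\<lambda>x. x k)"
  by (auto simp: homog_def intro: polys_coord)

lemma homog_zero: "homog K n (\<lambda>_. 0)"
  by (auto simp: homog_def intro: polyfuns.const)

lemma homog_diff: "homog K n p \<Longrightarrow> homog K n q \<Longrightarrow> homog K n (\<lambda>x. p x - q x)"
  by (auto simp: homog_def algebra_simps intro: polyfuns_diff)

definition form :: "'k set \<Rightarrow> (('k \<Rightarrow> complex) \<Rightarrow> complex) \<Rightarrow> bool" where
  "form K h \<longleftrightarrow> (\<exists>e\<ge>1. homog K e h)"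

lemma form_polys: "form K h \<Longrightarrow> h \<in> polys K"
  by (auto simp: form_def homog_polys)

inductive_set idl :: "'k set \<Rightarrow> (('k \<Rightarrow> complex) \<Rightarrow> complex) set \<Rightarrow> (('k \<Rightarrow> complex) \<Rightarrow> complex) set"
  for K S where
  zero: "(\<lambda>_. 0) \<in> idl K S"
| step: "g \<in> idl K S \<Longrightarrow> h \<in> S \<Longrightarrow> a \<in> polys K \<Longrightarrow> (\<lambda>x. a x * h x + g x) \<in> idl K S"

lemma idl_add: "f \<in> idl K S \<Longrightarrow> g \<in> idl K S \<Longrightarrow> (\<lambda>x. f x + g x) \<in> idl K S"
  by (induction rule: idl.induct) (auto simp: add.assoc intro: idl.step)

lemma idl_mult: "f \<in> idl K S \<Longrightarrow> r \<in> polys K \<Longrightarrow> (\<lambda>x. r x * f x) \<in> idl K S"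
proof (induction rule: idl.induct)
  case (step g h a)
  have "(\<lambda>x. (r x * a x) * h x + r x * g x) \<in> idl K S"
    by (rule idl.step[of "\<lambda>x. r x * g x" K S h "\<lambda>x. r x * a x"]) (use step in \<open>auto intro: polyfuns.mult\<close>)
  then show ?case by (simp add: algebra_simps)
qed (auto intro: idl.zero)

lemma idl_mult_right: "f \<in> idl K S \<Longrightarrow> r \<in> polys K \<Longrightarrow> (\<lambda>x. f x * r x) \<in> idl K S"
  using idl_mult[of f K S r] by (simp add: mult.commute)

lemma idl_scale: "f \<in> idl K S \<Longrightarrow> (\<lambda>x. c * f x) \<in> idl K S"
  using idl_mult[of f K S "\<lambda>_. c"] polyfuns.const by auto

lemma idl_diff: "f \<in> idl K S \<Longrightarrow> g \<in> idl K S \<Longrightarrow> (\<lambda>x. f x - g x) \<in> idl K S"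
  using idl_add[OF _ idl_scale[of g K S "-1"], of f] by simp

lemma idl_sum: "(\<And>i. i \<in> I \<Longrightarrow> f i \<in> idl K S) \<Longrightarrow> (\<lambda>x. \<Sum>i\<in>I. f i x) \<in> idl K S"
proof (induction I rule: infinite_finite_induct)
  case (insert x I)
  then show ?case using idl_add[of "f x" K S "\<lambda>z. \<Sum>i\<in>I. f i z"] by simp
qed (auto intro: idl.zero)

lemma idl_gen: "h \<in> S \<Longrightarrow> h \<in> idl K S"
  using idl.step[OF idl.zero, of h S "\<lambda>_. 1" K] polyfuns.const[of 1 "crd K"] by simp

lemma idl_mono: "f \<in> idl K S \<Longrightarrow> S \<subseteq> S' \<Longrightarrow> f \<in> idl K S'"
  by (induction rule: idl.induct) (auto intro: idl.intros)

lemma idl_vanish: "f \<in> idl K S \<Longrightarrow> (\<forall>h\<in>S. h x = 0) \<Longrightarrow> f x = 0"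
  by (induction rule: idl.induct) auto

lemma idl_polys: "f \<in> idl K S \<Longrightarrow> S \<subseteq> polys K \<Longrightarrow> f \<in> polys K"
proof (induction rule: idl.induct)
  case (step g h a)
  then show ?case by (intro polyfuns.add polyfuns.mult) auto
qed (rule polyfuns.const)

lemma idl_insert:
  "f \<in> idl K (insert h S) \<Longrightarrow> \<exists>a\<in>polys K. \<exists>g\<in>idl K S. f = (\<lambda>x. a x * h x + g x)"
proof (induction rule: idl.induct)
  case zero
  show ?case by (intro bexI[of _ "\<lambda>_. 0"]) (auto intro: polyfuns.const idl.zero)
next
  case (step g h' a)
  then obtain b g' where b: "b \<in> polys K" "g' \<in> idl K S" "g = (\<lambda>x. b x * h x + g' x)" by blast
  show ?case
  proof (cases "h' = h")
    case True
    have "(\<lambda>x. a x * h' x + g x) = (\<lambda>x. (a x + b x) * h x + g' x)" using b True by (auto simp: algebra_simps)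
    then show ?thesis using polyfuns.add[OF step.hyps(3) b(1)] b(2) by (intro bexI)
  next
    case False
    have "(\<lambda>x. a x * h' x + g' x) \<in> idl K S" using False step b by (intro idl.step) auto
    moreover have "(\<lambda>x. a x * h' x + g x) = (\<lambda>x. b x * h x + (a x * h' x + g' x))"
      using b by (auto simp: algebra_simps)
    ultimately show ?thesis using b(1) by (intro bexI)
  qed
qed

lemma idl_insertI: "a \<in> polys K \<Longrightarrow> g \<in> idl K S \<Longrightarrow> (\<lambda>x. a x * h x + g x) \<in> idl K (insert h S)"
  using idl.step[of g K "insert h S" h a] idl_mono[of g K S "insert h S"] by auto

lemma idl_hc:
  assumes "f \<in> idl K S" "\<And>h. h \<in> S \<Longrightarrow> form K h"
  shows "hc n f \<in> idl K S"
  using assms(1)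
proof (induction rule: idl.induct)
  case zero
  show ?case by (auto simp: hc_const[abs_def] intro: idl.zero)
next
  case (step g h a)
  obtain e where e: "homog K e h" using assms(2) step by (auto simp: form_def)
  have "g \<in> polys K" using idl_polys[OF step.hyps(1)] assms(2) form_polys by auto
  then have "hc n (\<lambda>x. a x * h x + g x) = (\<lambda>x. hc n (\<lambda>x. a x * h x) x + hc n g x)"
    using step e by (intro hc_add) (auto intro: polyfuns.mult homog_polys)
  also have "\<dots> \<in> idl K S"
    unfolding hc_mult_homog[OF step.hyps(3) e]
    using step hc_polys[OF step.hyps(3)] by (cases "e \<le> n") (auto intro: idl.step)
  finally show ?case .
qed

lemma idl_of_hc:
  assumes "f \<in> polys K" "\<And>n. hc n f \<in> idl K S"
  shows "f \<in> idl K S"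
  by (rule hc_sum_eq[OF assms(1)], erule ssubst) (auto intro!: idl_sum assms(2))

section \<open>Regular sequences of forms\<close>

definition nonzerodiv :: "'k set \<Rightarrow> (('k \<Rightarrow> complex) \<Rightarrow> complex) set \<Rightarrow> (('k \<Rightarrow> complex) \<Rightarrow> complex) \<Rightarrow> bool" where
  "nonzerodiv K S h \<longleftrightarrow> (\<forall>f\<in>polys K. (\<lambda>x. f x * h x) \<in> idl K S \<longrightarrow> f \<in> idl K S)"

lemma nonzerodiv_homogI:
  assumes "\<And>h. h \<in> S \<Longrightarrow> form K h" "form K j"
    "\<And>n f. homog K n f \<Longrightarrow> (\<lambda>x. f x * j x) \<in> idl K S \<Longrightarrow> f \<in> idl K S"
  shows "nonzerodiv K S j"
  unfolding nonzerodiv_def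
proof (intro ballI impI)
  fix f assume f: "f \<in> polys K" "(\<lambda>x. f x * j x) \<in> idl K S"
  obtain e where e: "homog K e j" using assms(2) by (auto simp: form_def)
  show "f \<in> idl K S"
  proof (rule idl_of_hc[OF f(1)], rule assms(3)[OF homog_hc[OF f(1)]])
    fix n
    show "(\<lambda>x. hc n f x * j x) \<in> idl K S"
      using idl_hc[OF f(2) assms(1), of "n + e"] unfolding hc_mult_homog[OF f(1) e] by simp
  qed
qed

text \<open>By degree: if f j is in the ideal, then f is a multiple a k modulo the ideal, and a has smaller degree than f and
  the same property.\<close>

lemma nonzerodiv_descend:
  assumes S: "\<And>h. h \<in> S \<Longrightarrow> form K h" and k: "form K k" and j: "form K j"
    and "nonzerodiv K (insert k S) j" "nonzerodiv K S k"
  shows "nonzerodiv K S j"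
proof (rule nonzerodiv_homogI[OF S j])
  obtain e where e: "homog K e k" "e \<ge> 1" using k by (auto simp: form_def)
  fix n f assume "homog K n f" "(\<lambda>x. f x * j x) \<in> idl K S"
  then show "f \<in> idl K S"
  proof (induction n arbitrary: f rule: less_induct)
    case (less n)
    have fp: "f \<in> polys K" using less by (simp add: homog_polys)
    have "(\<lambda>x. f x * j x) \<in> idl K (insert k S)" using less idl_mono[of _ K S "insert k S"] by auto
    then have "f \<in> idl K (insert k S)" using assms(4) fp by (auto simp: nonzerodiv_def)
    then obtain a g where a: "a \<in> polys K" "g \<in> idl K S" "f = (\<lambda>x. a x * k x + g x)" using idl_insert by blast
    have gp: "g \<in> polys K" using idl_polys[OF a(2)] S form_polys by auto
    have g': "hc n g \<in> idl K S" by (rule idl_hc[OF a(2) S])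
    have f: "f = (\<lambda>x. hc n (\<lambda>x. a x * k x) x + hc n g x)"
      using hc_homog[OF less.prems(1), of n] hc_add[OF polyfuns.mult[OF a(1) form_polys[OF k]] gp, of n] a(3) by simp
    show ?case
    proof (cases "e \<le> n")
      case False
      then show ?thesis using f g' hc_mult_homog[OF a(1) e(1), of n] by simp
    next
      case True
      define a' where "a' = hc (n - e) a"
      have a': "homog K (n - e) a'" unfolding a'_def by (rule homog_hc[OF a(1)])
      have f': "f = (\<lambda>x. a' x * k x + hc n g x)" using f hc_mult_homog[OF a(1) e(1), of n] True by (simp add: a'_def)
      have "(\<lambda>x. f x * j x - hc n g x * j x) \<in> idl K S"
        by (intro idl_diff less.prems(2) idl_mult_right[OF g'] form_polys j)
      moreover have "(\<lambda>x. f x * j x - hc n g x * j x) = (\<lambda>x. (a' x * j x) * k x)"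
        by (subst f') (simp add: algebra_simps)
      ultimately have "(\<lambda>x. a' x * j x) \<in> idl K S"
        using assms(5) polyfuns.mult[OF homog_polys[OF a'] form_polys[OF j]] by (auto simp: nonzerodiv_def)
      then have "a' \<in> idl K S" using less.IH[OF _ a'] e True by auto
      then show ?thesis by (subst f') (intro idl_add g' idl_mult_right form_polys k)
    qed
  qed
qed

text \<open>The exchange of neighbours in a regular sequence.\<close>

lemma nonzerodiv_swap:
  assumes S: "\<And>h. h \<in> S \<Longrightarrow> form K h" and i: "form K i" and j: "form K j"
    and "nonzerodiv K S i" "nonzerodiv K (insert i S) j"
  shows "nonzerodiv K (insert j S) i"
  unfolding nonzerodiv_def
proof (intro ballI impI)
  fix f assume f: "f \<in> polys K" "(\<lambda>x. f x * i x) \<in> idl K (insert j S)"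
  then obtain b g where b: "b \<in> polys K" "g \<in> idl K S" "(\<lambda>x. f x * i x) = (\<lambda>x. b x * j x + g x)"
    using idl_insert by blast
  have ip: "i \<in> polys K" "j \<in> polys K" using i j form_polys by auto
  have "(\<lambda>x. f x * i x + (- 1) * g x) \<in> idl K (insert i S)"
    using f(1) idl_scale[OF b(2)] by (rule idl_insertI)
  moreover have "(\<lambda>x. f x * i x + (- 1) * g x) = (\<lambda>x. b x * j x)"
    using b(3) by (auto simp: fun_eq_iff)
  ultimately have "b \<in> idl K (insert i S)" using assms(5) b(1) by (auto simp: nonzerodiv_def)
  then obtain c g2 where c: "c \<in> polys K" "g2 \<in> idl K S" "b = (\<lambda>x. c x * i x + g2 x)" using idl_insert by blast
  have "(\<lambda>x. g2 x * j x + g x) \<in> idl K S" by (intro idl_add idl_mult_right b c ip)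
  moreover have "(\<lambda>x. g2 x * j x + g x) = (\<lambda>x. (f x - c x * j x) * i x)"
    using b(3) c(3) by (auto simp: fun_eq_iff algebra_simps)
  moreover have fc: "(\<lambda>x. f x - c x * j x) \<in> polys K" by (intro polyfuns_diff polyfuns.mult f c ip)
  ultimately have "(\<lambda>x. f x - c x * j x) \<in> idl K S" using assms(4) by (auto simp: nonzerodiv_def)
  from idl_insertI[OF c(1) this, of j] show "f \<in> idl K (insert j S)" by simp
qed

text \<open>A regular sequence in every order. Quantifying over all subfamilies makes the members
  interchangeable, so that they can be replaced one at a time.\<close>

definition regular_family :: "'k set \<Rightarrow> 'j set \<Rightarrow> ('j \<Rightarrow> ('k \<Rightarrow> complex) \<Rightarrow> complex) \<Rightarrow> bool" where
  "regular_family K J h \<longleftrightarrow> (\<forall>S\<subseteq>J. \<forall>j\<in>J - S. nonzerodiv K (h ` S) (h j))"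

text \<open>The new member is regular modulo subfamilies by descent, and old members stay regular after it by the swap.\<close>

lemma regular_family_extend:
  assumes "finite J" "j \<in> J" and forms: "\<And>i. i \<in> J \<Longrightarrow> form K (h i)"
    and reg: "regular_family K (J - {j}) h" and nz: "nonzerodiv K (h ` (J - {j})) (h j)"
  shows "regular_family K J h"
proof -
  have down: "nonzerodiv K (h ` S) (h j)" if "S \<subseteq> J - {j}" for S
    using that
  proof (induction "card (J - {j} - S)" arbitrary: S)
    case 0
    then have "S = J - {j}" using assms(1) by auto
    then show ?case using nz by simp
  next
    case (Suc n)
    then have "J - {j} - S \<noteq> {}" by force
    then obtain k where k: "k \<in> J - {j} - S" by blast
    have "J - {j} - insert k S = J - {j} - S - {k}" by auto
    then have "n = card (J - {j} - insert k S)" using Suc.hyps(2) k assms(1) by simp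
    then have "nonzerodiv K (h ` insert k S) (h j)" using Suc.hyps(1)[of "insert k S"] Suc.prems k by auto
    moreover have "nonzerodiv K (h ` S) (h k)" using reg k Suc.prems by (auto simp: regular_family_def)
    ultimately show ?case
      using nonzerodiv_descend[of "h ` S" K "h k" "h j"] forms k Suc.prems assms(2) by auto
  qed
  show ?thesis unfolding regular_family_def
  proof (intro allI impI ballI)
    fix S i assume S: "S \<subseteq> J" "i \<in> J - S"
    show "nonzerodiv K (h ` S) (h i)"
    proof (cases "i = j")
      case True
      then show ?thesis using down[of S] S by auto
    next
      case False
      show ?thesis
      proof (cases "j \<in> S")
        case False
        then show ?thesis using reg S \<open>i \<noteq> j\<close> by (auto simp: regular_family_def)
      next
        case True
        define T where "T = S - {j}"
        have ST: "S = insert j T" "j \<notin> T" using True by (auto simp: T_def)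
        have "nonzerodiv K (h ` T) (h i)" using reg S ST \<open>i \<noteq> j\<close> by (auto simp: regular_family_def)
        moreover have "nonzerodiv K (h ` insert i T) (h j)" using down[of "insert i T"] S ST \<open>i \<noteq> j\<close> by auto
        ultimately have "nonzerodiv K (insert (h j) (h ` T)) (h i)"
          using nonzerodiv_swap[of "h ` T" K "h i" "h j"] forms S ST by auto
        then show ?thesis using ST by simp
      qed
    qed
  qed
qed

lemma regular_family_subset: "regular_family K J h \<Longrightarrow> J' \<subseteq> J \<Longrightarrow> regular_family K J' h"
  unfolding regular_family_def by blast

lemma regular_family_cong: "(\<And>j. j \<in> J \<Longrightarrow> h j = h' j) \<Longrightarrow> regular_family K J h = regular_family K J h'"
  unfolding regular_family_def
  by (rule all_cong, rule ball_cong) (auto simp: image_def subset_iff intro!: arg_cong2[of _ _ _ _ "nonzerodiv K"])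

section \<open>Nullstellensatz\<close>

definition is_ideal :: "'k set \<Rightarrow> (('k \<Rightarrow> complex) \<Rightarrow> complex) set \<Rightarrow> bool" where
  "is_ideal K I \<longleftrightarrow> (\<lambda>_. 0) \<in> I \<and> (\<forall>f\<in>I. \<forall>g\<in>I. (\<lambda>x. f x + g x) \<in> I) \<and>
     (\<forall>f\<in>I. \<forall>r\<in>polys K. (\<lambda>x. r x * f x) \<in> I)"

lemma is_ideal_idl: "is_ideal K (idl K S)"
  unfolding is_ideal_def by (auto intro: idl.zero idl_add idl_mult)

lemma is_ideal_sum: "is_ideal K I \<Longrightarrow> (\<And>i. i \<in> A \<Longrightarrow> f i \<in> I) \<Longrightarrow> (\<lambda>x. \<Sum>i\<in>A. f i x) \<in> I"
proof (induction A rule: infinite_finite_induct)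
  case (insert x A)
  then have "f x \<in> I" "(\<lambda>z. \<Sum>i\<in>A. f i z) \<in> I" by auto
  then show ?case using insert.hyps insert.prems(1) by (auto simp: is_ideal_def)
qed (auto simp: is_ideal_def)

definition adjoin_root where
  "adjoin_root K I k r = {(\<lambda>x. g x + u x * (x k - r)) |g u. g \<in> I \<and> u \<in> polys K}"

lemma adjoin_rootI:
  "f = (\<lambda>x. g x + u x * (x k - r)) \<Longrightarrow> g \<in> I \<Longrightarrow> u \<in> polys K \<Longrightarrow> f \<in> adjoin_root K I k r"
  unfolding adjoin_root_def by (rule CollectI, intro exI conjI) assumption+

lemma is_ideal_adjoin_root:
  assumes I: "is_ideal K I"
  shows "is_ideal K (adjoin_root K I k r)"
  unfolding is_ideal_def
proof (intro conjI ballI)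
  have "(\<lambda>_. 0) \<in> I" using I by (auto simp: is_ideal_def)
  then show "(\<lambda>_. 0) \<in> adjoin_root K I k r"
    by (intro adjoin_rootI[of _ "\<lambda>_. 0" "\<lambda>_. 0"] polyfuns.const) auto
next
  fix f f' assume "f \<in> adjoin_root K I k r" "f' \<in> adjoin_root K I k r"
  then obtain g u g' u' where 1: "g \<in> I" "u \<in> polys K" "f = (\<lambda>x. g x + u x * (x k - r))"
    "g' \<in> I" "u' \<in> polys K" "f' = (\<lambda>x. g' x + u' x * (x k - r))" unfolding adjoin_root_def by blast
  then have "(\<lambda>x. f x + f' x) = (\<lambda>x. (g x + g' x) + (u x + u' x) * (x k - r))" by (auto simp: algebra_simps)
  moreover have "(\<lambda>x. g x + g' x) \<in> I" "(\<lambda>x. u x + u' x) \<in> polys K"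
    using 1 I by (auto simp: is_ideal_def intro: polyfuns.add)
  ultimately show "(\<lambda>x. f x + f' x) \<in> adjoin_root K I k r" by (rule adjoin_rootI)
next
  fix f p assume "f \<in> adjoin_root K I k r" and p: "p \<in> polys K"
  then obtain g u where 1: "g \<in> I" "u \<in> polys K" "f = (\<lambda>x. g x + u x * (x k - r))"
    unfolding adjoin_root_def by blast
  then have "(\<lambda>x. p x * f x) = (\<lambda>x. (p x * g x) + (p x * u x) * (x k - r))" by (auto simp: algebra_simps)
  moreover have "(\<lambda>x. p x * g x) \<in> I" "(\<lambda>x. p x * u x) \<in> polys K"
    using 1 I p by (auto simp: is_ideal_def intro: polyfuns.mult)
  ultimately show "(\<lambda>x. p x * f x) \<in> adjoin_root K I k r" by (rule adjoin_rootI)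
qed

lemma adjoin_root_mono: "g \<in> I \<Longrightarrow> g \<in> adjoin_root K I k r"
  by (rule adjoin_rootI[of _ g "\<lambda>_. 0"]) (auto intro: polyfuns.const)

lemma adjoin_root_gen: "is_ideal K I \<Longrightarrow> (\<lambda>x. x k - r) \<in> adjoin_root K I k r"
  by (rule adjoin_rootI[of _ "\<lambda>_. 0" "\<lambda>_. 1"]) (auto simp: is_ideal_def intro: polyfuns.const)

lemma polys_poly: "k \<in> K \<Longrightarrow> (\<lambda>x. poly q (x k)) \<in> polys K"
  by (induction q) (auto intro!: polyfuns.const polyfuns.add polyfuns.mult polys_coord)

lemma spanned_pdeg:
  assumes "finite K"
  shows "\<exists>m. spanned UNIV m (pdeg (crd K) n)"
proof -
  have "growth UNIV ({} \<union> (\<lambda>k x. x k) ` K) (0 + int (card K))"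
    by (intro growth_add_functions growth_no_functions assms)
  then have "growth (UNIV :: ('a \<Rightarrow> complex) set) (crd K) (int (card K))" by (simp add: crd_def)
  then obtain c where "\<And>n. n \<ge> 1 \<Longrightarrow> \<exists>m. real m \<le> c * real n powi int (card K) \<and>
    spanned (UNIV :: ('a \<Rightarrow> complex) set) m (pdeg (crd K) n)" using growth_pos by blast
  from this[of "Suc n"] obtain m where m: "spanned (UNIV :: ('a \<Rightarrow> complex) set) m (pdeg (crd K) (Suc n))" by auto
  then obtain g where "\<forall>p. pdeg (crd K) (Suc n) p \<longrightarrow> (\<exists>a. \<forall>z\<in>(UNIV :: ('a \<Rightarrow> complex) set). p z = (\<Sum>i<m. a i * g i z))"
    unfolding spanned_def by blast
  then have "\<forall>p. pdeg (crd K) n p \<longrightarrow> (\<exists>a. \<forall>z\<in>(UNIV :: ('a \<Rightarrow> complex) set). p z = (\<Sum>i<m. a i * g i z))"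
    using pdeg_Suc by blast
  then show ?thesis unfolding spanned_def by blast
qed

text \<open>If no translate of the coordinate could be adjoined, then the uncountably many inverses of
  the translates would satisfy a linear relation, so that the coordinate would satisfy an
  algebraic equation modulo I; one of the roots can then be adjoined after all.\<close>

lemma adjoin_root_proper:
  assumes I: "is_ideal K I" "(\<lambda>_. 1) \<notin> I" and K: "finite K" and k: "k \<in> K"
  shows "\<exists>r. (\<lambda>_. 1) \<notin> adjoin_root K I k r"
proof (rule ccontr)
  assume "\<not> (\<exists>r. (\<lambda>_. 1) \<notin> adjoin_root K I k r)"
  then have "\<forall>r. \<exists>w. fst w \<in> I \<and> snd w \<in> polys K \<and> (\<lambda>_. 1) = (\<lambda>x. fst w x + snd w x * (x k - r))"
    unfolding adjoin_root_def by fastforce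
  from choice[OF this] obtain w where w: "\<forall>r. fst (w r) \<in> I \<and> snd (w r) \<in> polys K \<and>
    (\<lambda>_. 1) = (\<lambda>x. fst (w r) x + snd (w r) x * (x k - r))" by blast
  define u g where "u = (\<lambda>r. snd (w r))" "g = (\<lambda>r. fst (w r))"
  then have ug: "\<And>r. g r \<in> I" "\<And>r. u r \<in> polys K" "\<And>r. (\<lambda>_. 1) = (\<lambda>x. g r x + u r x * (x k - r))"
    using w by blast+
  have ug1: "u r x * (x k - r) = 1 - g r x" for r x using fun_cong[OF ug(3)[of r], of x] by (simp add: algebra_simps)
  have IM: "(\<lambda>x. r x * f x) \<in> I" if "f \<in> I" "r \<in> polys K" for f r using I that by (auto simp: is_ideal_def)
  have IA: "(\<lambda>x. f x + f' x) \<in> I" if "f \<in> I" "f' \<in> I" for f f' using I that by (auto simp: is_ideal_def)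
  have "\<exists>n. infinite {r. pdeg (crd K) n (u r)}"
  proof (rule ccontr)
    assume "\<not> ?thesis"
    then have "countable (\<Union>n. {r. pdeg (crd K) n (u r)})" by (intro countable_UN) (auto intro: countable_finite)
    moreover have "r \<in> (\<Union>n. {r. pdeg (crd K) n (u r)})" for r using polyfuns_imp_pdeg[OF ug(2)[of r]] by simp
    then have "(\<Union>n. {r. pdeg (crd K) n (u r)}) = UNIV" by blast
    ultimately show False using uncountable_UNIV_complex by simp
  qed
  then obtain n where n: "infinite {r. pdeg (crd K) n (u r)}" by blast
  obtain m where "spanned (UNIV :: ('a \<Rightarrow> complex) set) m (pdeg (crd K) n)" using spanned_pdeg[OF K] by blast
  then obtain b where b: "\<forall>p. pdeg (crd K) n p \<longrightarrow> (\<exists>a. \<forall>z\<in>UNIV. p z = (\<Sum>i<m. a i * b i z))"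
    unfolding spanned_def by blast
  obtain R where R: "finite R" "card R = Suc m" "R \<subseteq> {r. pdeg (crd K) n (u r)}"
    using infinite_arbitrarily_large[OF n] by blast
  then have "\<forall>r\<in>R. \<exists>a. \<forall>z. u r z = (\<Sum>i<m. a i * b i z)" using b by auto
  from bchoice[OF this] obtain \<alpha> where \<alpha>: "\<And>r z. r \<in> R \<Longrightarrow> u r z = (\<Sum>i<m. \<alpha> r i * b i z)" by blast
  obtain a where a: "\<exists>r\<in>R. a r \<noteq> 0" "\<forall>j<m. (\<Sum>r\<in>R. a r * \<alpha> r j) = 0"
    using underdetermined_solution[of R m \<alpha>] R by auto
  have dep: "(\<Sum>r\<in>R. a r * u r z) = 0" for z
  proof -
    have "(\<Sum>r\<in>R. a r * u r z) = (\<Sum>r\<in>R. \<Sum>i<m. a r * \<alpha> r i * b i z)"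
      using \<alpha> by (intro sum.cong) (auto simp: sum_distrib_left mult.assoc)
    also have "\<dots> = (\<Sum>i<m. (\<Sum>r\<in>R. a r * \<alpha> r i) * b i z)" by (subst sum.swap) (simp add: sum_distrib_right)
    finally show ?thesis using a(2) by simp
  qed
  define q where "q = (\<Sum>r\<in>R. smult (a r) (\<Prod>s\<in>R - {r}. [:- s, 1:]))"
  have q: "poly q t = (\<Sum>r\<in>R. a r * (\<Prod>s\<in>R - {r}. t - s))" for t
    by (simp add: q_def poly_sum poly_prod)
  obtain r0 where r0: "r0 \<in> R" "a r0 \<noteq> 0" using a(1) by blast
  have "poly q r0 = a r0 * (\<Prod>s\<in>R - {r0}. r0 - s)"
    unfolding q using R(1) r0 by (subst sum.remove[of _ r0]) (auto intro!: sum.neutral)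
  then have "poly q r0 \<noteq> 0" using R(1) r0 by auto
  then have "q \<noteq> 0" by auto
  moreover have "(\<lambda>x. poly q (x k)) \<in> I"
  proof -
    have "poly q (x k) = (\<Sum>r\<in>R. (a r * (\<Prod>s\<in>R - {r}. x k - s)) * g r x)" for x
    proof -
      have "poly q (x k) = (\<Sum>r\<in>R. a r * (\<Prod>s\<in>R - {r}. x k - s) * (g r x + u r x * (x k - r)))"
        unfolding q by (simp add: ug1)
      also have "\<dots> = (\<Sum>r\<in>R. a r * (\<Prod>s\<in>R - {r}. x k - s) * g r x) + (\<Sum>r\<in>R. (\<Prod>s\<in>R. x k - s) * (a r * u r x))"
        unfolding sum.distrib[symmetric]
      proof (rule sum.cong)
        fix r assume "r \<in> R"
        then have "(\<Prod>s\<in>R. x k - s) = (x k - r) * (\<Prod>s\<in>R - {r}. x k - s)" using R(1) by (simp add: prod.remove)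
        then show "a r * (\<Prod>s\<in>R - {r}. x k - s) * (g r x + u r x * (x k - r)) =
          a r * (\<Prod>s\<in>R - {r}. x k - s) * g r x + (\<Prod>s\<in>R. x k - s) * (a r * u r x)"
            by (simp only: distrib_left mult_ac)
      qed simp
      also have "(\<Sum>r\<in>R. (\<Prod>s\<in>R. x k - s) * (a r * u r x)) = (\<Prod>s\<in>R. x k - s) * (\<Sum>r\<in>R. a r * u r x)"
        by (simp add: sum_distrib_left)
      finally show ?thesis using dep by simp
    qed
    moreover have "(\<lambda>x. \<Sum>r\<in>R. (a r * (\<Prod>s\<in>R - {r}. x k - s)) * g r x) \<in> I"
      by (rule is_ideal_sum[OF I(1)], rule IM[OF ug(1)])
        (intro polyfuns.mult polyfuns.const polyfuns_prod polyfuns_diff polys_coord k)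
    ultimately show ?thesis by simp
  qed
  ultimately show False
  proof (induction "degree q" arbitrary: q rule: less_induct)
    case less
    show False
    proof (cases "constant (poly q)")
      case True
      then have c: "poly q t = poly q 0" for t by (auto simp: constant_def)
      have "poly q 0 \<noteq> 0"
      proof
        assume "poly q 0 = 0"
        then have "\<forall>t. poly q t = 0" using c by simp
        then show False using less.prems(1) poly_all_0_iff_0[of q] by blast
      qed
      then have "(\<lambda>_. 1) = (\<lambda>x. (1 / poly q 0) * poly q (x k))" using c by (auto simp: fun_eq_iff)
      also have "\<dots> \<in> I" by (rule IM[OF less.prems(2) polyfuns.const])
      finally show False using I(2) by simp
    next
      case False
      then obtain r where r: "poly q r = 0" using fundamental_theorem_of_algebra by blast
      then obtain q' where q': "q = [:- r, 1:] * q'" using poly_eq_0_iff_dvd by blast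
      have "q' \<noteq> 0" using less.prems q' by auto
      then have "degree q' < degree q" unfolding q' by (subst degree_mult_eq) auto
      moreover have "(\<lambda>x. poly q' (x k)) \<in> I"
      proof -
        have "poly q' (x k) = poly q' (x k) * g r x + u r x * poly q (x k)" for x
        proof -
          have "u r x * poly q (x k) = (u r x * (x k - r)) * poly q' (x k)" by (simp add: q' algebra_simps)
          also have "\<dots> = (1 - g r x) * poly q' (x k)" by (simp only: ug1)
          finally have e: "u r x * poly q (x k) = (1 - g r x) * poly q' (x k)" .
          show ?thesis unfolding e by (simp add: algebra_simps)
        qed
        moreover have "(\<lambda>x. poly q' (x k) * g r x + u r x * poly q (x k)) \<in> I"
          by (intro IA IM ug less.prems polys_poly k)
        ultimately show ?thesis by simp
      qed
      ultimately show False using less.hyps \<open>q' \<noteq> 0\<close> by blast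
    qed
  qed
qed

text \<open>The coordinates can be specialized one after the other.\<close>

lemma nullstellensatz:
  assumes I: "is_ideal K I" "(\<lambda>_. 1) \<notin> I" "I \<subseteq> polys K" and K: "finite K"
  shows "\<exists>r. \<forall>p\<in>I. p r = 0"
proof -
  have "\<exists>I' r. is_ideal K I' \<and> I \<subseteq> I' \<and> (\<lambda>_. 1) \<notin> I' \<and> (\<forall>k\<in>L. (\<lambda>x. x k - r k) \<in> I')" if "L \<subseteq> K" for L
    using finite_subset[OF that K] that
  proof (induction L rule: finite_induct)
    case empty
    then show ?case using I by (intro exI[of _ I]) auto
  next
    case (insert k L)
    then obtain I' r where I': "is_ideal K I'" "I \<subseteq> I'" "(\<lambda>_. 1) \<notin> I'" "\<forall>k\<in>L. (\<lambda>x. x k - r k) \<in> I'" by auto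
    obtain s where s: "(\<lambda>_. 1) \<notin> adjoin_root K I' k s" using adjoin_root_proper[OF I'(1,3) K] insert.prems by blast
    show ?case
    proof (intro exI[of _ "adjoin_root K I' k s"] exI[of _ "r(k := s)"] conjI)
      show "\<forall>ka\<in>insert k L. (\<lambda>x. x ka - (r(k := s)) ka) \<in> adjoin_root K I' k s"
      proof
        fix l assume "l \<in> insert k L"
        then show "(\<lambda>x. x l - (r(k := s)) l) \<in> adjoin_root K I' k s"
          using I'(4) adjoin_root_mono[of "\<lambda>x. x l - r l" I'] adjoin_root_gen[OF I'(1)] insert.hyps
          by (cases "l = k") auto
      qed
      show "I \<subseteq> adjoin_root K I' k s" using I'(2) adjoin_root_mono[of _ I' K k s] by blast
    qed (rule is_ideal_adjoin_root[OF I'(1)] s)+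
  qed
  then obtain I' r where I': "is_ideal K I'" "I \<subseteq> I'" "(\<lambda>_. 1) \<notin> I'" "\<forall>k\<in>K. (\<lambda>x. x k - r k) \<in> I'" by blast
  have IM: "(\<lambda>x. r x * f x) \<in> I'" if "f \<in> I'" "r \<in> polys K" for f r using I' that by (auto simp: is_ideal_def)
  have IA: "(\<lambda>x. f x + f' x) \<in> I'" if "f \<in> I'" "f' \<in> I'" for f f' using I' that by (auto simp: is_ideal_def)
  have ev: "(\<lambda>x. p x - p r) \<in> I'" if "p \<in> polys K" for p
    using that
  proof (induction rule: polyfuns.induct)
    case (const c)
    then show ?case using I'(1) by (simp add: is_ideal_def)
  next
    case (coord f)
    then show ?case using I'(4) by (auto simp: crd_def)
  next
    case (add f g)
    have "(\<lambda>x. (f x - f r) + (g x - g r)) = (\<lambda>x. f x + g x - (f r + g r))" by (auto simp: fun_eq_iff)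
    then show ?case using IA[OF add.IH] by simp
  next
    case (mult f g)
    have "(\<lambda>x. g x * (f x - f r) + f r * (g x - g r)) \<in> I'"
      by (intro IA IM mult polyfuns.const)
    moreover have "(\<lambda>x. g x * (f x - f r) + f r * (g x - g r)) = (\<lambda>x. f x * g x - f r * g r)"
      by (auto simp: fun_eq_iff algebra_simps)
    ultimately show ?case by simp
  qed
  have "p r = 0" if p: "p \<in> I" for p
  proof (rule ccontr)
    assume nz: "p r \<noteq> 0"
    have "(\<lambda>x. p x + (-1) * (p x - p r)) \<in> I'"
      using p I'(2) I(3) by (intro IA IM ev polyfuns.const) auto
    then have "(\<lambda>x. (1 / p r) * (p x + (-1) * (p x - p r))) \<in> I'" by (rule IM[OF _ polyfuns.const])
    then show False using nz I'(3) by simp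
  qed
  then show ?thesis by blast
qed

text \<open>Rabinowitsch's trick with x k in the role of the inverse: 1 is a combination of the ideal and x k - 1, and
  comparing homogeneous components turns this into a power of x k.\<close>

lemma power_in_idl:
  assumes S: "\<And>h. h \<in> S \<Longrightarrow> form K h" and K: "finite K" and k: "k \<in> K"
    and V: "\<And>x. \<forall>h\<in>S. h x = 0 \<Longrightarrow> x k = 0"
  shows "\<exists>m. (\<lambda>x. x k ^ m) \<in> idl K S"
proof -
  define I where "I = adjoin_root K (idl K S) k 1"
  have Sp: "S \<subseteq> polys K" using S form_polys by auto
  have I: "is_ideal K I" unfolding I_def by (rule is_ideal_adjoin_root[OF is_ideal_idl])
  have Ip: "I \<subseteq> polys K" unfolding I_def adjoin_root_def
    using idl_polys[OF _ Sp] by (auto intro!: polyfuns.add polyfuns.mult polyfuns_diff polyfuns.const polys_coord k)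
  have "(\<lambda>_. 1) \<in> I"
  proof (rule ccontr)
    assume "(\<lambda>_. 1) \<notin> I"
    then obtain r where r: "\<forall>p\<in>I. p r = 0" using nullstellensatz[OF I _ Ip K] by blast
    have "\<forall>h\<in>S. h r = 0" using r adjoin_root_mono[OF idl_gen[of _ S K]] unfolding I_def by blast
    then have "r k = 0" by (rule V)
    moreover have "(\<lambda>x. x k - 1) r = 0"
      by (rule bspec[OF r]) (unfold I_def, rule adjoin_root_gen[OF is_ideal_idl])
    ultimately show False by simp
  qed
  then obtain g u where gu: "g \<in> idl K S" "u \<in> polys K" "(\<lambda>_. 1) = (\<lambda>x. g x + u x * (x k - 1))"
    unfolding I_def adjoin_root_def by blast
  have gp: "g \<in> polys K" using idl_polys[OF gu(1) Sp] .
  have u: "u = (\<lambda>x. u x * x k + (g x + (- 1)))"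
  proof
    fix x
    have "g x + u x * (x k - 1) = 1" using fun_cong[OF gu(3), of x] by simp
    then show "u x = u x * x k + (g x + (- 1))" by (simp add: algebra_simps)
  qed
  have hcu: "hc n u = (\<lambda>x. (if 1 \<le> n then hc (n - 1) u x * x k else 0) + (hc n g x + (if n = 0 then - 1 else 0)))" for n
  proof -
    have p: "(\<lambda>x. u x * x k) \<in> polys K" "(\<lambda>x. g x + (- 1)) \<in> polys K" "(\<lambda>x. - 1) \<in> polys K"
      by (intro polyfuns.mult polyfuns.add polyfuns.const polys_coord k gu(2) gp)+
    have "hc n u = hc n (\<lambda>x. u x * x k + (g x + (- 1)))" using arg_cong[OF u, of "hc n"] .
    also have "\<dots> = (\<lambda>x. hc n (\<lambda>x. u x * x k) x + hc n (\<lambda>x. g x + (- 1)) x)" by (rule hc_add[OF p(1,2)])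
    also have "hc n (\<lambda>x. g x + (- 1)) = (\<lambda>x. hc n g x + hc n (\<lambda>x. - 1) x)" by (rule hc_add[OF gp p(3)])
    also have "hc n (\<lambda>x. u x * x k) = (if 1 \<le> n then (\<lambda>x. hc (n - 1) u x * x k) else (\<lambda>_. 0))"
      by (rule hc_mult_homog[OF gu(2) homog_coord[OF k]])
    finally show ?thesis by (auto simp: hc_const fun_eq_iff)
  qed
  have main: "(\<lambda>x. hc n u x + x k ^ n) \<in> idl K S" for n
  proof (induction n)
    case 0
    have "(\<lambda>x. hc 0 u x + x k ^ 0) = hc 0 g" using hcu[of 0] by (simp add: fun_eq_iff)
    then show ?case using idl_hc[OF gu(1) S, of 0] by simp
  next
    case (Suc n)
    have "(\<lambda>x. hc (Suc n) u x + x k ^ Suc n) = (\<lambda>x. x k * (hc n u x + x k ^ n) + hc (Suc n) g x)"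
      using hcu[of "Suc n"] by (simp add: fun_eq_iff algebra_simps)
    then show ?case using idl_add[OF idl_mult[OF Suc polys_coord[OF k]] idl_hc[OF gu(1) S]] by simp
  qed
  obtain d where "\<And>n. n > d \<Longrightarrow> hc n u = (\<lambda>_. 0)" using hc_sum_eq[OF gu(2)] by blast
  then have "hc (Suc d) u = (\<lambda>_. 0)" by simp
  with main[of "Suc d"] have "(\<lambda>x. x k ^ Suc d) \<in> idl K S" by simp
  then show ?thesis by (intro exI[of _ "Suc d"]) simp
qed

lemma homog_in_idl:
  assumes S: "\<And>h. h \<in> S \<Longrightarrow> form K h" and K: "finite K"
    and V: "\<And>x k. \<forall>h\<in>S. h x = 0 \<Longrightarrow> k \<in> K \<Longrightarrow> x k = 0"
  shows "\<exists>N. \<forall>n\<ge>N. \<forall>f. homog K n f \<longrightarrow> f \<in> idl K S"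
proof -
  have "\<exists>N. \<forall>n\<ge>N. \<forall>f. homog L n f \<longrightarrow> f \<in> idl K S" if "L \<subseteq> K" for L
    using finite_subset[OF that K] that
  proof (induction L rule: finite_induct)
    case empty
    have "f = (\<lambda>_. 0)" if f: "homog {} n f" "n \<ge> 1" for n f
    proof -
      have "f x = f (\<lambda>k. 0 * x k)" for x by (rule polys_cong[OF homog_polys[OF f(1)]]) auto
      moreover have "f (\<lambda>k. 0 * x k) = 0 ^ n * f x" for x using f(1) unfolding homog_def by blast
      moreover have "(0::complex) ^ n = 0" using f(2) by simp
      ultimately have "f x = 0" for x by (metis mult_zero_left)
      then show ?thesis by (rule ext)
    qed
    then show ?case by (intro exI[of _ 1]) (auto intro: idl.zero)
  next
    case (insert k L)
    then obtain N where N: "\<And>n f. n \<ge> N \<Longrightarrow> homog L n f \<Longrightarrow> f \<in> idl K S" by auto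
    have kK: "k \<in> K" using insert.prems by simp
    obtain m where m: "(\<lambda>x. x k ^ m) \<in> idl K S" using power_in_idl[OF S K kK] V[OF _ kK] by blast
    show ?case
    proof (intro exI[of _ "N + m"] allI impI)
      fix n f assume n: "N + m \<le> n" and f: "homog (insert k L) n f"
      obtain e where e: "pdeg (crd (insert k L)) e f" using polyfuns_imp_pdeg[OF homog_polys[OF f]] by blast
      have "crd (insert k L) = insert (\<lambda>x. x k) (crd L)" by (auto simp: crd_def)
      then obtain P where P: "\<forall>j\<le>e. pdeg (crd L) e (P j)" "f = (\<lambda>x. \<Sum>j\<le>e. P j x * x k ^ j)"
        using pdeg_insert[of "\<lambda>x. x k" "crd L" e f] e by auto
      have PL: "P j \<in> polys L" if "j \<le> e" for j using P(1) that pdeg_imp_polyfuns by blast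
      have PK: "P j \<in> polys K" if "j \<le> e" for j by (rule polys_mono[OF PL[OF that]]) (use insert.prems in auto)
      have hk: "homog K j (\<lambda>x. x k ^ j)" for j using homog_power[OF homog_coord[OF kK], of j] by simp
      have term_in: "hc n (\<lambda>x. P j x * x k ^ j) \<in> idl K S" if j: "j \<le> e" for j
      proof (cases "j \<ge> m")
        case True
        have "(\<lambda>x. (P j x * x k ^ (j - m)) * x k ^ m) \<in> idl K S"
          by (intro idl_mult m polyfuns.mult PK j polyfuns_power polys_coord kK)
        moreover have "(\<lambda>x. (P j x * x k ^ (j - m)) * x k ^ m) = (\<lambda>x. P j x * x k ^ j)"
          using True by (simp add: mult.assoc power_add[symmetric])
        ultimately have "(\<lambda>x. P j x * x k ^ j) \<in> idl K S" by simp
        then show ?thesis by (rule idl_hc[OF _ S])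
      next
        case False
        have "homog L (n - j) (hc (n - j) (P j))" by (rule homog_hc[OF PL[OF j]])
        then have "hc (n - j) (P j) \<in> idl K S" using N[of "n - j"] n False by auto
        then have "(\<lambda>x. hc (n - j) (P j) x * x k ^ j) \<in> idl K S"
          by (rule idl_mult_right) (intro polyfuns_power polys_coord kK)
        then show ?thesis unfolding hc_mult_homog[OF PK[OF j] hk] using idl.zero[of K S] by simp
      qed
      have "hc n (\<lambda>x. \<Sum>j\<in>A. P j x * x k ^ j) = (\<lambda>x. \<Sum>j\<in>A. hc n (\<lambda>x. P j x * x k ^ j) x)" if "A \<subseteq> {..e}" for A
        using finite_subset[OF that finite_atMost] that
      proof (induction A rule: finite_induct)
        case empty
        then show ?case by (auto simp: hc_const)
      next
        case (insert j A)
        have "(\<lambda>x. P j x * x k ^ j) \<in> polys K"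
          by (intro polyfuns.mult PK polyfuns_power polys_coord kK) (use insert.prems in auto)
        moreover have "(\<lambda>x. \<Sum>j\<in>A. P j x * x k ^ j) \<in> polys K"
          by (intro polyfuns_sum polyfuns.mult PK polyfuns_power polys_coord kK) (use insert.prems in auto)
        ultimately have "hc n (\<lambda>x. P j x * x k ^ j + (\<Sum>j\<in>A. P j x * x k ^ j)) =
            (\<lambda>x. hc n (\<lambda>x. P j x * x k ^ j) x + hc n (\<lambda>x. \<Sum>j\<in>A. P j x * x k ^ j) x)" by (rule hc_add)
        then show ?case using insert by auto
      qed
      from this[OF order_refl] have "hc n f = (\<lambda>x. \<Sum>j\<le>e. hc n (\<lambda>x. P j x * x k ^ j) x)" unfolding P(2)[symmetric] by simp
      moreover have "hc n f = f" using hc_homog[OF f, of n] by simp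
      moreover have "(\<lambda>x. \<Sum>j\<le>e. hc n (\<lambda>x. P j x * x k ^ j) x) \<in> idl K S" by (intro idl_sum term_in) auto
      ultimately show "f \<in> idl K S" by simp
    qed
  qed
  then show ?thesis by blast
qed

section \<open>Systems of parameters\<close>

lemma poly_on_line:
  assumes "p \<in> polys K"
  shows "\<exists>Q. \<forall>s. poly Q s = p (\<lambda>k. x k + s * y k)"
  using assms
proof (induction rule: polyfuns.induct)
  case (const c) then show ?case by (intro exI[of _ "[:c:]"]) auto
next
  case (coord f)
  then obtain k where "f = (\<lambda>x. x k)" by (auto simp: crd_def)
  then show ?case by (intro exI[of _ "[:x k, y k:]"]) auto
next
  case (add f g)
  then obtain q r where "\<forall>s. poly q s = f (\<lambda>k. x k + s * y k)" "\<forall>s. poly r s = g (\<lambda>k. x k + s * y k)" by blast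
  then show ?case by (intro exI[of _ "q + r"]) auto
next
  case (mult f g)
  then obtain q r where "\<forall>s. poly q s = f (\<lambda>k. x k + s * y k)" "\<forall>s. poly r s = g (\<lambda>k. x k + s * y k)" by blast
  then show ?case by (intro exI[of _ "q * r"]) auto
qed

lemma polys_domain:
  assumes "p \<in> polys K" "q \<in> polys K" "\<And>x. p x * q x = 0"
  shows "(\<forall>x. p x = 0) \<or> (\<forall>x. q x = 0)"
proof (rule ccontr)
  assume "\<not> ?thesis"
  then obtain x y where xy: "p x \<noteq> 0" "q y \<noteq> 0" by blast
  obtain P where P: "\<And>s. poly P s = p (\<lambda>k. x k + s * (y k - x k))"
    using poly_on_line[OF assms(1), of x "\<lambda>k. y k - x k"] by blast
  obtain Q where Q: "\<And>s. poly Q s = q (\<lambda>k. x k + s * (y k - x k))"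
    using poly_on_line[OF assms(2), of x "\<lambda>k. y k - x k"] by blast
  have "poly (P * Q) s = 0" for s using assms(3) P Q by simp
  then have "P * Q = 0" using poly_all_0_iff_0 by blast
  moreover have "poly P 0 \<noteq> 0" "poly Q 1 \<noteq> 0" using xy P[of 0] Q[of 1] by auto
  ultimately show False by auto
qed

lemma vanish_on_coordinate_subspace:
  assumes "f \<in> polys K" "L \<subseteq> K" "\<And>x. \<forall>k\<in>L. x k = 0 \<Longrightarrow> f x = 0"
  shows "f \<in> idl K ((\<lambda>k x. x k) ` L)"
proof -
  define \<pi> where "\<pi> = (\<lambda>(x :: 'a \<Rightarrow> complex) k. if k \<in> L then 0 else x k)"
  have "(\<lambda>x. p x - p (\<pi> x)) \<in> idl K ((\<lambda>k x. x k) ` L) \<and> (\<lambda>x. p (\<pi> x)) \<in> polys K" if "p \<in> polys K" for p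
    using that
  proof (induction rule: polyfuns.induct)
    case (const c)
    then show ?case by (auto intro: idl.zero polyfuns.const)
  next
    case (coord f)
    then obtain k where k: "f = (\<lambda>x. x k)" "k \<in> K" by (auto simp: crd_def)
    show ?case
    proof (cases "k \<in> L")
      case True
      then show ?thesis by (auto simp: k \<pi>_def intro!: idl_gen polyfuns.const)
    next
      case False
      then show ?thesis using polys_coord[OF k(2)] by (auto simp: k \<pi>_def intro: idl.zero)
    qed
  next
    case (add f g)
    have "(\<lambda>x. (f x - f (\<pi> x)) + (g x - g (\<pi> x))) \<in> idl K ((\<lambda>k x. x k) ` L)"
      using add.IH by (intro idl_add) auto
    moreover have "(\<lambda>x. (f x - f (\<pi> x)) + (g x - g (\<pi> x))) = (\<lambda>x. f x + g x - (f (\<pi> x) + g (\<pi> x)))"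
      by (auto simp: fun_eq_iff)
    ultimately show ?case using add.IH by (auto intro: polyfuns.add)
  next
    case (mult f g)
    have "(\<lambda>x. g x * (f x - f (\<pi> x)) + f (\<pi> x) * (g x - g (\<pi> x))) \<in> idl K ((\<lambda>k x. x k) ` L)"
      using mult.IH mult.hyps by (intro idl_add idl_mult) auto
    moreover have "(\<lambda>x. g x * (f x - f (\<pi> x)) + f (\<pi> x) * (g x - g (\<pi> x))) = (\<lambda>x. f x * g x - f (\<pi> x) * g (\<pi> x))"
      by (auto simp: fun_eq_iff algebra_simps)
    ultimately show ?case using mult.IH by (auto intro: polyfuns.mult)
  qed
  from conjunct1[OF this[OF assms(1)]] show ?thesis using assms(3) by (simp add: \<pi>_def)
qed

lemma nonzerodiv_coordinate:
  assumes "L \<subseteq> K" "j \<in> K - L"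
  shows "nonzerodiv K ((\<lambda>k x. x k) ` L) (\<lambda>x. x j)"
  unfolding nonzerodiv_def
proof (intro ballI impI)
  fix f assume f: "f \<in> polys K" "(\<lambda>x. f x * x j) \<in> idl K ((\<lambda>k x. x k) ` L)"
  define \<pi> where "\<pi> = (\<lambda>(x :: 'a \<Rightarrow> complex) k. if k \<in> L then 0 else x k)"
  have "(\<lambda>x. f (\<lambda>k. (\<lambda>x. if k \<in> L then 0 else x k) x)) \<in> polys K"
  proof (rule polys_subst[OF f(1)])
    fix k assume "k \<in> K"
    then show "(\<lambda>x. if k \<in> L then 0 else x k) \<in> polys K"
      by (cases "k \<in> L") (auto intro: polyfuns.const polys_coord)
  qed
  then have fp: "(\<lambda>x. f (\<pi> x)) \<in> polys K" by (simp add: \<pi>_def)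
  have "f (\<pi> x) * x j = 0" for x
  proof -
    have "(\<lambda>x. f x * x j) (\<pi> x) = 0" by (rule idl_vanish[OF f(2)]) (auto simp: \<pi>_def)
    then show ?thesis using assms(2) by (auto simp: \<pi>_def)
  qed
  then have "(\<forall>x. f (\<pi> x) = 0) \<or> (\<forall>x :: 'a \<Rightarrow> complex. x j = 0)"
    using assms(2) by (intro polys_domain[OF fp polys_coord[of j K]]) auto
  moreover have "\<not> (\<forall>x :: 'a \<Rightarrow> complex. x j = 0)"
    by (rule notI, drule spec[of _ "\<lambda>_. 1"]) simp
  ultimately have z: "f (\<pi> x) = 0" for x by blast
  have "f x = 0" if x: "\<forall>k\<in>L. x k = 0" for x
  proof -
    have "\<pi> x = x" using x by (auto simp: \<pi>_def fun_eq_iff)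
    then show ?thesis using z[of x] by simp
  qed
  then show "f \<in> idl K ((\<lambda>k x. x k) ` L)" by (rule vanish_on_coordinate_subspace[OF f(1) assms(1)])
qed

lemma homog_modulo:
  assumes S: "\<And>a. a \<in> S \<Longrightarrow> form K a" and h: "homog K e h" and f: "homog K (n + e) f" "f \<in> idl K (insert h S)"
  shows "\<exists>b. homog K n b \<and> (\<lambda>x. f x - b x * h x) \<in> idl K S"
proof -
  obtain a g where a: "a \<in> polys K" "g \<in> idl K S" "f = (\<lambda>x. a x * h x + g x)" using idl_insert[OF f(2)] by blast
  have gp: "g \<in> polys K" using idl_polys[OF a(2)] S form_polys by auto
  have ahp: "(\<lambda>x. a x * h x) \<in> polys K" by (intro polyfuns.mult a homog_polys[OF h])
  have "f = hc (n + e) (\<lambda>x. a x * h x + g x)" using hc_homog[OF f(1), of "n + e"] a(3) by simp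
  also have "\<dots> = (\<lambda>x. hc (n + e) (\<lambda>x. a x * h x) x + hc (n + e) g x)" by (rule hc_add[OF ahp gp])
  finally have "(\<lambda>x. f x - hc n a x * h x) = hc (n + e) g"
    using hc_mult_homog[OF a(1) h, of "n + e"] by (simp add: fun_eq_iff)
  then show ?thesis using homog_hc[OF a(1), of n] idl_hc[OF a(2) S, of "n + e"] by auto
qed

text \<open>If f h lies in the ideal and f does not, then the products f l^j give nonzero classes killed by h in all
  large degrees. As multiplication by h is onto in large degrees, the homogeneous parts of the quotient in
  degrees n, n + e, n + 2 e, ... would have strictly decreasing dimensions.\<close>

lemma nonzerodiv_exchange:
  assumes S: "\<And>a. a \<in> S \<Longrightarrow> form K a" and K: "finite K"
    and l: "homog K 1 l" "nonzerodiv K S l" and h: "homog K e h" "e \<ge> 1"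
    and N: "\<And>n f. n \<ge> N \<Longrightarrow> homog K n f \<Longrightarrow> f \<in> idl K (insert h S)"
  shows "nonzerodiv K S h"
proof (rule nonzerodiv_homogI[OF S])
  show "form K h" using h by (auto simp: form_def)
  fix n f assume f: "homog K n f" "(\<lambda>x. f x * h x) \<in> idl K S"
  have hp: "h \<in> polys K" "l \<in> polys K" using h l homog_polys by auto
  show "f \<in> idl K S"
  proof (rule ccontr)
    assume nf: "f \<notin> idl K S"
    define u where "u = (\<lambda>j x. f x * l x ^ j)"
    have uh: "homog K (n + j) (u j)" for j
      unfolding u_def using homog_mult[OF f(1) homog_power[OF l(1), of j]] by simp
    have uni: "u j \<notin> idl K S" for j
    proof (induction j)
      case 0
      then show ?case using nf by (simp add: u_def)
    next
      case (Suc j)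
      have "u (Suc j) = (\<lambda>x. u j x * l x)" by (simp add: u_def fun_eq_iff mult_ac)
      then show ?case using Suc l(2) homog_polys[OF uh[of j]] by (auto simp: nonzerodiv_def)
    qed
    have uhz: "(\<lambda>x. u j x * h x) \<in> idl K S" for j
    proof -
      have "(\<lambda>x. l x ^ j * (f x * h x)) \<in> idl K S" by (intro idl_mult f polyfuns_power hp)
      then show ?thesis by (simp add: u_def mult_ac)
    qed
    have no: "\<not> (\<exists>(I::nat set) g. finite I \<and> card I = d \<and>
      (\<forall>p. homog K (n + j) p \<longrightarrow> (\<exists>a. (\<lambda>x. p x - (\<Sum>i\<in>I. a i * g i x)) \<in> idl K S)))" if "n + j \<ge> N" for d j
      using that
    proof (induction d arbitrary: j)
      case 0
      show ?case using uni[of j] uh[of j] by force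
    next
      case (Suc d)
      show ?case
      proof
        assume "\<exists>(I::nat set) g. finite I \<and> card I = Suc d \<and>
          (\<forall>p. homog K (n + j) p \<longrightarrow> (\<exists>a. (\<lambda>x. p x - (\<Sum>i\<in>I. a i * g i x)) \<in> idl K S))"
        then obtain I :: "nat set" and g where I: "finite I" "card I = Suc d"
          "\<And>p. homog K (n + j) p \<Longrightarrow> \<exists>a. (\<lambda>x. p x - (\<Sum>i\<in>I. a i * g i x)) \<in> idl K S" by blast
        obtain a where a: "(\<lambda>x. u j x - (\<Sum>i\<in>I. a i * g i x)) \<in> idl K S" using I(3)[OF uh] by blast
        have "\<exists>i0\<in>I. a i0 \<noteq> 0"
        proof (rule ccontr)
          assume "\<not> (\<exists>i0\<in>I. a i0 \<noteq> 0)"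
          then show False using a uni[of j] by simp
        qed
        then obtain i0 where i0: "i0 \<in> I" "a i0 \<noteq> 0" by blast
        have lower: "\<exists>a'. (\<lambda>x. p x - (\<Sum>i\<in>I - {i0}. a' i * (g i x * h x))) \<in> idl K S" if p: "homog K (n + (j + e)) p" for p
        proof -
          have "p \<in> idl K (insert h S)" using N[OF _ p] Suc.prems by simp
          then obtain b where b: "homog K (n + j) b" "(\<lambda>x. p x - b x * h x) \<in> idl K S"
            using homog_modulo[OF S h(1), where n = "n + j" and f = p] p by (auto simp: add.assoc)
          obtain c where c: "(\<lambda>x. b x - (\<Sum>i\<in>I. c i * g i x)) \<in> idl K S" using I(3)[OF b(1)] by blast
          define t where "t = c i0 / a i0"
          have "(\<lambda>x. (p x - b x * h x) + (h x * (b x - (\<Sum>i\<in>I. c i * g i x)) +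
              t * (u j x * h x - h x * (u j x - (\<Sum>i\<in>I. a i * g i x))))) \<in> idl K S"
            by (intro idl_add idl_mult idl_scale idl_diff a b c uhz hp)
          moreover have "(p x - b x * h x) + (h x * (b x - (\<Sum>i\<in>I. c i * g i x)) +
              t * (u j x * h x - h x * (u j x - (\<Sum>i\<in>I. a i * g i x)))) =
              p x - (\<Sum>i\<in>I - {i0}. (c i - t * a i) * (g i x * h x))" for x
          proof -
            have "(\<Sum>i\<in>I - {i0}. (c i - t * a i) * (g i x * h x)) = (\<Sum>i\<in>I. (c i - t * a i) * (g i x * h x))"
              using I(1) i0 by (simp add: sum.remove t_def)
            also have "\<dots> = h x * (\<Sum>i\<in>I. c i * g i x) - t * (h x * (\<Sum>i\<in>I. a i * g i x))"
              by (simp add: sum_distrib_left sum_subtractf[symmetric] algebra_simps)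
            finally show ?thesis by (simp add: algebra_simps)
          qed
          ultimately show ?thesis by auto
        qed
        have "finite (I - {i0})" "card (I - {i0}) = d" using I i0 by auto
        then have "\<exists>(I::nat set) g. finite I \<and> card I = d \<and>
          (\<forall>p. homog K (n + (j + e)) p \<longrightarrow> (\<exists>a. (\<lambda>x. p x - (\<Sum>i\<in>I. a i * g i x)) \<in> idl K S))"
          by (intro exI[of _ "I - {i0}"] exI[of _ "\<lambda>i x. g i x * h x"] conjI allI impI lower) auto
        then show False by (rule notE[OF Suc.IH[of "j + e"], rotated]) (use Suc.prems in simp)
      qed
    qed
    obtain m where "spanned (UNIV :: ('a \<Rightarrow> complex) set) m (pdeg (crd K) (n + N))" using spanned_pdeg[OF K] by blast
    then obtain g where g: "\<And>p. pdeg (crd K) (n + N) p \<Longrightarrow> \<exists>a. \<forall>z. p z = (\<Sum>i<m. a i * g i z)"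
      unfolding spanned_def by auto
    have lev: "\<exists>a. (\<lambda>x. p x - (\<Sum>i\<in>{..<m}. a i * g i x)) \<in> idl K S" if p: "homog K (n + N) p" for p
    proof -
      obtain a where "\<forall>z. p z = (\<Sum>i<m. a i * g i z)" using g[OF homog_imp_pdeg[OF p]] by blast
      then have "(\<lambda>x. p x - (\<Sum>i\<in>{..<m}. a i * g i x)) = (\<lambda>_. 0)" by simp
      then show ?thesis using idl.zero[of K S] by (intro exI[of _ a]) simp
    qed
    have "\<exists>(I::nat set) g. finite I \<and> card I = m \<and>
      (\<forall>p. homog K (n + N) p \<longrightarrow> (\<exists>a. (\<lambda>x. p x - (\<Sum>i\<in>I. a i * g i x)) \<in> idl K S))"
      by (intro exI[of _ "{..<m}"] exI[of _ g] conjI allI impI lev) auto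
    then show False by (rule notE[OF no[of N m], rotated]) simp
  qed
qed

text \<open>Linear forms on the moment curve: those with M distinct parameters are linearly independent.\<close>

definition curve_form :: "(nat \<Rightarrow> 'k) \<Rightarrow> nat \<Rightarrow> complex \<Rightarrow> ('k \<Rightarrow> complex) \<Rightarrow> complex" where
  "curve_form ks M c x = (\<Sum>i<M. c ^ i * x (ks i))"

lemma homog_curve_form: "ks ` {..<M} \<subseteq> K \<Longrightarrow> homog K 1 (curve_form ks M c)"
  unfolding curve_form_def[abs_def] by (intro homog_sum homog_const_mult homog_coord) auto

lemma curve_form_roots:
  assumes "i < M" "x (ks i) \<noteq> 0"
  shows "finite {c. curve_form ks M c x = 0}" "card {c. curve_form ks M c x = 0} < M"
proof -
  obtain M' where M: "M = Suc M'" using assms(1) by (cases M) auto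
  have "{c. curve_form ks M c x = 0} = {c. (\<Sum>i\<le>M'. x (ks i) * c ^ i) = 0}"
    by (simp add: curve_form_def M lessThan_Suc_atMost mult.commute)
  then show "finite {c. curve_form ks M c x = 0}" "card {c. curve_form ks M c x = 0} < M"
    using polyfun_roots_finite[of "\<lambda>i. x (ks i)" i M'] polyfun_roots_card[of "\<lambda>i. x (ks i)" i M'] assms M by auto
qed

lemma nontrivial_point_sequence:
  assumes ks: "ks ` {..<M} = K" and C0: "finite C0"
    and bad: "\<And>c. c \<notin> C0 \<Longrightarrow> \<exists>x. P x \<and> curve_form ks M c x = 0 \<and> (\<exists>k\<in>K. x k \<noteq> 0)"
  shows "\<exists>c z. \<forall>j<m::nat. P (z j) \<and> curve_form ks M (c j) (z j) = 0 \<and> (\<exists>k\<in>K. z j k \<noteq> 0) \<and>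
    (\<forall>i<j. curve_form ks M (c j) (z i) \<noteq> 0)"
proof (induction m)
  case 0
  then show ?case by auto
next
  case (Suc m)
  then obtain c z where cz: "\<And>j. j < m \<Longrightarrow> P (z j) \<and> curve_form ks M (c j) (z j) = 0 \<and> (\<exists>k\<in>K. z j k \<noteq> 0) \<and>
    (\<forall>i<j. curve_form ks M (c j) (z i) \<noteq> 0)" by blast
  have "finite (C0 \<union> (\<Union>i<m. {c. curve_form ks M c (z i) = 0}))"
  proof (intro finite_UnI C0 finite_UN_I)
    fix i assume "i \<in> {..<m}"
    then obtain l where "l < M" "z i (ks l) \<noteq> 0" using cz[of i] ks by auto
    then show "finite {c. curve_form ks M c (z i) = 0}" by (rule curve_form_roots)
  qed auto
  then obtain c' where c': "c' \<notin> C0 \<union> (\<Union>i<m. {c. curve_form ks M c (z i) = 0})"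
    using ex_new_if_finite[OF infinite_UNIV_char_0] by blast
  then have "c' \<notin> C0" by simp
  from bad[OF this] obtain x where x: "P x \<and> curve_form ks M c' x = 0 \<and> (\<exists>k\<in>K. x k \<noteq> 0)" ..
  show ?case
  proof (intro exI[of _ "c(m := c')"] exI[of _ "z(m := x)"] allI impI)
    fix j assume j: "j < Suc m"
    show "P ((z(m := x)) j) \<and> curve_form ks M ((c(m := c')) j) ((z(m := x)) j) = 0 \<and>
      (\<exists>k\<in>K. (z(m := x)) j k \<noteq> 0) \<and> (\<forall>i<j. curve_form ks M ((c(m := c')) j) ((z(m := x)) i) \<noteq> 0)"
    proof (cases "j = m")
      case True
      then show ?thesis using x c' by simp
    next
      case False
      then have "j < m" using j by simp
      then show ?thesis using cz[of j] by simp
    qed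
  qed
qed

text \<open>The zero set of the forms in A consists of finitely many lines, since the homogeneous parts
  modulo A have bounded dimension; so almost all linear forms on the moment curve vanish on none of them.\<close>

lemma curve_form_avoids:
  assumes A: "\<And>a. a \<in> A \<Longrightarrow> form K a" and K: "finite K" and ks: "ks ` {..<M} = K"
    and h: "homog K e h" "e \<ge> 1"
    and V: "\<And>x k. \<forall>a\<in>insert h A. a x = 0 \<Longrightarrow> k \<in> K \<Longrightarrow> x k = 0" and C0: "finite C0"
  shows "\<exists>c. c \<notin> C0 \<and> (\<forall>x. (\<forall>a\<in>A. a x = 0) \<longrightarrow> curve_form ks M c x = 0 \<longrightarrow> (\<forall>k\<in>K. x k = 0))"
proof (rule ccontr)
  assume "\<not> ?thesis"
  then have bad: "\<exists>x. (\<forall>a\<in>A. a x = 0) \<and> curve_form ks M c x = 0 \<and> (\<exists>k\<in>K. x k \<noteq> 0)" if "c \<notin> C0" for c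
    using that by blast
  have hp: "h \<in> polys K" using h homog_polys by auto
  have fh: "form K a" if "a \<in> insert h A" for a using that A h by (auto simp: form_def)
  obtain N where N: "\<And>n f. n \<ge> N \<Longrightarrow> homog K n f \<Longrightarrow> f \<in> idl K (insert h A)"
  proof -
    have "\<exists>N. \<forall>n\<ge>N. \<forall>f. homog K n f \<longrightarrow> f \<in> idl K (insert h A)"
      by (rule homog_in_idl[OF _ K]) (use fh V in blast)+
    then show ?thesis using that by blast
  qed
  obtain m where "spanned (UNIV :: ('a \<Rightarrow> complex) set) m (pdeg (crd K) N)" using spanned_pdeg[OF K] by blast
  then obtain g where g: "\<And>p. pdeg (crd K) N p \<Longrightarrow> \<exists>a. \<forall>z. p z = (\<Sum>i<m. a i * g i z)"
    unfolding spanned_def by auto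
  have level: "\<exists>g. \<forall>p. homog K (N + e * q) p \<longrightarrow> (\<exists>a. (\<lambda>x. p x - (\<Sum>i<m. a i * g i x)) \<in> idl K A)" for q
  proof (induction q)
    case 0
    have "\<exists>a. (\<lambda>x. p x - (\<Sum>i\<in>{..<m}. a i * g i x)) \<in> idl K A" if p: "homog K N p" for p
    proof -
      obtain a where "\<forall>z. p z = (\<Sum>i<m. a i * g i z)" using g[OF homog_imp_pdeg[OF p]] by blast
      then have "(\<lambda>x. p x - (\<Sum>i\<in>{..<m}. a i * g i x)) = (\<lambda>_. 0)" by simp
      then show ?thesis using idl.zero[of K A] by (intro exI[of _ a]) simp
    qed
    then show ?case by (intro exI[of _ g]) simp
  next
    case (Suc q)
    then obtain g where g: "\<And>p. homog K (N + e * q) p \<Longrightarrow> \<exists>a. (\<lambda>x. p x - (\<Sum>i<m. a i * g i x)) \<in> idl K A" by blast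
    have "\<exists>a. (\<lambda>x. p x - (\<Sum>i<m. a i * (g i x * h x))) \<in> idl K A" if p: "homog K (N + e * Suc q) p" for p
    proof -
      have p': "homog K (N + e * q + e) p" using p by (simp add: algebra_simps)
      have "p \<in> idl K (insert h A)" by (rule N[OF _ p']) simp
      then obtain b where b: "homog K (N + e * q) b" "(\<lambda>x. p x - b x * h x) \<in> idl K A"
        using homog_modulo[OF A h(1) p'] by blast
      obtain a where a: "(\<lambda>x. b x - (\<Sum>i<m. a i * g i x)) \<in> idl K A" using g[OF b(1)] by blast
      have "(\<lambda>x. (p x - b x * h x) + h x * (b x - (\<Sum>i<m. a i * g i x))) \<in> idl K A"
        by (intro idl_add idl_mult a b hp)
      moreover have "(p x - b x * h x) + h x * (b x - (\<Sum>i<m. a i * g i x)) = p x - (\<Sum>i<m. a i * (g i x * h x))" for x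
        by (simp add: algebra_simps sum_distrib_left)
      ultimately show ?thesis by auto
    qed
    then show ?case by (intro exI[of _ "\<lambda>i x. g i x * h x"] allI impI)
  qed
  define n where "n = N + e * m"
  have nm: "n \<ge> m" using h(2) by (simp add: n_def trans_le_add2)
  obtain g where g: "\<And>p. homog K n p \<Longrightarrow> \<exists>a. (\<lambda>x. p x - (\<Sum>i<m. a i * g i x)) \<in> idl K A"
    using level[of m] unfolding n_def by blast
  have "\<exists>c z. \<forall>j<m + 2. (\<forall>a\<in>A. a (z j) = 0) \<and> curve_form ks M (c j) (z j) = 0 \<and> (\<exists>k\<in>K. z j k \<noteq> 0) \<and>
    (\<forall>i<j. curve_form ks M (c j) (z i) \<noteq> 0)"
    by (rule nontrivial_point_sequence[OF ks C0, where P = "\<lambda>x. \<forall>a\<in>A. a x = 0"]) (rule bad)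
  then obtain c z where cz: "\<And>j. j < m + 2 \<Longrightarrow> (\<forall>a\<in>A. a (z j) = 0)" "\<And>j. j < m + 2 \<Longrightarrow> curve_form ks M (c j) (z j) = 0"
    "\<And>i j. j < m + 2 \<Longrightarrow> i < j \<Longrightarrow> curve_form ks M (c j) (z i) \<noteq> 0" by blast
  \<comment> \<open>G i vanishes at z j for i < j \<le> m but not at z i, and m + 1 such forms are dependent modulo the ideal.\<close>
  define G where "G = (\<lambda>i x. (\<Prod>j\<in>{i<..m}. curve_form ks M (c j) x) * curve_form ks M (c (m + 1)) x ^ (n - (m - i)))"
  have cf: "homog K 1 (curve_form ks M c)" for c using homog_curve_form ks by blast
  have G: "homog K n (G i)" if "i \<le> m" for i
  proof -
    have "homog K ((\<Sum>j\<in>{i<..m}. 1) + 1 * (n - (m - i))) (G i)"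
      unfolding G_def by (intro homog_mult homog_prod homog_power cf) auto
    then show ?thesis using that nm by simp
  qed
  have "\<forall>i\<in>{..m}. \<exists>a. (\<lambda>x. G i x - (\<Sum>l<m. a l * g l x)) \<in> idl K A" using g G by blast
  from bchoice[OF this] obtain \<alpha> where \<alpha>: "\<And>i. i \<le> m \<Longrightarrow> (\<lambda>x. G i x - (\<Sum>l<m. \<alpha> i l * g l x)) \<in> idl K A" by auto
  obtain a where a: "\<exists>i\<in>{..m}. a i \<noteq> 0" "\<forall>l<m. (\<Sum>i\<in>{..m}. a i * \<alpha> i l) = 0"
    using underdetermined_solution[of "{..m}" m \<alpha>] by auto
  have "(\<lambda>x. \<Sum>i\<le>m. a i * (G i x - (\<Sum>l<m. \<alpha> i l * g l x))) \<in> idl K A"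
    by (intro idl_sum idl_scale \<alpha>) auto
  moreover have "(\<Sum>i\<le>m. a i * (G i x - (\<Sum>l<m. \<alpha> i l * g l x))) = (\<Sum>i\<le>m. a i * G i x)" for x
  proof -
    have "(\<Sum>i\<le>m. a i * (\<Sum>l<m. \<alpha> i l * g l x)) = (\<Sum>l<m. (\<Sum>i\<le>m. a i * \<alpha> i l) * g l x)"
      by (simp add: sum_distrib_left sum_distrib_right mult.assoc) (rule sum.swap)
    also have "\<dots> = 0" using a(2) by simp
    finally show ?thesis by (simp add: right_diff_distrib sum_subtractf)
  qed
  ultimately have F: "(\<lambda>x. \<Sum>i\<le>m. a i * G i x) \<in> idl K A" by simp
  define i0 where "i0 = Max {i. i \<le> m \<and> a i \<noteq> 0}"
  have "finite {i. i \<le> m \<and> a i \<noteq> 0}" "{i. i \<le> m \<and> a i \<noteq> 0} \<noteq> {}" using a(1) by auto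
  then have i0: "i0 \<le> m" "a i0 \<noteq> 0" "\<And>i. i \<le> m \<Longrightarrow> a i \<noteq> 0 \<Longrightarrow> i \<le> i0"
    using Max_in[of "{i. i \<le> m \<and> a i \<noteq> 0}"] Max_ge[of "{i. i \<le> m \<and> a i \<noteq> 0}"] unfolding i0_def by blast+
  have "(\<Sum>i\<le>m. a i * G i (z i0)) = (\<Sum>i\<in>{i0}. a i * G i (z i0))"
  proof (rule sum.mono_neutral_right)
    show "\<forall>i\<in>{..m} - {i0}. a i * G i (z i0) = 0"
    proof
      fix i assume i: "i \<in> {..m} - {i0}"
      show "a i * G i (z i0) = 0"
      proof (cases "i < i0")
        case True
        then have "i0 \<in> {i<..m}" using i0(1) by simp
        then have "(\<Prod>j\<in>{i<..m}. curve_form ks M (c j) (z i0)) = 0" using cz(2)[of i0] i0(1) by (intro prod_zero) auto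
        then show ?thesis by (simp add: G_def)
      next
        case False
        then show ?thesis using i0(3)[of i] i by fastforce
      qed
    qed
  qed (use i0 in auto)
  moreover have "(\<Sum>i\<le>m. a i * G i (z i0)) = 0" using idl_vanish[OF F] cz(1)[of i0] i0(1) by auto
  moreover have "G i0 (z i0) \<noteq> 0" unfolding G_def using cz(3) i0(1) by auto
  ultimately show False using i0(2) by simp
qed

text \<open>All forms of large degree lie in the ideal of the family h, so multiplication by h j is onto in large degrees
  modulo the other members; then h j inherits regularity from l.\<close>

lemma regular_family_exchange:
  assumes K: "finite K" and J: "finite J" "j \<in> J" and forms: "\<And>i. i \<in> J \<Longrightarrow> form K (h i)"
    and V: "\<And>x k. \<forall>i\<in>J. h i x = 0 \<Longrightarrow> k \<in> K \<Longrightarrow> x k = 0"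
    and l: "homog K 1 l" and reg: "regular_family K J (h(j := l))"
  shows "regular_family K J h"
proof (rule regular_family_extend[OF J forms])
  have img: "(h(j := l)) ` (J - {j}) = h ` (J - {j})" by auto
  have "regular_family K (J - {j}) (h(j := l))" by (rule regular_family_subset[OF reg]) auto
  then show "regular_family K (J - {j}) h"
    by (subst regular_family_cong[where h' = "h(j := l)"]) auto
  have nzl: "nonzerodiv K (h ` (J - {j})) l"
  proof -
    have "nonzerodiv K ((h(j := l)) ` (J - {j})) ((h(j := l)) j)"
      using reg J(2) unfolding regular_family_def by blast
    then show ?thesis unfolding img by simp
  qed
  obtain e where e: "homog K e (h j)" "e \<ge> 1" using forms[OF J(2)] by (auto simp: form_def)
  have ins: "insert (h j) (h ` (J - {j})) = h ` J" using J(2) by auto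
  have "\<exists>N. \<forall>n\<ge>N. \<forall>f. homog K n f \<longrightarrow> f \<in> idl K (h ` J)"
    by (rule homog_in_idl[OF _ K]) (use forms V in auto)
  then obtain N where N: "\<And>n f. n \<ge> N \<Longrightarrow> homog K n f \<Longrightarrow> f \<in> idl K (insert (h j) (h ` (J - {j})))"
    unfolding ins by blast
  show "nonzerodiv K (h ` (J - {j})) (h j)"
    by (rule nonzerodiv_exchange[OF _ K l nzl e N]) (use forms in auto)
qed

text \<open>Coordinates form a regular family, and the forms on the curve are exchanged in one by one. The common zero
  stays trivial since a nonzero polynomial of degree less than n has fewer than n roots.\<close>

lemma regular_family_curve_forms:
  assumes K: "finite K" and ks: "bij_betw ks {..<M} K" and \<beta>: "bij_betw \<beta> J {..<M}" and c: "inj_on c J"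
  shows "regular_family K J (\<lambda>j. curve_form ks M (c j))"
proof -
  have J: "finite J" using \<beta> bij_betw_finite by blast
  have ksi: "ks ` {..<M} = K" using ks by (simp add: bij_betw_def)
  define h where "h = (\<lambda>k j. if \<beta> j < k then curve_form ks M (c j) else (\<lambda>x. x (ks (\<beta> j))))"
  have cf: "homog K 1 (curve_form ks M c)" for c using homog_curve_form ksi by blast
  have \<beta>M: "\<beta> j < M" if "j \<in> J" for j using \<beta> that by (auto simp: bij_betw_def)
  have hk: "homog K 1 (h k j)" if "j \<in> J" for k j
    unfolding h_def using cf homog_coord[of "ks (\<beta> j)" K] \<beta>M[OF that] ksi by auto
  have V: "x k = 0" if x: "\<forall>j\<in>J. h n j x = 0" and k: "k \<in> K" and n: "n \<le> M" for x k n
  proof -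
    have big: "x (ks i) = 0" if i: "n \<le> i" "i < M" for i
    proof -
      obtain j where "j \<in> J" "\<beta> j = i" using \<beta> i by (metis bij_betw_iff_bijections lessThan_iff)
      then show ?thesis using x i by (auto simp: h_def)
    qed
    have "x (ks i) = 0" if i: "i < n" for i
    proof (rule ccontr)
      assume nz: "x (ks i) \<noteq> 0"
      have cn: "curve_form ks M c x = curve_form ks n c x" for c
        unfolding curve_form_def by (rule sum.mono_neutral_right) (use n big in auto)
      define Jn where "Jn = {j \<in> J. \<beta> j < n}"
      have "bij_betw \<beta> Jn {..<n}"
        using \<beta> n by (auto simp: bij_betw_def Jn_def inj_on_def image_iff)
      then have "card Jn = n" using bij_betw_same_card by fastforce
      moreover have "c ` Jn \<subseteq> {c. curve_form ks n c x = 0}" using x by (auto simp: Jn_def h_def cn[symmetric])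
      moreover have "card (c ` Jn) = card Jn" using c by (intro card_image) (auto simp: Jn_def inj_on_def)
      ultimately have "n \<le> card {c. curve_form ks n c x = 0}"
        using card_mono[OF curve_form_roots(1)[of i n x ks]] i nz by metis
      then show False using curve_form_roots(2)[of i n x ks] i nz by simp
    qed
    then show ?thesis using big k ksi by (metis imageE lessThan_iff linorder_not_le)
  qed
  have "regular_family K J (h n)" if "n \<le> M" for n
    using that
  proof (induction n)
    case 0
    show ?case unfolding regular_family_def
    proof (intro allI impI ballI)
      fix S j assume S: "S \<subseteq> J" "j \<in> J - S"
      define L where "L = (\<lambda>j. ks (\<beta> j)) ` S"
      have "h 0 ` S = (\<lambda>k x. x k) ` L" by (auto simp: h_def L_def)
      moreover have "inj_on (\<lambda>j. ks (\<beta> j)) J"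
        using comp_inj_on[of \<beta> J ks] \<beta> ks by (auto simp: bij_betw_def comp_def)
      then have "ks (\<beta> j) \<in> K - L" using S \<beta>M ksi by (auto simp: L_def inj_on_def)
      moreover have "L \<subseteq> K" using S \<beta>M ksi by (auto simp: L_def)
      ultimately show "nonzerodiv K (h 0 ` S) (h 0 j)"
        using nonzerodiv_coordinate[of L K "ks (\<beta> j)"] by (simp add: h_def)
    qed
  next
    case (Suc n)
    obtain j where j: "j \<in> J" "\<beta> j = n" using \<beta> Suc.prems by (metis bij_betw_iff_bijections lessThan_iff Suc_le_lessD)
    have "regular_family K J ((h (Suc n))(j := (\<lambda>x. x (ks (\<beta> j)))))"
    proof (subst regular_family_cong[where h' = "h n"])
      fix i assume i: "i \<in> J"
      show "((h (Suc n))(j := (\<lambda>x. x (ks (\<beta> j))))) i = h n i"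
        using i j \<beta> by (auto simp: h_def less_Suc_eq bij_betw_def inj_on_def)
    qed (use Suc in auto)
    then show ?case
    proof (rule regular_family_exchange[OF K J j(1), rotated 3])
      show "homog K 1 (\<lambda>x. x (ks (\<beta> j)))" by (rule homog_coord) (use \<beta>M[OF j(1)] ksi in auto)
      show "form K (h (Suc n) i)" if "i \<in> J" for i using hk[OF that, of "Suc n"] by (auto simp: form_def)
      show "x k = 0" if "\<forall>i\<in>J. h (Suc n) i x = 0" "k \<in> K" for x k using V[OF that Suc.prems] .
    qed
  qed
  from this[OF order_refl] show ?thesis
    by (subst regular_family_cong[where h' = "h M"]) (use \<beta>M in \<open>auto simp: h_def\<close>)
qed

text \<open>The polynomial ring is Cohen-Macaulay: a homogeneous system of parameters is regular. The given forms are
  replaced by linear forms on the moment curve one after the other, keeping the common zero trivial; by the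
  exchange lemma regularity passes back from the linear forms to the given ones.\<close>

theorem regular_family_of_forms:
  assumes K: "finite K" and J: "finite J" "card J = card K" and forms: "\<And>j. j \<in> J \<Longrightarrow> form K (h j)"
    and V: "\<And>x k. \<forall>j\<in>J. h j x = 0 \<Longrightarrow> k \<in> K \<Longrightarrow> x k = 0"
  shows "regular_family K J h"
proof -
  define M where "M = card K"
  obtain ks where ks: "bij_betw ks {..<M} K" unfolding M_def using ex_bij_betw_nat_finite[OF K] by (auto simp: atLeast0LessThan)
  then have ksi: "ks ` {..<M} = K" by (simp add: bij_betw_def)
  obtain \<beta> where \<beta>: "bij_betw \<beta> J {..<M}" unfolding M_def J(2)[symmetric] using ex_bij_betw_finite_nat[OF J(1)] by (auto simp: atLeast0LessThan)
  have cf: "homog K 1 (curve_form ks M c)" for c using homog_curve_form ksi by blast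
  have "regular_family K J h" if "T \<subseteq> J" "inj_on c T" "\<And>j. j \<in> T \<Longrightarrow> h j = curve_form ks M (c j)"
    "\<And>j. j \<in> J \<Longrightarrow> form K (h j)" "\<And>x k. \<forall>j\<in>J. h j x = 0 \<Longrightarrow> k \<in> K \<Longrightarrow> x k = 0" for T c h
    using that
  proof (induction "card (J - T)" arbitrary: T c h)
    case 0
    then have "T = J" using J(1) by auto
    then show ?case
      using regular_family_curve_forms[OF K ks \<beta>, of c] 0
      by (subst regular_family_cong[where h' = "\<lambda>j. curve_form ks M (c j)"]) auto
  next
    case (Suc n)
    then obtain j where j: "j \<in> J - T" by (metis card.empty ex_in_conv nat.distinct(1))
    obtain e where e: "homog K e (h j)" "e \<ge> 1" using Suc.prems(4) j by (auto simp: form_def)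
    have ins: "insert (h j) (h ` (J - {j})) = h ` J" using j by auto
    have "finite (c ` T)" using finite_subset[OF Suc.prems(1) J(1)] by simp
    then have "\<exists>c0. c0 \<notin> c ` T \<and> (\<forall>x. (\<forall>a\<in>h ` (J - {j}). a x = 0) \<longrightarrow> curve_form ks M c0 x = 0 \<longrightarrow> (\<forall>k\<in>K. x k = 0))"
    proof (rule curve_form_avoids[OF _ K ksi e, rotated 2])
      show "x k = 0" if "\<forall>a\<in>insert (h j) (h ` (J - {j})). a x = 0" "k \<in> K" for x k
        using Suc.prems(5)[of x k] that unfolding ins by auto
    qed (use Suc.prems(4) in auto)
    then obtain c0 where c0: "c0 \<notin> c ` T"
      "\<And>x k. \<forall>i\<in>J - {j}. h i x = 0 \<Longrightarrow> curve_form ks M c0 x = 0 \<Longrightarrow> k \<in> K \<Longrightarrow> x k = 0" by auto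
    have "regular_family K J (h(j := curve_form ks M c0))"
    proof (rule Suc.hyps(1)[of "insert j T" "c(j := c0)"])
      have "J - insert j T = J - T - {j}" by auto
      then show "n = card (J - insert j T)" using Suc.hyps(2) j J(1) by simp
      show "inj_on (c(j := c0)) (insert j T)" using Suc.prems(2) c0(1) j by (auto simp: inj_on_def)
      show "x k = 0" if "\<forall>i\<in>J. (h(j := curve_form ks M c0)) i x = 0" "k \<in> K" for x k
      proof (rule c0(2)[OF _ _ that(2)])
        show "\<forall>i\<in>J - {j}. h i x = 0"
        proof
          fix i assume i: "i \<in> J - {j}"
          then show "h i x = 0" using bspec[OF that(1), of i] by simp
        qed
        show "curve_form ks M c0 x = 0" using bspec[OF that(1), of j] j by simp
      qed
      show "form K ((h(j := curve_form ks M c0)) i)" if "i \<in> J" for i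
        using Suc.prems(4)[OF that] cf by (auto simp: form_def)
    qed (use Suc.prems j in auto)
    then show ?case
    proof (rule regular_family_exchange[OF K J(1), rotated 4])
      show "form K (h i)" if "i \<in> J" for i by (rule Suc.prems(4)[OF that])
      show "x k = 0" if "\<forall>i\<in>J. h i x = 0" "k \<in> K" for x k by (rule Suc.prems(5)[OF that])
    qed (use j cf in auto)
  qed
  from this[of "{}"] show ?thesis using forms V by auto
qed

section \<open>Polynomial rings are integrally closed\<close>

definition dir_poly :: "(('k \<Rightarrow> complex) \<Rightarrow> complex) \<Rightarrow> ('k \<Rightarrow> complex) \<Rightarrow> ('k \<Rightarrow> complex) \<Rightarrow> complex poly" where
  "dir_poly p w x = (THE Q. \<forall>s. poly Q s = p (\<lambda>k. x k + s * w k))"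

lemma dir_polyI: "(\<And>s. poly Q s = p (\<lambda>k. x k + s * w k)) \<Longrightarrow> dir_poly p w x = Q"
  unfolding dir_poly_def by (rule the_equality) (auto simp: poly_eq_poly_eq_iff[symmetric])

lemma poly_dir_poly:
  assumes "p \<in> polys K" shows "poly (dir_poly p w x) s = p (\<lambda>k. x k + s * w k)"
proof -
  obtain Q where Q: "\<And>s. poly Q s = p (\<lambda>k. x k + s * w k)" using poly_on_line[OF assms, of x w] by blast
  then show ?thesis using dir_polyI[of Q p x w] by simp
qed

lemma dir_poly_const: "dir_poly (\<lambda>_. c) w x = [:c:]"
  by (rule dir_polyI) simp

lemma dir_poly_coord: "dir_poly (\<lambda>x. x k) w x = [:x k, w k:]"
  by (rule dir_polyI) simp

lemma dir_poly_add:
  "p \<in> polys K \<Longrightarrow> q \<in> polys K \<Longrightarrow> dir_poly (\<lambda>x. p x + q x) w x = dir_poly p w x + dir_poly q w x"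
  by (rule dir_polyI) (simp add: poly_dir_poly)

lemma dir_poly_diff:
  "p \<in> polys K \<Longrightarrow> q \<in> polys K \<Longrightarrow> dir_poly (\<lambda>x. p x - q x) w x = dir_poly p w x - dir_poly q w x"
  by (rule dir_polyI) (simp add: poly_dir_poly)

lemma dir_poly_mult:
  "p \<in> polys K \<Longrightarrow> q \<in> polys K \<Longrightarrow> dir_poly (\<lambda>x. p x * q x) w x = dir_poly p w x * dir_poly q w x"
  by (rule dir_polyI) (simp add: poly_dir_poly)

lemma dir_poly_power: "p \<in> polys K \<Longrightarrow> dir_poly (\<lambda>x. p x ^ n) w x = dir_poly p w x ^ n"
  by (rule dir_polyI) (simp add: poly_dir_poly)

lemma dir_poly_coeff_polys: "p \<in> polys K \<Longrightarrow> (\<lambda>x. coeff (dir_poly p w x) j) \<in> polys K"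
proof (induction arbitrary: j rule: polyfuns.induct)
  case (const c)
  then show ?case unfolding dir_poly_const by (intro polyfuns.const)
next
  case (coord f)
  then obtain k where k: "f = (\<lambda>x. x k)" "k \<in> K" by (auto simp: crd_def)
  show ?case unfolding k(1) dir_poly_coord
    by (cases j) (auto simp: coeff_pCons split: nat.split intro: polys_coord k polyfuns.const)
next
  case (add f g)
  then show ?case by (simp add: dir_poly_add polyfuns.add)
next
  case (mult f g)
  then show ?case by (simp add: dir_poly_mult coeff_mult) (intro polyfuns_sum polyfuns.mult, auto)
qed

lemma dir_poly_degree_top:
  assumes "pdeg (crd K) n p"
  shows "degree (dir_poly p w x) \<le> n \<and> coeff (dir_poly p w x) n = hc n p w"
  using assms
proof (induction rule: pdeg.induct)
  case (const n c)
  show ?case by (cases n) (auto simp: dir_poly_const hc_const)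
next
  case (coord_mult f n p)
  then obtain k where k: "f = (\<lambda>x. x k)" "k \<in> K" by (auto simp: crd_def)
  have p: "p \<in> polys K" using coord_mult pdeg_imp_polyfuns by blast
  have e: "dir_poly (\<lambda>z. f z * p z) w x = [:x k, w k:] * dir_poly p w x"
    unfolding k(1) by (subst dir_poly_mult[OF polys_coord[OF k(2)] p]) (simp only: dir_poly_coord)
  have "degree ([:x k, w k:] * dir_poly p w x) \<le> degree [:x k, w k:] + degree (dir_poly p w x)"
    by (rule degree_mult_le)
  also have "\<dots> \<le> Suc n" using coord_mult.IH by simp
  finally have "degree (dir_poly (\<lambda>z. f z * p z) w x) \<le> Suc n" unfolding e .
  moreover have "coeff (dir_poly p w x) (Suc n) = 0" using coord_mult.IH by (simp add: coeff_eq_0)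
  then have "coeff (dir_poly (\<lambda>z. f z * p z) w x) (Suc n) = w k * coeff (dir_poly p w x) n"
    unfolding e by simp
  moreover have "hc (Suc n) (\<lambda>z. f z * p z) w = w k * hc n p w"
    using fun_cong[OF hc_mult_homog[OF p homog_coord[OF k(2)], of "Suc n"], of w] by (simp add: k(1) mult.commute)
  ultimately show ?case using coord_mult.IH by simp
next
  case (add n p q)
  then have pq: "p \<in> polys K" "q \<in> polys K" using pdeg_imp_polyfuns by auto
  show ?case using add.IH fun_cong[OF hc_add[OF pq, of n], of w]
    by (auto simp: dir_poly_add[OF pq] intro: degree_add_le)
qed

text \<open>The leading coefficient in direction w is the value at w of the top homogeneous component, which is nonzero
  for generic w.\<close>

lemma monic_direction:
  assumes "b \<in> polys K" "b x0 \<noteq> 0" "k \<in> K"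
  obtains w d \<beta> where "w k = 1" "\<beta> \<noteq> 0" "\<And>x. degree (dir_poly b w x) = d \<and> coeff (dir_poly b w x) d = \<beta>"
proof -
  obtain D where D: "\<And>n. n > D \<Longrightarrow> hc n b = (\<lambda>_. 0)" "b = (\<lambda>x. \<Sum>n\<le>D. hc n b x)" using hc_sum_eq[OF assms(1)] by blast
  have "\<exists>n. \<exists>x. hc n b x \<noteq> 0"
  proof (rule ccontr)
    assume "\<not> ?thesis"
    then have "(\<Sum>n\<le>D. hc n b x0) = 0" by simp
    then show False using assms(2) fun_cong[OF D(2), of x0] by simp
  qed
  then obtain n where n: "\<exists>x. hc n b x \<noteq> 0" by blast
  have bd: "\<forall>n. (\<exists>x. hc n b x \<noteq> 0) \<longrightarrow> n \<le> D" using D(1) by (metis linorder_not_le)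
  define d where "d = (GREATEST n. \<exists>x. hc n b x \<noteq> 0)"
  have d: "\<exists>x. hc d b x \<noteq> 0" unfolding d_def by (rule GreatestI_nat[of "\<lambda>n. \<exists>x. hc n b x \<noteq> 0" n D]) (use n bd in auto)
  have d0: "hc n b = (\<lambda>_. 0)" if "n > d" for n
  proof (rule ccontr)
    assume "hc n b \<noteq> (\<lambda>_. 0)"
    then have "\<exists>x. hc n b x \<noteq> 0" by auto
    then have "n \<le> d" unfolding d_def by (rule Greatest_le_nat[of "\<lambda>n. \<exists>x. hc n b x \<noteq> 0"]) (use bd in auto)
    then show False using that by simp
  qed
  have "pdeg (crd K) d b"
  proof -
    have "pdeg (crd K) d (hc n b)" for n
    proof (cases "n \<le> d")
      case True
      then show ?thesis by (rule pdeg_mono[OF pdeg_hc[OF assms(1)]])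
    next
      case False
      then show ?thesis using d0[of n] pdeg.const[of "crd K" d 0] by simp
    qed
    then have "pdeg (crd K) d (\<lambda>x. \<Sum>n\<le>D. hc n b x)" by (intro pdeg_sum)
    then show ?thesis using D(2) by simp
  qed
  note top = dir_poly_degree_top[OF this]
  have hd: "homog K d (hc d b)" by (rule homog_hc[OF assms(1)])
  have "\<not> ((\<forall>x. hc d b x = 0) \<or> (\<forall>x :: 'a \<Rightarrow> complex. x k = 0))"
    using d by (auto dest: spec[of _ "\<lambda>_. 1"])
  then have "\<exists>x. hc d b x * x k \<noteq> 0" using polys_domain[OF homog_polys[OF hd] polys_coord[OF assms(3)]] by blast
  then obtain y where y: "hc d b y \<noteq> 0" "y k \<noteq> 0" by auto
  define w where "w = (\<lambda>i. inverse (y k) * y i)"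
  have "w k = 1" using y by (simp add: w_def)
  moreover have "hc d b w \<noteq> 0" using hd y unfolding w_def homog_def by simp
  moreover have "degree (dir_poly b w x) = d \<and> coeff (dir_poly b w x) d = hc d b w" for x
    using top[of w x] \<open>hc d b w \<noteq> 0\<close> le_degree[of "dir_poly b w x" d] by force
  ultimately show thesis using that by blast
qed

lemma polys_division:
  assumes b: "b \<in> polys K" and k: "k \<in> K" and w: "w k = 1" and \<beta>: "\<beta> \<noteq> 0"
    and bt: "\<And>x. degree (dir_poly b w x) = d \<and> coeff (dir_poly b w x) d = \<beta>" and a: "a \<in> polys K"
  shows "\<exists>q\<in>polys K. \<exists>\<rho>\<in>polys K. a = (\<lambda>x. b x * q x + \<rho> x) \<and> (\<forall>x. \<forall>j\<ge>d. coeff (dir_poly \<rho> w x) j = 0)"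
proof -
  have div: "\<exists>q\<in>polys K. \<exists>\<rho>\<in>polys K. a = (\<lambda>x. b x * q x + \<rho> x) \<and> (\<forall>x. \<forall>j\<ge>d. coeff (dir_poly \<rho> w x) j = 0)"
    if "a \<in> polys K" "\<forall>x. \<forall>j\<ge>n. coeff (dir_poly a w x) j = 0" for a n
    using that
  proof (induction n arbitrary: a)
    case 0
    then show ?case by (intro bexI[of _ "\<lambda>_. 0"] bexI[of _ a]) (auto intro: polyfuns.const)
  next
    case (Suc n)
    show ?case
    proof (cases "d \<le> n")
      case False
      then show ?thesis using Suc.prems by (intro bexI[of _ "\<lambda>_. 0"] bexI[of _ a]) (auto intro: polyfuns.const)
    next
      case True
      define t where "t = (\<lambda>x. coeff (dir_poly a w x) n)"
      define q where "q = (\<lambda>x. (t x / \<beta>) * x k ^ (n - d))"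
      have tp: "t \<in> polys K" unfolding t_def by (rule dir_poly_coeff_polys[OF Suc.prems(1)])
      have dega: "degree (dir_poly a w x) \<le> n" for x
        using Suc.prems(2) by (intro degree_le) auto
      have tinv: "t (\<lambda>i. x i + s * w i) = t x" for x s
      proof -
        have "dir_poly a w (\<lambda>i. x i + s * w i) = pcompose (dir_poly a w x) [:s, 1:]"
          by (rule dir_polyI) (simp add: poly_pcompose poly_dir_poly[OF Suc.prems(1)] algebra_simps)
        moreover have "coeff (pcompose (dir_poly a w x) [:s, 1:]) n = coeff (dir_poly a w x) n"
        proof (cases "degree (dir_poly a w x) = n")
          case True
          have "degree (pcompose (dir_poly a w x) [:s, 1:]) = n" using True by (simp add: degree_pcompose)
          then show ?thesis using lead_coeff_comp[of "[:s, 1:]" "dir_poly a w x"] True by simp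
        next
          case False
          then have "degree (dir_poly a w x) < n" using dega[of x] by simp
          then show ?thesis by (simp add: coeff_eq_0 degree_pcompose)
        qed
        ultimately show ?thesis by (simp add: t_def)
      qed
      have qp: "q \<in> polys K" unfolding q_def using polyfuns.mult[OF polyfuns_scale[OF tp, of "1 / \<beta>"] polyfuns_power[OF polys_coord[OF k], of "n - d"]]
        by (simp add: mult.commute)
      have dq: "dir_poly q w x = smult (t x / \<beta>) ([:x k, 1:] ^ (n - d))" for x
        by (rule dir_polyI) (simp add: q_def tinv w algebra_simps)
      define a' where "a' = (\<lambda>x. a x - b x * q x)"
      have a'p: "a' \<in> polys K" unfolding a'_def by (intro polyfuns_diff polyfuns.mult Suc.prems b qp)
      have "coeff (dir_poly a' w x) j = 0" if j: "j \<ge> n" for x j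
      proof -
        let ?B = "dir_poly b w x" and ?l = "[:x k, 1:] ^ (n - d)"
        have e: "dir_poly a' w x = dir_poly a w x - ?B * smult (t x / \<beta>) ?l"
          unfolding a'_def by (subst dir_poly_diff[OF Suc.prems(1) polyfuns.mult[OF b qp]]) (simp add: dir_poly_mult[OF b qp] dq)
        have dl: "degree ?l = n - d" by (simp add: degree_power_eq)
        have cl: "coeff ?l (n - d) = 1" using coeff_degree_mult[of ?l] dl lead_coeff_power[of "[:x k, 1:]" "n - d"] by simp
        have "coeff (?B * ?l) j = (if j = n then \<beta> else 0)"
        proof (cases "j = n")
          case True
          have "coeff (?B * ?l) (degree ?B + degree ?l) = coeff ?B (degree ?B) * coeff ?l (degree ?l)"
            by (rule coeff_mult_degree_sum)
          then show ?thesis using bt[of x] dl cl True \<open>d \<le> n\<close> by simp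
        next
          case False
          have "degree (?B * ?l) \<le> n" using degree_mult_le[of ?B ?l] bt[of x] dl \<open>d \<le> n\<close> by simp
          then show ?thesis using False j by (simp add: coeff_eq_0)
        qed
        then show ?thesis using Suc.prems(2) j \<beta> unfolding e by (auto simp: t_def)
      qed
      then obtain q' \<rho> where q': "q' \<in> polys K" "\<rho> \<in> polys K" "a' = (\<lambda>x. b x * q' x + \<rho> x)"
        "\<forall>x. \<forall>j\<ge>d. coeff (dir_poly \<rho> w x) j = 0" using Suc.IH[OF a'p] by blast
      have "a = (\<lambda>x. b x * (q x + q' x) + \<rho> x)"
      proof
        fix x show "a x = b x * (q x + q' x) + \<rho> x" using fun_cong[OF q'(3), of x] by (simp add: a'_def algebra_simps)
      qed
      then show ?thesis using q' polyfuns.add[OF qp q'(1)] by (intro bexI[of _ "\<lambda>x. q x + q' x"] bexI[of _ \<rho>] conjI)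
    qed
  qed
  obtain n where "pdeg (crd K) n a" using polyfuns_imp_pdeg[OF a] by blast
  then have "\<forall>x. \<forall>j\<ge>Suc n. coeff (dir_poly a w x) j = 0"
    using dir_poly_degree_top by (metis Suc_le_lessD coeff_eq_0 le_less_trans)
  then show ?thesis by (rule div[OF a])
qed

text \<open>The integral equation rewrites every power of a/b in terms of those below the m-th, so that all powers have
  the common denominator b^m.\<close>

lemma integral_imp_almost_integral:
  assumes a: "a \<in> polys K" and b: "b \<in> polys K" and c: "\<And>i. i < m \<Longrightarrow> c i \<in> polys K"
    and eq: "\<And>x. a x ^ m + (\<Sum>i<m. c i x * a x ^ i * b x ^ (m - i)) = 0"
  shows "\<exists>e\<in>polys K. \<forall>x. b x ^ m * a x ^ n = b x ^ n * e x"
proof (induction n rule: less_induct)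
  case (less n)
  show ?case
  proof (cases "n < m")
    case True
    have "\<forall>x. b x ^ m * a x ^ n = b x ^ n * (b x ^ (m - n) * a x ^ n)"
      using True by (simp add: power_add[symmetric] mult.assoc[symmetric])
    moreover have "(\<lambda>x. b x ^ (m - n) * a x ^ n) \<in> polys K" by (intro polyfuns.mult polyfuns_power a b)
    ultimately show ?thesis by (rule bexI)
  next
    case False
    have "\<exists>e\<in>polys K. \<forall>x. b x ^ m * a x ^ (n - m + i) = b x ^ (n - m + i) * e x" if "i < m" for i
      using less[of "n - m + i"] that False by simp
    then obtain e where e: "\<And>i. i < m \<Longrightarrow> e i \<in> polys K"
      "\<And>i x. i < m \<Longrightarrow> b x ^ m * a x ^ (n - m + i) = b x ^ (n - m + i) * e i x" by metis
    have "b x ^ m * a x ^ n = b x ^ n * (- (\<Sum>i<m. c i x * e i x))" for x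
    proof -
      have "a x ^ n = a x ^ (n - m) * a x ^ m" using False by (simp add: power_add[symmetric])
      also have "a x ^ m = - (\<Sum>i<m. c i x * a x ^ i * b x ^ (m - i))" using eq[of x] by (simp add: eq_neg_iff_add_eq_0)
      finally have "b x ^ m * a x ^ n = - (\<Sum>i<m. c i x * b x ^ (m - i) * (b x ^ m * a x ^ (n - m + i)))"
        by (simp add: sum_distrib_left power_add mult_ac)
      also have "\<dots> = - (\<Sum>i<m. b x ^ n * (c i x * e i x))"
      proof (intro arg_cong[of _ _ uminus] sum.cong refl)
        fix i assume "i \<in> {..<m}"
        then have i: "i < m" by simp
        have "b x ^ (m - i) * b x ^ (n - m + i) = b x ^ n" using i False by (simp add: power_add[symmetric])
        then show "c i x * b x ^ (m - i) * (b x ^ m * a x ^ (n - m + i)) = b x ^ n * (c i x * e i x)"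
          unfolding e(2)[OF i] by (metis mult.assoc mult.left_commute)
      qed
      finally show ?thesis by (simp add: sum_distrib_left)
    qed
    moreover have "(\<lambda>x. - (\<Sum>i<m. c i x * e i x)) \<in> polys K"
      by (intro polyfuns_uminus polyfuns_sum polyfuns.mult c e) auto
    ultimately show ?thesis by (intro bexI[of _ "\<lambda>x. - (\<Sum>i<m. c i x * e i x)"] allI)
  qed
qed

text \<open>After a choice of direction the denominator b is monic, and the remainder of a modulo b is
  again almost integral over b; comparing degrees of high powers shows that it is zero.\<close>

lemma polys_integrally_closed:
  assumes a: "a \<in> polys K" and b: "b \<in> polys K" and c: "\<And>i. i < m \<Longrightarrow> c i \<in> polys K"
    and eq: "\<And>x. a x ^ m + (\<Sum>i<m. c i x * a x ^ i * b x ^ (m - i)) = 0" and bn: "b x0 \<noteq> 0"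
  shows "\<exists>q\<in>polys K. \<forall>x. a x = b x * q x"
proof (cases "K = {}")
  case True
  have "a x = a x0" "b x = b x0" for x by (rule polys_cong[OF a], simp add: True, rule polys_cong[OF b], simp add: True)
  then have "a x = b x * (a x0 / b x0)" for x using bn by (metis nonzero_mult_div_cancel_left times_divide_eq_right)
  then show ?thesis by (intro bexI[of _ "\<lambda>_. a x0 / b x0"] allI polyfuns.const)
next
  case False
  then obtain k where k: "k \<in> K" by blast
  obtain w d \<beta> where w: "w k = 1" "\<beta> \<noteq> 0" "\<And>x. degree (dir_poly b w x) = d \<and> coeff (dir_poly b w x) d = \<beta>"
    by (rule monic_direction[OF b bn k]) (rule that)
  obtain q \<rho> where q: "q \<in> polys K" "\<rho> \<in> polys K" "a = (\<lambda>x. b x * q x + \<rho> x)"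
    "\<forall>x. \<forall>j\<ge>d. coeff (dir_poly \<rho> w x) j = 0" using polys_division[OF b k w a] by blast
  have alm: "\<exists>e\<in>polys K. \<forall>x. b x ^ m * \<rho> x ^ n = b x ^ n * e x" for n
  proof -
    have "\<forall>i. \<exists>e\<in>polys K. \<forall>x. b x ^ m * a x ^ i = b x ^ i * e x"
      using integral_imp_almost_integral[OF a b c eq] by blast
    then obtain e where e: "\<And>i. e i \<in> polys K" "\<And>i x. b x ^ m * a x ^ i = b x ^ i * e i x" by metis
    have "b x ^ m * \<rho> x ^ n = b x ^ n * (\<Sum>i\<le>n. of_nat (n choose i) * e i x * (- q x) ^ (n - i))" for x
    proof -
      have "\<rho> x = a x + b x * (- q x)" using fun_cong[OF q(3), of x] by simp
      then have "\<rho> x ^ n = (\<Sum>i\<le>n. of_nat (n choose i) * a x ^ i * (b x * (- q x)) ^ (n - i))"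
        by (simp only: binomial_ring)
      then have "b x ^ m * \<rho> x ^ n = (\<Sum>i\<le>n. of_nat (n choose i) * (b x ^ m * a x ^ i) * (b x * (- q x)) ^ (n - i))"
        by (simp add: sum_distrib_left mult_ac)
      also have "\<dots> = (\<Sum>i\<le>n. b x ^ n * (of_nat (n choose i) * e i x * (- q x) ^ (n - i)))"
      proof (rule sum.cong)
        fix i assume i: "i \<in> {..n}"
        have "b x ^ i * b x ^ (n - i) = b x ^ n" using i by (simp add: power_add[symmetric])
        then show "of_nat (n choose i) * (b x ^ m * a x ^ i) * (b x * - q x) ^ (n - i) =
          b x ^ n * (of_nat (n choose i) * e i x * (- q x) ^ (n - i))"
          unfolding e(2) power_mult_distrib by (metis mult.assoc mult.left_commute)
      qed simp
      finally show ?thesis by (simp add: sum_distrib_left)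
    qed
    moreover have "(\<lambda>x. \<Sum>i\<le>n. of_nat (n choose i) * e i x * (- q x) ^ (n - i)) \<in> polys K"
      by (intro polyfuns_sum polyfuns.mult polyfuns_power polyfuns_uminus polyfuns.const e q)
    ultimately show ?thesis
      by (intro bexI[of _ "\<lambda>x. \<Sum>i\<le>n. of_nat (n choose i) * e i x * (- q x) ^ (n - i)"] allI)
  qed
  have "dir_poly \<rho> w x = 0" for x
  proof (rule ccontr)
    assume nz: "dir_poly \<rho> w x \<noteq> 0"
    have dr: "degree (dir_poly \<rho> w x) < d"
      using q(4) nz by (metis leading_coeff_0_iff linorder_not_le)
    define n where "n = m * d + 1"
    obtain e where e: "e \<in> polys K" "\<forall>x. b x ^ m * \<rho> x ^ n = b x ^ n * e x" using alm by blast
    have bw: "degree (dir_poly b w x) = d" "dir_poly b w x \<noteq> 0" using w(3)[of x] w(2) by auto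
    have "dir_poly (\<lambda>x. b x ^ m * \<rho> x ^ n) w x = dir_poly (\<lambda>x. b x ^ n * e x) w x"
      using e(2) by (intro arg_cong[of _ _ "\<lambda>f. dir_poly f w x"] ext) simp
    then have eqp: "dir_poly b w x ^ m * dir_poly \<rho> w x ^ n = dir_poly b w x ^ n * dir_poly e w x"
      by (simp add: dir_poly_mult[OF polyfuns_power polyfuns_power, OF b q(2)] dir_poly_mult[OF polyfuns_power e(1), OF b]
          dir_poly_power[OF b] dir_poly_power[OF q(2)])
    then have "dir_poly e w x \<noteq> 0" using nz bw by auto
    then have "degree (dir_poly b w x ^ n * dir_poly e w x) = n * d + degree (dir_poly e w x)"
      using bw by (simp add: degree_mult_eq degree_power_eq)
    moreover have "degree (dir_poly b w x ^ m * dir_poly \<rho> w x ^ n) = m * d + n * degree (dir_poly \<rho> w x)"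
      using bw nz by (simp add: degree_mult_eq degree_power_eq)
    ultimately have "n * d \<le> m * d + n * degree (dir_poly \<rho> w x)" using eqp by simp
    moreover have "n * degree (dir_poly \<rho> w x) + n \<le> n * d" using dr mult_le_mono2[of "Suc (degree (dir_poly \<rho> w x))" d n] by simp
    ultimately show False by (simp add: n_def)
  qed
  then have "\<rho> x = 0" for x using poly_dir_poly[OF q(2), of w x 0] by simp
  then show ?thesis using q(1,3) by (intro bexI[of _ q]) auto
qed

section \<open>Determinants of polynomial functions\<close>

definition detf :: "nat \<Rightarrow> (nat \<Rightarrow> nat \<Rightarrow> 'a \<Rightarrow> complex) \<Rightarrow> 'a \<Rightarrow> complex" where
  "detf r M x = det (mat r r (\<lambda>(i, j). M i j x))"

lemma detf_sum: "detf r M x = (\<Sum>p\<in>{p. p permutes {0..<r}}. signof p * (\<Prod>i = 0..<r. M i (p i) x))"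
proof -
  have "(\<Prod>i = 0..<r. mat r r (\<lambda>(i, j). M i j x) $$ (i, p i)) = (\<Prod>i = 0..<r. M i (p i) x)" if "p permutes {0..<r}" for p
    using permutes_in_image[OF that] by (intro prod.cong) auto
  then show ?thesis unfolding detf_def by (subst det_def'[of _ r]) (auto intro!: sum.cong)
qed

lemma detf_polyfuns:
  assumes "\<And>i j. i < r \<Longrightarrow> j < r \<Longrightarrow> M i j \<in> polyfuns F"
  shows "detf r M \<in> polyfuns F"
proof -
  have "M i (p i) \<in> polyfuns F" if "p permutes {0..<r}" "i \<in> {0..<r}" for p i
    using permutes_in_image[OF that(1), of i] that assms by auto
  then show ?thesis unfolding detf_sum[abs_def]
    by (intro polyfuns_sum polyfuns.mult polyfuns.const polyfuns_prod) auto
qed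

lemma detf_homog:
  assumes "\<And>i j. i < r \<Longrightarrow> j < r \<Longrightarrow> homog K 1 (M i j)"
  shows "homog K r (detf r M)"
proof -
  have "homog K r (\<lambda>x. \<Prod>i = 0..<r. M i (p i) x)" if "p permutes {0..<r}" for p
  proof -
    have "homog K (\<Sum>i = 0..<r. 1) (\<lambda>x. \<Prod>i = 0..<r. M i (p i) x)"
      by (rule homog_prod) (use permutes_in_image[OF that] assms in auto)
    then show ?thesis by simp
  qed
  then show ?thesis unfolding detf_sum[abs_def] by (intro homog_sum homog_const_mult) auto
qed

lemma detf_adjugate:
  assumes "\<And>i j. i < r \<Longrightarrow> j < r \<Longrightarrow> M i j \<in> polyfuns F"
  shows "\<exists>C. (\<forall>i<r. \<forall>j<r. C i j \<in> polyfuns F) \<and>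
    (\<forall>j<r. \<forall>l<r. \<forall>x. (\<Sum>i<r. C j i x * M i l x) = (if j = l then detf r M x else 0)) \<and>
    (\<forall>j<r. \<forall>l<r. \<forall>x. (\<Sum>i<r. M j i x * C i l x) = (if j = l then detf r M x else 0))"
proof -
  define A where "A = (\<lambda>x. mat r r (\<lambda>(i, j). M i j x))"
  have Ac: "A x \<in> carrier_mat r r" for x by (simp add: A_def)
  define C where "C = (\<lambda>i j x. adj_mat (A x) $$ (i, j))"
  have "C i j \<in> polyfuns F" if ij: "i < r" "j < r" for i j
  proof -
    have "C i j = (\<lambda>x. (-1) ^ (j + i) * detf (r - 1) (\<lambda>a b. M (if a < j then a else Suc a) (if b < i then b else Suc b)) x)"
      by (rule ext) (use ij in \<open>simp add: C_def adj_mat_def A_def cofactor_def mat_delete_def detf_def,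
        intro arg_cong[of _ _ det] cong_mat, auto\<close>)
    moreover have "(\<lambda>x. (-1) ^ (j + i) * detf (r - 1) (\<lambda>a b. M (if a < j then a else Suc a) (if b < i then b else Suc b)) x) \<in> polyfuns F"
      by (intro polyfuns_scale detf_polyfuns assms) (use ij in auto)
    ultimately show ?thesis by simp
  qed
  moreover have "(\<Sum>i<r. C j i x * M i l x) = (if j = l then detf r M x else 0)" if "j < r" "l < r" for j l x
  proof -
    have "(adj_mat (A x) * A x) $$ (j, l) = (\<Sum>i<r. C j i x * M i l x)"
      using that adj_mat(1)[OF Ac, of x] by (simp add: scalar_prod_def C_def A_def atLeast0LessThan)
    then show ?thesis unfolding adj_mat(3)[OF Ac] using that by (cases "j = l") (simp_all add: detf_def A_def)
  qed
  moreover have "(\<Sum>i<r. M j i x * C i l x) = (if j = l then detf r M x else 0)" if "j < r" "l < r" for j l x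
  proof -
    have "(A x * adj_mat (A x)) $$ (j, l) = (\<Sum>i<r. M j i x * C i l x)"
      using that adj_mat(1)[OF Ac, of x] by (simp add: scalar_prod_def C_def A_def atLeast0LessThan)
    then show ?thesis unfolding adj_mat(2)[OF Ac] using that by (cases "j = l") (simp_all add: detf_def A_def)
  qed
  ultimately show ?thesis by (intro exI[of _ C]) simp
qed

lemma detf_nonzero_independent:
  assumes "detf r M x \<noteq> 0" "\<And>j. j < r \<Longrightarrow> (\<Sum>i<r. \<xi> i * M i j x) = 0"
  shows "\<forall>i<r. \<xi> i = 0"
proof (rule ccontr)
  assume n: "\<not> (\<forall>i<r. \<xi> i = 0)"
  define A where "A = mat r r (\<lambda>(i, j). M i j x)"
  define v where "v = vec r \<xi>"
  have "transpose_mat A *\<^sub>v v = 0\<^sub>v r"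
    by (rule eq_vecI) (use assms(2) in \<open>auto simp: A_def v_def scalar_prod_def atLeast0LessThan mult.commute\<close>)
  moreover have "v \<in> carrier_vec r" "v \<noteq> 0\<^sub>v r" using n by (auto simp: v_def vec_eq_iff)
  moreover have "transpose_mat A \<in> carrier_mat r r" by (simp add: A_def)
  ultimately have "det (transpose_mat A) = 0" using det_0_iff_vec_prod_zero_field by blast
  then have "det A = 0" by (subst (asm) det_transpose[of _ r]) (auto simp: A_def)
  then show False using assms(1) by (simp add: detf_def A_def)
qed

lemma independent_rows_detf:
  fixes M :: "nat \<Rightarrow> 'k \<Rightarrow> complex"
  assumes "\<And>\<xi>. \<forall>k\<in>I. (\<Sum>i<r. \<xi> i * M i k) = 0 \<Longrightarrow> \<forall>i<r. \<xi> i = 0"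
  shows "\<exists>\<sigma>. (\<forall>j<r. \<sigma> j \<in> I) \<and> detf r (\<lambda>i j _. M i (\<sigma> j)) () \<noteq> 0"
  using assms
proof (induction r)
  case 0
  then show ?case by (auto simp: detf_def)
next
  case (Suc m)
  have "\<forall>i<m. \<xi> i = 0" if \<xi>: "\<forall>k\<in>I. (\<Sum>i<m. \<xi> i * M i k) = 0" for \<xi>
  proof -
    have "(\<Sum>i<Suc m. (if i < m then \<xi> i else 0) * M i k) = (\<Sum>i<m. \<xi> i * M i k)" for k by simp
    then have "\<forall>i<Suc m. (if i < m then \<xi> i else 0) = 0" using Suc.prems[of "\<lambda>i. if i < m then \<xi> i else 0"] \<xi> by simp
    then show ?thesis by (metis less_SucI)
  qed
  then obtain \<sigma> where \<sigma>: "\<forall>j<m. \<sigma> j \<in> I" "detf m (\<lambda>i j _. M i (\<sigma> j)) () \<noteq> 0" using Suc.IH by blast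
  define A where "A = (\<lambda>k. mat (Suc m) (Suc m) (\<lambda>(i, j). M i ((\<sigma>(m := k)) j)))"
  have Ac: "A k \<in> carrier_mat (Suc m) (Suc m)" for k by (simp add: A_def)
  define \<xi> where "\<xi> = (\<lambda>i. cofactor (A undefined) i m)"
  have cof: "cofactor (A k) i m = \<xi> i" if "i < Suc m" for i k
  proof -
    have "mat_delete (A k) i m = mat_delete (A undefined) i m"
      by (rule eq_matI) (auto simp: mat_delete_def A_def)
    then show ?thesis by (simp add: \<xi>_def cofactor_def)
  qed
  have "mat_delete (A undefined) m m = mat m m (\<lambda>(i, j). M i (\<sigma> j))"
    by (rule eq_matI) (auto simp: mat_delete_def A_def)
  then have \<xi>m: "\<xi> m \<noteq> 0" using \<sigma>(2) by (simp add: \<xi>_def cofactor_def detf_def)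
  have ex: "det (A k) = (\<Sum>i<Suc m. \<xi> i * M i k)" for k
    using laplace_expansion_column[OF Ac, of m k] cof by (auto simp: A_def mult.commute intro!: sum.cong)
  have "\<exists>k\<in>I. det (A k) \<noteq> 0"
  proof (rule ccontr)
    assume "\<not> ?thesis"
    then have "\<forall>k\<in>I. (\<Sum>i<Suc m. \<xi> i * M i k) = 0" unfolding ex by blast
    then have "\<forall>i<Suc m. \<xi> i = 0" by (rule Suc.prems)
    then show False using \<xi>m by simp
  qed
  then obtain k where "k \<in> I" "det (A k) \<noteq> 0" by blast
  then show ?case using \<sigma>(1) by (intro exI[of _ "\<sigma>(m := k)"]) (auto simp: detf_def A_def less_Suc_eq)
qed

lemma maximal_independent_rows:
  fixes M :: "'e \<Rightarrow> 'k \<Rightarrow> complex"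
  assumes "finite E"
  shows "\<exists>E'\<subseteq>E. (\<forall>\<xi>. (\<forall>k\<in>I. (\<Sum>e\<in>E'. \<xi> e * M e k) = 0) \<longrightarrow> (\<forall>e\<in>E'. \<xi> e = 0)) \<and>
    (\<forall>e\<in>E. \<exists>\<eta>. \<forall>k\<in>I. M e k = (\<Sum>e'\<in>E'. \<eta> e' * M e' k))"
  using assms
proof (induction E rule: finite_induct)
  case empty
  then show ?case by auto
next
  case (insert a E)
  then obtain E' where E': "E' \<subseteq> E" "\<forall>\<xi>. (\<forall>k\<in>I. (\<Sum>e\<in>E'. \<xi> e * M e k) = 0) \<longrightarrow> (\<forall>e\<in>E'. \<xi> e = 0)"
    "\<forall>e\<in>E. \<exists>\<eta>. \<forall>k\<in>I. M e k = (\<Sum>e'\<in>E'. \<eta> e' * M e' k)" by blast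
  have fin: "finite E'" using E'(1) insert.hyps finite_subset by blast
  have aE: "a \<notin> E'" using E'(1) insert.hyps by blast
  show ?case
  proof (cases "\<exists>\<eta>. \<forall>k\<in>I. M a k = (\<Sum>e'\<in>E'. \<eta> e' * M e' k)")
    case True
    then show ?thesis using E' by (intro exI[of _ E']) auto
  next
    case False
    have ind: "\<forall>e\<in>insert a E'. \<xi> e = 0" if \<xi>: "\<forall>k\<in>I. (\<Sum>e\<in>insert a E'. \<xi> e * M e k) = 0" for \<xi>
    proof -
      have s: "\<xi> a * M a k + (\<Sum>e\<in>E'. \<xi> e * M e k) = 0" if "k \<in> I" for k using \<xi> that fin aE by simp
      have a0: "\<xi> a = 0"
      proof (rule ccontr)
        assume nz: "\<xi> a \<noteq> 0"
        have "M a k = (\<Sum>e'\<in>E'. (- \<xi> e' / \<xi> a) * M e' k)" if "k \<in> I" for k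
        proof -
          have "M a k = - (\<Sum>e\<in>E'. \<xi> e * M e k) / \<xi> a" using s[OF that] nz by (simp add: field_simps eq_neg_iff_add_eq_0)
          also have "\<dots> = (\<Sum>e'\<in>E'. (- \<xi> e' / \<xi> a) * M e' k)" by (simp add: sum_divide_distrib sum_negf[symmetric])
          finally show ?thesis .
        qed
        then have "\<forall>k\<in>I. M a k = (\<Sum>e'\<in>E'. (\<lambda>e'. - \<xi> e' / \<xi> a) e' * M e' k)" by simp
        then show False using False by (rule notE[rotated, OF exI])
      qed
      have "\<forall>k\<in>I. (\<Sum>e\<in>E'. \<xi> e * M e k) = 0" using s a0 by simp
      then have "\<forall>e\<in>E'. \<xi> e = 0" using E'(2) by blast
      then show ?thesis using a0 by simp
    qed
    have "\<exists>\<eta>. \<forall>k\<in>I. M e k = (\<Sum>e'\<in>insert a E'. \<eta> e' * M e' k)" if e: "e \<in> insert a E" for e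
    proof (cases "e = a")
      case True
      have "(\<Sum>e'\<in>E'. (if e' = a then 1 else 0) * M e' k) = 0" for k using aE by (intro sum.neutral) auto
      then show ?thesis using True fin aE by (intro exI[of _ "\<lambda>e'. if e' = a then 1 else 0"]) auto
    next
      case False
      then obtain \<eta> where \<eta>: "\<forall>k\<in>I. M e k = (\<Sum>e'\<in>E'. \<eta> e' * M e' k)" using E'(3) e by blast
      have "(\<Sum>e'\<in>E'. (\<eta>(a := 0)) e' * M e' k) = (\<Sum>e'\<in>E'. \<eta> e' * M e' k)" for k
        using aE by (intro sum.cong) auto
      then show ?thesis using \<eta> fin aE by (intro exI[of _ "\<eta>(a := 0)"]) (simp del: fun_upd_apply, simp)
    qed
    then have "\<forall>e\<in>insert a E. \<exists>\<eta>. \<forall>k\<in>I. M e k = (\<Sum>e'\<in>insert a E'. \<eta> e' * M e' k)" by (rule ballI)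
    moreover have "insert a E' \<subseteq> insert a E" using E'(1) by blast
    ultimately show ?thesis using ind by (intro exI[of _ "insert a E'"] conjI allI impI)
  qed
qed

section \<open>Generic vanishing\<close>

lemma growth_coordinates:
  assumes "finite K"
  shows "growth Z (crd K) (int (card K))"
proof -
  have "growth Z ({} \<union> (\<lambda>k x. x k) ` K) (0 + int (card K))"
    by (intro growth_add_functions growth_no_functions assms)
  then show ?thesis by (simp add: crd_def)
qed

text \<open>The scaling factor is a free parameter on the cone over the slice, and is traded for one dimension.\<close>

lemma growth_slice:
  assumes g: "growth Y (crd K) s" and k: "k \<in> K" and K: "finite K"
    and scale: "\<And>c x. x \<in> Y \<Longrightarrow> c \<noteq> 0 \<Longrightarrow> (\<lambda>k. c * x k) \<in> Y"
  shows "growth {x \<in> Y. x k = 1} (crd K) (s - 1)"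
proof -
  define Z where "Z = {(c :: complex, x). c \<noteq> 0 \<and> x \<in> Y \<and> x k = 1}"
  define F where "F = (\<lambda>i (c :: complex, x :: 'a \<Rightarrow> complex). c * x i) ` K"
  have F: "growth Z F s"
  proof (rule growth_pullback[OF g, where \<phi> = "\<lambda>(c, x) i. c * x i"])
    fix z assume "z \<in> Z"
    then show "(case z of (c, x) \<Rightarrow> \<lambda>i. c * x i) \<in> Y" using scale[of "snd z" "fst z"] by (simp add: Z_def case_prod_unfold)
  next
    fix f assume "f \<in> F"
    then obtain i where i: "i \<in> K" "f = (\<lambda>(c, x). c * x i)" by (auto simp: F_def)
    have "\<forall>z\<in>Z. f z = (\<lambda>x. x i) ((\<lambda>(c, x) i. c * x i) z)" unfolding i(2) by (simp add: case_prod_unfold)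
    moreover have "(\<lambda>x. x i) \<in> crd K" using i(1) unfolding crd_def by (rule imageI)
    ultimately show "\<exists>g\<in>crd K. \<forall>z\<in>Z. f z = g (case z of (c, x) \<Rightarrow> \<lambda>i. c * x i)"
      by (intro bexI[where x = "\<lambda>x. x i"]) simp_all
  qed
  have kF: "(\<lambda>(c, x). c * x k) \<in> F" using k unfolding F_def by (rule imageI)
  have "growth Z (F \<union> (\<lambda>i (c, x). x i) ` K) s"
  proof (rule growth_rational_functions[OF F K])
    fix i assume "i \<in> K"
    then have "(\<lambda>(c, x). c * x i) \<in> F" unfolding F_def by (rule imageI)
    then show "\<exists>p\<in>polyfuns F. \<exists>q\<in>polyfuns F. \<forall>z\<in>Z. q z \<noteq> 0 \<and> (case z of (c, x) \<Rightarrow> x i) * q z = p z"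
      using kF by (intro bexI[of _ "\<lambda>(c, x). c * x i"] bexI[of _ "\<lambda>(c, x). c * x k"]) (auto simp: Z_def intro: polyfuns.coord)
  qed
  then have "growth Z (insert (\<lambda>(c, x). c * x k) ((\<lambda>i (c, x). x i) ` K)) s"
    by (rule growth_mono) (use kF in auto)
  then have "growth Z ((\<lambda>i (c, x). x i) ` K) (s - 1)"
  proof (rule growth_trade)
    fix z assume z: "z \<in> Z"
    obtain c x where cx: "z = (c, x)" by (cases z)
    have "UNIV - {0} \<subseteq> {(case z' of (c, x) \<Rightarrow> c * x k) |z'. z' \<in> Z \<and> (\<forall>f\<in>(\<lambda>i (c, x). x i) ` K. f z' = f z)}"
    proof
      fix c' :: complex assume "c' \<in> UNIV - {0}"
      then show "c' \<in> {(case z' of (c, x) \<Rightarrow> c * x k) |z'. z' \<in> Z \<and> (\<forall>f\<in>(\<lambda>i (c, x). x i) ` K. f z' = f z)}"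
        using z cx by (intro CollectI exI[of _ "(c', x)"]) (auto simp: Z_def)
    qed
    moreover have "infinite (UNIV - {0 :: complex})" by (simp add: infinite_UNIV_char_0)
    ultimately show "infinite {(case z' of (c, x) \<Rightarrow> c * x k) |z'. z' \<in> Z \<and> (\<forall>f\<in>(\<lambda>i (c, x). x i) ` K. f z' = f z)}"
      using finite_subset by blast
  qed
  then show ?thesis
  proof (rule growth_pullback[where \<phi> = "\<lambda>x. (1, x)"])
    fix f assume "f \<in> crd K"
    then obtain i where i: "i \<in> K" "f = (\<lambda>x. x i)" by (auto simp: crd_def)
    have "(\<lambda>(c, x). x i) \<in> (\<lambda>i (c :: complex, x). x i) ` K" using i(1) by (rule imageI)
    then show "\<exists>g\<in>(\<lambda>i (c :: complex, x). x i) ` K. \<forall>z\<in>{x \<in> Y. x k = 1}. f z = g (1, z)"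
      by (intro bexI[where x = "\<lambda>(c, x). x i"]) (simp_all add: i(2))
  qed (auto simp: Z_def)
qed

text \<open>Each free coordinate is traded for one dimension; the remaining exponent is not negative on a nonempty set.\<close>

lemma growth_free_functions:
  fixes Q :: "'q set"
  assumes "finite Q" "growth (UNIV :: ('q \<Rightarrow> complex) set) ((\<lambda>q \<theta>. \<theta> q) ` Q) s"
  shows "s \<ge> int (card Q)"
proof -
  have "growth (UNIV :: ('q \<Rightarrow> complex) set) {} (s - int (card Q))"
    using assms
  proof (induction Q arbitrary: s rule: finite_induct)
    case (insert q Q)
    have "growth UNIV ((\<lambda>q \<theta>. \<theta> q) ` Q) (s - 1)"
    proof (rule growth_trade[where h = "\<lambda>\<theta>. \<theta> q"])
      fix z :: "'q \<Rightarrow> complex"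
      have "UNIV \<subseteq> {z' q |z'. z' \<in> UNIV \<and> (\<forall>f\<in>(\<lambda>q \<theta>. \<theta> q) ` Q. f z' = f z)}"
      proof
        fix c
        show "c \<in> {z' q |z'. z' \<in> UNIV \<and> (\<forall>f\<in>(\<lambda>q \<theta>. \<theta> q) ` Q. f z' = f z)}"
          using insert.hyps by (intro CollectI exI[of _ "z(q := c)"]) auto
      qed
      then show "infinite {z' q |z'. z' \<in> UNIV \<and> (\<forall>f\<in>(\<lambda>q \<theta>. \<theta> q) ` Q. f z' = f z)}"
        using infinite_UNIV_char_0 finite_subset by blast
    qed (use insert.prems in simp)
    from insert.IH[OF this] show ?case using insert.hyps by (simp add: algebra_simps)
  qed simp
  then show ?thesis using growth_nonneg by fastforce
qed

text \<open>If every choice of the parameters theta had a bad point x in some Y(a), then x and the other parameters would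
  determine the card (D a) parameters at which a coefficient G is nonzero, as rational functions. The space of all
  parameters would have smaller growth than its dimension. The bad point is an arbitrary function of
  theta, which is why growth is defined for arbitrary sets and functions.\<close>

lemma generic_nonvanishing:
  fixes G :: "'c \<Rightarrow> 'w \<Rightarrow> ('k \<Rightarrow> complex) \<Rightarrow> complex"
  assumes A: "finite A" and C: "finite C" and W: "\<And>i. i \<in> C \<Longrightarrow> finite (W i)" and K: "finite K"
    and G: "\<And>i w. i \<in> C \<Longrightarrow> w \<in> W i \<Longrightarrow> G i w \<in> polys K"
    and Y: "\<And>a. a \<in> A \<Longrightarrow> growth (Y a) (crd K) (s a)"
    and Ca: "\<And>a. a \<in> A \<Longrightarrow> D a \<subseteq> C" "\<And>a. a \<in> A \<Longrightarrow> s a < int (card (D a))"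
    and nz: "\<And>a x i. a \<in> A \<Longrightarrow> x \<in> Y a \<Longrightarrow> i \<in> D a \<Longrightarrow> \<exists>w\<in>W i. G i w x \<noteq> 0"
  shows "\<exists>\<theta> :: 'c \<Rightarrow> 'w \<Rightarrow> complex. \<forall>a\<in>A. \<forall>x\<in>Y a. \<exists>i\<in>D a. (\<Sum>w\<in>W i. \<theta> i w * G i w x) \<noteq> 0"
proof (rule ccontr)
  assume "\<not> ?thesis"
  then have "\<forall>\<theta> :: 'c \<times> 'w \<Rightarrow> complex. \<exists>ax. fst ax \<in> A \<and> snd ax \<in> Y (fst ax) \<and>
    (\<forall>i\<in>D (fst ax). (\<Sum>w\<in>W i. \<theta> (i, w) * G i w (snd ax)) = 0)"
  proof (intro allI)
    fix \<theta> :: "'c \<times> 'w \<Rightarrow> complex"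
    assume "\<not> (\<exists>\<theta>. \<forall>a\<in>A. \<forall>x\<in>Y a. \<exists>i\<in>D a. (\<Sum>w\<in>W i. \<theta> i w * G i w x) \<noteq> 0)"
    then have "\<not> (\<forall>a\<in>A. \<forall>x\<in>Y a. \<exists>i\<in>D a. (\<Sum>w\<in>W i. (\<lambda>i w. \<theta> (i, w)) i w * G i w x) \<noteq> 0)" by (rule contrapos_nn) (rule exI)
    then obtain a x where "a \<in> A" "x \<in> Y a" "\<forall>i\<in>D a. (\<Sum>w\<in>W i. \<theta> (i, w) * G i w x) = 0" by blast
    then show "\<exists>ax. fst ax \<in> A \<and> snd ax \<in> Y (fst ax) \<and> (\<forall>i\<in>D (fst ax). (\<Sum>w\<in>W i. \<theta> (i, w) * G i w (snd ax)) = 0)"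
      by (intro exI[of _ "(a, x)"]) simp
  qed
  from choice[OF this] obtain ax where ax: "\<And>\<theta>. fst (ax \<theta>) \<in> A" "\<And>\<theta>. snd (ax \<theta>) \<in> Y (fst (ax \<theta>))"
    "\<And>\<theta> i. i \<in> D (fst (ax \<theta>)) \<Longrightarrow> (\<Sum>w\<in>W i. \<theta> (i, w) * G i w (snd (ax \<theta>))) = 0" by blast
  define x where "x = (\<lambda>\<theta>. snd (ax \<theta>))"
  define Q where "Q = Sigma C W"
  have Qf: "finite Q" unfolding Q_def using C W by blast
  define Z where "Z = (\<lambda>(a, \<pi>). {\<theta>. fst (ax \<theta>) = a \<and> (\<forall>i\<in>D a. G i (\<pi> i) (x \<theta>) \<noteq> 0)})"
  have "growth UNIV ((\<lambda>q \<theta>. \<theta> q) ` Q) (int (card Q) - 1)"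
  proof (rule growth_UN[of "Sigma A (\<lambda>a. Pi\<^sub>E (D a) W)" Z])
    have "finite (Pi\<^sub>E (D a) W)" if "a \<in> A" for a
      using Ca(1)[OF that] C W by (intro finite_PiE) (auto intro: finite_subset)
    then show "finite (Sigma A (\<lambda>a. Pi\<^sub>E (D a) W))" using A by blast
    show "UNIV \<subseteq> (\<Union>i\<in>Sigma A (\<lambda>a. Pi\<^sub>E (D a) W). Z i)"
    proof
      fix \<theta> :: "'c \<times> 'w \<Rightarrow> complex"
      define a where "a = fst (ax \<theta>)"
      have "\<forall>i\<in>D a. \<exists>w\<in>W i. G i w (x \<theta>) \<noteq> 0" using nz[OF ax(1,2)] by (simp add: a_def x_def)
      then have "\<forall>i\<in>D a. \<exists>w. w \<in> W i \<and> G i w (x \<theta>) \<noteq> 0" by blast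
      from bchoice[OF this] obtain \<pi> where \<pi>: "\<forall>i\<in>D a. \<pi> i \<in> W i \<and> G i (\<pi> i) (x \<theta>) \<noteq> 0" by blast
      have "(a, restrict \<pi> (D a)) \<in> Sigma A (\<lambda>a. Pi\<^sub>E (D a) W)" using \<pi> ax(1) by (auto simp: a_def)
      moreover have "\<theta> \<in> Z (a, restrict \<pi> (D a))" using \<pi> by (auto simp: Z_def a_def)
      ultimately show "\<theta> \<in> (\<Union>i\<in>Sigma A (\<lambda>a. Pi\<^sub>E (D a) W). Z i)" by blast
    qed
  next
    fix i assume "i \<in> Sigma A (\<lambda>a. Pi\<^sub>E (D a) W)"
    then obtain a \<pi> where a: "i = (a, \<pi>)" "a \<in> A" "\<pi> \<in> Pi\<^sub>E (D a) W" by blast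
    have DC: "D a \<subseteq> C" by (rule Ca(1)[OF a(2)])
    define F where "F = (\<lambda>f \<theta>. f (x \<theta>)) ` crd K"
    have F: "growth (Z i) F (s a)"
    proof (rule growth_pullback[OF Y[OF a(2)], where \<phi> = x])
      show "x z \<in> Y a" if "z \<in> Z i" for z using that ax(2)[of z] by (auto simp: Z_def a x_def)
      show "\<exists>g\<in>crd K. \<forall>z\<in>Z i. f z = g (x z)" if "f \<in> F" for f using that by (auto simp: F_def)
    qed
    define R where "R = (\<lambda>i. (i, \<pi> i)) ` D a"
    have RQ: "R \<subseteq> Q" using a(3) DC by (auto simp: R_def Q_def)
    have cR: "card R = card (D a)" unfolding R_def by (intro card_image) (auto simp: inj_on_def)
    have "growth (Z i) (F \<union> (\<lambda>q \<theta>. \<theta> q) ` (Q - R)) (s a + int (card (Q - R)))"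
      by (intro growth_add_functions F finite_Diff Qf)
    then have "growth (Z i) ((F \<union> (\<lambda>q \<theta>. \<theta> q) ` (Q - R)) \<union> (\<lambda>q \<theta>. \<theta> q) ` R) (s a + int (card (Q - R)))"
    proof (rule growth_rational_functions)
      show "finite R" using RQ Qf finite_subset by blast
      fix q assume "q \<in> R"
      then obtain j where j: "j \<in> D a" "q = (j, \<pi> j)" by (auto simp: R_def)
      have jW: "\<pi> j \<in> W j" "finite (W j)" "j \<in> C" using a(3) j DC W by auto
      let ?F = "F \<union> (\<lambda>q \<theta>. \<theta> q) ` (Q - R)"
      have Gp: "(\<lambda>\<theta>. G j w (x \<theta>)) \<in> polyfuns ?F" if w: "w \<in> W j" for w
      proof -
        have "(\<lambda>\<theta>. G j w (\<lambda>k. x \<theta> k)) \<in> polyfuns ?F"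
          by (rule polys_subst[OF G[OF jW(3) w]]) (auto simp: F_def crd_def intro!: polyfuns.coord)
        then show ?thesis by simp
      qed
      have \<theta>p: "(\<lambda>\<theta>. \<theta> (j, w)) \<in> polyfuns ?F" if w: "w \<in> W j - {\<pi> j}" for w
      proof (rule polyfuns.coord)
        have "(j, w) \<in> Q - R" using w jW by (auto simp: Q_def R_def)
        then show "(\<lambda>\<theta>. \<theta> (j, w)) \<in> ?F" by blast
      qed
      have "(\<lambda>\<theta>. - (\<Sum>w\<in>W j - {\<pi> j}. \<theta> (j, w) * G j w (x \<theta>))) \<in> polyfuns ?F"
        by (intro polyfuns_uminus polyfuns_sum polyfuns.mult Gp \<theta>p) auto
      moreover have "\<theta> (j, \<pi> j) * G j (\<pi> j) (x \<theta>) = - (\<Sum>w\<in>W j - {\<pi> j}. \<theta> (j, w) * G j w (x \<theta>))"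
        and "G j (\<pi> j) (x \<theta>) \<noteq> 0" if \<theta>: "\<theta> \<in> Z i" for \<theta>
      proof -
        have "fst (ax \<theta>) = a" using \<theta> by (simp add: Z_def a)
        then have "(\<Sum>w\<in>W j. \<theta> (j, w) * G j w (x \<theta>)) = 0" using ax(3)[of j \<theta>] j by (simp add: x_def)
        then show "\<theta> (j, \<pi> j) * G j (\<pi> j) (x \<theta>) = - (\<Sum>w\<in>W j - {\<pi> j}. \<theta> (j, w) * G j w (x \<theta>))"
          using jW by (simp add: sum.remove[of "W j" "\<pi> j"] eq_neg_iff_add_eq_0)
        show "G j (\<pi> j) (x \<theta>) \<noteq> 0" using \<theta> j by (simp add: Z_def a)
      qed
      ultimately show "\<exists>p\<in>polyfuns ?F. \<exists>q'\<in>polyfuns ?F. \<forall>z\<in>Z i. q' z \<noteq> 0 \<and> z q * q' z = p z"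
        unfolding j(2) by (intro bexI[OF _ Gp[OF jW(1)]] bexI[where x = "\<lambda>\<theta>. - (\<Sum>w\<in>W j - {\<pi> j}. \<theta> (j, w) * G j w (x \<theta>))"]) auto
    qed
    then show "growth (Z i) ((\<lambda>q \<theta>. \<theta> q) ` Q) (int (card Q) - 1)"
    proof (rule growth_mono)
      show "(\<lambda>q \<theta>. \<theta> q) ` Q \<subseteq> (F \<union> (\<lambda>q \<theta>. \<theta> q) ` (Q - R)) \<union> (\<lambda>q \<theta>. \<theta> q) ` R" by blast
      have "card (Q - R) = card Q - card R" using RQ Qf by (meson card_Diff_subset finite_subset)
      moreover have "card R \<le> card Q" using RQ Qf by (rule card_mono[rotated])
      ultimately show "s a + int (card (Q - R)) \<le> int (card Q) - 1" using Ca(2)[OF a(2)] cR by linarith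
    qed auto
  qed
  then show False using growth_free_functions[OF Qf] by fastforce
qed

section \<open>Linear fibrations\<close>

text \<open>The fibre over b is the kernel of the matrix L(b). A point of the variety of relations is b with a nonzero linear
  relation xi between the rows of L(b); its dimension card Ib - 2 says that the locus where L(b) drops rank has
  codimension at least 2 even after weighting by the corank, so that X is a complete intersection that is smooth in
  codimension one.\<close>

locale linear_fibration =
  fixes Ib Iy :: "'k set" and r :: nat and L :: "nat \<Rightarrow> 'k \<Rightarrow> ('k \<Rightarrow> complex) \<Rightarrow> complex"
  assumes fin: "finite Ib" "finite Iy" and disj: "Ib \<inter> Iy = {}"
    and L_homog: "\<And>e k. e < r \<Longrightarrow> k \<in> Iy \<Longrightarrow> homog Ib 1 (L e k)"
    and relations: "growth {(b, \<xi>). (\<exists>e<r. \<xi> e \<noteq> 0) \<and> (\<forall>k\<in>Iy. (\<Sum>e<r. \<xi> e * L e k b) = 0)}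
      ((\<lambda>k (b, \<xi>). b k) ` Ib \<union> (\<lambda>e (b, \<xi>). \<xi> e) ` {..<r}) (int (card Ib) - 2)"
begin

definition "K = Ib \<union> Iy"

definition "\<mu> e x = (\<Sum>k\<in>Iy. L e k x * x k)"

definition "X = {x. \<forall>e<r. \<mu> e x = 0}"

definition "minors = Pi\<^sub>E {..<r} (\<lambda>_. Iy)"

definition "minor \<sigma> = detf r (\<lambda>i j. L i (\<sigma> j))"

definition "I = idl K (\<mu> ` {..<r})"

lemma finK: "finite K" using fin by (simp add: K_def)

lemma cardK: "card K = card Ib + card Iy" using fin disj by (simp add: K_def card_Un_disjoint)

lemma fin_minors: "finite minors" unfolding minors_def by (intro finite_PiE) (auto simp: fin)

lemma homog_IbK: "homog Ib n p \<Longrightarrow> homog K n p"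
  unfolding homog_def K_def using polys_mono[of p Ib "Ib \<union> Iy"] by blast

lemma L_polys: "e < r \<Longrightarrow> k \<in> Iy \<Longrightarrow> L e k \<in> polys Ib"
  by (rule homog_polys[OF L_homog])

lemma \<mu>_homog: "e < r \<Longrightarrow> homog K 2 (\<mu> e)"
proof -
  assume e: "e < r"
  have "homog K (1 + 1) (\<lambda>x. L e k x * x k)" if "k \<in> Iy" for k
    by (intro homog_mult homog_IbK L_homog e that homog_coord) (simp add: K_def that)
  then show ?thesis unfolding \<mu>_def[abs_def] by (intro homog_sum) (simp add: numeral_2_eq_2)
qed

lemma minor_index: "\<sigma> \<in> minors \<Longrightarrow> j < r \<Longrightarrow> \<sigma> j \<in> Iy"
  unfolding minors_def by auto

lemma minor_homog: "\<sigma> \<in> minors \<Longrightarrow> homog Ib r (minor \<sigma>)"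
  unfolding minor_def by (intro detf_homog L_homog minor_index)

lemma minor_polys: "\<sigma> \<in> minors \<Longrightarrow> minor \<sigma> \<in> polys K"
  by (rule homog_polys[OF homog_IbK[OF minor_homog]])

lemma minor_cong: "\<sigma> \<in> minors \<Longrightarrow> (\<And>k. k \<in> Ib \<Longrightarrow> x k = y k) \<Longrightarrow> minor \<sigma> x = minor \<sigma> y"
  by (rule polys_cong[OF homog_polys[OF minor_homog]])

lemma minor_nonzero_independent:
  assumes "\<sigma> \<in> minors" "minor \<sigma> x \<noteq> 0" "\<forall>k\<in>Iy. (\<Sum>e<r. \<xi> e * L e k x) = 0"
  shows "\<forall>e<r. \<xi> e = 0"
  using detf_nonzero_independent[of r "\<lambda>i j. L i (\<sigma> j)" x \<xi>] assms minor_index unfolding minor_def by blast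

lemma minors_zero_dependent:
  assumes "\<forall>\<sigma>\<in>minors. minor \<sigma> x = 0"
  shows "\<exists>\<xi>. (\<forall>k\<in>Iy. (\<Sum>e<r. \<xi> e * L e k x) = 0) \<and> (\<exists>e<r. \<xi> e \<noteq> 0)"
proof (rule ccontr)
  assume n: "\<not> ?thesis"
  have "\<exists>\<sigma>. (\<forall>j<r. \<sigma> j \<in> Iy) \<and> detf r (\<lambda>i j _. L i (\<sigma> j) x) () \<noteq> 0"
    by (rule independent_rows_detf) (use n in blast)
  then obtain \<sigma> where \<sigma>: "\<forall>j<r. \<sigma> j \<in> Iy" "detf r (\<lambda>i j _. L i (\<sigma> j) x) () \<noteq> 0" by blast
  define \<tau> where "\<tau> = restrict \<sigma> {..<r}"
  have "\<tau> \<in> minors" using \<sigma>(1) by (auto simp: minors_def \<tau>_def)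
  moreover have "minor \<tau> x = detf r (\<lambda>i j _. L i (\<sigma> j) x) ()"
    unfolding minor_def detf_def by (intro arg_cong[of _ _ det] cong_mat) (auto simp: \<tau>_def)
  ultimately show False using assms \<sigma>(2) by simp
qed

end

context linear_fibration
begin

lemma crdK: "crd K = crd Ib \<union> (\<lambda>k x. x k) ` Iy"
  by (auto simp: crd_def K_def)

lemma scale_X: "x \<in> X \<Longrightarrow> (\<lambda>k. c * x k) \<in> X"
  using \<mu>_homog unfolding X_def homog_def by simp

lemma minor_scale: "\<sigma> \<in> minors \<Longrightarrow> minor \<sigma> (\<lambda>k. c * x k) = c ^ r * minor \<sigma> x"
  using minor_homog unfolding homog_def by blast

definition "X_good = {x \<in> X. \<exists>\<sigma>\<in>minors. minor \<sigma> x \<noteq> 0}"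

definition "X_bad = {x \<in> X. \<forall>\<sigma>\<in>minors. minor \<sigma> x = 0}"

lemma growth_X_good: "growth X_good (crd K) (int (card K) - int r)"
proof -
  have "growth X_good (crd Ib \<union> (\<lambda>k x. x k) ` Iy) (int (card Ib) + int (card Iy) - int (card {..<r}))"
  proof (rule growth_linear_system[where A = L and C = "\<lambda>_ _. 0"])
    show "growth X_good (crd Ib) (int (card Ib))" by (rule growth_coordinates[OF fin(1)])
    show "(\<Sum>k\<in>Iy. L e k z * z k) = 0" if "z \<in> X_good" "e \<in> {..<r}" for z e
      using that by (auto simp: X_good_def X_def \<mu>_def)
    show "\<forall>e\<in>{..<r}. \<xi> e = 0" if "z \<in> X_good" "\<forall>k\<in>Iy. (\<Sum>e<r. \<xi> e * L e k z) = 0" for z \<xi>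
      using that minor_nonzero_independent[of _ z \<xi>] by (auto simp: X_good_def)
  qed (auto simp: fin L_polys intro: polyfuns.const)
  then show ?thesis using cardK by (simp add: crdK)
qed

text \<open>The points where the rows with index in R form a basis of the row space.\<close>

definition "row_basis_locus R = {x. (\<forall>\<xi>. (\<forall>k\<in>Iy. (\<Sum>e\<in>R. \<xi> e * L e k x) = 0) \<longrightarrow> (\<forall>e\<in>R. \<xi> e = 0)) \<and>
  (\<forall>e<r. \<exists>\<eta>. \<forall>k\<in>Iy. L e k x = (\<Sum>e'\<in>R. \<eta> e' * L e' k x))}"

text \<open>Over the locus of rank r - s the nonzero relations form a punctured vector space of dimension s,
  so the locus has dimension s less than the variety of relations.\<close>

lemma growth_row_basis_locus:
  assumes R: "R \<subset> {..<r}"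
  shows "growth (row_basis_locus R) (crd Ib) (int (card Ib) - 2 - (int r - int (card R)))"
proof -
  define W where "W = {..<r} - R"
  have W: "finite W" "W \<noteq> {}" using R by (auto simp: W_def)
  have Rf: "finite R" using R finite_subset by blast
  have "card W = r - card R" "card R \<le> r" using R Rf card_mono[of "{..<r}" R] by (auto simp: W_def card_Diff_subset)
  then have cW: "int (card W) = int r - int (card R)" by simp
  define Z where "Z = {(b :: 'k \<Rightarrow> complex, \<xi> :: nat \<Rightarrow> complex). b \<in> row_basis_locus R \<and> (\<exists>e\<in>W. \<xi> e \<noteq> 0)}"
  define Fb where "Fb = (\<lambda>k (b :: 'k \<Rightarrow> complex, \<xi> :: nat \<Rightarrow> complex). b k) ` Ib"
  define F\<xi> where "F\<xi> = (\<lambda>V. (\<lambda>e (b :: 'k \<Rightarrow> complex, \<xi> :: nat \<Rightarrow> complex). \<xi> e) ` V)"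
  have "\<exists>\<zeta>. \<forall>k\<in>Iy. (\<Sum>e\<in>R. \<zeta> e * L e k b) + (\<Sum>e\<in>W. \<xi> e * L e k b) = 0" if b: "b \<in> row_basis_locus R" for b and \<xi> :: "nat \<Rightarrow> complex"
  proof -
    have "\<forall>e\<in>W. \<exists>\<eta>. \<forall>k\<in>Iy. L e k b = (\<Sum>e'\<in>R. \<eta> e' * L e' k b)" using b by (auto simp: row_basis_locus_def W_def)
    from bchoice[OF this] obtain \<eta> where \<eta>: "\<forall>e\<in>W. \<forall>k\<in>Iy. L e k b = (\<Sum>e'\<in>R. \<eta> e e' * L e' k b)" by blast
    have "(\<Sum>e\<in>R. (- (\<Sum>e'\<in>W. \<xi> e' * \<eta> e' e)) * L e k b) + (\<Sum>e\<in>W. \<xi> e * L e k b) = 0" if k: "k \<in> Iy" for k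
    proof -
      have "(\<Sum>e\<in>W. \<xi> e * L e k b) = (\<Sum>e\<in>W. \<Sum>e'\<in>R. \<xi> e * \<eta> e e' * L e' k b)"
      proof (rule sum.cong)
        fix e assume "e \<in> W"
        then have "L e k b = (\<Sum>e'\<in>R. \<eta> e e' * L e' k b)" using \<eta> k by blast
        then show "\<xi> e * L e k b = (\<Sum>e'\<in>R. \<xi> e * \<eta> e e' * L e' k b)" by (simp add: sum_distrib_left mult.assoc)
      qed simp
      also have "\<dots> = (\<Sum>e'\<in>R. (\<Sum>e\<in>W. \<xi> e * \<eta> e e') * L e' k b)"
        by (subst sum.swap) (simp add: sum_distrib_right)
      finally show ?thesis by (simp add: sum_negf)
    qed
    then show ?thesis by (intro exI[of _ "\<lambda>e. - (\<Sum>e'\<in>W. \<xi> e' * \<eta> e' e)"] ballI)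
  qed
  then have "\<forall>b \<xi>. \<exists>\<zeta>. b \<in> row_basis_locus R \<longrightarrow> (\<forall>k\<in>Iy. (\<Sum>e\<in>R. \<zeta> e * L e k b) + (\<Sum>e\<in>W. \<xi> e * L e k b) = 0)"
    by blast
  then obtain \<zeta> where \<zeta>: "\<And>b \<xi> k. b \<in> row_basis_locus R \<Longrightarrow> k \<in> Iy \<Longrightarrow>
    (\<Sum>e\<in>R. \<zeta> b \<xi> e * L e k b) + (\<Sum>e\<in>W. \<xi> e * L e k b) = 0" by metis
  define \<Phi> where "\<Phi> = (\<lambda>(b :: 'k \<Rightarrow> complex, \<xi>). (b, \<lambda>e. if e \<in> R then \<zeta> b \<xi> e else \<xi> e))"
  have "growth Z (Fb \<union> F\<xi> W) (int (card Ib) - 2)"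
  proof (rule growth_pullback[OF relations, where \<phi> = \<Phi>])
    fix z assume z: "z \<in> Z"
    obtain b \<xi> where b: "z = (b, \<xi>)" by (cases z)
    have "(\<Sum>e<r. (if e \<in> R then \<zeta> b \<xi> e else \<xi> e) * L e k b) = 0" if k: "k \<in> Iy" for k
    proof -
      have "{..<r} = R \<union> W" "R \<inter> W = {}" using R by (auto simp: W_def)
      then have "(\<Sum>e<r. (if e \<in> R then \<zeta> b \<xi> e else \<xi> e) * L e k b) =
        (\<Sum>e\<in>R. (if e \<in> R then \<zeta> b \<xi> e else \<xi> e) * L e k b) + (\<Sum>e\<in>W. (if e \<in> R then \<zeta> b \<xi> e else \<xi> e) * L e k b)"
        using Rf W by (simp add: sum.union_disjoint)
      also have "\<dots> = (\<Sum>e\<in>R. \<zeta> b \<xi> e * L e k b) + (\<Sum>e\<in>W. \<xi> e * L e k b)"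
        by (intro arg_cong2[of _ _ _ _ "(+)"] sum.cong) (auto simp: W_def)
      finally show ?thesis using \<zeta>[of b k \<xi>] z b k by (simp add: Z_def)
    qed
    moreover have "\<exists>e<r. (if e \<in> R then \<zeta> b \<xi> e else \<xi> e) \<noteq> 0"
    proof -
      obtain e where "e \<in> W" "\<xi> e \<noteq> 0" using z b by (auto simp: Z_def)
      then show ?thesis by (intro exI[of _ e]) (auto simp: W_def)
    qed
    ultimately show "\<Phi> z \<in> {(b, \<xi>). (\<exists>e<r. \<xi> e \<noteq> 0) \<and> (\<forall>k\<in>Iy. (\<Sum>e<r. \<xi> e * L e k b) = 0)}"
      by (simp add: \<Phi>_def b)
  next
    fix f assume "f \<in> Fb \<union> F\<xi> W"
    then consider k where "k \<in> Ib" "f = (\<lambda>(b, \<xi>). b k)" | e where "e \<in> W" "f = (\<lambda>(b, \<xi>). \<xi> e)"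
      unfolding Fb_def F\<xi>_def by (auto simp: image_iff)
    then show "\<exists>g\<in>(\<lambda>k (b, \<xi>). b k) ` Ib \<union> (\<lambda>e (b, \<xi>). \<xi> e) ` {..<r}. \<forall>z\<in>Z. f z = g (\<Phi> z)"
    proof cases
      case 1
      then show ?thesis by (intro bexI[where x = "\<lambda>(b, \<xi>). b k"]) (auto simp: \<Phi>_def)
    next
      case 2
      then show ?thesis by (intro bexI[where x = "\<lambda>(b, \<xi>). \<xi> e"]) (auto simp: \<Phi>_def W_def)
    qed
  qed
  have "growth Z Fb (int (card Ib) - 2 - int (card V))" if "growth Z (Fb \<union> F\<xi> V) (int (card Ib) - 2)" "V \<subseteq> W" for V
  proof -
    have "growth Z Fb (s - int (card V))" if "growth Z (Fb \<union> F\<xi> V) s" "V \<subseteq> W" for s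
      using finite_subset[OF that(2) W(1)] that
    proof (induction V arbitrary: s rule: finite_induct)
      case empty
      then show ?case by (simp add: F\<xi>_def)
    next
      case (insert e V)
      have "growth Z (Fb \<union> F\<xi> V) (s - 1)"
      proof (rule growth_trade[where h = "\<lambda>(b, \<xi>). \<xi> e"])
        have "Fb \<union> F\<xi> (insert e V) = insert (\<lambda>(b, \<xi>). \<xi> e) (Fb \<union> F\<xi> V)" by (auto simp: F\<xi>_def)
        then show "growth Z (insert (\<lambda>(b, \<xi>). \<xi> e) (Fb \<union> F\<xi> V)) s" using insert.prems by simp
        fix z assume z: "z \<in> Z"
        obtain b \<xi> where b: "z = (b, \<xi>)" by (cases z)
        have "UNIV - {0} \<subseteq> {(case z' of (b, \<xi>) \<Rightarrow> \<xi> e) |z'. z' \<in> Z \<and> (\<forall>f\<in>Fb \<union> F\<xi> V. f z' = f z)}"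
        proof
          fix c :: complex assume "c \<in> UNIV - {0}"
          then have "(b, \<xi>(e := c)) \<in> Z" using z b insert.prems by (auto simp: Z_def)
          moreover have "\<forall>f\<in>Fb \<union> F\<xi> V. f (b, \<xi>(e := c)) = f z" using insert.hyps by (auto simp: b Fb_def F\<xi>_def)
          ultimately show "c \<in> {(case z' of (b, \<xi>) \<Rightarrow> \<xi> e) |z'. z' \<in> Z \<and> (\<forall>f\<in>Fb \<union> F\<xi> V. f z' = f z)}"
            by (intro CollectI exI[of _ "(b, \<xi>(e := c))"]) simp
        qed
        moreover have "infinite (UNIV - {0 :: complex})" by (simp add: infinite_UNIV_char_0)
        ultimately show "infinite {(case z' of (b, \<xi>) \<Rightarrow> \<xi> e) |z'. z' \<in> Z \<and> (\<forall>f\<in>Fb \<union> F\<xi> V. f z' = f z)}"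
          using finite_subset by blast
      qed
      then have "growth Z Fb (s - 1 - int (card V))" using insert.IH insert.prems by simp
      then show ?case using insert.hyps by (simp add: algebra_simps)
    qed
    then show ?thesis using that by blast
  qed
  from this[OF \<open>growth Z (Fb \<union> F\<xi> W) (int (card Ib) - 2)\<close>]
  have "growth Z Fb (int (card Ib) - 2 - (int r - int (card R)))" unfolding cW by simp
  then show ?thesis
  proof (rule growth_pullback[where \<phi> = "\<lambda>b. (b, \<lambda>_. 1)"])
    show "(z, \<lambda>_. 1) \<in> Z" if "z \<in> row_basis_locus R" for z using that W(2) by (auto simp: Z_def)
    fix f assume "f \<in> crd Ib"
    then obtain k where k: "k \<in> Ib" "f = (\<lambda>x. x k)" by (auto simp: crd_def)
    then show "\<exists>g\<in>Fb. \<forall>z\<in>row_basis_locus R. f z = g (z, \<lambda>_. 1)"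
      by (intro bexI[where x = "\<lambda>(b, \<xi>). b k"]) (auto simp: Fb_def)
  qed
qed

text \<open>Over the locus of rank r - s the fibre has s dimensions more than the generic one, which the
  codimension s + 2 of the locus outweighs.\<close>

lemma growth_X_bad: "growth X_bad (crd K) (int (card K) - int r - 2)"
proof (rule growth_UN[of "{R. R \<subset> {..<r}}" "\<lambda>R. X \<inter> row_basis_locus R"])
  show "finite {R. R \<subset> {..<r}}" by (rule finite_subset[of _ "Pow {..<r}"]) auto
  show "X_bad \<subseteq> (\<Union>R\<in>{R. R \<subset> {..<r}}. X \<inter> row_basis_locus R)"
  proof
    fix x assume x: "x \<in> X_bad"
    obtain R where R: "R \<subseteq> {..<r}" "\<forall>\<xi>. (\<forall>k\<in>Iy. (\<Sum>e\<in>R. \<xi> e * L e k x) = 0) \<longrightarrow> (\<forall>e\<in>R. \<xi> e = 0)"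
      "\<forall>e\<in>{..<r}. \<exists>\<eta>. \<forall>k\<in>Iy. L e k x = (\<Sum>e'\<in>R. \<eta> e' * L e' k x)"
      using maximal_independent_rows[of "{..<r}" Iy "\<lambda>e k. L e k x"] by blast
    obtain \<xi> where "\<forall>k\<in>Iy. (\<Sum>e<r. \<xi> e * L e k x) = 0" "\<exists>e<r. \<xi> e \<noteq> 0"
      using minors_zero_dependent[of x] x by (auto simp: X_bad_def)
    then have "R \<noteq> {..<r}" using R(2) by blast
    then have "R \<subset> {..<r}" using R(1) by blast
    moreover have "x \<in> row_basis_locus R" using R(2,3) unfolding row_basis_locus_def by blast
    ultimately show "x \<in> (\<Union>R\<in>{R. R \<subset> {..<r}}. X \<inter> row_basis_locus R)" using x by (auto simp: X_bad_def)
  qed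
next
  fix R assume "R \<in> {R. R \<subset> {..<r}}"
  then have R: "R \<subset> {..<r}" by simp
  have Rf: "finite R" using R finite_subset by blast
  have "growth (X \<inter> row_basis_locus R) (crd Ib \<union> (\<lambda>k x. x k) ` Iy)
    ((int (card Ib) - 2 - (int r - int (card R))) + int (card Iy) - int (card R))"
  proof (rule growth_linear_system[where A = L and C = "\<lambda>_ _. 0"])
    show "growth (X \<inter> row_basis_locus R) (crd Ib) (int (card Ib) - 2 - (int r - int (card R)))"
      by (rule growth_mono[OF growth_row_basis_locus[OF R]]) auto
    show "(\<Sum>k\<in>Iy. L e k z * z k) = 0" if "z \<in> X \<inter> row_basis_locus R" "e \<in> R" for z e
      using that R by (auto simp: X_def \<mu>_def)
    show "\<forall>e\<in>R. \<xi> e = 0" if "z \<in> X \<inter> row_basis_locus R" "\<forall>k\<in>Iy. (\<Sum>e\<in>R. \<xi> e * L e k z) = 0" for z \<xi>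
      using that by (auto simp: row_basis_locus_def)
    show "L e k \<in> polys Ib" if "e \<in> R" "k \<in> Iy" for e k using L_polys that R by blast
  qed (auto simp: fin Rf intro: polyfuns.const)
  then show "growth (X \<inter> row_basis_locus R) (crd K) (int (card K) - int r - 2)"
    using cardK by (simp add: crdK algebra_simps)
qed

lemma zero_in_X: "(\<lambda>_. 0) \<in> X"
  by (simp add: X_def \<mu>_def)

lemma L_zero: "e < r \<Longrightarrow> k \<in> Iy \<Longrightarrow> L e k (\<lambda>_. 0) = 0"
proof -
  assume "e < r" "k \<in> Iy"
  then have "\<forall>s x. L e k (\<lambda>k. s * x k) = s ^ 1 * L e k x" using L_homog[of e k] by (simp add: homog_def)
  from spec[OF spec[OF this, of 0], of "\<lambda>_. 0"] show ?thesis by simp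
qed

lemma card_bound: "r \<ge> 1 \<Longrightarrow> r + 2 \<le> card Ib"
proof -
  assume "r \<ge> 1"
  then have "0 \<in> {..<r}" by simp
  then have R: "{} \<subset> {..<r}" by blast
  have "(\<lambda>_. 0) \<in> row_basis_locus {}" by (simp add: row_basis_locus_def L_zero)
  then have ne: "row_basis_locus {} \<noteq> {}" by blast
  have "\<not> int (card Ib) - 2 - (int r - int (card ({} :: nat set))) < 0"
    using ne growth_nonneg[OF growth_row_basis_locus[OF R]] by (rule contrapos_nn)
  then show ?thesis by simp
qed

text \<open>X has dimension D = card K - r, and X_bad at most D - 2. So D - 2 generic linear forms have only the
  origin as common zero on X_bad, and together with two generic combinations of the minors also on X_good.
  Slicing by x k = 1 removes the origin and one dimension.\<close>

lemma system_of_parameters: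
  assumes r: "r \<ge> 1"
  shows "\<exists>(l :: nat \<Rightarrow> 'k \<Rightarrow> complex) \<zeta>. \<forall>x\<in>X. (\<forall>i<card K - r - 2. (\<Sum>k\<in>K. l i k * x k) = 0) \<longrightarrow>
    (\<forall>j<2::nat. (\<Sum>\<sigma>\<in>minors. \<zeta> j \<sigma> * minor \<sigma> x) = 0) \<longrightarrow> (\<forall>k\<in>K. x k = 0)"
proof -
  define D where "D = card K - r"
  have D: "int D = int (card K) - int r" "D \<ge> 2" using card_bound[OF r] by (auto simp: D_def cardK)
  define Y where "Y = (\<lambda>(k, g). {x \<in> (if g then X_good else X_bad). x k = 1})"
  define W :: "nat \<Rightarrow> ('k + (nat \<Rightarrow> 'k)) set" where "W = (\<lambda>i. if i < D - 2 then Inl ` K else Inr ` minors)"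
  define G :: "nat \<Rightarrow> 'k + (nat \<Rightarrow> 'k) \<Rightarrow> ('k \<Rightarrow> complex) \<Rightarrow> complex" where "G = (\<lambda>_. case_sum (\<lambda>k x. x k) minor)"
  define dim where "dim = (\<lambda>(k :: 'k, g). if g then int D - 1 else int D - 3)"
  define conds where "conds = (\<lambda>(k :: 'k, g). if g then {..<D} else {..<D - 2})"
  have "\<exists>\<theta>. \<forall>a\<in>K \<times> UNIV. \<forall>x\<in>Y a. \<exists>i\<in>conds a. (\<Sum>w\<in>W i. \<theta> i w * G i w x) \<noteq> 0"
  proof (rule generic_nonvanishing[where C = "{..<D}" and s = dim and K = K])
    show "finite (K \<times> (UNIV :: bool set))" using finK by simp
    show "finite (W i)" for i using finK fin_minors by (simp add: W_def)
    show "G i w \<in> polys K" if "i \<in> {..<D}" "w \<in> W i" for i w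
      using that minor_polys polys_coord by (auto simp: G_def W_def split: if_splits)
    show "growth (Y a) (crd K) (dim a)" if "a \<in> K \<times> UNIV" for a
    proof -
      obtain k g where a: "a = (k, g)" "k \<in> K" using \<open>a \<in> K \<times> UNIV\<close> by (cases a) auto
      have sc: "(\<lambda>k. c * x k) \<in> X_good" if "x \<in> X_good" "c \<noteq> 0" for c x
        using that scale_X by (auto simp: X_good_def minor_scale)
      have sc': "(\<lambda>k. c * x k) \<in> X_bad" if "x \<in> X_bad" "c \<noteq> 0" for c x
        using that scale_X by (auto simp: X_bad_def minor_scale)
      show ?thesis
      proof (cases g)
        case True
        have "growth {x \<in> X_good. x k = 1} (crd K) (int (card K) - int r - 1)"
          by (rule growth_slice[OF growth_X_good a(2) finK sc])
        then show ?thesis using True by (simp add: a Y_def dim_def D(1))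
      next
        case False
        have "growth {x \<in> X_bad. x k = 1} (crd K) (int (card K) - int r - 2 - 1)"
          by (rule growth_slice[OF growth_X_bad a(2) finK sc'])
        then show ?thesis using False by (simp add: a Y_def dim_def D(1))
      qed
    qed
    show "dim a < int (card (conds a))" for a using D(2) by (auto simp: dim_def conds_def split: prod.split)
    show "\<exists>w\<in>W i. G i w x \<noteq> 0" if "a \<in> K \<times> UNIV" "x \<in> Y a" "i \<in> conds a" for a x i
    proof -
      obtain k g where a: "a = (k, g)" "k \<in> K" using \<open>a \<in> K \<times> UNIV\<close> by (cases a) auto
      show ?thesis
      proof (cases "i < D - 2")
        case True
        then show ?thesis using that a by (intro bexI[of _ "Inl k"]) (auto simp: W_def G_def Y_def)
      next
        case False
        then have g: "g" using that(3) a by (auto simp: conds_def split: if_splits)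
        then obtain \<sigma> where "\<sigma> \<in> minors" "minor \<sigma> x \<noteq> 0" using \<open>x \<in> Y a\<close> a by (auto simp: Y_def X_good_def)
        then show ?thesis using False by (intro bexI[of _ "Inr \<sigma>"]) (auto simp: W_def G_def)
      qed
    qed
  qed (auto simp: conds_def finK split: prod.split)
  then obtain \<theta> where \<theta>: "\<And>a x. a \<in> K \<times> UNIV \<Longrightarrow> x \<in> Y a \<Longrightarrow> \<exists>i\<in>conds a. (\<Sum>w\<in>W i. \<theta> i w * G i w x) \<noteq> 0"
    by blast
  define l where "l = (\<lambda>i k. \<theta> i (Inl k))"
  define \<zeta> where "\<zeta> = (\<lambda>j \<sigma>. \<theta> (D - 2 + j) (Inr \<sigma>))"
  show ?thesis
  proof (intro exI[of _ l] exI[of _ \<zeta>] ballI impI)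
    fix x k0
    assume x: "x \<in> X" and lx': "\<forall>i<card K - r - 2. (\<Sum>k\<in>K. l i k * x k) = 0"
      and \<zeta>x': "\<forall>j<2. (\<Sum>\<sigma>\<in>minors. \<zeta> j \<sigma> * minor \<sigma> x) = 0" and k0: "k0 \<in> K"
    have lx: "(\<Sum>k\<in>K. l i k * x k) = 0" if "i < card K - r - 2" for i using lx' that by blast
    have \<zeta>x: "(\<Sum>\<sigma>\<in>minors. \<zeta> j \<sigma> * minor \<sigma> x) = 0" if "j < 2" for j using \<zeta>x' that by blast
    show "x k0 = 0"
    proof (rule ccontr)
      assume nz: "x k0 \<noteq> 0"
      define c where "c = inverse (x k0)"
      define y where "y = (\<lambda>k. c * x k)"
      have y: "y \<in> X" unfolding y_def by (rule scale_X[OF x])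
      have yk: "y k0 = 1" using nz by (simp add: y_def c_def)
      have ly: "(\<Sum>k\<in>K. l i k * y k) = 0" if "i < D - 2" for i
      proof -
        have "(\<Sum>k\<in>K. l i k * y k) = c * (\<Sum>k\<in>K. l i k * x k)" by (simp add: y_def sum_distrib_left mult.left_commute)
        then show ?thesis using lx[of i] that by (simp add: D_def)
      qed
      have \<zeta>y: "(\<Sum>\<sigma>\<in>minors. \<zeta> j \<sigma> * minor \<sigma> y) = 0" if "j < 2" for j
      proof -
        have "(\<Sum>\<sigma>\<in>minors. \<zeta> j \<sigma> * minor \<sigma> y) = c ^ r * (\<Sum>\<sigma>\<in>minors. \<zeta> j \<sigma> * minor \<sigma> x)"
          by (simp add: y_def minor_scale sum_distrib_left mult.left_commute)
        then show ?thesis using \<zeta>x[OF that] by simp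
      qed
      define g where "g = (\<exists>\<sigma>\<in>minors. minor \<sigma> y \<noteq> 0)"
      have "y \<in> Y (k0, g)" using y yk by (auto simp: Y_def X_good_def X_bad_def g_def)
      then obtain i where i: "i \<in> conds (k0, g)" "(\<Sum>w\<in>W i. \<theta> i w * G i w y) \<noteq> 0" using \<theta>[of "(k0, g)" y] k0 by blast
      have iD: "i < D" using i(1) by (auto simp: conds_def split: if_splits)
      have "(\<Sum>w\<in>W i. \<theta> i w * G i w y) = 0"
      proof (cases "i < D - 2")
        case True
        have "(\<Sum>w\<in>Inl ` K. \<theta> i w * G i w y) = (\<Sum>k\<in>K. l i k * y k)"
          by (subst sum.reindex) (auto simp: l_def G_def)
        then show ?thesis using ly[OF True] True by (simp add: W_def)
      next
        case False
        define j where "j = i - (D - 2)"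
        have j: "i = D - 2 + j" "j < 2" using False iD D(2) by (auto simp: j_def)
        have "(\<Sum>w\<in>Inr ` minors. \<theta> i w * G i w y) = (\<Sum>\<sigma>\<in>minors. \<zeta> j \<sigma> * minor \<sigma> y)"
          by (subst sum.reindex) (auto simp: \<zeta>_def G_def j)
        then show ?thesis using \<zeta>y[OF j(2)] False by (simp add: W_def)
      qed
      then show False using i(2) by simp
    qed
  qed
qed

end

section \<open>Charts of the total space\<close>

lemma idl_power_sum:
  assumes "finite A" "\<And>\<sigma>. \<sigma> \<in> A \<Longrightarrow> g \<sigma> \<in> polys K" "p \<in> polys K"
    "\<And>\<sigma>. \<sigma> \<in> A \<Longrightarrow> \<exists>n. (\<lambda>x. g \<sigma> x ^ n * p x) \<in> idl K S"
  shows "\<exists>n. (\<lambda>x. (\<Sum>\<sigma>\<in>A. c \<sigma> * g \<sigma> x) ^ n * p x) \<in> idl K S"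
  using assms
proof (induction A rule: finite_induct)
  case empty
  then show ?case by (intro exI[of _ 1]) (auto intro: idl.zero)
next
  case (insert \<sigma> A)
  define G where "G = (\<lambda>x. \<Sum>\<sigma>\<in>A. c \<sigma> * g \<sigma> x)"
  define h where "h = (\<lambda>x. c \<sigma> * g \<sigma> x)"
  obtain m where m: "(\<lambda>x. G x ^ m * p x) \<in> idl K S" using insert by (auto simp: G_def)
  obtain n where n: "(\<lambda>x. g \<sigma> x ^ n * p x) \<in> idl K S" using insert.prems(3) by blast
  have Gp: "G \<in> polys K" unfolding G_def by (intro polyfuns_sum polyfuns_scale) (use insert.prems in auto)
  have hp: "h \<in> polys K" unfolding h_def by (intro polyfuns_scale) (use insert.prems in auto)
  have "(\<lambda>x. c \<sigma> ^ n * (g \<sigma> x ^ n * p x)) \<in> idl K S" by (rule idl_scale[OF n])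
  then have n': "(\<lambda>x. h x ^ n * p x) \<in> idl K S" by (simp add: h_def power_mult_distrib mult.assoc)
  have "(\<lambda>x. \<Sum>i\<le>n + m. of_nat ((n + m) choose i) * (h x ^ i * G x ^ (n + m - i) * p x)) \<in> idl K S"
  proof (intro idl_sum idl_scale)
    fix i assume i: "i \<in> {..n + m}"
    show "(\<lambda>x. h x ^ i * G x ^ (n + m - i) * p x) \<in> idl K S"
    proof (cases "n \<le> i")
      case True
      have "(\<lambda>x. (h x ^ (i - n) * G x ^ (n + m - i)) * (h x ^ n * p x)) \<in> idl K S"
        by (intro idl_mult n' polyfuns.mult polyfuns_power hp Gp)
      moreover have "(h x ^ (i - n) * G x ^ (n + m - i)) * (h x ^ n * p x) = h x ^ i * G x ^ (n + m - i) * p x" for x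
        using True power_add[of "h x" "i - n" n] by simp
      ultimately show ?thesis by simp
    next
      case False
      have "(\<lambda>x. (h x ^ i * G x ^ (n - i)) * (G x ^ m * p x)) \<in> idl K S"
        by (intro idl_mult m polyfuns.mult polyfuns_power hp Gp)
      moreover have "(h x ^ i * G x ^ (n - i)) * (G x ^ m * p x) = h x ^ i * G x ^ (n + m - i) * p x" for x
        using False power_add[of "G x" "n - i" m] by simp
      ultimately show ?thesis by simp
    qed
  qed
  moreover have "(\<Sum>i\<le>n + m. of_nat ((n + m) choose i) * (h x ^ i * G x ^ (n + m - i) * p x)) = (h x + G x) ^ (n + m) * p x" for x
    unfolding binomial_ring by (simp add: sum_distrib_right mult.assoc)
  ultimately have "(\<lambda>x. (h x + G x) ^ (n + m) * p x) \<in> idl K S" by simp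
  then show ?case using insert.hyps by (intro exI[of _ "n + m"]) (simp add: h_def G_def)
qed

context linear_fibration
begin

definition "free \<sigma> = K - \<sigma> ` {..<r}"

lemma free_subset: "free \<sigma> \<subseteq> K" by (auto simp: free_def)

lemma Ib_free: "\<sigma> \<in> minors \<Longrightarrow> Ib \<subseteq> free \<sigma>"
  using minor_index disj by (auto simp: free_def K_def)

lemma minor_free: "\<sigma> \<in> minors \<Longrightarrow> minor \<sigma> \<in> polys (free \<sigma>)"
  by (rule polys_mono[OF homog_polys[OF minor_homog] Ib_free])

lemma minor_nonzero_inj:
  assumes "\<sigma> \<in> minors" "minor \<sigma> z \<noteq> 0"
  shows "inj_on \<sigma> {..<r}"
proof (rule inj_onI, rule ccontr)
  fix i j assume ij: "i \<in> {..<r}" "j \<in> {..<r}" "\<sigma> i = \<sigma> j" "i \<noteq> j"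
  have "det (mat r r (\<lambda>(i, j). L i (\<sigma> j) z)) = 0"
    by (rule det_identical_columns[of _ r i j]) (use ij in \<open>auto intro!: eq_vecI\<close>)
  then show False using assms(2) by (simp add: minor_def detf_def)
qed

lemma minor_adjugate:
  assumes "\<sigma> \<in> minors"
  obtains C where "\<And>i j. i < r \<Longrightarrow> j < r \<Longrightarrow> C i j \<in> polys Ib"
    "\<And>j l x. j < r \<Longrightarrow> l < r \<Longrightarrow> (\<Sum>i<r. C j i x * L i (\<sigma> l) x) = (if j = l then minor \<sigma> x else 0)"
    "\<And>j l x. j < r \<Longrightarrow> l < r \<Longrightarrow> (\<Sum>i<r. L j (\<sigma> i) x * C i l x) = (if j = l then minor \<sigma> x else 0)"
proof -
  have "\<And>i j. i < r \<Longrightarrow> j < r \<Longrightarrow> L i (\<sigma> j) \<in> polys Ib" using L_polys minor_index[OF assms] by blast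
  from detf_adjugate[of r "\<lambda>i j. L i (\<sigma> j)", OF this]
  obtain C where "(\<forall>i<r. \<forall>j<r. C i j \<in> polys Ib) \<and>
    (\<forall>j<r. \<forall>l<r. \<forall>x. (\<Sum>i<r. C j i x * L i (\<sigma> l) x) = (if j = l then detf r (\<lambda>i j. L i (\<sigma> j)) x else 0)) \<and>
    (\<forall>j<r. \<forall>l<r. \<forall>x. (\<Sum>i<r. L j (\<sigma> i) x * C i l x) = (if j = l then detf r (\<lambda>i j. L i (\<sigma> j)) x else 0))"
    by blast
  then show thesis by (intro that[of C]) (simp_all add: minor_def)
qed

lemma sum_Iy_split:
  assumes "\<sigma> \<in> minors" "inj_on \<sigma> {..<r}"
  shows "(\<Sum>k\<in>Iy. f k) = (\<Sum>j<r. f (\<sigma> j)) + (\<Sum>k\<in>Iy - \<sigma> ` {..<r}. f k)"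
proof -
  have "\<sigma> ` {..<r} \<subseteq> Iy" using minor_index[OF assms(1)] by blast
  then have "(\<Sum>k\<in>Iy. f k) = (\<Sum>k\<in>Iy - \<sigma> ` {..<r}. f k) + (\<Sum>k\<in>\<sigma> ` {..<r}. f k)"
    by (rule sum.subset_diff[OF _ fin(2)])
  then show ?thesis using assms(2) by (simp add: sum.reindex add.commute)
qed

text \<open>Where the minor does not vanish, Cramer's rule eliminates the coordinates belonging to its columns.\<close>

lemma chart_reduction:
  assumes \<sigma>: "\<sigma> \<in> minors" "inj_on \<sigma> {..<r}" and p: "p \<in> polys K"
  shows "\<exists>n. \<exists>p'\<in>polys (free \<sigma>). (\<lambda>x. minor \<sigma> x ^ n * p x - p' x) \<in> I"
proof -
  obtain C where C: "\<And>i j. i < r \<Longrightarrow> j < r \<Longrightarrow> C i j \<in> polys Ib"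
    "\<And>j l x. j < r \<Longrightarrow> l < r \<Longrightarrow> (\<Sum>i<r. C j i x * L i (\<sigma> l) x) = (if j = l then minor \<sigma> x else 0)"
    by (rule minor_adjugate[OF \<sigma>(1)]) (rule that)
  let ?t = "minor \<sigma>"
  have tK: "?t \<in> polys K" by (rule minor_polys[OF \<sigma>(1)])
  have t: "?t \<in> polys (free \<sigma>)" by (rule minor_free[OF \<sigma>(1)])
  have fK: "q \<in> polys K" if "q \<in> polys (free \<sigma>)" for q by (rule polys_mono[OF that free_subset])
  show ?thesis using p
  proof (induction rule: polyfuns.induct)
    case (const c)
    show ?case by (intro exI[of _ 0] bexI[of _ "\<lambda>_. c"] polyfuns.const) (simp add: I_def idl.zero)
  next
    case (coord f)
    then obtain k where k: "f = (\<lambda>x. x k)" "k \<in> K" by (auto simp: crd_def)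
    show ?case
    proof (cases "k \<in> free \<sigma>")
      case True
      then show ?thesis by (intro exI[of _ 0] bexI[of _ f]) (auto simp: k I_def idl.zero polys_coord)
    next
      case False
      then obtain j where j: "j < r" "k = \<sigma> j" using k by (auto simp: free_def)
      define R where "R = (\<lambda>x. \<Sum>k\<in>Iy - \<sigma> ` {..<r}. (\<Sum>i<r. C j i x * L i k x) * x k)"
      have Rp: "R \<in> polys (free \<sigma>)" unfolding R_def
      proof (intro polyfuns_sum polyfuns.mult)
        fix k i assume "k \<in> Iy - \<sigma> ` {..<r}" "i \<in> {..<r}"
        then show "C j i \<in> polys (free \<sigma>)" "L i k \<in> polys (free \<sigma>)"
          using polys_mono[OF _ Ib_free[OF \<sigma>(1)]] C(1)[OF j(1), of i] L_polys[of i k] by auto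
      qed (auto simp: free_def K_def intro: polys_coord)
      have "(\<lambda>x. \<Sum>i<r. C j i x * \<mu> i x) \<in> I" unfolding I_def
      proof (intro idl_sum idl_mult idl_gen)
        fix i assume "i \<in> {..<r}"
        then show "C j i \<in> polys K" "\<mu> i \<in> \<mu> ` {..<r}"
          using polys_mono[OF C(1)[OF j(1), of i], of K] by (auto simp: K_def)
      qed
      moreover have "(\<Sum>i<r. C j i x * \<mu> i x) = ?t x * x k + R x" for x
      proof -
        have "(\<Sum>i<r. C j i x * \<mu> i x) = (\<Sum>i<r. \<Sum>k\<in>Iy. C j i x * L i k x * x k)"
          by (simp add: \<mu>_def sum_distrib_left mult.assoc)
        also have "\<dots> = (\<Sum>k\<in>Iy. (\<Sum>i<r. C j i x * L i k x) * x k)"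
          by (subst sum.swap) (simp add: sum_distrib_right)
        also have "\<dots> = (\<Sum>l<r. (\<Sum>i<r. C j i x * L i (\<sigma> l) x) * x (\<sigma> l)) + R x"
          unfolding R_def by (rule sum_Iy_split[OF \<sigma>])
        also have "(\<Sum>l<r. (\<Sum>i<r. C j i x * L i (\<sigma> l) x) * x (\<sigma> l)) = (\<Sum>l<r. if l = j then ?t x * x k else 0)"
          by (intro sum.cong) (use C(2)[OF j(1)] j in auto)
        also have "\<dots> = ?t x * x k" using j(1) by simp
        finally show ?thesis .
      qed
      ultimately have "(\<lambda>x. ?t x ^ 1 * f x - (- R x)) \<in> I" by (simp add: k)
      then show ?thesis by (intro exI[of _ 1] bexI[of _ "\<lambda>x. - R x"] polyfuns_uminus Rp)
    qed
  next
    case (add p q)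
    then obtain n p' m q' where 1: "p' \<in> polys (free \<sigma>)" "(\<lambda>x. ?t x ^ n * p x - p' x) \<in> I"
      "q' \<in> polys (free \<sigma>)" "(\<lambda>x. ?t x ^ m * q x - q' x) \<in> I" by blast
    have "(\<lambda>x. ?t x ^ m * (?t x ^ n * p x - p' x) + ?t x ^ n * (?t x ^ m * q x - q' x)) \<in> I"
      using 1 unfolding I_def by (intro idl_add idl_mult polyfuns_power tK)
    moreover have "?t x ^ m * (?t x ^ n * p x - p' x) + ?t x ^ n * (?t x ^ m * q x - q' x) =
      ?t x ^ (n + m) * (p x + q x) - (?t x ^ m * p' x + ?t x ^ n * q' x)" for x
      by (simp add: algebra_simps power_add)
    ultimately have "(\<lambda>x. ?t x ^ (n + m) * (p x + q x) - (?t x ^ m * p' x + ?t x ^ n * q' x)) \<in> I" by simp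
    moreover have "(\<lambda>x. ?t x ^ m * p' x + ?t x ^ n * q' x) \<in> polys (free \<sigma>)"
      by (intro polyfuns.add polyfuns.mult polyfuns_power t 1)
    ultimately show ?case
      by (intro exI[of _ "n + m"] bexI[of _ "\<lambda>x. ?t x ^ m * p' x + ?t x ^ n * q' x"])
  next
    case (mult p q)
    then obtain n p' m q' where 1: "p' \<in> polys (free \<sigma>)" "(\<lambda>x. ?t x ^ n * p x - p' x) \<in> I"
      "q' \<in> polys (free \<sigma>)" "(\<lambda>x. ?t x ^ m * q x - q' x) \<in> I" by blast
    have "(\<lambda>x. (?t x ^ m * q x) * (?t x ^ n * p x - p' x) + p' x * (?t x ^ m * q x - q' x)) \<in> I"
      using 1 mult.hyps fK[OF 1(1)] unfolding I_def by (intro idl_add idl_mult polyfuns.mult polyfuns_power tK)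
    moreover have "(?t x ^ m * q x) * (?t x ^ n * p x - p' x) + p' x * (?t x ^ m * q x - q' x) =
      ?t x ^ (n + m) * (p x * q x) - p' x * q' x" for x
      by (simp add: algebra_simps power_add)
    ultimately have "(\<lambda>x. ?t x ^ (n + m) * (p x * q x) - p' x * q' x) \<in> I" by simp
    moreover have "(\<lambda>x. p' x * q' x) \<in> polys (free \<sigma>)" by (intro polyfuns.mult 1)
    ultimately show ?case by (intro exI[of _ "n + m"] bexI[of _ "\<lambda>x. p' x * q' x"])
  qed
qed

lemma chart_lift:
  assumes \<sigma>: "\<sigma> \<in> minors" and x: "minor \<sigma> x \<noteq> 0"
  shows "\<exists>y\<in>X. \<forall>k\<in>free \<sigma>. y k = x k"
proof -
  have inj: "inj_on \<sigma> {..<r}" by (rule minor_nonzero_inj[OF \<sigma> x])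
  obtain C where C: "\<And>j l x. j < r \<Longrightarrow> l < r \<Longrightarrow> (\<Sum>i<r. L j (\<sigma> i) x * C i l x) = (if j = l then minor \<sigma> x else 0)"
    by (rule minor_adjugate[OF \<sigma>]) (rule that)
  define c where "c = (\<lambda>e. - (\<Sum>k\<in>Iy - \<sigma> ` {..<r}. L e k x * x k))"
  define w where "w = (\<lambda>j. \<Sum>l<r. C j l x * c l / minor \<sigma> x)"
  define y where "y = (\<lambda>k. if k \<in> \<sigma> ` {..<r} then w (the_inv_into {..<r} \<sigma> k) else x k)"
  have yf: "y k = x k" if "k \<in> free \<sigma>" for k using that by (auto simp: y_def free_def)
  have ys: "y (\<sigma> j) = w j" if "j < r" for j using that inj by (auto simp: y_def the_inv_into_f_f)
  have "\<mu> e y = 0" if e: "e < r" for e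
  proof -
    have Ly: "L e k y = L e k x" if "k \<in> Iy" for k
      by (rule polys_cong[OF L_polys[OF e that]]) (use yf Ib_free[OF \<sigma>] in auto)
    have "\<mu> e y = (\<Sum>k\<in>Iy. L e k x * y k)" unfolding \<mu>_def using Ly by (intro sum.cong) auto
    also have "\<dots> = (\<Sum>j<r. L e (\<sigma> j) x * y (\<sigma> j)) + (\<Sum>k\<in>Iy - \<sigma> ` {..<r}. L e k x * y k)"
      by (rule sum_Iy_split[OF \<sigma> inj])
    also have "(\<Sum>j<r. L e (\<sigma> j) x * y (\<sigma> j)) = (\<Sum>j<r. \<Sum>l<r. (L e (\<sigma> j) x * C j l x) * (c l / minor \<sigma> x))"
      by (intro sum.cong) (auto simp: ys w_def sum_distrib_left mult.assoc)
    also have "\<dots> = (\<Sum>l<r. (\<Sum>j<r. L e (\<sigma> j) x * C j l x) * (c l / minor \<sigma> x))"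
      by (subst sum.swap) (simp only: sum_distrib_right)
    also have "\<dots> = (\<Sum>l<r. if l = e then c e else 0)" by (intro sum.cong) (use C[OF e] x in auto)
    also have "\<dots> = c e" using e by simp
    also have "(\<Sum>k\<in>Iy - \<sigma> ` {..<r}. L e k x * y k) = (\<Sum>k\<in>Iy - \<sigma> ` {..<r}. L e k x * x k)"
      by (intro sum.cong) (auto simp: y_def)
    finally show ?thesis by (simp add: c_def)
  qed
  then show ?thesis using yf by (intro bexI[of _ y]) (auto simp: X_def)
qed

lemma I_vanish: "f \<in> I \<Longrightarrow> x \<in> X \<Longrightarrow> f x = 0"
  unfolding I_def X_def by (erule idl_vanish) auto

lemma chart_zero:
  assumes \<sigma>: "\<sigma> \<in> minors" and p: "p \<in> polys K" and \<tau>: "\<tau> \<in> minors" "minor \<tau> z \<noteq> 0"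
    and van: "\<And>x. x \<in> X \<Longrightarrow> minor \<sigma> x \<noteq> 0 \<Longrightarrow> p x * minor \<tau> x = 0"
  shows "\<exists>n. (\<lambda>x. minor \<sigma> x ^ n * p x) \<in> I"
proof (cases "\<forall>x. minor \<sigma> x = 0")
  case True
  then show ?thesis by (intro exI[of _ 1]) (simp add: I_def idl.zero)
next
  case False
  then obtain z' where z': "minor \<sigma> z' \<noteq> 0" by blast
  obtain n p' where p': "p' \<in> polys (free \<sigma>)" "(\<lambda>x. minor \<sigma> x ^ n * p x - p' x) \<in> I"
    using chart_reduction[OF \<sigma> minor_nonzero_inj[OF \<sigma> z'] p] by blast
  have p'K: "p' \<in> polys K" by (rule polys_mono[OF p'(1) free_subset])
  have "p' x * (minor \<sigma> x * minor \<tau> x) = 0" for x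
  proof (cases "minor \<sigma> x = 0")
    case False
    then obtain y where y: "y \<in> X" "\<forall>k\<in>free \<sigma>. y k = x k" using chart_lift[OF \<sigma>] by blast
    have m: "minor \<rho> y = minor \<rho> x" if "\<rho> \<in> minors" for \<rho>
      by (rule minor_cong[OF that]) (use y(2) Ib_free[OF \<sigma>] in auto)
    have "minor \<sigma> y ^ n * p y - p' y = 0" using I_vanish[OF p'(2) y(1)] .
    moreover have "p' y = p' x" by (rule polys_cong[OF p'(1)]) (use y(2) in auto)
    moreover have "p y * minor \<tau> x = 0" using van[OF y(1)] m \<sigma> \<tau>(1) False by simp
    ultimately show ?thesis by auto
  qed simp
  then have "(\<forall>x. p' x = 0) \<or> (\<forall>x. minor \<sigma> x * minor \<tau> x = 0)"
    by (intro polys_domain[OF p'K polyfuns.mult[OF minor_polys minor_polys]] \<sigma> \<tau>)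
  moreover have "\<not> (\<forall>x. minor \<sigma> x * minor \<tau> x = 0)"
    using polys_domain[OF minor_polys[OF \<sigma>] minor_polys[OF \<tau>(1)]] z' \<tau>(2) by blast
  ultimately have "\<forall>x. p' x = 0" by blast
  then show ?thesis using p'(2) by (intro exI[of _ n]) simp
qed

text \<open>Powers are included since elements are later known to lie in the ideal only up to powers of the minors.\<close>

lemma regular_pair:
  assumes r: "r \<ge> 1"
  shows "\<exists>\<zeta> :: nat \<Rightarrow> (nat \<Rightarrow> 'k) \<Rightarrow> complex. \<forall>m\<ge>1.
    nonzerodiv K (\<mu> ` {..<r}) (\<lambda>x. (\<Sum>\<sigma>\<in>minors. \<zeta> 0 \<sigma> * minor \<sigma> x) ^ m) \<and>
    nonzerodiv K (insert (\<lambda>x. (\<Sum>\<sigma>\<in>minors. \<zeta> 0 \<sigma> * minor \<sigma> x) ^ m) (\<mu> ` {..<r}))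
      (\<lambda>x. (\<Sum>\<sigma>\<in>minors. \<zeta> 1 \<sigma> * minor \<sigma> x) ^ m)"
proof -
  obtain l :: "nat \<Rightarrow> 'k \<Rightarrow> complex" and \<zeta> :: "nat \<Rightarrow> (nat \<Rightarrow> 'k) \<Rightarrow> complex" where l\<zeta>:
    "\<forall>x\<in>X. (\<forall>i<card K - r - 2. (\<Sum>k\<in>K. l i k * x k) = 0) \<longrightarrow>
      (\<forall>j<2. (\<Sum>\<sigma>\<in>minors. \<zeta> j \<sigma> * minor \<sigma> x) = 0) \<longrightarrow> (\<forall>k\<in>K. x k = 0)"
    using system_of_parameters[OF r] by (elim exE)
  define D where "D = card K - r"
  have D: "D \<ge> 2" "r + D = card K" using card_bound[OF r] by (auto simp: D_def cardK)
  define T where "T = (\<lambda>j x. \<Sum>\<sigma>\<in>minors. \<zeta> j \<sigma> * minor \<sigma> x)"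
  have T: "homog K r (T j)" for j unfolding T_def
    by (intro homog_sum homog_const_mult homog_IbK minor_homog)
  define J :: "(nat + nat) set" where "J = Inl ` {..<r} \<union> Inr ` {..<D}"
  have "card J = card (Inl ` {..<r} :: (nat + nat) set) + card (Inr ` {..<D} :: (nat + nat) set)"
    unfolding J_def by (rule card_Un_disjoint) auto
  then have J: "finite J" "card J = card K"
    using D(2) by (auto simp: J_def card_image)
  \<comment> \<open>The indices below D - 2 belong to linear forms, the last two to the combinations of minors.\<close>
  have reg: "regular_family K J (case_sum \<mu> (\<lambda>i. if i < D - 2 then (\<lambda>x. \<Sum>k\<in>K. l i k * x k) else (\<lambda>x. T (i - (D - 2)) x ^ m)))"
    if m: "m \<ge> 1" for m
  proof (rule regular_family_of_forms[OF finK J])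
    let ?h = "case_sum \<mu> (\<lambda>i. if i < D - 2 then (\<lambda>x. \<Sum>k\<in>K. l i k * x k) else (\<lambda>x. T (i - (D - 2)) x ^ m))"
    show "form K (?h j)" if j: "j \<in> J" for j
    proof (cases j)
      case (Inl e)
      then have "homog K 2 (?h j)" using j \<mu>_homog by (auto simp: J_def)
      then show ?thesis unfolding form_def by (intro exI[of _ 2]) simp
    next
      case (Inr i)
      show ?thesis
      proof (cases "i < D - 2")
        case True
        have "homog K 1 (\<lambda>x. \<Sum>k\<in>K. l i k * x k)" by (intro homog_sum homog_const_mult homog_coord)
        then show ?thesis using Inr True unfolding form_def by (intro exI[of _ 1]) simp
      next
        case False
        have "homog K (r * m) (\<lambda>x. T (i - (D - 2)) x ^ m)" by (rule homog_power[OF T])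
        then show ?thesis using Inr False r m unfolding form_def by (intro exI[of _ "r * m"]) simp
      qed
    qed
    show "x k = 0" if z: "\<forall>j\<in>J. ?h j x = 0" and k: "k \<in> K" for x k
    proof -
      have "x \<in> X" unfolding X_def
      proof (intro CollectI allI impI)
        fix e assume "e < r"
        then have "Inl e \<in> J" by (auto simp: J_def)
        from bspec[OF z this] show "\<mu> e x = 0" by simp
      qed
      moreover have "(\<Sum>k\<in>K. l i k * x k) = 0" if i: "i < card K - r - 2" for i
      proof -
        have "Inr i \<in> J" "i < D - 2" using i by (auto simp: J_def D_def)
        from bspec[OF z this(1)] this(2) show ?thesis by simp
      qed
      moreover have "(\<Sum>\<sigma>\<in>minors. \<zeta> j \<sigma> * minor \<sigma> x) = 0" if j: "j < 2" for j
      proof -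
        have "Inr (D - 2 + j) \<in> J" using j D(1) by (auto simp: J_def)
        from bspec[OF z this] have "T j x ^ m = 0" by simp
        then show ?thesis by (simp add: T_def)
      qed
      ultimately show ?thesis using l\<zeta> k by simp
    qed
  qed
  show ?thesis
  proof (intro exI[of _ \<zeta>] allI impI conjI)
    fix m :: nat assume m: "m \<ge> 1"
    let ?h = "case_sum \<mu> (\<lambda>i. if i < D - 2 then (\<lambda>x. \<Sum>k\<in>K. l i k * x k) else (\<lambda>x. T (i - (D - 2)) x ^ m))"
    have h: "?h ` Inl ` {..<r} = \<mu> ` {..<r}" "?h (Inr (D - 2)) = (\<lambda>x. T 0 x ^ m)" "?h (Inr (D - 1)) = (\<lambda>x. T 1 x ^ m)"
      using D(1) by (auto simp: image_image)
    have "nonzerodiv K (?h ` Inl ` {..<r}) (?h (Inr (D - 2)))"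
      using reg[OF m] D(1) unfolding regular_family_def by (elim allE[of _ "Inl ` {..<r}"]) (auto simp: J_def simp del: sum.case)
    then show "nonzerodiv K (\<mu> ` {..<r}) (\<lambda>x. (\<Sum>\<sigma>\<in>minors. \<zeta> 0 \<sigma> * minor \<sigma> x) ^ m)"
      unfolding h by (simp add: T_def)
    have "nonzerodiv K (?h ` insert (Inr (D - 2)) (Inl ` {..<r})) (?h (Inr (D - 1)))"
      using reg[OF m] D(1) unfolding regular_family_def
      by (elim allE[of _ "insert (Inr (D - 2)) (Inl ` {..<r})"]) (auto simp: J_def simp del: sum.case)
    then show "nonzerodiv K (insert (\<lambda>x. (\<Sum>\<sigma>\<in>minors. \<zeta> 0 \<sigma> * minor \<sigma> x) ^ m) (\<mu> ` {..<r}))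
        (\<lambda>x. (\<Sum>\<sigma>\<in>minors. \<zeta> 1 \<sigma> * minor \<sigma> x) ^ m)"
      unfolding image_insert h by (simp add: T_def)
  qed
qed

lemma one_notin_I: "(\<lambda>_. 1) \<notin> I"
  using I_vanish[OF _ zero_in_X, of "\<lambda>_. 1"] by auto

lemma idl_power_minors:
  assumes "p \<in> polys K" "\<And>\<sigma>. \<sigma> \<in> minors \<Longrightarrow> \<exists>n. (\<lambda>x. minor \<sigma> x ^ n * p x) \<in> idl K S"
  shows "\<exists>n. (\<lambda>x. (\<Sum>\<sigma>\<in>minors. c \<sigma> * minor \<sigma> x) ^ n * p x) \<in> idl K S"
  by (rule idl_power_sum[OF fin_minors minor_polys assms])

lemma combination_polys: "(\<lambda>x. \<Sum>\<sigma>\<in>minors. c \<sigma> * minor \<sigma> x) \<in> polys K"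
  by (intro polyfuns_sum polyfuns_scale minor_polys)

lemma nonzerodiv_mem:
  assumes "\<And>m. m \<ge> 1 \<Longrightarrow> nonzerodiv K S (\<lambda>x. t x ^ m)" "t \<in> polys K" "p \<in> polys K" "(\<lambda>x. t x ^ n * p x) \<in> idl K S"
  shows "p \<in> idl K S"
proof -
  have "(\<lambda>x. t x * (t x ^ n * p x)) \<in> idl K S" by (rule idl_mult[OF assms(4,2)])
  then have "(\<lambda>x. p x * t x ^ Suc n) \<in> idl K S" by (simp add: mult_ac)
  then show ?thesis using assms(1)[of "Suc n"] assms(3) by (simp add: nonzerodiv_def)
qed

text \<open>A product that vanishes on the chart of tau has a factor that vanishes there, since the chart has a polynomial ring up to
  denominators. This factor then vanishes on every chart, so it lies in the ideal up to powers of all minors, and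
  a generic combination of the minors is a nonzerodivisor.\<close>

lemma prime_ideal:
  assumes r: "r \<ge> 1" and p: "p \<in> polys K" and q: "q \<in> polys K" and pq: "\<And>x. x \<in> X \<Longrightarrow> p x * q x = 0"
  shows "p \<in> I \<or> q \<in> I"
proof -
  obtain \<zeta> :: "nat \<Rightarrow> (nat \<Rightarrow> 'k) \<Rightarrow> complex" where nz':
    "\<forall>m\<ge>1. nonzerodiv K (\<mu> ` {..<r}) (\<lambda>x. (\<Sum>\<sigma>\<in>minors. \<zeta> 0 \<sigma> * minor \<sigma> x) ^ m) \<and>
      nonzerodiv K (insert (\<lambda>x. (\<Sum>\<sigma>\<in>minors. \<zeta> 0 \<sigma> * minor \<sigma> x) ^ m) (\<mu> ` {..<r}))
        (\<lambda>x. (\<Sum>\<sigma>\<in>minors. \<zeta> 1 \<sigma> * minor \<sigma> x) ^ m)"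
    using regular_pair[OF r] by (elim exE)
  then have nz: "nonzerodiv K (\<mu> ` {..<r}) (\<lambda>x. (\<Sum>\<sigma>\<in>minors. \<zeta> 0 \<sigma> * minor \<sigma> x) ^ m)" if "m \<ge> 1" for m
    using that by blast
  have "\<exists>\<sigma>\<in>minors. \<exists>z. minor \<sigma> z \<noteq> 0"
  proof (rule ccontr)
    assume "\<not> ?thesis"
    then have "(\<lambda>x. (\<Sum>\<sigma>\<in>minors. \<zeta> 0 \<sigma> * minor \<sigma> x) ^ 1 * 1) = (\<lambda>_. 0)" by simp
    then have "(\<lambda>x. (\<Sum>\<sigma>\<in>minors. \<zeta> 0 \<sigma> * minor \<sigma> x) ^ 1 * (\<lambda>_. 1) x) \<in> idl K (\<mu> ` {..<r})" using idl.zero[of K "\<mu> ` {..<r}"] by simp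
    then have "(\<lambda>_. 1) \<in> idl K (\<mu> ` {..<r})" 
      by (intro nonzerodiv_mem[OF nz combination_polys polyfuns.const, where n = 1]) simp_all
    then show False using one_notin_I by (simp add: I_def)
  qed
  then obtain \<tau> z where \<tau>: "\<tau> \<in> minors" "minor \<tau> z \<noteq> 0" by blast
  have inj: "inj_on \<tau> {..<r}" by (rule minor_nonzero_inj[OF \<tau>])
  have *: "p \<in> I" if p: "p \<in> polys K" and van: "\<And>x. x \<in> X \<Longrightarrow> p x * minor \<tau> x = 0" for p
  proof -
    have "\<exists>n. (\<lambda>x. minor \<sigma> x ^ n * p x) \<in> idl K (\<mu> ` {..<r})" if "\<sigma> \<in> minors" for \<sigma>
      using chart_zero[OF that p \<tau>] van by (simp add: I_def)
    from idl_power_minors[OF p this] obtain n where "(\<lambda>x. (\<Sum>\<sigma>\<in>minors. \<zeta> 0 \<sigma> * minor \<sigma> x) ^ n * p x) \<in> idl K (\<mu> ` {..<r})" by blast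
    then show "p \<in> I" unfolding I_def
      by (intro nonzerodiv_mem[of "\<mu> ` {..<r}" "\<lambda>x. \<Sum>\<sigma>\<in>minors. \<zeta> 0 \<sigma> * minor \<sigma> x" p n] nz combination_polys p)
  qed
  obtain n p' where p': "p' \<in> polys (free \<tau>)" "(\<lambda>x. minor \<tau> x ^ n * p x - p' x) \<in> I" using chart_reduction[OF \<tau>(1) inj p] by blast
  obtain m q' where q': "q' \<in> polys (free \<tau>)" "(\<lambda>x. minor \<tau> x ^ m * q x - q' x) \<in> I" using chart_reduction[OF \<tau>(1) inj q] by blast
  have K': "p' \<in> polys K" "q' \<in> polys K" using p'(1) q'(1) polys_mono[OF _ free_subset] by blast+
  have "p' x * (q' x * minor \<tau> x) = 0" for x
  proof (cases "minor \<tau> x = 0")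
    case False
    then obtain y where y: "y \<in> X" "\<forall>k\<in>free \<tau>. y k = x k" using chart_lift[OF \<tau>(1)] by blast
    have "p' x = p' y" "q' x = q' y" using y(2) by (auto intro: polys_cong[OF p'(1)] polys_cong[OF q'(1)])
    moreover have "p' y = minor \<tau> y ^ n * p y" "q' y = minor \<tau> y ^ m * q y"
      using I_vanish[OF p'(2) y(1)] I_vanish[OF q'(2) y(1)] by auto
    ultimately show ?thesis using pq[OF y(1)] by auto
  qed simp
  then have "(\<forall>x. p' x = 0) \<or> (\<forall>x. q' x * minor \<tau> x = 0)"
    by (intro polys_domain[OF K'(1) polyfuns.mult[OF K'(2) minor_polys[OF \<tau>(1)]]])
  moreover have "(\<forall>x. q' x = 0)" if "\<forall>x. q' x * minor \<tau> x = 0"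
    using polys_domain[OF K'(2) minor_polys[OF \<tau>(1)]] that \<tau>(2) by blast
  ultimately consider "\<forall>x. p' x = 0" | "\<forall>x. q' x = 0" by blast
  then show ?thesis
  proof cases
    case 1
    have "p x * minor \<tau> x = 0" if "x \<in> X" for x using I_vanish[OF p'(2) that] 1 by auto
    then show ?thesis using *[OF p] by blast
  next
    case 2
    have "q x * minor \<tau> x = 0" if "x \<in> X" for x using I_vanish[OF q'(2) that] 2 by auto
    then show ?thesis using *[OF q] by blast
  qed
qed

text \<open>On a chart the coordinate ring is a localized polynomial ring, where integral fractions are regular.\<close>

lemma chart_integral:
  assumes r: "r \<ge> 1" and \<sigma>: "\<sigma> \<in> minors" and a: "a \<in> polys K" and b: "b \<in> polys K" and c: "\<And>i. i < m \<Longrightarrow> c i \<in> polys K"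
    and eq: "\<And>x. x \<in> X \<Longrightarrow> a x ^ m + (\<Sum>i<m. c i x * a x ^ i * b x ^ (m - i)) = 0" and bI: "b \<notin> I"
  shows "\<exists>n. (\<lambda>x. minor \<sigma> x ^ n * a x) \<in> idl K (insert b (\<mu> ` {..<r}))"
proof (cases "\<forall>x. minor \<sigma> x = 0")
  case True
  then show ?thesis by (intro exI[of _ 1]) (simp add: idl.zero)
next
  case False
  then obtain z where z: "minor \<sigma> z \<noteq> 0" by blast
  have inj: "inj_on \<sigma> {..<r}" by (rule minor_nonzero_inj[OF \<sigma> z])
  let ?t = "minor \<sigma>"
  have tK: "?t \<in> polys K" by (rule minor_polys[OF \<sigma>])
  have tf: "?t \<in> polys (free \<sigma>)" by (rule minor_free[OF \<sigma>])
  have fK: "q \<in> polys K" if "q \<in> polys (free \<sigma>)" for q by (rule polys_mono[OF that free_subset])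
  have m: "m \<ge> 1"
  proof (rule ccontr)
    assume "\<not> m \<ge> 1"
    then have "m = 0" by simp
    then show False using eq[OF zero_in_X] by simp
  qed
  define g where "g = (\<lambda>i. if i < m then c i else if i = m then a else b)"
  have g: "g i \<in> polys K" for i using a b c by (simp add: g_def)
  have "\<forall>i. \<exists>n. \<exists>p'\<in>polys (free \<sigma>). (\<lambda>x. ?t x ^ n * g i x - p' x) \<in> I"
    using chart_reduction[OF \<sigma> inj g] by blast
  from choice[OF this] obtain n where "\<forall>i. \<exists>p'\<in>polys (free \<sigma>). (\<lambda>x. ?t x ^ n i * g i x - p' x) \<in> I" by blast
  then have "\<forall>i. \<exists>p'. p' \<in> polys (free \<sigma>) \<and> (\<lambda>x. ?t x ^ n i * g i x - p' x) \<in> I" by blast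
  from choice[OF this] obtain g' where g': "\<And>i. g' i \<in> polys (free \<sigma>)" "\<And>i. (\<lambda>x. ?t x ^ n i * g i x - g' i x) \<in> I" by blast
  define N where "N = (\<Sum>i\<le>Suc m. n i)"
  have nN: "n i \<le> N" if "i \<le> Suc m" for i unfolding N_def using that by (intro member_le_sum) auto
  define G where "G = (\<lambda>i x. ?t x ^ (N - n i) * g' i x)"
  have Gf: "G i \<in> polys (free \<sigma>)" for i unfolding G_def by (intro polyfuns.mult polyfuns_power tf g')
  have GI: "(\<lambda>x. ?t x ^ N * g i x - G i x) \<in> I" if i: "i \<le> Suc m" for i
  proof -
    have "(\<lambda>x. ?t x ^ (N - n i) * (?t x ^ n i * g i x - g' i x)) \<in> I"
      using g'(2) unfolding I_def by (intro idl_mult polyfuns_power tK)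
    moreover have "?t x ^ (N - n i) * (?t x ^ n i * g i x - g' i x) = ?t x ^ N * g i x - G i x" for x
      using power_add[of "?t x" "N - n i" "n i"] nN[OF i] by (simp add: G_def algebra_simps)
    ultimately show ?thesis by simp
  qed
  have GK: "G i \<in> polys K" for i by (rule fK[OF Gf])
  define A B where "A = G m" and "B = G (Suc m)"
  have ga: "g m = a" "g (Suc m) = b" by (auto simp: g_def)
  have "(?t x ^ N * A x ^ m + (\<Sum>i<m. G i x * A x ^ i * B x ^ (m - i))) * ?t x = 0" for x
  proof (cases "?t x = 0")
    case False
    then obtain y where y: "y \<in> X" "\<forall>k\<in>free \<sigma>. y k = x k" using chart_lift[OF \<sigma>] by blast
    have ty: "?t y = ?t x" by (rule polys_cong[OF tf]) (use y(2) in auto)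
    have Gy: "G i x = ?t x ^ N * g i y" if "i \<le> Suc m" for i
    proof -
      have "G i x = G i y" by (rule polys_cong[OF Gf]) (use y(2) in auto)
      then show ?thesis using I_vanish[OF GI[OF that] y(1)] ty by simp
    qed
    have "?t x ^ N * A x ^ m + (\<Sum>i<m. G i x * A x ^ i * B x ^ (m - i)) =
      ?t x ^ (N * Suc m) * (a y ^ m + (\<Sum>i<m. c i y * a y ^ i * b y ^ (m - i)))"
    proof -
      have "G i x * A x ^ i * B x ^ (m - i) = ?t x ^ (N * Suc m) * (c i y * a y ^ i * b y ^ (m - i))" if "i < m" for i
      proof -
        have u: "(?t x ^ N) ^ i * (?t x ^ N) ^ (m - i) = (?t x ^ N) ^ m" using that by (simp add: power_add[symmetric])
        have "G i x * A x ^ i * B x ^ (m - i) = (?t x ^ N * ((?t x ^ N) ^ i * (?t x ^ N) ^ (m - i))) * (c i y * a y ^ i * b y ^ (m - i))"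
          using that by (simp add: A_def B_def Gy ga power_mult_distrib g_def mult_ac)
        then show ?thesis unfolding u by (simp add: power_mult power_add)
      qed
      moreover have "?t x ^ N * A x ^ m = ?t x ^ (N * Suc m) * a y ^ m"
        by (simp add: A_def Gy ga power_mult_distrib power_mult[symmetric] power_add)
      ultimately show ?thesis by (simp add: sum_distrib_left algebra_simps)
    qed
    then show ?thesis using eq[OF y(1)] by simp
  qed simp
  then have "(\<forall>x. ?t x ^ N * A x ^ m + (\<Sum>i<m. G i x * A x ^ i * B x ^ (m - i)) = 0) \<or> (\<forall>x. ?t x = 0)"
    by (intro polys_domain polyfuns.add polyfuns_sum polyfuns.mult polyfuns_power tK) (auto simp: A_def B_def intro: GK tK)
  then have eqf: "?t x ^ N * A x ^ m + (\<Sum>i<m. G i x * A x ^ i * B x ^ (m - i)) = 0" for x using z by blast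
  \<comment> \<open>Multiplication by t^N makes the equation of A over B monic.\<close>
  define \<alpha> where "\<alpha> = (\<lambda>x. ?t x ^ N * A x)"
  have "\<exists>q\<in>polys (free \<sigma>). \<forall>x. \<alpha> x = B x * q x"
  proof (rule polys_integrally_closed)
    show "\<alpha> \<in> polys (free \<sigma>)" "B \<in> polys (free \<sigma>)" unfolding \<alpha>_def A_def B_def by (intro polyfuns.mult polyfuns_power tf Gf)+
    show "(\<lambda>x. G i x * (?t x ^ N) ^ (m - 1 - i)) \<in> polys (free \<sigma>)" for i by (intro polyfuns.mult polyfuns_power tf Gf)
    show "\<alpha> x ^ m + (\<Sum>i<m. G i x * (?t x ^ N) ^ (m - 1 - i) * \<alpha> x ^ i * B x ^ (m - i)) = 0" for x
    proof -
      have s: "G i x * (?t x ^ N) ^ (m - 1 - i) * \<alpha> x ^ i * B x ^ (m - i) = (?t x ^ N) ^ (m - 1) * (G i x * A x ^ i * B x ^ (m - i))"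
        if "i < m" for i
      proof -
        have "(?t x ^ N) ^ (m - 1) = (?t x ^ N) ^ (m - 1 - i) * (?t x ^ N) ^ i" using that by (simp add: power_add[symmetric])
        then show ?thesis by (simp add: \<alpha>_def power_mult_distrib mult_ac)
      qed
      have l: "\<alpha> x ^ m = (?t x ^ N) ^ (m - 1) * (?t x ^ N * A x ^ m)"
      proof -
        have "(?t x ^ N) ^ m = (?t x ^ N) ^ (m - 1) * ?t x ^ N" by (rule power_minus_mult[symmetric]) (use m in simp)
        then show ?thesis by (simp add: \<alpha>_def power_mult_distrib mult.assoc)
      qed
      have "(\<Sum>i<m. G i x * (?t x ^ N) ^ (m - 1 - i) * \<alpha> x ^ i * B x ^ (m - i)) =
        (\<Sum>i<m. (?t x ^ N) ^ (m - 1) * (G i x * A x ^ i * B x ^ (m - i)))"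
        by (rule sum.cong[OF refl], rule s) simp
      then have "\<alpha> x ^ m + (\<Sum>i<m. G i x * (?t x ^ N) ^ (m - 1 - i) * \<alpha> x ^ i * B x ^ (m - i)) =
        (?t x ^ N) ^ (m - 1) * (?t x ^ N * A x ^ m + (\<Sum>i<m. G i x * A x ^ i * B x ^ (m - i)))"
        unfolding l by (simp only: sum_distrib_left distrib_left)
      then show ?thesis using eqf by simp
    qed
    have "\<exists>x. B x \<noteq> 0"
    proof (rule ccontr)
      assume "\<not> ?thesis"
      then have "?t x ^ N * b x = 0" if "x \<in> X" for x using I_vanish[OF GI[of "Suc m"] that] by (simp add: B_def ga)
      then have "(\<lambda>x. ?t x ^ N) \<in> I \<or> b \<in> I" by (intro prime_ideal[OF r _ b] polyfuns_power tK)
      moreover obtain y where y: "y \<in> X" "\<forall>k\<in>free \<sigma>. y k = z k" using chart_lift[OF \<sigma> z] by blast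
      have "?t y = ?t z" by (rule polys_cong[OF tf]) (use y(2) in auto)
      then have "(\<lambda>x. ?t x ^ N) \<notin> I" using I_vanish[OF _ y(1)] z by fastforce
      ultimately show False using bI by blast
    qed
    then show "B (SOME x. B x \<noteq> 0) \<noteq> 0" by (rule someI_ex)
  qed
  then obtain q where q: "q \<in> polys (free \<sigma>)" "\<And>x. ?t x ^ N * A x = B x * q x" by (auto simp: \<alpha>_def)
  have "(\<lambda>x. ?t x ^ N * (?t x ^ N * a x - A x) - q x * (?t x ^ N * b x - B x)) \<in> I"
  proof -
    have "(\<lambda>x. ?t x ^ N * a x - A x) \<in> idl K (\<mu> ` {..<r})" "(\<lambda>x. ?t x ^ N * b x - B x) \<in> idl K (\<mu> ` {..<r})"
      using GI[of m] GI[of "Suc m"] by (simp_all add: I_def ga A_def B_def)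
    from idl_diff[OF idl_mult[OF this(1) polyfuns_power[OF tK, of N]] idl_mult[OF this(2) fK[OF q(1)]]]
    show ?thesis by (simp add: I_def)
  qed
  moreover have "?t x ^ N * (?t x ^ N * a x - A x) - q x * (?t x ^ N * b x - B x) = ?t x ^ (N + N) * a x - (?t x ^ N * q x) * b x" for x
    using q(2)[of x] by (simp add: algebra_simps power_add)
  ultimately have 1: "(\<lambda>x. ?t x ^ (N + N) * a x - (?t x ^ N * q x) * b x) \<in> idl K (\<mu> ` {..<r})" by (simp add: I_def)
  have "(\<lambda>x. (?t x ^ N * q x) * b x + (?t x ^ (N + N) * a x - (?t x ^ N * q x) * b x)) \<in> idl K (insert b (\<mu> ` {..<r}))"
    by (rule idl_insertI[OF _ 1]) (intro polyfuns.mult polyfuns_power tK fK q)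
  then show ?thesis by (intro exI[of _ "N + N"]) simp
qed

theorem domain_on_X:
  assumes p: "p \<in> polys K" and q: "q \<in> polys K" and pq: "\<And>x. x \<in> X \<Longrightarrow> p x * q x = 0"
  shows "(\<forall>x\<in>X. p x = 0) \<or> (\<forall>x\<in>X. q x = 0)"
proof (cases "r \<ge> 1")
  case True
  from prime_ideal[OF True p q pq] show ?thesis using I_vanish by blast
next
  case False
  then have "X = UNIV" by (auto simp: X_def)
  then show ?thesis using polys_domain[OF p q] pq by blast
qed

text \<open>On charts a is a multiple of b, so t0^M a = u b and t1^M a = v b for the regular pair t0, t1. Then
  u t1^M = v t0^M on X, regularity gives u = w t0^M, and finally a = w b.\<close>

theorem integrally_closed_on_X:
  assumes a: "a \<in> polys K" and b: "b \<in> polys K" and c: "\<And>i. i < m \<Longrightarrow> c i \<in> polys K"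
    and eq: "\<And>x. x \<in> X \<Longrightarrow> a x ^ m + (\<Sum>i<m. c i x * a x ^ i * b x ^ (m - i)) = 0" and x0: "x0 \<in> X" "b x0 \<noteq> 0"
  shows "\<exists>q\<in>polys K. \<forall>x\<in>X. a x = b x * q x"
proof (cases "r \<ge> 1")
  case False
  then have X: "X = UNIV" by (auto simp: X_def)
  have "\<exists>q\<in>polys K. \<forall>x. a x = b x * q x"
    by (rule polys_integrally_closed[OF a b c _ x0(2)]) (use eq X in auto)
  then show ?thesis by blast
next
  case True
  let ?S = "\<mu> ` {..<r}"
  have bI: "b \<notin> I" using I_vanish[OF _ x0(1)] x0(2) by blast
  obtain \<zeta> :: "nat \<Rightarrow> (nat \<Rightarrow> 'k) \<Rightarrow> complex" where nz':
    "\<forall>m\<ge>1. nonzerodiv K (\<mu> ` {..<r}) (\<lambda>x. (\<Sum>\<sigma>\<in>minors. \<zeta> 0 \<sigma> * minor \<sigma> x) ^ m) \<and>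
      nonzerodiv K (insert (\<lambda>x. (\<Sum>\<sigma>\<in>minors. \<zeta> 0 \<sigma> * minor \<sigma> x) ^ m) (\<mu> ` {..<r}))
        (\<lambda>x. (\<Sum>\<sigma>\<in>minors. \<zeta> 1 \<sigma> * minor \<sigma> x) ^ m)"
    using regular_pair[OF True] by (elim exE)
  then have nz: "nonzerodiv K ?S (\<lambda>x. (\<Sum>\<sigma>\<in>minors. \<zeta> 0 \<sigma> * minor \<sigma> x) ^ m)"
    "nonzerodiv K (insert (\<lambda>x. (\<Sum>\<sigma>\<in>minors. \<zeta> 0 \<sigma> * minor \<sigma> x) ^ m) ?S)
        (\<lambda>x. (\<Sum>\<sigma>\<in>minors. \<zeta> 1 \<sigma> * minor \<sigma> x) ^ m)" if "m \<ge> 1" for m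
    using that by blast+
  define t where "t = (\<lambda>j x. \<Sum>\<sigma>\<in>minors. \<zeta> j \<sigma> * minor \<sigma> x)"
  have tK: "t j \<in> polys K" for j unfolding t_def by (rule combination_polys)
  have "\<forall>j. \<exists>n. (\<lambda>x. t j x ^ n * a x) \<in> idl K (insert b ?S)" unfolding t_def
    by (rule allI, rule idl_power_minors[OF a]) (rule chart_integral[OF True _ a b c eq bI])
  from choice[OF this] obtain n where "\<forall>j. (\<lambda>x. t j x ^ n j * a x) \<in> idl K (insert b ?S)" by (elim exE)
  then have n: "(\<lambda>x. t j x ^ n j * a x) \<in> idl K (insert b ?S)" for j by (rule spec)
  define M where "M = n 0 + n 1 + 1"
  have "\<exists>u\<in>polys K. \<forall>x\<in>X. t j x ^ M * a x = u x * b x" if "j < 2" for j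
  proof -
    have "n j \<le> M" using that by (auto simp: M_def less_2_cases_iff)
    then have "(\<lambda>x. t j x ^ (M - n j) * (t j x ^ n j * a x)) = (\<lambda>x. t j x ^ M * a x)"
      by (simp add: mult.assoc[symmetric] power_add[symmetric])
    moreover have "(\<lambda>x. t j x ^ (M - n j) * (t j x ^ n j * a x)) \<in> idl K (insert b ?S)"
      by (intro idl_mult n polyfuns_power tK)
    ultimately have "(\<lambda>x. t j x ^ M * a x) \<in> idl K (insert b ?S)" by simp
    then obtain u g where u: "u \<in> polys K" "g \<in> idl K ?S" "(\<lambda>x. t j x ^ M * a x) = (\<lambda>x. u x * b x + g x)" using idl_insert by blast
    have "t j x ^ M * a x = u x * b x" if "x \<in> X" for x
      using fun_cong[OF u(3), of x] I_vanish[OF _ that, of g] u(2) by (simp add: I_def)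
    then show ?thesis using u(1) by blast
  qed
  from this[of 0] this[of 1] obtain u v where u: "u \<in> polys K" "\<forall>x\<in>X. t 0 x ^ M * a x = u x * b x"
    and v: "v \<in> polys K" "\<forall>x\<in>X. t 1 x ^ M * a x = v x * b x" by auto
  have "(u x * t 1 x ^ M - v x * t 0 x ^ M) * b x = 0" if "x \<in> X" for x
  proof -
    have "(u x * t 1 x ^ M - v x * t 0 x ^ M) * b x = t 1 x ^ M * (u x * b x) - t 0 x ^ M * (v x * b x)" by (simp add: algebra_simps)
    also have "\<dots> = t 1 x ^ M * (t 0 x ^ M * a x) - t 0 x ^ M * (t 1 x ^ M * a x)" using u(2) v(2) that by simp
    finally show ?thesis by simp
  qed
  then have "(\<lambda>x. u x * t 1 x ^ M - v x * t 0 x ^ M) \<in> I \<or> b \<in> I"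
    by (intro prime_ideal[OF True _ b] polyfuns_diff polyfuns.mult polyfuns_power tK u v)
  then have "(\<lambda>x. u x * t 1 x ^ M - v x * t 0 x ^ M) \<in> idl K ?S" using bI by (simp add: I_def)
  from idl_insertI[OF v(1) this, of "\<lambda>x. t 0 x ^ M"] have "(\<lambda>x. u x * t 1 x ^ M) \<in> idl K (insert (\<lambda>x. t 0 x ^ M) ?S)" by simp
  moreover have "nonzerodiv K (insert (\<lambda>x. t 0 x ^ M) ?S) (\<lambda>x. t 1 x ^ M)" unfolding t_def by (rule nz(2)) (simp add: M_def)
  ultimately have "u \<in> idl K (insert (\<lambda>x. t 0 x ^ M) ?S)" using u(1) by (simp add: nonzerodiv_def)
  then obtain w g where w: "w \<in> polys K" "g \<in> idl K ?S" "u = (\<lambda>x. w x * t 0 x ^ M + g x)" using idl_insert by blast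
  have "t 0 x ^ M * (a x - b x * w x) = 0" if "x \<in> X" for x
  proof -
    have "u x = w x * t 0 x ^ M" using fun_cong[OF w(3), of x] I_vanish[OF _ that, of g] w(2) by (simp add: I_def)
    then show ?thesis using u(2) that by (simp add: algebra_simps)
  qed
  then have "(\<lambda>x. t 0 x ^ M) \<in> I \<or> (\<lambda>x. a x - b x * w x) \<in> I"
    by (intro prime_ideal[OF True] polyfuns_power tK polyfuns_diff polyfuns.mult a b w)
  moreover have "(\<lambda>x. t 0 x ^ M) \<notin> I"
  proof
    assume "(\<lambda>x. t 0 x ^ M) \<in> I"
    then have "(\<lambda>x. (\<lambda>_. 1) x * t 0 x ^ M) \<in> idl K ?S" by (simp add: I_def)
    moreover have "nonzerodiv K ?S (\<lambda>x. t 0 x ^ M)" unfolding t_def by (rule nz(1)) (simp add: M_def)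
    ultimately have "(\<lambda>_. 1) \<in> idl K ?S" using polyfuns.const[of 1 "crd K"] by (simp add: nonzerodiv_def)
    then show False using one_notin_I by (simp add: I_def)
  qed
  ultimately have "(\<lambda>x. a x - b x * w x) \<in> I" by blast
  from I_vanish[OF this] have "\<forall>x\<in>X. a x = b x * w x" by simp
  then show ?thesis using w(1) by blast
qed

end

section \<open>Systems of linear equations along a set\<close>

definition polyon :: "'z set \<Rightarrow> ('z \<Rightarrow> complex) set \<Rightarrow> ('z \<Rightarrow> complex) \<Rightarrow> bool" where
  "polyon Z F f \<longleftrightarrow> (\<exists>p\<in>polyfuns F. \<forall>z\<in>Z. f z = p z)"

lemma polyon_coord: "f \<in> F \<Longrightarrow> polyon Z F f"
  unfolding polyon_def by (rule bexI[where x = f]) (auto intro: polyfuns.coord)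

lemma polyon_const: "polyon Z F (\<lambda>_. c)"
  unfolding polyon_def by (rule bexI[where x = "\<lambda>_. c"]) (auto intro: polyfuns.const)

lemma polyon_add: assumes "polyon Z F f" "polyon Z F g" shows "polyon Z F (\<lambda>z. f z + g z)"
proof -
  obtain p q where "p \<in> polyfuns F" "\<forall>z\<in>Z. f z = p z" "q \<in> polyfuns F" "\<forall>z\<in>Z. g z = q z"
    using assms unfolding polyon_def by auto
  then show ?thesis unfolding polyon_def by (intro bexI[where x = "\<lambda>z. p z + q z"] polyfuns.add) auto
qed

lemma polyon_mult: assumes "polyon Z F f" "polyon Z F g" shows "polyon Z F (\<lambda>z. f z * g z)"
proof -
  obtain p q where "p \<in> polyfuns F" "\<forall>z\<in>Z. f z = p z" "q \<in> polyfuns F" "\<forall>z\<in>Z. g z = q z"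
    using assms unfolding polyon_def by auto
  then show ?thesis unfolding polyon_def by (intro bexI[where x = "\<lambda>z. p z * q z"] polyfuns.mult) auto
qed

lemma polyon_sum: "(\<And>i. i \<in> I \<Longrightarrow> polyon Z F (f i)) \<Longrightarrow> polyon Z F (\<lambda>z. \<Sum>i\<in>I. f i z)"
proof (induction I rule: infinite_finite_induct)
  case (insert x I)
  then show ?case using polyon_add[of Z F "f x" "\<lambda>z. \<Sum>i\<in>I. f i z"] by simp
qed (auto intro: polyon_const)

lemma polyon_diff: "polyon Z F f \<Longrightarrow> polyon Z F g \<Longrightarrow> polyon Z F (\<lambda>z. f z - g z)"
  using polyon_add[OF _ polyon_mult[OF polyon_const[of Z F "-1"]], of f g] by simp

lemma polyon_cong: "polyon Z F g \<Longrightarrow> (\<And>z. z \<in> Z \<Longrightarrow> f z = g z) \<Longrightarrow> polyon Z F f"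
  unfolding polyon_def by simp

lemma polyon_mono: "polyon Z F f \<Longrightarrow> F \<subseteq> F' \<Longrightarrow> polyon Z F' f"
  unfolding polyon_def using polyfuns_mono by blast

lemma growth_polyon:
  assumes "growth Z F s" "finite F'" "\<And>f. f \<in> F' \<Longrightarrow> polyon Z F f"
  shows "growth Z (F \<union> F') s"
proof -
  have "growth Z (F \<union> (\<lambda>f. f) ` F') s"
    by (rule growth_poly_functions[OF assms(1,2)]) (use assms(3) polyon_def in blast)
  then show ?thesis by simp
qed

text \<open>Block systems: a block without equations adjoins free functions.\<close>

lemma growth_linear_systems:
  assumes "growth Z F s" "finite J" "\<And>j. j \<in> J \<Longrightarrow> finite (K j)" "\<And>j. j \<in> J \<Longrightarrow> finite (E j)"
    and A: "\<And>j e k. j \<in> J \<Longrightarrow> e \<in> E j \<Longrightarrow> k \<in> K j \<Longrightarrow> polyon Z F (A j e k)"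
    and C: "\<And>j e. j \<in> J \<Longrightarrow> e \<in> E j \<Longrightarrow> polyon Z F (C j e)"
    and eq: "\<And>z j e. z \<in> Z \<Longrightarrow> j \<in> J \<Longrightarrow> e \<in> E j \<Longrightarrow> (\<Sum>k\<in>K j. A j e k z * y j k z) = C j e z"
    and ind: "\<And>z j \<xi>. z \<in> Z \<Longrightarrow> j \<in> J \<Longrightarrow> (\<forall>k\<in>K j. (\<Sum>e\<in>E j. \<xi> e * A j e k z) = 0) \<Longrightarrow> (\<forall>e\<in>E j. \<xi> e = 0)"
  shows "growth Z (F \<union> (\<Union>j\<in>J. y j ` K j)) (s + (\<Sum>j\<in>J. int (card (K j)) - int (card (E j))))"
  using assms(2-)
proof (induction J rule: finite_induct)
  case empty
  then show ?case using assms(1) by simp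
next
  case (insert j J)
  let ?G = "F \<union> (\<Union>j\<in>J. y j ` K j)"
  have IH: "growth Z ?G (s + (\<Sum>j\<in>J. int (card (K j)) - int (card (E j))))"
    by (rule insert.IH) (rule insert.prems; (assumption | rule insertI2)+)+
  have "\<forall>e k. \<exists>p. e \<in> E j \<longrightarrow> k \<in> K j \<longrightarrow> p \<in> polyfuns ?G \<and> (\<forall>z\<in>Z. A j e k z = p z)"
    using insert.prems(3)[of j] polyon_mono[of Z F _ ?G] unfolding polyon_def by blast
  then obtain A' where A': "e \<in> E j \<Longrightarrow> k \<in> K j \<Longrightarrow> A' e k \<in> polyfuns ?G \<and> (\<forall>z\<in>Z. A j e k z = A' e k z)" for e k
    by (metis (no_types))
  have "\<forall>e. \<exists>p. e \<in> E j \<longrightarrow> p \<in> polyfuns ?G \<and> (\<forall>z\<in>Z. C j e z = p z)"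
    using insert.prems(4)[of j] polyon_mono[of Z F _ ?G] unfolding polyon_def by blast
  then obtain C' where C': "e \<in> E j \<Longrightarrow> C' e \<in> polyfuns ?G \<and> (\<forall>z\<in>Z. C j e z = C' e z)" for e
    by (metis (no_types))
  have "growth Z (?G \<union> y j ` K j) (s + (\<Sum>j\<in>J. int (card (K j)) - int (card (E j))) + int (card (K j)) - int (card (E j)))"
  proof (rule growth_linear_system[OF IH, of _ _ A' C'])
    show "finite (K j)" "finite (E j)" using insert.prems(1,2) by auto
    show "A' e k \<in> polyfuns ?G" if "e \<in> E j" "k \<in> K j" for e k using A' that by blast
    show "C' e \<in> polyfuns ?G" if "e \<in> E j" for e using C' that by blast
    show "(\<Sum>k\<in>K j. A' e k z * y j k z) = C' e z" if z: "z \<in> Z" and e: "e \<in> E j" for z e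
    proof -
      have "(\<Sum>k\<in>K j. A' e k z * y j k z) = (\<Sum>k\<in>K j. A j e k z * y j k z)" by (rule sum.cong) (use A' e z in auto)
      then show ?thesis using insert.prems(5)[OF z _ e] C'[OF e] z by simp
    qed
    show "\<forall>e\<in>E j. \<xi> e = 0" if z: "z \<in> Z" and x: "\<forall>k\<in>K j. (\<Sum>e\<in>E j. \<xi> e * A' e k z) = 0" for z \<xi>
    proof (rule insert.prems(6)[OF z])
      have "(\<Sum>e\<in>E j. \<xi> e * A j e k z) = (\<Sum>e\<in>E j. \<xi> e * A' e k z)" if "k \<in> K j" for k by (rule sum.cong) (use A' that z in auto)
      then show "\<forall>k\<in>K j. (\<Sum>e\<in>E j. \<xi> e * A j e k z) = 0" using x by simp
    qed simp
  qed
  moreover have "?G \<union> y j ` K j = F \<union> (\<Union>j\<in>insert j J. y j ` K j)" by auto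
  ultimately show ?case using insert.hyps by (simp add: algebra_simps)
qed

section \<open>Matrices with arbitrary index sets\<close>

text \<open>Index sets are arbitrary finite sets, so that submatrices need no renumbering.\<close>

definition mm :: "'b set \<Rightarrow> ('a \<Rightarrow> 'b \<Rightarrow> complex) \<Rightarrow> ('b \<Rightarrow> 'c \<Rightarrow> complex) \<Rightarrow> 'a \<Rightarrow> 'c \<Rightarrow> complex" where
  "mm A f g = (\<lambda>p q. \<Sum>w\<in>A. f p w * g w q)"

lemma mm_assoc: "mm B (mm A f g) h = mm A f (mm B g h)"
proof (intro ext)
  fix p q
  have "mm B (mm A f g) h p q = (\<Sum>w\<in>B. \<Sum>u\<in>A. f p u * (g u w * h w q))" by (simp add: mm_def sum_distrib_right mult.assoc)
  also have "\<dots> = (\<Sum>u\<in>A. \<Sum>w\<in>B. f p u * (g u w * h w q))" by (rule sum.swap)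
  also have "\<dots> = mm A f (mm B g h) p q" by (simp add: mm_def sum_distrib_left)
  finally show "mm B (mm A f g) h p q = mm A f (mm B g h) p q" .
qed

lemma mm_cong: "(\<And>w. w \<in> A \<Longrightarrow> f p w = f' p' w) \<Longrightarrow> (\<And>w. w \<in> A \<Longrightarrow> g w q = g' w q') \<Longrightarrow> mm A f g p q = mm A f' g' p' q'"
  by (simp add: mm_def)

text \<open>A pair of endomorphisms together with an intertwiner x induces the same data on the images: if
  the rows I of each endomorphism span its row space, the image is parametrized by the columns of the matrix
  iota of coefficients.\<close>

lemma intertwiner_on_images:
  assumes comm: "\<And>p q. p \<in> Vt \<Longrightarrow> q \<in> Vs \<Longrightarrow> mm Vt \<eta>t x p q = mm Vs x \<eta>s p q"
    and \<iota>t: "\<And>p q. p \<in> Vt \<Longrightarrow> q \<in> Vt \<Longrightarrow> \<eta>t p q = mm It \<iota>t \<eta>t p q"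
    and \<iota>s: "\<And>p q. p \<in> Vs \<Longrightarrow> q \<in> Vs \<Longrightarrow> \<eta>s p q = mm Is \<iota>s \<eta>s p q"
    and ind: "\<And>\<xi>. (\<And>q. q \<in> Vs \<Longrightarrow> (\<Sum>r\<in>Is. \<xi> r * \<eta>s r q) = 0) \<Longrightarrow> \<forall>r\<in>Is. \<xi> r = 0"
    and I: "It \<subseteq> Vt" "Is \<subseteq> Vs"
  shows "\<And>p q. p \<in> Vt \<Longrightarrow> q \<in> Vs \<Longrightarrow> mm Vt \<eta>t x p q = mm Is (mm Vs x \<iota>s) \<eta>s p q"
    and "\<And>p w. p \<in> Vt \<Longrightarrow> w \<in> Is \<Longrightarrow> mm Vs x \<iota>s p w = mm It \<iota>t (mm Vs x \<iota>s) p w"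
    and "\<And>r w. r \<in> It \<Longrightarrow> w \<in> Is \<Longrightarrow> mm It (mm Vt \<eta>t \<iota>t) (mm Vs x \<iota>s) r w = mm Is (mm Vs x \<iota>s) (mm Vs \<eta>s \<iota>s) r w"
proof -
  show 1: "mm Vt \<eta>t x p q = mm Is (mm Vs x \<iota>s) \<eta>s p q" if "p \<in> Vt" "q \<in> Vs" for p q
  proof -
    have "mm Vt \<eta>t x p q = mm Vs x \<eta>s p q" using comm that .
    also have "\<dots> = mm Vs x (mm Is \<iota>s \<eta>s) p q" by (rule mm_cong) (use \<iota>s that in auto)
    finally show ?thesis by (simp only: mm_assoc)
  qed
  show 2: "mm Vs x \<iota>s p w = mm It \<iota>t (mm Vs x \<iota>s) p w" if p: "p \<in> Vt" and w: "w \<in> Is" for p w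
  proof -
    have "(\<Sum>r\<in>Is. (mm Vs x \<iota>s p r - mm It \<iota>t (mm Vs x \<iota>s) p r) * \<eta>s r q) = 0" if q: "q \<in> Vs" for q
    proof -
      have "mm Is (mm Vs x \<iota>s) \<eta>s p q = mm Vt \<eta>t x p q" using 1[OF p q] by simp
      also have "\<dots> = mm Vt (mm It \<iota>t \<eta>t) x p q" by (rule mm_cong) (use \<iota>t p in auto)
      also have "\<dots> = mm It \<iota>t (mm Vt \<eta>t x) p q" by (simp only: mm_assoc)
      also have "\<dots> = mm It \<iota>t (mm Is (mm Vs x \<iota>s) \<eta>s) p q" by (rule mm_cong) (use 1 q I in auto)
      also have "\<dots> = mm Is (mm It \<iota>t (mm Vs x \<iota>s)) \<eta>s p q" by (simp only: mm_assoc)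
      finally have "mm Is (mm Vs x \<iota>s) \<eta>s p q = mm Is (mm It \<iota>t (mm Vs x \<iota>s)) \<eta>s p q" .
      then show ?thesis by (simp add: mm_def[of Is] left_diff_distrib sum_subtractf)
    qed
    from ind[OF this] w show ?thesis by auto
  qed
  show "mm It (mm Vt \<eta>t \<iota>t) (mm Vs x \<iota>s) r w = mm Is (mm Vs x \<iota>s) (mm Vs \<eta>s \<iota>s) r w" if r: "r \<in> It" and w: "w \<in> Is" for r w
  proof -
    have r': "r \<in> Vt" using I r by auto
    have "mm It (mm Vt \<eta>t \<iota>t) (mm Vs x \<iota>s) r w = mm Vt \<eta>t (mm It \<iota>t (mm Vs x \<iota>s)) r w" by (simp only: mm_assoc)
    also have "\<dots> = mm Vt \<eta>t (mm Vs x \<iota>s) r w" by (rule mm_cong) (use 2 w in auto)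
    also have "\<dots> = mm Vs (mm Vt \<eta>t x) \<iota>s r w" by (simp only: mm_assoc)
    also have "\<dots> = mm Vs (mm Is (mm Vs x \<iota>s) \<eta>s) \<iota>s r w" by (rule mm_cong) (use 1 r' in auto)
    finally show ?thesis by (simp only: mm_assoc)
  qed
qed

section \<open>Commuting families over a quiver\<close>

locale quiver_shape =
  fixes N :: "nat set" and Om :: "'h set" and s t :: "'h \<Rightarrow> nat"
  assumes finN: "finite N" and finOm: "finite Om" and st: "h \<in> Om \<Longrightarrow> s h \<in> N" "h \<in> Om \<Longrightarrow> t h \<in> N"
begin

definition arrow_funs :: "(nat \<Rightarrow> nat set) \<Rightarrow> ('h \<Rightarrow> nat \<Rightarrow> nat \<Rightarrow> 'z) \<Rightarrow> 'z set" where
  "arrow_funs V x = {x h p q |h p q. h \<in> Om \<and> p \<in> V (t h) \<and> q \<in> V (s h)}"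

definition vertex_funs :: "(nat \<Rightarrow> nat set) \<Rightarrow> (nat \<Rightarrow> nat set) \<Rightarrow> (nat \<Rightarrow> nat \<Rightarrow> nat \<Rightarrow> 'z) \<Rightarrow> 'z set" where
  "vertex_funs D V y = {y i p q |i p q. i \<in> N \<and> p \<in> D i \<and> q \<in> V i}"

lemma arrow_funsI: "h \<in> Om \<Longrightarrow> p \<in> V (t h) \<Longrightarrow> q \<in> V (s h) \<Longrightarrow> x h p q \<in> arrow_funs V x"
  unfolding arrow_funs_def by (rule CollectI, rule exI[of _ h], rule exI[of _ p], rule exI[of _ q]) simp

lemma vertex_funsI: "i \<in> N \<Longrightarrow> p \<in> D i \<Longrightarrow> q \<in> V i \<Longrightarrow> y i p q \<in> vertex_funs D V y"
  unfolding vertex_funs_def by (rule CollectI, rule exI[of _ i], rule exI[of _ p], rule exI[of _ q]) simp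

lemma finite_arrow_funs: assumes "\<And>i. i \<in> N \<Longrightarrow> finite (V i)" shows "finite (arrow_funs V x)"
proof -
  have "arrow_funs V x \<subseteq> (\<lambda>(h, p, q). x h p q) ` (SIGMA h:Om. V (t h) \<times> V (s h))" by (auto simp: arrow_funs_def intro!: image_eqI[where x = "(h, p, q)" for h p q])
  moreover have "finite (SIGMA h:Om. V (t h) \<times> V (s h))" using finOm assms st by auto
  ultimately show ?thesis using finite_surj by blast
qed

lemma finite_vertex_funs: assumes "\<And>i. i \<in> N \<Longrightarrow> finite (V i)" "\<And>i. i \<in> N \<Longrightarrow> finite (D i)" shows "finite (vertex_funs D V y)"
proof -
  have "vertex_funs D V y \<subseteq> (\<lambda>(i, p, q). y i p q) ` (SIGMA i:N. D i \<times> V i)" by (auto simp: vertex_funs_def intro!: image_eqI[where x = "(i, p, q)" for i p q])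
  moreover have "finite (SIGMA i:N. D i \<times> V i)" using finN assms by auto
  ultimately show ?thesis using finite_surj by blast
qed

definition commuting :: "(nat \<Rightarrow> nat set) \<Rightarrow> (('h \<Rightarrow> nat \<Rightarrow> nat \<Rightarrow> complex) \<times> (nat \<Rightarrow> nat \<Rightarrow> nat \<Rightarrow> complex)) set" where
  "commuting V = {(x, \<xi>). \<forall>h\<in>Om. \<forall>p\<in>V (t h). \<forall>q\<in>V (s h). mm (V (t h)) (\<xi> (t h)) (x h) p q = mm (V (s h)) (x h) (\<xi> (s h)) p q}"

definition commuting_funs :: "(nat \<Rightarrow> nat set) \<Rightarrow> (('h \<Rightarrow> nat \<Rightarrow> nat \<Rightarrow> complex) \<times> (nat \<Rightarrow> nat \<Rightarrow> nat \<Rightarrow> complex) \<Rightarrow> complex) set" where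
  "commuting_funs V = arrow_funs V (\<lambda>h p q z. fst z h p q) \<union> vertex_funs V V (\<lambda>i p q z. snd z i p q)"

definition row_bases :: "(nat \<Rightarrow> nat set) \<Rightarrow> (nat \<Rightarrow> nat set) \<Rightarrow> (nat \<Rightarrow> nat \<Rightarrow> nat \<Rightarrow> complex) \<Rightarrow> bool" where
  "row_bases V I \<eta> \<longleftrightarrow> (\<forall>i\<in>N. (\<forall>\<xi>. (\<forall>q\<in>V i. (\<Sum>r\<in>I i. \<xi> r * \<eta> i r q) = 0) \<longrightarrow> (\<forall>r\<in>I i. \<xi> r = 0)) \<and>
     (\<forall>p\<in>V i. \<exists>\<zeta>. \<forall>q\<in>V i. \<eta> i p q = (\<Sum>r\<in>I i. \<zeta> r * \<eta> i r q)))"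

text \<open>Let pi be the rows I of eta, so that eta = iota pi. The data induced on the image, x' = x iota and eta' = pi iota
  restricted to I, range over commuting pairs on I; this contributes g. The entries of iota
  and pi outside I are free. The columns of x outside I solve the linear system pi x = x' pi, whose equations are independent; the
  columns in I follow from x iota = iota x'. Likewise delta iota = 0 determines the columns of delta in I.\<close>

lemma growth_stratum:
  fixes x :: "'z \<Rightarrow> 'h \<Rightarrow> nat \<Rightarrow> nat \<Rightarrow> complex" and \<eta> \<delta> :: "'z \<Rightarrow> nat \<Rightarrow> nat \<Rightarrow> nat \<Rightarrow> complex"
  assumes V: "\<And>i. i \<in> N \<Longrightarrow> finite (V i)" and D: "\<And>i. i \<in> N \<Longrightarrow> finite (D i)"
    and I: "\<And>i. i \<in> N \<Longrightarrow> I i \<subseteq> V i"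
    and comm: "\<And>z. z \<in> Z \<Longrightarrow> (x z, \<eta> z) \<in> commuting V"
    and ann: "\<And>z i a q. z \<in> Z \<Longrightarrow> i \<in> N \<Longrightarrow> a \<in> D i \<Longrightarrow> q \<in> V i \<Longrightarrow> mm (V i) (\<delta> z i) (\<eta> z i) a q = 0"
    and bases: "\<And>z. z \<in> Z \<Longrightarrow> row_bases V I (\<eta> z)"
    and base: "growth (commuting I) (commuting_funs I) g"
  shows "growth Z (arrow_funs V (\<lambda>h p q z. x z h p q) \<union> vertex_funs V V (\<lambda>i p q z. \<eta> z i p q) \<union>
    vertex_funs D V (\<lambda>i p q z. \<delta> z i p q))
    (g + (\<Sum>i\<in>N. 2 * int (card (I i)) * int (card (V i - I i))) +
     (\<Sum>h\<in>Om. int (card (V (t h) - I (t h))) * int (card (V (s h) - I (s h)))) +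
     (\<Sum>i\<in>N. int (card (D i)) * int (card (V i - I i))))"
proof -
  let ?s0 = "(\<Sum>i\<in>N. int (card (V i - I i)) * int (card (I i)))" and ?s1 = "(\<Sum>i\<in>N. 2 * int (card (I i)) * int (card (V i - I i)))"
    and ?s2 = "(\<Sum>h\<in>Om. int (card (V (t h) - I (t h))) * int (card (V (s h) - I (s h))))"
    and ?s3 = "(\<Sum>i\<in>N. int (card (D i)) * int (card (V i - I i)))"
  define \<iota> where "\<iota> = (\<lambda>z i p r. if p \<in> I i then if p = r then 1 else 0
    else (SOME \<zeta>. \<forall>q\<in>V i. \<eta> z i p q = (\<Sum>r\<in>I i. \<zeta> r * \<eta> z i r q)) r)"
  have If: "finite (I i)" if "i \<in> N" for i using I[OF that] V[OF that] by (rule finite_subset)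
  have ind: "\<forall>r\<in>I i. \<xi> r = 0" if "z \<in> Z" "i \<in> N" "\<And>q. q \<in> V i \<Longrightarrow> (\<Sum>r\<in>I i. \<xi> r * \<eta> z i r q) = 0" for z i \<xi>
    using bases[OF that(1)] that(2,3) unfolding row_bases_def by blast
  have \<iota>: "\<eta> z i p q = mm (I i) (\<iota> z i) (\<eta> z i) p q" if z: "z \<in> Z" and i: "i \<in> N" and p: "p \<in> V i" and q: "q \<in> V i" for z i p q
  proof (cases "p \<in> I i")
    case True
    have "mm (I i) (\<iota> z i) (\<eta> z i) p q = (\<Sum>r\<in>I i. if p = r then \<eta> z i r q else 0)"
      unfolding mm_def by (rule sum.cong) (use True in \<open>auto simp: \<iota>_def\<close>)
    then show ?thesis using True If[OF i] by simp
  next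
    case False
    have "\<exists>\<zeta>. \<forall>q\<in>V i. \<eta> z i p q = (\<Sum>r\<in>I i. \<zeta> r * \<eta> z i r q)" using bases[OF z] i p unfolding row_bases_def by blast
    from someI_ex[OF this] q False show ?thesis by (simp add: mm_def \<iota>_def)
  qed
  have split_sum: "mm (V i) f (\<iota> z i) p w = (\<Sum>u\<in>V i - I i. f p u * \<iota> z i u w) + f p w" if i: "i \<in> N" and w: "w \<in> I i" for f p z i w
  proof -
    have "mm (V i) f (\<iota> z i) p w = (\<Sum>u\<in>V i - I i. f p u * \<iota> z i u w) + (\<Sum>u\<in>I i. f p u * \<iota> z i u w)"
      unfolding mm_def by (rule sum.subset_diff[OF I[OF i] V[OF i]])
    moreover have "(\<Sum>u\<in>I i. f p u * \<iota> z i u w) = (\<Sum>u\<in>I i. if u = w then f p u else 0)" by (rule sum.cong) (auto simp: \<iota>_def)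
    ultimately show ?thesis using w If[OF i] by simp
  qed
  define x' where "x' = (\<lambda>z h. mm (V (s h)) (x z h) (\<iota> z (s h)))"
  define \<eta>' where "\<eta>' = (\<lambda>z i. mm (V i) (\<eta> z i) (\<iota> z i))"
  have imgs: "\<And>p q. p \<in> V (t h) \<Longrightarrow> q \<in> V (s h) \<Longrightarrow> mm (V (t h)) (\<eta> z (t h)) (x z h) p q = mm (I (s h)) (x' z h) (\<eta> z (s h)) p q"
    "\<And>p w. p \<in> V (t h) \<Longrightarrow> w \<in> I (s h) \<Longrightarrow> x' z h p w = mm (I (t h)) (\<iota> z (t h)) (x' z h) p w"
    "\<And>r w. r \<in> I (t h) \<Longrightarrow> w \<in> I (s h) \<Longrightarrow> mm (I (t h)) (\<eta>' z (t h)) (x' z h) r w = mm (I (s h)) (x' z h) (\<eta>' z (s h)) r w"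
    if z: "z \<in> Z" and h: "h \<in> Om" for z h
  proof -
    have c: "mm (V (t h)) (\<eta> z (t h)) (x z h) p q = mm (V (s h)) (x z h) (\<eta> z (s h)) p q" if "p \<in> V (t h)" "q \<in> V (s h)" for p q
      using comm[OF z] h that unfolding commuting_def by simp
    note im = intertwiner_on_images[of "V (t h)" "V (s h)" "\<eta> z (t h)" "x z h" "\<eta> z (s h)" "I (t h)" "\<iota> z (t h)" "I (s h)" "\<iota> z (s h)",
        OF c \<iota>[OF z st(2)[OF h]] \<iota>[OF z st(1)[OF h]] ind[OF z st(1)[OF h]] I[OF st(2)[OF h]] I[OF st(1)[OF h]]]
    show "mm (V (t h)) (\<eta> z (t h)) (x z h) p q = mm (I (s h)) (x' z h) (\<eta> z (s h)) p q" if "p \<in> V (t h)" "q \<in> V (s h)" for p q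
      unfolding x'_def by (rule im(1)) (use that in auto)
    show "x' z h p w = mm (I (t h)) (\<iota> z (t h)) (x' z h) p w" if "p \<in> V (t h)" "w \<in> I (s h)" for p w
      unfolding x'_def by (rule im(2)) (use that in auto)
    show "mm (I (t h)) (\<eta>' z (t h)) (x' z h) r w = mm (I (s h)) (x' z h) (\<eta>' z (s h)) r w" if "r \<in> I (t h)" "w \<in> I (s h)" for r w
      unfolding x'_def \<eta>'_def by (rule im(3)) (use that in auto)
  qed
  have \<delta>\<iota>: "mm (V i) (\<delta> z i) (\<iota> z i) a w = 0" if z: "z \<in> Z" and i: "i \<in> N" and a: "a \<in> D i" and w: "w \<in> I i" for z i a w
  proof -
    have "(\<Sum>r\<in>I i. mm (V i) (\<delta> z i) (\<iota> z i) a r * \<eta> z i r q) = 0" if q: "q \<in> V i" for q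
    proof -
      have "mm (I i) (mm (V i) (\<delta> z i) (\<iota> z i)) (\<eta> z i) a q = mm (V i) (\<delta> z i) (mm (I i) (\<iota> z i) (\<eta> z i)) a q" by (simp only: mm_assoc)
      also have "\<dots> = mm (V i) (\<delta> z i) (\<eta> z i) a q" by (rule mm_cong) (use \<iota>[OF z i] q in auto)
      finally show ?thesis using ann[OF z i a q] by (simp add: mm_def[of "I i"])
    qed
    from ind[OF z i this] w show ?thesis by blast
  qed
  define F0 where "F0 = arrow_funs I (\<lambda>h p q z. x' z h p q) \<union> vertex_funs I I (\<lambda>i p q z. \<eta>' z i p q)"
  have 0: "growth Z F0 g"
  proof (rule growth_pullback[OF base, of _ "\<lambda>z. (x' z, \<eta>' z)"])
    show "(x' z, \<eta>' z) \<in> commuting I" if "z \<in> Z" for z unfolding commuting_def using imgs(3)[OF that] by simp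
    show "\<exists>g\<in>commuting_funs I. \<forall>z\<in>Z. f z = g (x' z, \<eta>' z)" if "f \<in> F0" for f
    proof (cases "f \<in> arrow_funs I (\<lambda>h p q z. x' z h p q)")
      case True
      then obtain h p q where f: "f = (\<lambda>z. x' z h p q)" "h \<in> Om" "p \<in> I (t h)" "q \<in> I (s h)" unfolding arrow_funs_def by auto
      show ?thesis by (rule bexI[of _ "\<lambda>z. fst z h p q"]) (use f in \<open>auto simp: commuting_funs_def arrow_funs_def\<close>)
    next
      case False
      with that have "f \<in> vertex_funs I I (\<lambda>i p q z. \<eta>' z i p q)" by (simp add: F0_def)
      then obtain i p q where f: "f = (\<lambda>z. \<eta>' z i p q)" "i \<in> N" "p \<in> I i" "q \<in> I i" unfolding vertex_funs_def by auto
      show ?thesis by (rule bexI[of _ "\<lambda>z. snd z i p q"]) (use f in \<open>auto simp: commuting_funs_def vertex_funs_def\<close>)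
    qed
  qed
  define F1 where "F1 = F0 \<union> (\<Union>i\<in>N. (\<lambda>(p, w) z. \<iota> z i p w) ` ((V i - I i) \<times> I i))"
  have "growth Z F1 (g + (\<Sum>i\<in>N. int (card ((V i - I i) \<times> I i)) - int (card ({} :: nat set))))" unfolding F1_def
    by (rule growth_linear_systems[OF 0 finN]) (use V If in auto)
  then have 1: "growth Z F1 (g + ?s0)" by (simp add: card_cartesian_product)
  define F2 where "F2 = F1 \<union> (\<Union>i\<in>N. (\<lambda>(p, q) z. \<eta> z i p q) ` (I i \<times> (V i - I i)))"
  have "growth Z F2 (g + ?s0 +
      (\<Sum>i\<in>N. int (card (I i \<times> (V i - I i))) - int (card ({} :: nat set))))" unfolding F2_def
    by (rule growth_linear_systems[OF 1 finN]) (use V If in auto)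
  then have "growth Z F2 (g + ?s0 + ?s0)"
    by (simp add: card_cartesian_product mult.commute)
  moreover have "?s0 + ?s0
      = ?s1"
    by (subst sum.distrib[symmetric]) (rule sum.cong, auto)
  ultimately have 2: "growth Z F2 (g + ?s1)" by (simp add: add.assoc)
  have F012: "F0 \<subseteq> F2" "F1 \<subseteq> F2" by (auto simp: F1_def F2_def)
  have \<iota>2: "polyon Z F2 (\<lambda>z. \<iota> z i p w)" if "i \<in> N" "p \<in> V i" "w \<in> I i" for i p w
  proof (cases "p \<in> I i")
    case True
    show ?thesis by (rule polyon_cong[OF polyon_const[of Z F2 "if p = w then 1 else 0"]]) (use True in \<open>simp add: \<iota>_def\<close>)
  next
    case False
    have "(\<lambda>z. \<iota> z i p w) \<in> F1" unfolding F1_def using that False by (auto intro!: bexI[of _ i] image_eqI[of _ _ "(p, w)"])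
    then show ?thesis using F012 by (intro polyon_coord) blast
  qed
  have \<eta>2: "polyon Z F2 (\<lambda>z. \<eta> z i r q)" if "i \<in> N" "r \<in> I i" "q \<in> V i" for i r q
  proof -
    have n: "polyon Z F2 (\<lambda>z. \<eta> z i r q)" if "q \<in> V i - I i" for q
    proof (rule polyon_coord)
      show "(\<lambda>z. \<eta> z i r q) \<in> F2" unfolding F2_def using that \<open>i \<in> N\<close> \<open>r \<in> I i\<close> by (auto intro!: bexI[of _ i] image_eqI[of _ _ "(r, q)"])
    qed
    show ?thesis
    proof (cases "q \<in> I i")
      case True
      have "(\<lambda>z. \<eta>' z i r q) \<in> F2" using F012 vertex_funsI[of i r I q I "\<lambda>i p q z. \<eta>' z i p q"] that True by (auto simp: F0_def)
      then have "polyon Z F2 (\<lambda>z. \<eta>' z i r q - (\<Sum>u\<in>V i - I i. \<eta> z i r u * \<iota> z i u q))"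
        using that True by (intro polyon_diff polyon_sum polyon_mult n \<iota>2 polyon_coord) auto
      then show ?thesis
      proof (rule polyon_cong)
        show "\<eta> z i r q = \<eta>' z i r q - (\<Sum>u\<in>V i - I i. \<eta> z i r u * \<iota> z i u q)" for z
          using split_sum[OF that(1) True, of "\<eta> z i" z r] by (simp add: \<eta>'_def)
      qed
    qed (use n that in blast)
  qed
  define J where "J = (SIGMA h:Om. V (s h) - I (s h))"
  have Jf: "finite J" unfolding J_def using finOm V st by auto
  define F3 where "F3 = F2 \<union> (\<Union>j\<in>J. (\<lambda>p z. x z (fst j) p (snd j)) ` V (t (fst j)))"
  have "growth Z F3 (g + ?s1 +
      (\<Sum>j\<in>J. int (card (V (t (fst j)))) - int (card (I (t (fst j))))))"
    unfolding F3_def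
  proof (rule growth_linear_systems[OF 2 Jf, where A = "\<lambda>j r p z. \<eta> z (t (fst j)) r p" and
        C = "\<lambda>j r z. mm (I (s (fst j))) (x' z (fst j)) (\<eta> z (s (fst j))) r (snd j)"])
    fix j assume j: "j \<in> J"
    then have h: "fst j \<in> Om" "snd j \<in> V (s (fst j)) - I (s (fst j))" by (auto simp: J_def)
    note tN = st(2)[OF h(1)] and sN = st(1)[OF h(1)]
    show "finite (V (t (fst j)))" "finite (I (t (fst j)))" using V If tN by auto
    fix r assume r: "r \<in> I (t (fst j))"
    show "polyon Z F2 (\<lambda>z. \<eta> z (t (fst j)) r p)" if "p \<in> V (t (fst j))" for p by (rule \<eta>2[OF tN r that])
    have "polyon Z F2 (\<lambda>z. x' z (fst j) r w)" if "w \<in> I (s (fst j))" for w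
      by (rule polyon_coord) (use F012 arrow_funsI[of "fst j" r I w "\<lambda>h p q z. x' z h p q"] h(1) r that in \<open>auto simp: F0_def\<close>)
    then show "polyon Z F2 (\<lambda>z. mm (I (s (fst j))) (x' z (fst j)) (\<eta> z (s (fst j))) r (snd j))" unfolding mm_def
      using h(2) by (intro polyon_sum polyon_mult \<eta>2[OF sN]) auto
    show "(\<Sum>k\<in>V (t (fst j)). \<eta> z (t (fst j)) r k * x z (fst j) k (snd j)) = mm (I (s (fst j))) (x' z (fst j)) (\<eta> z (s (fst j))) r (snd j)"
      if "z \<in> Z" for z
      using imgs(1)[OF that h(1), of r "snd j"] h(2) r I[OF tN] by (auto simp: mm_def)
  next
    fix z j \<xi> assume "z \<in> Z" "j \<in> J" and x: "\<forall>k\<in>V (t (fst j)). (\<Sum>e\<in>I (t (fst j)). \<xi> e * \<eta> z (t (fst j)) e k) = 0"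
    then have "fst j \<in> Om" by (auto simp: J_def)
    show "\<forall>e\<in>I (t (fst j)). \<xi> e = 0" by (rule ind[OF \<open>z \<in> Z\<close> st(2)[OF \<open>fst j \<in> Om\<close>]]) (use x in auto)
  qed
  moreover have "(\<Sum>j\<in>J. int (card (V (t (fst j)))) - int (card (I (t (fst j))))) =
    ?s2"
  proof -
    have "(\<Sum>j\<in>J. int (card (V (t (fst j)))) - int (card (I (t (fst j))))) =
      (\<Sum>h\<in>Om. \<Sum>q\<in>V (s h) - I (s h). int (card (V (t h))) - int (card (I (t h))))"
      unfolding J_def using finOm V st by (subst sum.Sigma) (auto simp: case_prod_unfold)
    also have "\<dots> = ?s2"
    proof (rule sum.cong[OF refl])
      fix h assume "h \<in> Om"
      then have "int (card (V (t h) - I (t h))) = int (card (V (t h))) - int (card (I (t h)))"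
        using card_Diff_subset[OF If I] card_mono[OF V I] st(2) by (simp add: of_nat_diff)
      then show "(\<Sum>q\<in>V (s h) - I (s h). int (card (V (t h))) - int (card (I (t h)))) = int (card (V (t h) - I (t h))) * int (card (V (s h) - I (s h)))"
        by (simp add: mult.commute)
    qed
    finally show ?thesis .
  qed
  ultimately have 3: "growth Z F3 (g + ?s1 +
      ?s2)" by simp
  define F4 where "F4 = F3 \<union> (\<Union>i\<in>N. (\<lambda>(a, q) z. \<delta> z i a q) ` (D i \<times> (V i - I i)))"
  have "growth Z F4 (g + ?s1 +
      ?s2 +
      (\<Sum>i\<in>N. int (card (D i \<times> (V i - I i))) - int (card ({} :: nat set))))" unfolding F4_def
    by (rule growth_linear_systems[OF 3 finN]) (use V D in auto)
  then have 4: "growth Z F4 (g + ?s1 +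
      ?s2 +
      ?s3)" by (simp add: card_cartesian_product)
  have F24: "F2 \<subseteq> F4" "F3 \<subseteq> F4" by (auto simp: F3_def F4_def)
  note \<iota>4 = polyon_mono[OF \<iota>2 F24(1)] and \<eta>4 = polyon_mono[OF \<eta>2 F24(1)]
  let ?F = "arrow_funs V (\<lambda>h p q z. x z h p q) \<union> vertex_funs V V (\<lambda>i p q z. \<eta> z i p q) \<union> vertex_funs D V (\<lambda>i p q z. \<delta> z i p q)"
  have "polyon Z F4 (\<lambda>z. x z h p q)" if h: "h \<in> Om" and p: "p \<in> V (t h)" and q: "q \<in> V (s h)" for h p q
  proof -
    have n: "polyon Z F4 (\<lambda>z. x z h p q)" if "q \<in> V (s h) - I (s h)" for q
    proof (rule polyon_coord)
      have "(\<lambda>z. x z h p q) \<in> F3" unfolding F3_def J_def using that h p by (auto intro!: bexI[of _ "(h, q)"])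
      then show "(\<lambda>z. x z h p q) \<in> F4" using F24 by blast
    qed
    show ?thesis
    proof (cases "q \<in> I (s h)")
      case True
      have x': "polyon Z F4 (\<lambda>z. x' z h r w)" if "r \<in> I (t h)" "w \<in> I (s h)" for r w
      proof (rule polyon_coord)
        have "(\<lambda>z. x' z h r w) \<in> F0" using arrow_funsI[of h r I w "\<lambda>h p q z. x' z h p q"] h that by (simp add: F0_def)
        then show "(\<lambda>z. x' z h r w) \<in> F4" using F012 F24 by blast
      qed
      have "polyon Z F4 (\<lambda>z. mm (I (t h)) (\<iota> z (t h)) (x' z h) p q - (\<Sum>u\<in>V (s h) - I (s h). x z h p u * \<iota> z (s h) u q))"
        unfolding mm_def using True p st h by (intro polyon_diff polyon_sum polyon_mult n \<iota>4 x') auto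
      then show ?thesis
      proof (rule polyon_cong)
        fix z assume "z \<in> Z"
        from imgs(2)[OF this h p True] show "x z h p q = mm (I (t h)) (\<iota> z (t h)) (x' z h) p q - (\<Sum>u\<in>V (s h) - I (s h). x z h p u * \<iota> z (s h) u q)"
          using split_sum[OF st(1)[OF h] True, of "x z h" z p] by (simp add: x'_def eq_diff_eq add.commute)
      qed
    qed (use n q in blast)
  qed
  moreover have "polyon Z F4 (\<lambda>z. \<eta> z i p q)" if "i \<in> N" "p \<in> V i" "q \<in> V i" for i p q
  proof -
    have "polyon Z F4 (\<lambda>z. mm (I i) (\<iota> z i) (\<eta> z i) p q)" unfolding mm_def using that by (intro polyon_sum polyon_mult \<iota>4 \<eta>4)
    then show ?thesis by (rule polyon_cong) (use \<iota> that in blast)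
  qed
  moreover have "polyon Z F4 (\<lambda>z. \<delta> z i a q)" if i: "i \<in> N" and a: "a \<in> D i" and q: "q \<in> V i" for i a q
  proof -
    have n: "polyon Z F4 (\<lambda>z. \<delta> z i a q)" if "q \<in> V i - I i" for q
    proof (rule polyon_coord)
      show "(\<lambda>z. \<delta> z i a q) \<in> F4" unfolding F4_def using that i a by (auto intro!: bexI[of _ i] image_eqI[of _ _ "(a, q)"])
    qed
    show ?thesis
    proof (cases "q \<in> I i")
      case True
      have "polyon Z F4 (\<lambda>z. 0 - (\<Sum>u\<in>V i - I i. \<delta> z i a u * \<iota> z i u q))"
        using True i by (intro polyon_diff polyon_const polyon_sum polyon_mult n \<iota>4) auto
      then show ?thesis
      proof (rule polyon_cong)
        fix z assume "z \<in> Z"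
        from \<delta>\<iota>[OF this i a True] show "\<delta> z i a q = 0 - (\<Sum>u\<in>V i - I i. \<delta> z i a u * \<iota> z i u q)"
          using split_sum[OF i True, of "\<delta> z i" z a] by (simp add: add_eq_0_iff2)
      qed
    qed (use n q in blast)
  qed
  ultimately have "polyon Z F4 f" if "f \<in> ?F" for f using that by (auto simp: arrow_funs_def vertex_funs_def)
  moreover have "finite ?F" using finite_arrow_funs[of V] finite_vertex_funs[of V] V D by blast
  ultimately have "growth Z (F4 \<union> ?F) (g + ?s1 +
      ?s2 +
      ?s3)" by (intro growth_polyon[OF 4])
  then show ?thesis by (rule growth_mono) auto
qed

end

lemma exists_eigenrow:
  fixes M :: "'a \<Rightarrow> 'a \<Rightarrow> complex"
  assumes V: "finite V" "V \<noteq> {}"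
  shows "\<exists>c \<xi>. (\<forall>q\<in>V. (\<Sum>r\<in>V. \<xi> r * (M r q - (if r = q then c else 0))) = 0) \<and> (\<exists>r\<in>V. \<xi> r \<noteq> 0)"
proof -
  define n where "n = card V"
  have n: "n > 0" using V by (auto simp: n_def card_gt_0_iff)
  obtain b where b: "bij_betw b {..<n} V" unfolding n_def using ex_bij_betw_nat_finite[OF V(1)] atLeast0LessThan by auto
  define A where "A = mat n n (\<lambda>(i, j). M (b j) (b i))"
  have A: "A \<in> carrier_mat n n" by (simp add: A_def)
  have "degree (char_poly A) = n" using degree_monic_char_poly[OF A] by blast
  then have "\<not> (\<exists>a l. a \<noteq> 0 \<and> l = 0 \<and> char_poly A = pCons a l)" using n by auto
  from fundamental_theorem_of_algebra_alt[OF this] obtain c where "eigenvalue A c" using eigenvalue_root_char_poly[OF A] by blast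
  then obtain w where w: "w \<in> carrier_vec n" "w \<noteq> 0\<^sub>v n" "A *\<^sub>v w = c \<cdot>\<^sub>v w" using A by (auto simp: eigenvalue_def eigenvector_def)
  define \<xi> where "\<xi> = (\<lambda>r. w $ inv_into {..<n} b r)"
  have \<xi>b: "\<xi> (b j) = w $ j" if "j < n" for j using bij_betw_inv_into_left[OF b] that by (simp add: \<xi>_def)
  have "(\<Sum>r\<in>V. \<xi> r * (M r q - (if r = q then c else 0))) = 0" if q: "q \<in> V" for q
  proof -
    obtain i where i: "i < n" "q = b i" using b q unfolding bij_betw_def by auto
    have "(\<Sum>r\<in>V. \<xi> r * (M r q - (if r = q then c else 0))) = (\<Sum>r\<in>V. \<xi> r * M r q) - (\<Sum>r\<in>V. if r = q then \<xi> r * c else 0)"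
      by (subst sum_subtractf[symmetric], rule sum.cong) (auto simp: algebra_simps)
    also have "(\<Sum>r\<in>V. if r = q then \<xi> r * c else 0) = \<xi> q * c" using q V by simp
    also have "(\<Sum>r\<in>V. \<xi> r * M r q) = (\<Sum>j<n. \<xi> (b j) * M (b j) q)" by (rule sum.reindex_bij_betw[OF b, symmetric])
    also have "\<dots> = (A *\<^sub>v w) $ i" using i w(1) by (auto simp: A_def scalar_prod_def \<xi>b atLeast0LessThan mult.commute intro!: sum.cong)
    also have "\<dots> = \<xi> q * c" using i w(1) by (simp add: w(3) \<xi>b mult.commute)
    finally show ?thesis by simp
  qed
  moreover have "\<exists>r\<in>V. \<xi> r \<noteq> 0"
  proof (rule ccontr)
    assume "\<not> ?thesis"
    then have "w $ j = 0" if "j < n" for j using \<xi>b[OF that] b that unfolding bij_betw_def by auto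
    then have "w = 0\<^sub>v n" using w(1) by (intro eq_vecI) auto
    then show False using w(2) by simp
  qed
  ultimately show ?thesis by (intro exI[of _ c] exI[of _ \<xi>] conjI ballI)
qed

context quiver_shape begin

lemma ex_row_bases:
  assumes "\<And>i. i \<in> N \<Longrightarrow> finite (V i)"
  shows "\<exists>I\<in>Pi\<^sub>E N (\<lambda>i. Pow (V i)). row_bases V I \<eta>"
proof -
  have "\<forall>i\<in>N. \<exists>J. J \<subseteq> V i \<and> (\<forall>\<xi>. (\<forall>k\<in>V i. (\<Sum>e\<in>J. \<xi> e * \<eta> i e k) = 0) \<longrightarrow> (\<forall>e\<in>J. \<xi> e = 0)) \<and>
    (\<forall>e\<in>V i. \<exists>\<zeta>. \<forall>k\<in>V i. \<eta> i e k = (\<Sum>e'\<in>J. \<zeta> e' * \<eta> i e' k))"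
    using maximal_independent_rows[OF assms] by blast
  from bchoice[OF this] obtain J where J: "\<forall>i\<in>N. J i \<subseteq> V i \<and> (\<forall>\<xi>. (\<forall>k\<in>V i. (\<Sum>e\<in>J i. \<xi> e * \<eta> i e k) = 0) \<longrightarrow> (\<forall>e\<in>J i. \<xi> e = 0)) \<and>
    (\<forall>e\<in>V i. \<exists>\<zeta>. \<forall>k\<in>V i. \<eta> i e k = (\<Sum>e'\<in>J i. \<zeta> e' * \<eta> i e' k))" by (elim exE)
  then have "row_bases V (restrict J N) \<eta>" by (simp add: row_bases_def)
  moreover have "restrict J N \<in> Pi\<^sub>E N (\<lambda>i. Pow (V i))" using J by auto
  ultimately show ?thesis by (rule bexI)
qed

lemma finite_strata: "(\<And>i. i \<in> N \<Longrightarrow> finite (V i)) \<Longrightarrow> finite {I \<in> Pi\<^sub>E N (\<lambda>i. Pow (V i)). P I}"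
  using finite_PiE[of N "\<lambda>i. Pow (V i)"] finN by auto

lemma commuting_shift:
  assumes V: "\<And>i. i \<in> N \<Longrightarrow> finite (V i)" and c: "(x, \<xi>) \<in> commuting V"
  shows "(x, \<lambda>i p q. \<xi> i p q - (if p = q then c else 0)) \<in> commuting V"
  unfolding commuting_def
proof (clarify)
  fix h p q assume h: "h \<in> Om" "p \<in> V (t h)" "q \<in> V (s h)"
  have "mm (V (t h)) (\<lambda>p q. \<xi> (t h) p q - (if p = q then c else 0)) (x h) p q =
    mm (V (t h)) (\<xi> (t h)) (x h) p q - (\<Sum>w\<in>V (t h). if p = w then c * x h w q else 0)"
    unfolding mm_def by (subst sum_subtractf[symmetric], rule sum.cong) (auto simp: algebra_simps)
  also have "\<dots> = mm (V (s h)) (x h) (\<xi> (s h)) p q - c * x h p q" using c h V st by (simp add: commuting_def)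
  also have "\<dots> = mm (V (s h)) (x h) (\<xi> (s h)) p q - (\<Sum>w\<in>V (s h). if w = q then c * x h p w else 0)" using h V st by simp
  also have "\<dots> = mm (V (s h)) (x h) (\<lambda>p q. \<xi> (s h) p q - (if p = q then c else 0)) p q"
    unfolding mm_def by (subst sum_subtractf[symmetric], rule sum.cong) (auto simp: algebra_simps)
  finally show "mm (V (t h)) (\<lambda>p q. \<xi> (t h) p q - (if p = q then c else 0)) (x h) p q =
    mm (V (s h)) (x h) (\<lambda>p q. \<xi> (s h) p q - (if p = q then c else 0)) p q" .
qed

end

locale positive_quiver = quiver_shape +
  assumes pos: "\<And>a :: nat \<Rightarrow> int. \<exists>i\<in>N. a i \<noteq> 0 \<Longrightarrow> (\<Sum>h\<in>Om. a (t h) * a (s h)) < (\<Sum>i\<in>N. a i * a i)"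
begin

text \<open>With c an eigenvalue of xi at some vertex, xi - c drops rank there, so its strata reduce to smaller index sets. The
  additional parameter c is paid for by the positive value of the Tits form at the vector of coranks.\<close>

theorem growth_commuting:
  assumes "\<And>i. i \<in> N \<Longrightarrow> finite (V i)"
  shows "growth (commuting V) (commuting_funs V) (\<Sum>i\<in>N. int (card (V i)) * int (card (V i)))"
  using assms
proof (induction "\<Sum>i\<in>N. card (V i)" arbitrary: V rule: less_induct)
  case less
  note V = less.prems
  show ?case
  proof (cases "\<exists>j\<in>N. V j \<noteq> {}")
    case False
    then have "commuting_funs V = {}" using st by (auto simp: commuting_funs_def arrow_funs_def vertex_funs_def)
    moreover have "(\<Sum>i\<in>N. int (card (V i)) * int (card (V i))) = 0" using False by (intro sum.neutral) auto
    ultimately show ?thesis using growth_no_functions by simp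
  next
    case True
    then obtain j where j: "j \<in> N" "V j \<noteq> {}" by blast
    \<comment> \<open>The eigenvalue is chosen separately at each point.\<close>
    define c where "c = (\<lambda>z :: ('a \<Rightarrow> nat \<Rightarrow> nat \<Rightarrow> complex) \<times> (nat \<Rightarrow> nat \<Rightarrow> nat \<Rightarrow> complex). SOME c.
      \<exists>\<xi>. (\<forall>q\<in>V j. (\<Sum>r\<in>V j. \<xi> r * (snd z j r q - (if r = q then c else 0))) = 0) \<and> (\<exists>r\<in>V j. \<xi> r \<noteq> 0))"
    define \<eta> where "\<eta> = (\<lambda>z i p q. snd z i p q - (if p = q then c z else 0))"
    have c: "\<exists>\<xi>. (\<forall>q\<in>V j. (\<Sum>r\<in>V j. \<xi> r * \<eta> z j r q) = 0) \<and> (\<exists>r\<in>V j. \<xi> r \<noteq> 0)" for z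
      unfolding \<eta>_def c_def by (rule someI_ex[OF exists_eigenrow[OF V[OF j(1)] j(2)]])
    define Z where "Z = (\<lambda>I. {z \<in> commuting V. row_bases V I (\<eta> z)})"
    show ?thesis
    proof (rule growth_UN)
      show "finite {I \<in> Pi\<^sub>E N (\<lambda>i. Pow (V i)). I j \<noteq> V j}" by (rule finite_strata[OF V])
      show "commuting V \<subseteq> (\<Union>I\<in>{I \<in> Pi\<^sub>E N (\<lambda>i. Pow (V i)). I j \<noteq> V j}. Z I)"
      proof
        fix z assume z: "z \<in> commuting V"
        have "\<exists>I\<in>Pi\<^sub>E N (\<lambda>i. Pow (V i)). row_bases V I (\<eta> z)" by (rule ex_row_bases) (rule V)
    then obtain I where I: "I \<in> Pi\<^sub>E N (\<lambda>i. Pow (V i))" "row_bases V I (\<eta> z)" by (elim bexE)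
        moreover have "I j \<noteq> V j" using I(2) c[of z] j(1) unfolding row_bases_def by metis
        ultimately show "z \<in> (\<Union>I\<in>{I \<in> Pi\<^sub>E N (\<lambda>i. Pow (V i)). I j \<noteq> V j}. Z I)" using z by (auto simp: Z_def)
      qed
    next
      fix I assume "I \<in> {I \<in> Pi\<^sub>E N (\<lambda>i. Pow (V i)). I j \<noteq> V j}"
      then have I: "\<And>i. i \<in> N \<Longrightarrow> I i \<subseteq> V i" and Ij: "I j \<noteq> V j" by auto
      have If: "finite (I i)" if "i \<in> N" for i using I[OF that] V[OF that] by (rule finite_subset)
      have "(\<Sum>i\<in>N. card (I i)) < (\<Sum>i\<in>N. card (V i))"
      proof (rule sum_strict_mono_ex1[OF finN])
        show "\<forall>i\<in>N. card (I i) \<le> card (V i)" using card_mono[OF V I] by blast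
        show "\<exists>i\<in>N. card (I i) < card (V i)" using psubset_card_mono[OF V[OF j(1)], of "I j"] I[OF j(1)] Ij j(1) by blast
      qed
      from less.hyps[OF this If] have IH: "growth (commuting I) (commuting_funs I) (\<Sum>i\<in>N. int (card (I i)) * int (card (I i)))" .
      define a where "a = (\<lambda>i. int (card (V i - I i)))"
      define u where "u = (\<lambda>i. int (card (I i)))"
      have v: "int (card (V i)) = u i + a i" if "i \<in> N" for i
        using card_Diff_subset[OF If[OF that] I[OF that]] card_mono[OF V[OF that] I[OF that]] by (simp add: a_def u_def)
      let ?F = "arrow_funs V (\<lambda>h p q z. fst z h p q) \<union> vertex_funs V V (\<lambda>i p q z. \<eta> z i p q)"
      have "growth (Z I) (?F \<union> vertex_funs (\<lambda>_. {}) V (\<lambda>i p q z. 0))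
        ((\<Sum>i\<in>N. u i * u i) + (\<Sum>i\<in>N. 2 * int (card (I i)) * int (card (V i - I i))) +
     (\<Sum>h\<in>Om. int (card (V (t h) - I (t h))) * int (card (V (s h) - I (s h)))) +
     (\<Sum>i\<in>N. int (card ({} :: nat set)) * int (card (V i - I i))))"
      proof (rule growth_stratum[where \<delta> = "\<lambda>_ _ _ _. 0"])
        show "growth (commuting I) (commuting_funs I) (\<Sum>i\<in>N. u i * u i)" using IH by (simp add: u_def)
        show "(fst z, \<eta> z) \<in> commuting V" if "z \<in> Z I" for z
        proof -
          have "(fst z, snd z) \<in> commuting V" using that by (simp add: Z_def)
          from commuting_shift[OF V this] show ?thesis by (simp add: \<eta>_def)
        qed
        show "row_bases V I (\<eta> z)" if "z \<in> Z I" for z using that by (simp add: Z_def)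
      qed (use V I in auto)
      then have "growth (Z I) ?F ((\<Sum>i\<in>N. u i * u i) + (\<Sum>i\<in>N. 2 * u i * a i) + (\<Sum>h\<in>Om. a (t h) * a (s h)))"
        by (simp add: vertex_funs_def u_def a_def)
      from growth_insert[OF this, of c]
      have "growth (Z I) (insert c ?F) ((\<Sum>i\<in>N. u i * u i) + (\<Sum>i\<in>N. 2 * u i * a i) + (\<Sum>h\<in>Om. a (t h) * a (s h)) + 1)" .
      then have "growth (Z I) (insert c ?F \<union> commuting_funs V) ((\<Sum>i\<in>N. u i * u i) + (\<Sum>i\<in>N. 2 * u i * a i) + (\<Sum>h\<in>Om. a (t h) * a (s h)) + 1)"
      proof (rule growth_polyon)
        show "finite (commuting_funs V)" unfolding commuting_funs_def using finite_arrow_funs[of V] finite_vertex_funs[of V V] V by blast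
        fix f assume "f \<in> commuting_funs V"
        then consider "f \<in> ?F" | i p q where "i \<in> N" "p \<in> V i" "q \<in> V i" "f = (\<lambda>z. snd z i p q)" 
          unfolding commuting_funs_def vertex_funs_def by blast
        then show "polyon (Z I) (insert c ?F) f"
        proof cases
          case 1
          then show ?thesis by (intro polyon_coord) blast
        next
          case 2
          have "(\<lambda>z. \<eta> z i p q) \<in> ?F" using vertex_funsI[of i p V q V "\<lambda>i p q z. \<eta> z i p q"] 2 by blast
          then have "polyon (Z I) (insert c ?F) (\<lambda>z. \<eta> z i p q + c z * (if p = q then 1 else 0))"
            by (intro polyon_add polyon_mult polyon_const polyon_coord) auto
          then show ?thesis by (rule polyon_cong) (simp add: 2 \<eta>_def)
        qed
      qed
      then show "growth (Z I) (commuting_funs V) (\<Sum>i\<in>N. int (card (V i)) * int (card (V i)))"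
      proof (rule growth_mono)
        have "card (V j - I j) > 0" using V[OF j(1)] I[OF j(1)] Ij by (auto simp: card_gt_0_iff)
        then have "\<exists>i\<in>N. a i \<noteq> 0" using j(1) by (auto simp: a_def intro!: bexI[of _ j])
        from pos[OF this] have "(\<Sum>h\<in>Om. a (t h) * a (s h)) + 1 \<le> (\<Sum>i\<in>N. a i * a i)" by simp
        moreover have "(\<Sum>i\<in>N. int (card (V i)) * int (card (V i))) = (\<Sum>i\<in>N. u i * u i + 2 * u i * a i + a i * a i)"
          by (rule sum.cong) (auto simp: v algebra_simps)
        ultimately show "(\<Sum>i\<in>N. u i * u i) + (\<Sum>i\<in>N. 2 * u i * a i) + (\<Sum>h\<in>Om. a (t h) * a (s h)) + 1 \<le> (\<Sum>i\<in>N. int (card (V i)) * int (card (V i)))"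
          by (simp add: sum.distrib)
      qed auto
    qed
  qed
qed

text \<open>Here u and a are the vectors of ranks and coranks of xi. The regularity of the weight, summed against u, bounds
  the pairing of d with u from below; positivity of the Tits form at u and \<Sum> u_i \<ge> 1 give the defect 2.\<close>

theorem growth_relations:
  fixes x :: "'z \<Rightarrow> 'a \<Rightarrow> nat \<Rightarrow> nat \<Rightarrow> complex" and \<xi> \<delta> :: "'z \<Rightarrow> nat \<Rightarrow> nat \<Rightarrow> nat \<Rightarrow> complex"
  assumes V: "\<And>i. i \<in> N \<Longrightarrow> finite (V i)" and D: "\<And>i. i \<in> N \<Longrightarrow> finite (D i)"
    and comm: "\<And>z. z \<in> Z \<Longrightarrow> (x z, \<xi> z) \<in> commuting V"
    and ann: "\<And>z i a q. z \<in> Z \<Longrightarrow> i \<in> N \<Longrightarrow> a \<in> D i \<Longrightarrow> q \<in> V i \<Longrightarrow> mm (V i) (\<delta> z i) (\<xi> z i) a q = 0"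
    and nz: "\<And>z. z \<in> Z \<Longrightarrow> \<exists>i\<in>N. \<exists>p\<in>V i. \<exists>q\<in>V i. \<xi> z i p q \<noteq> 0"
    and regular: "\<And>i. i \<in> N \<Longrightarrow> 2 * int (card (V i)) - (\<Sum>h | h \<in> Om \<and> s h = i. int (card (V (t h)))) -
      (\<Sum>h | h \<in> Om \<and> t h = i. int (card (V (s h)))) < int (card (D i))"
  shows "growth Z (arrow_funs V (\<lambda>h p q z. x z h p q) \<union> vertex_funs V V (\<lambda>i p q z. \<xi> z i p q) \<union> vertex_funs D V (\<lambda>i p q z. \<delta> z i p q))
    ((\<Sum>h\<in>Om. int (card (V (t h))) * int (card (V (s h)))) + (\<Sum>i\<in>N. int (card (D i)) * int (card (V i))) - 2)" (is "growth Z ?F ?s")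
proof (rule growth_UN)
  let ?J = "{I \<in> Pi\<^sub>E N (\<lambda>i. Pow (V i)). \<exists>i\<in>N. I i \<noteq> {}}"
  define Z' where "Z' = (\<lambda>I. {z \<in> Z. row_bases V I (\<xi> z)})"
  show "finite ?J" by (rule finite_strata[OF V])
  show "Z \<subseteq> (\<Union>I\<in>?J. Z' I)"
  proof
    fix z assume z: "z \<in> Z"
    have "\<exists>I\<in>Pi\<^sub>E N (\<lambda>i. Pow (V i)). row_bases V I (\<xi> z)" by (rule ex_row_bases) (rule V)
    then obtain I where I: "I \<in> Pi\<^sub>E N (\<lambda>i. Pow (V i))" "row_bases V I (\<xi> z)" by (elim bexE)
    obtain i p q where i: "i \<in> N" "p \<in> V i" "q \<in> V i" "\<xi> z i p q \<noteq> 0" using nz[OF z] by blast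
    have "I i \<noteq> {}"
    proof
      assume e: "I i = {}"
      have "\<exists>\<zeta>. \<forall>q\<in>V i. \<xi> z i p q = (\<Sum>r\<in>I i. \<zeta> r * \<xi> z i r q)" using I(2) i(1,2) unfolding row_bases_def by blast
      then show False using i by (simp add: e)
    qed
    with I(1) i(1) have IJ: "I \<in> ?J" by (intro CollectI conjI bexI[of _ i])
    have "z \<in> Z' I" using I(2) z by (simp add: Z'_def)
    then show "z \<in> (\<Union>I\<in>?J. Z' I)" using IJ unfolding UN_iff by (intro bexI[of _ I])
  qed
  fix I assume "I \<in> ?J"
  then obtain k where I: "\<And>i. i \<in> N \<Longrightarrow> I i \<subseteq> V i" and k: "k \<in> N" "I k \<noteq> {}" by auto
  have If: "finite (I i)" if "i \<in> N" for i using I[OF that] V[OF that] by (rule finite_subset)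
  define a where "a = (\<lambda>i. int (card (V i - I i)))"
  define u where "u = (\<lambda>i. int (card (I i)))"
  define d where "d = (\<lambda>i. int (card (D i)))"
  have v: "int (card (V i)) = u i + a i" if "i \<in> N" for i
    using card_Diff_subset[OF If[OF that] I[OF that]] card_mono[OF V[OF that] I[OF that]] by (simp add: a_def u_def)
  have g: "growth (Z' I) ?F
    ((\<Sum>i\<in>N. u i * u i) + (\<Sum>i\<in>N. 2 * u i * a i) + (\<Sum>h\<in>Om. a (t h) * a (s h)) + (\<Sum>i\<in>N. d i * a i))"
    unfolding a_def u_def d_def
  proof (rule growth_stratum[OF V D I])
    show "(x z, \<xi> z) \<in> commuting V" "row_bases V I (\<xi> z)" if "z \<in> Z' I" for z
      using that comm[of z] by (simp_all add: Z'_def)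
    show "mm (V i) (\<delta> z i) (\<xi> z i) a q = 0" if "z \<in> Z' I" "i \<in> N" "a \<in> D i" "q \<in> V i" for z i a q
      using that by (intro ann) (simp_all add: Z'_def)
  qed (assumption | rule growth_commuting[OF If])+
  have uk: "card (I k) > 0" using If[OF k(1)] k(2) by (simp add: card_gt_0_iff)
  have "(\<Sum>h\<in>Om. u (t h) * u (s h)) < (\<Sum>i\<in>N. u i * u i)" by (rule pos) (use uk k(1) in \<open>auto simp: u_def\<close>)
  moreover have "1 \<le> (\<Sum>i\<in>N. u i)"
  proof -
    have "u k \<le> (\<Sum>i\<in>N. u i)" by (rule member_le_sum[OF k(1) _ finN]) (simp add: u_def)
    then show ?thesis using uk by (simp add: u_def)
  qed
  moreover have "(\<Sum>i\<in>N. u i) + 2 * (\<Sum>i\<in>N. u i * u i) + (\<Sum>i\<in>N. 2 * u i * a i) - 2 * (\<Sum>h\<in>Om. u (t h) * u (s h)) -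
      (\<Sum>h\<in>Om. u (s h) * a (t h)) - (\<Sum>h\<in>Om. u (t h) * a (s h)) \<le> (\<Sum>i\<in>N. d i * u i)"
  proof -
    have "u i * (1 + 2 * (u i + a i) - (\<Sum>h | h \<in> Om \<and> s h = i. u (t h) + a (t h)) - (\<Sum>h | h \<in> Om \<and> t h = i. u (s h) + a (s h))) \<le> d i * u i"
      if i: "i \<in> N" for i
    proof -
      have "(\<Sum>h | h \<in> Om \<and> s h = i. int (card (V (t h)))) = (\<Sum>h | h \<in> Om \<and> s h = i. u (t h) + a (t h))"
        "(\<Sum>h | h \<in> Om \<and> t h = i. int (card (V (s h)))) = (\<Sum>h | h \<in> Om \<and> t h = i. u (s h) + a (s h))"
        using st by (auto intro!: sum.cong simp: v)
      then have "1 + 2 * (u i + a i) - (\<Sum>h | h \<in> Om \<and> s h = i. u (t h) + a (t h)) - (\<Sum>h | h \<in> Om \<and> t h = i. u (s h) + a (s h)) \<le> d i"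
        using regular[OF i] v[OF i] by (simp add: d_def)
      then show ?thesis by (subst mult.commute[of "d i"], intro mult_left_mono) (auto simp: u_def)
    qed
    then have le: "(\<Sum>i\<in>N. u i * (1 + 2 * (u i + a i) - (\<Sum>h | h \<in> Om \<and> s h = i. u (t h) + a (t h)) - (\<Sum>h | h \<in> Om \<and> t h = i. u (s h) + a (s h)))) \<le> (\<Sum>i\<in>N. d i * u i)"
      by (rule sum_mono)
    have fibres: "(\<Sum>i\<in>N. u i * (\<Sum>h | h \<in> Om \<and> f h = i. w h)) = (\<Sum>h\<in>Om. u (f h) * w h)" if "\<And>h. h \<in> Om \<Longrightarrow> f h \<in> N" for f and w :: "'a \<Rightarrow> int"
    proof -
      have "(\<Sum>i\<in>N. u i * (\<Sum>h | h \<in> Om \<and> f h = i. w h)) = (\<Sum>i\<in>N. \<Sum>h | h \<in> Om \<and> f h = i. u (f h) * w h)"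
        by (auto simp: sum_distrib_left intro!: sum.cong)
      also have "\<dots> = (\<Sum>h\<in>Om. u (f h) * w h)" by (rule sum.group[OF finOm finN]) (use that in auto)
      finally show ?thesis .
    qed
    have gs: "(\<Sum>i\<in>N. u i * (\<Sum>h | h \<in> Om \<and> s h = i. u (t h) + a (t h))) = (\<Sum>h\<in>Om. u (s h) * (u (t h) + a (t h)))"
      "(\<Sum>i\<in>N. u i * (\<Sum>h | h \<in> Om \<and> t h = i. u (s h) + a (s h))) = (\<Sum>h\<in>Om. u (t h) * (u (s h) + a (s h)))"
      by (rule fibres, erule st)+
    have "(\<Sum>i\<in>N. u i * (1 + 2 * (u i + a i) - (\<Sum>h | h \<in> Om \<and> s h = i. u (t h) + a (t h)) - (\<Sum>h | h \<in> Om \<and> t h = i. u (s h) + a (s h)))) =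
      (\<Sum>i\<in>N. u i + 2 * (u i * u i) + 2 * u i * a i) - (\<Sum>i\<in>N. u i * (\<Sum>h | h \<in> Om \<and> s h = i. u (t h) + a (t h))) - (\<Sum>i\<in>N. u i * (\<Sum>h | h \<in> Om \<and> t h = i. u (s h) + a (s h)))"
      unfolding sum_subtractf[symmetric] by (rule sum.cong) (simp_all add: algebra_simps)
    also have "\<dots> = (\<Sum>i\<in>N. u i) + 2 * (\<Sum>i\<in>N. u i * u i) + (\<Sum>i\<in>N. 2 * u i * a i) -
       ((\<Sum>h\<in>Om. u (t h) * u (s h)) + (\<Sum>h\<in>Om. u (s h) * a (t h))) - ((\<Sum>h\<in>Om. u (t h) * u (s h)) + (\<Sum>h\<in>Om. u (t h) * a (s h)))"
      unfolding gs by (simp add: sum.distrib sum_distrib_left distrib_left mult.commute)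
    finally show ?thesis using le by simp
  qed
  moreover have "(\<Sum>h\<in>Om. int (card (V (t h))) * int (card (V (s h)))) = (\<Sum>h\<in>Om. u (t h) * u (s h)) + (\<Sum>h\<in>Om. u (s h) * a (t h)) +
     (\<Sum>h\<in>Om. u (t h) * a (s h)) + (\<Sum>h\<in>Om. a (t h) * a (s h))"
    unfolding sum.distrib[symmetric] by (rule sum.cong) (auto simp: v st algebra_simps)
  moreover have "(\<Sum>i\<in>N. int (card (D i)) * int (card (V i))) = (\<Sum>i\<in>N. d i * u i) + (\<Sum>i\<in>N. d i * a i)"
    unfolding sum.distrib[symmetric] by (rule sum.cong) (auto simp: v d_def algebra_simps)
  ultimately have le: "(\<Sum>i\<in>N. u i * u i) + (\<Sum>i\<in>N. 2 * u i * a i) + (\<Sum>h\<in>Om. a (t h) * a (s h)) + (\<Sum>i\<in>N. d i * a i) \<le>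
    ?s" by linarith
  show "growth (Z' I) ?F
    ?s"
    by (rule growth_mono[OF g subset_refl subset_refl le])
qed

end

section \<open>The moment map as a linear fibration\<close>

datatype 'h coord = CB 'h nat nat | CG nat nat nat | CD nat nat nat

definition blk :: "('i \<Rightarrow> nat \<Rightarrow> nat \<Rightarrow> 'k) \<Rightarrow> 'i set \<Rightarrow> ('i \<Rightarrow> nat) \<Rightarrow> ('i \<Rightarrow> nat) \<Rightarrow> 'k set" where
  "blk C A m n = (\<lambda>(h, r, c). C h r c) ` (SIGMA h:A. {..<m h} \<times> {..<n h})"

lemma blkI: "h \<in> A \<Longrightarrow> r < m h \<Longrightarrow> c < n h \<Longrightarrow> C h r c \<in> blk C A m n"
  unfolding blk_def by (rule image_eqI[of _ _ "(h, r, c)"]) auto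

lemma blkE: assumes "k \<in> blk C A m n" obtains h r c where "k = C h r c" "h \<in> A" "r < m h" "c < n h"
  using assms unfolding blk_def by auto

lemma finite_blk: "finite A \<Longrightarrow> finite (blk C A m n)"
  unfolding blk_def by auto

lemma sum_blk:
  assumes "finite A" "\<And>h r c h' r' c'. C h r c = C h' r' c' \<Longrightarrow> h = h' \<and> r = r' \<and> c = c'"
  shows "sum f (blk C A m n) = (\<Sum>h\<in>A. \<Sum>r<m h. \<Sum>c<n h. f (C h r c))"
proof -
  have "sum f (blk C A m n) = (\<Sum>(h, r, c)\<in>(SIGMA h:A. {..<m h} \<times> {..<n h}). f (C h r c))"
    unfolding blk_def by (subst sum.reindex) (use assms(2) in \<open>auto simp: inj_on_def o_def case_prod_unfold\<close>)
  also have "\<dots> = (\<Sum>h\<in>A. \<Sum>x\<in>{..<m h} \<times> {..<n h}. f (C h (fst x) (snd x)))"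
    by (subst sum.Sigma) (use assms(1) in \<open>auto simp: case_prod_unfold\<close>)
  also have "\<dots> = (\<Sum>h\<in>A. \<Sum>r<m h. \<Sum>c<n h. f (C h r c))"
    by (intro sum.cong refl) (simp add: sum.cartesian_product case_prod_unfold)
  finally show ?thesis .
qed

lemma card_blk:
  assumes "finite A" "\<And>h r c h' r' c'. C h r c = C h' r' c' \<Longrightarrow> h = h' \<and> r = r' \<and> c = c'"
  shows "int (card (blk C A m n)) = (\<Sum>h\<in>A. int (m h) * int (n h))"
  using sum_blk[of A C, OF assms, where f = "\<lambda>_. 1 :: int" and m = m and n = n] by simp

lemma finsum_mat_entry:
  assumes "finite A" "\<And>h. h \<in> A \<Longrightarrow> F h \<in> carrier_mat n n"
  shows "finsum (ring_mat TYPE(complex) n ()) F A \<in> carrier_mat n n \<and>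
    (\<forall>p<n. \<forall>q<n. finsum (ring_mat TYPE(complex) n ()) F A $$ (p, q) = (\<Sum>h\<in>A. F h $$ (p, q)))"
  using assms
proof (induction A rule: finite_induct)
  case empty
  interpret ring "ring_mat TYPE(complex) n ()" by (rule ring_mat)
  show ?case by (simp add: ring_mat_simps)
next
  case (insert h A)
  interpret ring "ring_mat TYPE(complex) n ()" by (rule ring_mat)
  have "finsum (ring_mat TYPE(complex) n ()) F (insert h A) = F h + finsum (ring_mat TYPE(complex) n ()) F A"
    by (subst finsum_insert) (use insert in \<open>auto simp: ring_mat_simps\<close>)
  moreover have "F h \<in> carrier_mat n n" "finsum (ring_mat TYPE(complex) n ()) F A \<in> carrier_mat n n" using insert by auto
  ultimately show ?case using insert.IH insert.hyps insert.prems by auto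
qed

locale regular_quiver =
  fixes Q :: "'h dquiver" and d v :: "nat \<Rightarrow> nat"
  assumes dq: "double_quiver Q" and ft: "finite_type Q" and reg: "\<forall>i\<in>verts Q. weight_pairing Q d v i > 0"
begin

definition "N = verts Q"
definition "Om = {h \<in> arrows Q. eps Q h = 1}"
definition "Op = {h \<in> arrows Q. eps Q h = -1}"

lemma finN: "finite N" by (simp add: N_def verts_def)
lemma finA: "finite (arrows Q)" using dq by (simp add: double_quiver_def)
lemma finOm: "finite Om" "finite Op" using finA by (auto simp: Om_def Op_def)

lemma bar: assumes "h \<in> arrows Q"
  shows "bar Q h \<in> arrows Q" "bar Q (bar Q h) = h" "src Q (bar Q h) = tgt Q h" "tgt Q (bar Q h) = src Q h"
    "src Q h \<in> N" "tgt Q h \<in> N" "eps Q (bar Q h) = - eps Q h" "eps Q h = 1 \<or> eps Q h = -1"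
  using dq assms by (auto simp: double_quiver_def N_def)

lemma arrows_split: "arrows Q = Om \<union> Op" "Om \<inter> Op = {}"
  using bar(8) by (auto simp: Om_def Op_def)

lemma bar_bij: "bij_betw (bar Q) Op Om"
  by (rule bij_betwI[of _ _ _ "bar Q"]) (auto simp: Om_def Op_def bar)

lemma sum_arrows:
  fixes f :: "'h \<Rightarrow> 'b :: comm_monoid_add"
  shows "(\<Sum>h\<in>arrows Q. f h) = (\<Sum>h\<in>Op. f h + f (bar Q h))"
  unfolding arrows_split(1) sum.union_disjoint[OF finOm arrows_split(2)] sum.distrib
  using sum.reindex_bij_betw[OF bar_bij, of f] by (simp add: add.commute)

lemma cartan_sum:
  fixes f :: "nat \<Rightarrow> int"
  assumes i: "i \<in> N"
  shows "(\<Sum>j\<in>N. cartan Q i j * f j) = 2 * f i - (\<Sum>h | h \<in> arrows Q \<and> src Q h = i. f (tgt Q h))"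
proof -
  have "(\<Sum>j\<in>N. cartan Q i j * f j) = (\<Sum>j\<in>N. if i = j then 2 * f j else 0) -
      (\<Sum>j\<in>N. int (card {h \<in> arrows Q. src Q h = i \<and> tgt Q h = j}) * f j)"
    unfolding sum_subtractf[symmetric] by (rule sum.cong) (auto simp: cartan_def algebra_simps)
  also have "(\<Sum>j\<in>N. if i = j then 2 * f j else 0) = 2 * f i" using i finN by simp
  also have "(\<Sum>j\<in>N. int (card {h \<in> arrows Q. src Q h = i \<and> tgt Q h = j}) * f j) =
      (\<Sum>j\<in>N. \<Sum>h | h \<in> {h \<in> arrows Q. src Q h = i} \<and> tgt Q h = j. f (tgt Q h))"
    by (rule sum.cong) (auto simp: conj_assoc)
  also have "\<dots> = (\<Sum>h | h \<in> arrows Q \<and> src Q h = i. f (tgt Q h))"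
    by (rule sum.group) (use finA finN bar(6) in auto)
  finally show ?thesis .
qed

lemma regular_weight:
  assumes i: "i \<in> N"
  shows "2 * int (v i) - (\<Sum>h | h \<in> Om \<and> src Q h = i. int (v (tgt Q h))) - (\<Sum>h | h \<in> Om \<and> tgt Q h = i. int (v (src Q h))) < int (d i)"
proof -
  have "(\<Sum>h | h \<in> arrows Q \<and> src Q h = i. int (v (tgt Q h))) = (\<Sum>h\<in>arrows Q. if src Q h = i then int (v (tgt Q h)) else 0)"
    by (rule sum.inter_filter[OF finA])
  also have "\<dots> = (\<Sum>h\<in>Om. if src Q h = i then int (v (tgt Q h)) else 0) + (\<Sum>h\<in>Op. if src Q h = i then int (v (tgt Q h)) else 0)"
    unfolding arrows_split(1) by (rule sum.union_disjoint[OF finOm arrows_split(2)])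
  also have "(\<Sum>h\<in>Op. if src Q h = i then int (v (tgt Q h)) else 0) = (\<Sum>h\<in>Op. if tgt Q (bar Q h) = i then int (v (src Q (bar Q h))) else 0)"
    by (rule sum.cong) (auto simp: Op_def bar)
  also have "\<dots> = (\<Sum>h\<in>Om. if tgt Q h = i then int (v (src Q h)) else 0)"
    by (rule sum.reindex_bij_betw[OF bar_bij])
  finally have "(\<Sum>h | h \<in> arrows Q \<and> src Q h = i. int (v (tgt Q h))) =
    (\<Sum>h | h \<in> Om \<and> src Q h = i. int (v (tgt Q h))) + (\<Sum>h | h \<in> Om \<and> tgt Q h = i. int (v (src Q h)))"
    by (simp add: sum.inter_filter[OF finOm(1)])
  moreover have "int (d i) - (\<Sum>j\<in>N. cartan Q i j * int (v j)) > 0" using reg i by (simp add: weight_pairing_def N_def)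
  ultimately show ?thesis using cartan_sum[OF i, of "\<lambda>j. int (v j)"] by simp
qed

text \<open>The Cartan matrix counts each edge in both directions, so its quadratic form is twice the Tits form.\<close>

lemma tits_form_positive:
  fixes a :: "nat \<Rightarrow> int"
  assumes "\<exists>i\<in>N. a i \<noteq> 0"
  shows "(\<Sum>h\<in>Om. a (tgt Q h) * a (src Q h)) < (\<Sum>i\<in>N. a i * a i)"
proof -
  have "(\<Sum>i\<in>verts Q. \<Sum>j\<in>verts Q. of_int (cartan Q i j) * real_of_int (a i) * real_of_int (a j)) > 0"
  proof -
    have "\<exists>i\<in>verts Q. real_of_int (a i) \<noteq> 0" using assms by (auto simp: N_def)
    with spec[OF ft[unfolded finite_type_def], of "\<lambda>i. real_of_int (a i)"] show ?thesis by simp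
  qed
  also have "(\<Sum>i\<in>verts Q. \<Sum>j\<in>verts Q. of_int (cartan Q i j) * real_of_int (a i) * real_of_int (a j)) =
    real_of_int (\<Sum>i\<in>N. a i * (\<Sum>j\<in>N. cartan Q i j * a j))" by (simp add: N_def sum_distrib_left mult_ac)
  finally have "0 < (\<Sum>i\<in>N. a i * (\<Sum>j\<in>N. cartan Q i j * a j))" by (simp only: of_int_0_less_iff)
  also have "\<dots> = (\<Sum>i\<in>N. 2 * (a i * a i) - (\<Sum>h | h \<in> arrows Q \<and> src Q h = i. a (src Q h) * a (tgt Q h)))"
  proof (rule sum.cong[OF refl])
    fix i assume "i \<in> N"
    moreover have "(\<Sum>h | h \<in> arrows Q \<and> src Q h = i. a (src Q h) * a (tgt Q h)) = a i * (\<Sum>h | h \<in> arrows Q \<and> src Q h = i. a (tgt Q h))"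
      by (auto simp: sum_distrib_left intro!: sum.cong)
    ultimately show "a i * (\<Sum>j\<in>N. cartan Q i j * a j) = 2 * (a i * a i) - (\<Sum>h | h \<in> arrows Q \<and> src Q h = i. a (src Q h) * a (tgt Q h))"
      by (simp add: cartan_sum right_diff_distrib)
  qed
  also have "\<dots> = 2 * (\<Sum>i\<in>N. a i * a i) - (\<Sum>h\<in>arrows Q. a (src Q h) * a (tgt Q h))"
    using sum.group[OF finA finN, of "src Q" "\<lambda>h. a (src Q h) * a (tgt Q h)"] bar(5) by (simp add: sum_subtractf sum_distrib_left image_subset_iff)
  also have "(\<Sum>h\<in>arrows Q. a (src Q h) * a (tgt Q h)) = 2 * (\<Sum>h\<in>Om. a (tgt Q h) * a (src Q h))"
  proof -
    have "(\<Sum>h\<in>arrows Q. a (src Q h) * a (tgt Q h)) = (\<Sum>h\<in>Op. 2 * (a (tgt Q (bar Q h)) * a (src Q (bar Q h))))"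
      unfolding sum_arrows by (rule sum.cong) (auto simp: Op_def bar)
    also have "\<dots> = (\<Sum>h\<in>Om. 2 * (a (tgt Q h) * a (src Q h)))" by (rule sum.reindex_bij_betw[OF bar_bij])
    finally show ?thesis by (simp add: sum_distrib_left)
  qed
  finally show ?thesis by simp
qed

lemma Om_ends: "h \<in> Om \<Longrightarrow> src Q h \<in> N" "h \<in> Om \<Longrightarrow> tgt Q h \<in> N"
  unfolding Om_def using bar(5,6) by blast+

sublocale pq: positive_quiver N Om "src Q" "tgt Q"
  by (intro positive_quiver.intro quiver_shape.intro positive_quiver_axioms.intro finN finOm Om_ends tits_form_positive)

definition "Ib = blk CB Om (\<lambda>h. v (tgt Q h)) (\<lambda>h. v (src Q h)) \<union> blk CD N d v"
definition "Iy = blk CB Op (\<lambda>h. v (tgt Q h)) (\<lambda>h. v (src Q h)) \<union> blk CG N v d"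

definition "eqs = blk (\<lambda>i p q. (i, p, q)) N v v"
definition "neqs = card eqs"
definition en :: "nat \<Rightarrow> nat \<times> nat \<times> nat" where "en = (SOME b. bij_betw b {..<neqs} eqs)"

lemma finite_eqs: "finite eqs" unfolding eqs_def by (rule finite_blk[OF finN])

lemma en: "bij_betw en {..<neqs} eqs"
  unfolding en_def by (rule someI_ex[OF ex_bij_betw_nat_finite[OF finite_eqs, unfolded atLeast0LessThan, folded neqs_def]])

lemma sum_eqs: "sum f eqs = (\<Sum>i\<in>N. \<Sum>p<v i. \<Sum>q<v i. f (i, p, q))"
  unfolding eqs_def by (rule sum_blk[OF finN]) auto

text \<open>The index (i, p, q) stands for the entry (p, q) of the moment map at i. An arrow h of negative sign occurs
  in the products B_bar h B_h at its source and, with a sign, B_h B_bar h at its target.\<close>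

fun coeff :: "nat \<times> nat \<times> nat \<Rightarrow> 'h coord \<Rightarrow> ('h coord \<Rightarrow> complex) \<Rightarrow> complex" where
  "coeff (i, p, q) (CB h r c) = (\<lambda>x. (if i = src Q h \<and> q = c then x (CB (bar Q h) p r) else 0) - (if i = tgt Q h \<and> p = r then x (CB (bar Q h) c q) else 0))"
| "coeff (i, p, q) (CG j r c) = (\<lambda>x. if i = j \<and> p = r then x (CD i c q) else 0)"
| "coeff (i, p, q) (CD j r c) = (\<lambda>x. 0)"

lemma sum_fix_second:
  assumes "a \<in> N" "c < v a"
  shows "(\<Sum>i\<in>N. \<Sum>p<v i. \<Sum>q<v i. if i = a \<and> q = c then F i p q else (0::complex)) = (\<Sum>p<v a. F a p c)"
proof -
  have "(\<Sum>i\<in>N. \<Sum>p<v i. \<Sum>q<v i. if i = a \<and> q = c then F i p q else 0) = (\<Sum>i\<in>N. if i = a then \<Sum>p<v a. F a p c else 0)"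
    by (rule sum.cong) (use assms in auto)
  then show ?thesis using assms finN by simp
qed

lemma sum_fix_first:
  assumes "a \<in> N" "c < v a"
  shows "(\<Sum>i\<in>N. \<Sum>p<v i. \<Sum>q<m i. if i = a \<and> p = c then F i p q else (0::complex)) = (\<Sum>q<m a. F a c q)"
proof -
  have "(\<Sum>p<v a. \<Sum>q<m a. if p = c then F a p q else 0) = (\<Sum>p<v a. if p = c then \<Sum>q<m a. F a c q else 0)" 
    by (rule sum.cong) auto
  then have "(\<Sum>i\<in>N. \<Sum>p<v i. \<Sum>q<m i. if i = a \<and> p = c then F i p q else 0) = (\<Sum>i\<in>N. if i = a then \<Sum>q<m a. F a c q else 0)"
    by (intro sum.cong) (use assms in auto)
  then show ?thesis using assms finN by simp
qed

lemma relation_arrow: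
  assumes h: "h \<in> Op" and r: "r < v (tgt Q h)" and c: "c < v (src Q h)"
  shows "(\<Sum>e\<in>eqs. \<xi> e * coeff e (CB h r c) b) =
    (\<Sum>p<v (src Q h). \<xi> (src Q h, p, c) * b (CB (bar Q h) p r)) - (\<Sum>q<v (tgt Q h). \<xi> (tgt Q h, r, q) * b (CB (bar Q h) c q))"
proof -
  have N: "src Q h \<in> N" "tgt Q h \<in> N" using h bar by (auto simp: Op_def)
  have "(\<Sum>e\<in>eqs. \<xi> e * coeff e (CB h r c) b) =
    (\<Sum>i\<in>N. \<Sum>p<v i. \<Sum>q<v i. if i = src Q h \<and> q = c then \<xi> (i, p, q) * b (CB (bar Q h) p r) else 0) -
    (\<Sum>i\<in>N. \<Sum>p<v i. \<Sum>q<v i. if i = tgt Q h \<and> p = r then \<xi> (i, p, q) * b (CB (bar Q h) c q) else 0)"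
    unfolding sum_eqs sum_subtractf[symmetric] by (intro sum.cong refl) (simp add: right_diff_distrib)
  then show ?thesis by (simp add: sum_fix_second[OF N(1) c] sum_fix_first[OF N(2) r])
qed

lemma relation_vertex:
  assumes j: "j \<in> N" and r: "r < v j"
  shows "(\<Sum>e\<in>eqs. \<xi> e * coeff e (CG j r c) b) = (\<Sum>q<v j. \<xi> (j, r, q) * b (CD j c q))"
proof -
  have "(\<Sum>e\<in>eqs. \<xi> e * coeff e (CG j r c) b) = (\<Sum>i\<in>N. \<Sum>p<v i. \<Sum>q<v i. if i = j \<and> p = r then \<xi> (i, p, q) * b (CD i c q) else 0)"
    unfolding sum_eqs by (intro sum.cong refl) simp
  then show ?thesis by (simp add: sum_fix_first[OF j r])
qed

lemma coeff_homog:
  assumes e: "e \<in> eqs" and k: "k \<in> Iy"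
  shows "homog Ib 1 (coeff e k)"
proof -
  obtain i p q where e: "e = (i, p, q)" "i \<in> N" "p < v i" "q < v i" using e unfolding eqs_def by (rule blkE)
  have if_homog: "homog Ib 1 (\<lambda>x. if P then x l else 0)" if "P \<Longrightarrow> l \<in> Ib" for P l
    using that homog_coord[of l Ib] homog_zero[of Ib 1] by (cases P) auto
  from k consider h r c where "k = CB h r c" "h \<in> Op" "r < v (tgt Q h)" "c < v (src Q h)"
    | j r c where "k = CG j r c" "j \<in> N" "r < v j" "c < d j"
    unfolding Iy_def Un_iff by (elim disjE blkE) auto
  then show ?thesis
  proof cases
    case 1
    have b: "bar Q h \<in> Om" "tgt Q (bar Q h) = src Q h" "src Q (bar Q h) = tgt Q h" using 1(2) by (auto simp: Om_def Op_def bar)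
    have "CB (bar Q h) p r \<in> Ib" if "i = src Q h \<and> q = c"
      unfolding Ib_def by (rule UnI1, rule blkI) (use that b e 1 in auto)
    moreover have "CB (bar Q h) c q \<in> Ib" if "i = tgt Q h \<and> p = r"
      unfolding Ib_def by (rule UnI1, rule blkI) (use that b e 1 in auto)
    ultimately show ?thesis unfolding e(1) 1(1) coeff.simps by (intro homog_diff if_homog) auto
  next
    case 2
    have "CD i c q \<in> Ib" if "i = j \<and> p = r"
      unfolding Ib_def by (rule UnI2, rule blkI) (use that e 2 in auto)
    then show ?thesis unfolding e(1) 2(1) coeff.simps by (intro if_homog) auto
  qed
qed

lemma card_Ib: "int (card Ib) = (\<Sum>h\<in>Om. int (v (tgt Q h)) * int (v (src Q h))) + (\<Sum>i\<in>N. int (d i) * int (v i))"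
proof -
  have "blk CB Om (\<lambda>h. v (tgt Q h)) (\<lambda>h. v (src Q h)) \<inter> blk CD N d v = {}" by (auto elim!: blkE)
  then have "int (card Ib) = int (card (blk CB Om (\<lambda>h. v (tgt Q h)) (\<lambda>h. v (src Q h)))) + int (card (blk (CD :: _ \<Rightarrow> _ \<Rightarrow> _ \<Rightarrow> 'h coord) N d v))"
    unfolding Ib_def using finOm finN by (subst card_Un_disjoint) (auto intro: finite_blk)
  then show ?thesis using card_blk[of Om "CB :: 'h \<Rightarrow> _" "\<lambda>h. v (tgt Q h)" "\<lambda>h. v (src Q h)"]
    card_blk[of N "CD :: nat \<Rightarrow> nat \<Rightarrow> nat \<Rightarrow> 'h coord" d v] finOm finN by simp
qed

text \<open>After transposition a relation between the rows is an endomorphism of V: the coefficients of an arrow give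
  the commutation with its reverse, those of gamma the equation delta xi = 0.\<close>

lemma growth_relation_variety:
  "growth {(b, \<xi>). (\<exists>e<neqs. \<xi> e \<noteq> 0) \<and> (\<forall>k\<in>Iy. (\<Sum>e<neqs. \<xi> e * coeff (en e) k b) = 0)}
    ((\<lambda>k (b, \<xi>). b k) ` Ib \<union> (\<lambda>e (b, \<xi>). \<xi> e) ` {..<neqs}) (int (card Ib) - 2)" (is "growth ?Z ?F _")
proof -
  define num where "num = inv_into {..<neqs} en"
  have num: "num (en e) = e" if "e < neqs" for e using bij_betw_inv_into_left[OF en] that by (simp add: num_def)
  have num': "num e < neqs" "en (num e) = e" if "e \<in> eqs" for e
    using bij_betw_inv_into_right[OF en that] bij_betwE[OF bij_betw_inv_into[OF en]] that by (auto simp: num_def)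
  define x where "x = (\<lambda>z :: ('h coord \<Rightarrow> complex) \<times> (nat \<Rightarrow> complex). \<lambda>h p q. fst z (CB h p q))"
  define \<xi> where "\<xi> = (\<lambda>z :: ('h coord \<Rightarrow> complex) \<times> (nat \<Rightarrow> complex). \<lambda>i p q. snd z (num (i, q, p)))"
  define \<delta> where "\<delta> = (\<lambda>z :: ('h coord \<Rightarrow> complex) \<times> (nat \<Rightarrow> complex). \<lambda>i p q. fst z (CD i p q))"
  let ?V = "\<lambda>i. {..<v i}" and ?D = "\<lambda>i. {..<d i}"
  let ?W = "pq.arrow_funs ?V (\<lambda>h p q z. x z h p q) \<union> pq.vertex_funs ?V ?V (\<lambda>i p q z. \<xi> z i p q) \<union> pq.vertex_funs ?D ?V (\<lambda>i p q z. \<delta> z i p q)"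
  have rel: "(\<Sum>e\<in>eqs. snd z (num e) * coeff e k (fst z)) = 0" if "z \<in> ?Z" "k \<in> Iy" for z k
  proof -
    have "(\<Sum>e\<in>eqs. snd z (num e) * coeff e k (fst z)) = (\<Sum>e<neqs. snd z (num (en e)) * coeff (en e) k (fst z))"
      by (rule sum.reindex_bij_betw[OF en, symmetric])
    then show ?thesis using that by (auto simp: num)
  qed
  have "growth ?Z ?W
    ((\<Sum>h\<in>Om. int (card (?V (tgt Q h))) * int (card (?V (src Q h)))) + (\<Sum>i\<in>N. int (card (?D i)) * int (card (?V i))) - 2)"
  proof (rule pq.growth_relations)
    show "(x z, \<xi> z) \<in> pq.commuting ?V" if z: "z \<in> ?Z" for z
      unfolding pq.commuting_def
    proof (clarify)
      fix g c r assume g: "g \<in> Om" "c < v (tgt Q g)" "r < v (src Q g)"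
      define h where "h = bar Q g"
      have h: "h \<in> Op" "bar Q h = g" "src Q h = tgt Q g" "tgt Q h = src Q g" using g(1) by (auto simp: Om_def Op_def h_def bar)
      have "CB h r c \<in> Iy" unfolding Iy_def by (rule UnI1, rule blkI) (use h g in auto)
      from rel[OF z this] relation_arrow[OF h(1), of r c "\<lambda>e. snd z (num e)" "fst z"] h g
      show "mm (?V (tgt Q g)) (\<xi> z (tgt Q g)) (x z g) c r = mm (?V (src Q g)) (x z g) (\<xi> z (src Q g)) c r"
        by (simp add: mm_def \<xi>_def x_def mult.commute)
    qed
    show "mm (?V i) (\<delta> z i) (\<xi> z i) a q = 0" if z: "z \<in> ?Z" and i: "i \<in> N" and a: "a \<in> ?D i" and q: "q \<in> ?V i" for z i a q
    proof -
      have "CG i q a \<in> Iy" unfolding Iy_def by (rule UnI2, rule blkI) (use i a q in auto)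
      from rel[OF z this] relation_vertex[OF i, of q "\<lambda>e. snd z (num e)" a "fst z"] q
      show ?thesis by (simp add: mm_def \<xi>_def \<delta>_def mult.commute)
    qed
    show "\<exists>i\<in>N. \<exists>p\<in>?V i. \<exists>q\<in>?V i. \<xi> z i p q \<noteq> 0" if z: "z \<in> ?Z" for z
    proof -
      obtain e where e: "e < neqs" "snd z e \<noteq> 0" using z by auto
      have "en e \<in> eqs" using bij_betwE[OF en] e(1) by auto
      then obtain i p q where i: "en e = (i, p, q)" "i \<in> N" "p < v i" "q < v i" unfolding eqs_def by (rule blkE)
      show ?thesis by (rule bexI[of _ i], rule bexI[of _ q], rule bexI[of _ p]) (use i e num[OF e(1)] in \<open>auto simp: \<xi>_def\<close>)
    qed
  qed (use regular_weight in auto)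
  then have "growth ?Z ?W
    (int (card Ib) - 2)" by (simp add: card_Ib)
  then show ?thesis
  proof (rule growth_mono)
    show "?F \<subseteq> ?W"
    proof
      fix f assume "f \<in> ?F"
      then consider k where "k \<in> Ib" "f = (\<lambda>(b, \<xi>). b k)" | e where "e < neqs" "f = (\<lambda>(b, \<xi>). \<xi> e)" by auto
      then show "f \<in> ?W"
      proof cases
        case 1
        from 1(1) consider h p q where "k = CB h p q" "h \<in> Om" "p < v (tgt Q h)" "q < v (src Q h)"
          | j p q where "k = CD j p q" "j \<in> N" "p < d j" "q < v j"
          unfolding Ib_def Un_iff by (elim disjE blkE) auto
        then show ?thesis
        proof cases
          case 1
          have "(\<lambda>z. x z h p q) \<in> pq.arrow_funs ?V (\<lambda>h p q z. x z h p q)"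
            using pq.arrow_funsI[of h p ?V q "\<lambda>h p q z. x z h p q"] 1 by simp
          moreover have "f = (\<lambda>z. x z h p q)" using \<open>f = _\<close> 1 by (auto simp: x_def)
          ultimately show ?thesis by simp
        next
          case 2
          have "(\<lambda>z. \<delta> z j p q) \<in> pq.vertex_funs ?D ?V (\<lambda>i p q z. \<delta> z i p q)"
            using pq.vertex_funsI[of j p ?D q ?V "\<lambda>i p q z. \<delta> z i p q"] 2 by simp
          moreover have "f = (\<lambda>z. \<delta> z j p q)" using \<open>f = _\<close> 2 by (auto simp: \<delta>_def)
          ultimately show ?thesis by simp
        qed
      next
        case 2
        have "en e \<in> eqs" using bij_betwE[OF en] 2(1) by auto
        then obtain i p q where i: "en e = (i, p, q)" "i \<in> N" "p < v i" "q < v i" unfolding eqs_def by (rule blkE)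
        have "(\<lambda>z. \<xi> z i q p) \<in> pq.vertex_funs ?V ?V (\<lambda>i p q z. \<xi> z i p q)"
          using pq.vertex_funsI[of i q ?V p ?V "\<lambda>i p q z. \<xi> z i p q"] i by simp
        moreover have "f = (\<lambda>z. \<xi> z i q p)" using 2 i num[OF 2(1)] by (auto simp: \<xi>_def)
        ultimately show ?thesis by simp
      qed
    qed
  qed auto
qed

sublocale lf: linear_fibration Ib Iy neqs "\<lambda>e. coeff (en e)"
proof
  show "finite Ib" "finite Iy" unfolding Ib_def Iy_def using finOm finN by (auto intro: finite_blk)
  show "Ib \<inter> Iy = {}" unfolding Ib_def Iy_def using arrows_split(2) by (auto elim!: blkE)
  show "homog Ib 1 (coeff (en e) k)" if "e < neqs" "k \<in> Iy" for e k
    using bij_betwE[OF en] that by (intro coeff_homog) auto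
qed (rule growth_relation_variety)

end

section \<open>The zero set of the moment map\<close>

context regular_quiver begin

fun val :: "'h qpoint \<Rightarrow> 'h coord \<Rightarrow> complex" where
  "val (B, \<gamma>, \<delta>) (CB h r c) = B h $$ (r, c)"
| "val (B, \<gamma>, \<delta>) (CG i r c) = \<gamma> i $$ (r, c)"
| "val (B, \<gamma>, \<delta>) (CD i r c) = \<delta> i $$ (r, c)"

definition pt :: "('h coord \<Rightarrow> complex) \<Rightarrow> 'h qpoint" where
  "pt x = (\<lambda>h\<in>arrows Q. mat (v (tgt Q h)) (v (src Q h)) (\<lambda>(r, c). x (CB h r c)),
    \<lambda>i\<in>verts Q. mat (v i) (d i) (\<lambda>(r, c). x (CG i r c)), \<lambda>i\<in>verts Q. mat (d i) (v i) (\<lambda>(r, c). x (CD i r c)))"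

lemma K_coords: "k \<in> lf.K \<longleftrightarrow> (\<exists>h r c. k = CB h r c \<and> h \<in> arrows Q \<and> r < v (tgt Q h) \<and> c < v (src Q h)) \<or>
  (\<exists>i r c. k = CG i r c \<and> i \<in> verts Q \<and> r < v i \<and> c < d i) \<or> (\<exists>i r c. k = CD i r c \<and> i \<in> verts Q \<and> r < d i \<and> c < v i)" (is "_ \<longleftrightarrow> ?R")
proof
  assume "k \<in> lf.K"
  then consider "k \<in> blk CB Om (\<lambda>h. v (tgt Q h)) (\<lambda>h. v (src Q h))" | "k \<in> blk CD N d v"
    | "k \<in> blk CB Op (\<lambda>h. v (tgt Q h)) (\<lambda>h. v (src Q h))" | "k \<in> blk CG N v d"
    unfolding lf.K_def unfolding Ib_def Iy_def by blast
  then show ?R by cases (auto elim!: blkE simp: arrows_split(1) N_def)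
next
  assume ?R
  then consider h r c where "k = CB h r c" "h \<in> Om \<or> h \<in> Op" "r < v (tgt Q h)" "c < v (src Q h)"
    | i r c where "k = CG i r c" "i \<in> N" "r < v i" "c < d i"
    | i r c where "k = CD i r c" "i \<in> N" "r < d i" "c < v i" unfolding N_def arrows_split(1) by blast
  then show "k \<in> lf.K" unfolding lf.K_def unfolding Ib_def Iy_def by cases (auto intro: blkI)
qed

lemma rep_coords_val: "rep_coords Q d v = (\<lambda>k s. val s k) ` lf.K"
proof -
  have "val s (CB h r c) = (case s of (B, \<gamma>, \<delta>) \<Rightarrow> B h $$ (r, c))" for s h r c by (cases s) simp
  moreover have "val s (CG i r c) = (case s of (B, \<gamma>, \<delta>) \<Rightarrow> \<gamma> i $$ (r, c))" for s i r c by (cases s) simp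
  moreover have "val s (CD i r c) = (case s of (B, \<gamma>, \<delta>) \<Rightarrow> \<delta> i $$ (r, c))" for s i r c by (cases s) simp
  ultimately have eq: "(\<lambda>s. val s (CB h r c)) = (\<lambda>(B, \<gamma>, \<delta>). B h $$ (r, c))" "(\<lambda>s. val s (CG i r c)) = (\<lambda>(B, \<gamma>, \<delta>). \<gamma> i $$ (r, c))"
    "(\<lambda>s. val s (CD i r c)) = (\<lambda>(B, \<gamma>, \<delta>). \<delta> i $$ (r, c))" for h i r c by auto
  show ?thesis
  proof (intro equalityI subsetI)
    fix f assume "f \<in> rep_coords Q d v"
    then show "f \<in> (\<lambda>k s. val s k) ` lf.K" unfolding rep_coords_def eq[symmetric] Un_iff mem_Collect_eq
      by (elim disjE exE conjE) (auto simp: K_coords)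
  next
    fix f assume "f \<in> (\<lambda>k s. val s k) ` lf.K"
    then obtain k where k: "k \<in> lf.K" "f = (\<lambda>s. val s k)" by auto
    from k(1) consider h r c where "k = CB h r c" "h \<in> arrows Q" "r < v (tgt Q h)" "c < v (src Q h)"
      | i r c where "k = CG i r c" "i \<in> verts Q" "r < v i" "c < d i"
      | i r c where "k = CD i r c" "i \<in> verts Q" "r < d i" "c < v i" unfolding K_coords by blast
    then show "f \<in> rep_coords Q d v"
    proof cases
      case 1 then show ?thesis unfolding rep_coords_def k(2) 1(1) eq by (intro UnI1 CollectI exI[of _ h] exI[of _ r] exI[of _ c]) auto
    next
      case 2 then show ?thesis unfolding rep_coords_def k(2) 2(1) eq by (intro UnI1 UnI2 CollectI exI[of _ i] exI[of _ r] exI[of _ c]) auto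
    next
      case 3 then show ?thesis unfolding rep_coords_def k(2) 3(1) eq by (intro UnI2 CollectI exI[of _ i] exI[of _ r] exI[of _ c]) auto
    qed
  qed
qed

lemma polyfuns_val: "f \<in> polyfuns (rep_coords Q d v) \<Longrightarrow> \<exists>p\<in>polys lf.K. \<forall>s. f s = p (val s)"
proof (induction rule: polyfuns.induct)
  case (const c)
  show ?case by (rule bexI[of _ "\<lambda>_. c"]) (auto intro: polyfuns.const)
next
  case (coord f)
  then obtain k where "k \<in> lf.K" "f = (\<lambda>s. val s k)" unfolding rep_coords_val by auto
  then show ?case by (intro bexI[of _ "\<lambda>x. x k"] polys_coord) auto
next
  case (add f g)
  then obtain p q where "p \<in> polys lf.K" "q \<in> polys lf.K" "\<forall>s. f s = p (val s)" "\<forall>s. g s = q (val s)" by blast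
  then show ?case by (intro bexI[of _ "\<lambda>x. p x + q x"] polyfuns.add) auto
next
  case (mult f g)
  then obtain p q where "p \<in> polys lf.K" "q \<in> polys lf.K" "\<forall>s. f s = p (val s)" "\<forall>s. g s = q (val s)" by blast
  then show ?case by (intro bexI[of _ "\<lambda>x. p x * q x"] polyfuns.mult) auto
qed

lemma val_polyfuns: "p \<in> polys lf.K \<Longrightarrow> (\<lambda>s. p (val s)) \<in> polyfuns (rep_coords Q d v)"
  using polys_subst[of p lf.K "\<lambda>k s. val s k" "rep_coords Q d v"] unfolding rep_coords_val by (auto intro: polyfuns.coord)

lemma pt_rep: "pt x \<in> rep_space Q d v"
  by (simp add: pt_def rep_space_def)

lemma val_pt: "k \<in> lf.K \<Longrightarrow> val (pt x) k = x k"
  by (auto simp: K_coords pt_def)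

lemma moment_entry:
  assumes s: "(B, \<gamma>, \<delta>) \<in> rep_space Q d v" and i: "i \<in> verts Q"
  shows "moment Q v (B, \<gamma>, \<delta>) i \<in> carrier_mat (v i) (v i)"
    and "p < v i \<Longrightarrow> q < v i \<Longrightarrow> moment Q v (B, \<gamma>, \<delta>) i $$ (p, q) =
      (\<Sum>h | h \<in> arrows Q \<and> tgt Q h = i. of_int (eps Q h) * (\<Sum>w<v (src Q h). B h $$ (p, w) * B (bar Q h) $$ (w, q))) +
      (\<Sum>w<d i. \<gamma> i $$ (p, w) * \<delta> i $$ (w, q))"
proof -
  let ?A = "{h \<in> arrows Q. tgt Q h = i}" and ?F = "\<lambda>h. of_int (eps Q h) \<cdot>\<^sub>m (B h * B (bar Q h))"
  have B: "B h \<in> carrier_mat (v (tgt Q h)) (v (src Q h))" if "h \<in> arrows Q" for h using s that by (auto simp: rep_space_def)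
  have BB: "B h \<in> carrier_mat (v i) (v (src Q h))" "B (bar Q h) \<in> carrier_mat (v (src Q h)) (v i)" if "h \<in> ?A" for h
    using B[of h] B[of "bar Q h"] that bar by auto
  have F: "?F h \<in> carrier_mat (v i) (v i)" if "h \<in> ?A" for h using BB[OF that] by auto
  have \<gamma>: "\<gamma> i \<in> carrier_mat (v i) (d i)" "\<delta> i \<in> carrier_mat (d i) (v i)" using s i by (auto simp: rep_space_def)
  have fin: "finite ?A" using finA by simp
  note fs = finsum_mat_entry[of ?A ?F, OF fin F]
  show 1: "moment Q v (B, \<gamma>, \<delta>) i \<in> carrier_mat (v i) (v i)" using fs \<gamma> by (simp add: moment_def)
  assume p: "p < v i" and q: "q < v i"
  have "?F h $$ (p, q) = of_int (eps Q h) * (\<Sum>w<v (src Q h). B h $$ (p, w) * B (bar Q h) $$ (w, q))" if "h \<in> ?A" for h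
    using BB[OF that] p q by (auto simp: scalar_prod_def atLeast0LessThan)
  then have "(\<Sum>h\<in>?A. ?F h $$ (p, q)) = (\<Sum>h | h \<in> arrows Q \<and> tgt Q h = i. of_int (eps Q h) * (\<Sum>w<v (src Q h). B h $$ (p, w) * B (bar Q h) $$ (w, q)))"
    by (rule sum.cong[OF refl])
  moreover have "(\<gamma> i * \<delta> i) $$ (p, q) = (\<Sum>w<d i. \<gamma> i $$ (p, w) * \<delta> i $$ (w, q))"
    using \<gamma> p q by (auto simp: scalar_prod_def atLeast0LessThan)
  ultimately show "moment Q v (B, \<gamma>, \<delta>) i $$ (p, q) =
      (\<Sum>h | h \<in> arrows Q \<and> tgt Q h = i. of_int (eps Q h) * (\<Sum>w<v (src Q h). B h $$ (p, w) * B (bar Q h) $$ (w, q))) +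
      (\<Sum>w<d i. \<gamma> i $$ (p, w) * \<delta> i $$ (w, q))" using fs \<gamma> p q by (simp add: moment_def)
qed

lemma mu_moment:
  assumes s: "s \<in> rep_space Q d v" and e: "e < neqs" "en e = (i, p, q)"
  shows "lf.\<mu> e (val s) = moment Q v s i $$ (p, q)"
proof -
  have "(i, p, q) \<in> eqs" using bij_betwE[OF en] e by force
  then have ipq: "i \<in> N" "p < v i" "q < v i" by (auto simp: eqs_def elim: blkE)
  obtain B \<gamma> \<delta> where sB: "s = (B, \<gamma>, \<delta>)" by (cases s)
  let ?b = "\<lambda>h r c. B h $$ (r, c)"
  have "lf.\<mu> e (val s) = (\<Sum>k\<in>Iy. coeff (i, p, q) k (val s) * val s k)" by (simp add: lf.\<mu>_def e)
  also have "\<dots> = (\<Sum>k\<in>blk CB Op (\<lambda>h. v (tgt Q h)) (\<lambda>h. v (src Q h)). coeff (i, p, q) k (val s) * val s k) +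
      (\<Sum>k\<in>blk CG N v d. coeff (i, p, q) k (val s) * val s k)"
    unfolding Iy_def by (rule sum.union_disjoint) (use finOm finN in \<open>auto intro: finite_blk elim!: blkE\<close>)
  also have "(\<Sum>k\<in>blk CG N v d. coeff (i, p, q) k (val s) * val s k) =
      (\<Sum>j\<in>N. \<Sum>r<v j. \<Sum>c<d j. if j = i \<and> r = p then \<gamma> j $$ (r, c) * \<delta> j $$ (c, q) else 0)"
    by (subst sum_blk[OF finN]) (auto simp: sB intro!: sum.cong)
  also have "\<dots> = (\<Sum>c<d i. \<gamma> i $$ (p, c) * \<delta> i $$ (c, q))" by (rule sum_fix_first[OF ipq(1,2)])
  also have "(\<Sum>k\<in>blk CB Op (\<lambda>h. v (tgt Q h)) (\<lambda>h. v (src Q h)). coeff (i, p, q) k (val s) * val s k) =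
      (\<Sum>h\<in>Op. \<Sum>r<v (tgt Q h). \<Sum>c<v (src Q h). coeff (i, p, q) (CB h r c) (val s) * val s (CB h r c))"
    by (subst sum_blk[OF finOm(2)]) auto
  also have "\<dots> = (\<Sum>h\<in>Op. (if tgt Q h = i then of_int (eps Q h) * (\<Sum>w<v (src Q h). ?b h p w * ?b (bar Q h) w q) else 0) +
      (if tgt Q (bar Q h) = i then of_int (eps Q (bar Q h)) * (\<Sum>w<v (src Q (bar Q h)). ?b (bar Q h) p w * ?b (bar Q (bar Q h)) w q) else 0))"
  proof (rule sum.cong[OF refl])
    fix h assume "h \<in> Op"
    then have h: "h \<in> arrows Q" "eps Q h = -1" by (auto simp: Op_def)
    note hb = bar(2-4,7)[OF h(1)]
    have "(\<Sum>r<v (tgt Q h). \<Sum>c<v (src Q h). coeff (i, p, q) (CB h r c) (val s) * val s (CB h r c)) =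
      (\<Sum>r<v (tgt Q h). \<Sum>c<v (src Q h). (if q = c then (if i = src Q h then ?b (bar Q h) p r * ?b h r c else 0) else 0)) -
      (\<Sum>r<v (tgt Q h). if p = r then (\<Sum>c<v (src Q h). if i = tgt Q h then ?b (bar Q h) c q * ?b h r c else 0) else 0)"
      unfolding sum_subtractf[symmetric]
    proof (rule sum.cong[OF refl])
      fix r
      have "(if p = r then (\<Sum>c<v (src Q h). if i = tgt Q h then ?b (bar Q h) c q * ?b h r c else 0) else 0) =
        (\<Sum>c<v (src Q h). if i = tgt Q h \<and> p = r then ?b (bar Q h) c q * ?b h r c else 0)" by auto
      then show "(\<Sum>c<v (src Q h). coeff (i, p, q) (CB h r c) (val s) * val s (CB h r c)) =
        (\<Sum>c<v (src Q h). (if q = c then (if i = src Q h then ?b (bar Q h) p r * ?b h r c else 0) else 0)) -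
        (if p = r then (\<Sum>c<v (src Q h). if i = tgt Q h then ?b (bar Q h) c q * ?b h r c else 0) else 0)"
        by (simp only: sum_subtractf[symmetric]) (intro sum.cong refl, simp add: sB left_diff_distrib)
    qed
    also have "(\<Sum>r<v (tgt Q h). \<Sum>c<v (src Q h). (if q = c then (if i = src Q h then ?b (bar Q h) p r * ?b h r c else 0) else 0)) =
      (if i = src Q h then (\<Sum>r<v (tgt Q h). ?b (bar Q h) p r * ?b h r q) else 0)"
      using ipq(3) by (cases "i = src Q h") (auto intro!: sum.neutral)
    also have "(\<Sum>r<v (tgt Q h). if p = r then (\<Sum>c<v (src Q h). if i = tgt Q h then ?b (bar Q h) c q * ?b h r c else 0) else 0) =
      (if i = tgt Q h then (\<Sum>c<v (src Q h). ?b (bar Q h) c q * ?b h p c) else 0)"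
      using ipq(2) by (cases "i = tgt Q h") (auto intro!: sum.neutral)
    finally show "(\<Sum>r<v (tgt Q h). \<Sum>c<v (src Q h). coeff (i, p, q) (CB h r c) (val s) * val s (CB h r c)) =
      (if tgt Q h = i then of_int (eps Q h) * (\<Sum>w<v (src Q h). ?b h p w * ?b (bar Q h) w q) else 0) +
      (if tgt Q (bar Q h) = i then of_int (eps Q (bar Q h)) * (\<Sum>w<v (src Q (bar Q h)). ?b (bar Q h) p w * ?b (bar Q (bar Q h)) w q) else 0)"
      unfolding hb h(2) by (auto simp: mult.commute)
  qed
  also have "\<dots> = (\<Sum>h\<in>arrows Q. if tgt Q h = i then of_int (eps Q h) * (\<Sum>w<v (src Q h). ?b h p w * ?b (bar Q h) w q) else 0)"
    unfolding sum_arrows ..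
  also have "\<dots> = (\<Sum>h | h \<in> arrows Q \<and> tgt Q h = i. of_int (eps Q h) * (\<Sum>w<v (src Q h). ?b h p w * ?b (bar Q h) w q))"
    by (rule sum.inter_filter[OF finA, symmetric])
  finally show ?thesis using moment_entry(2)[of B \<gamma> \<delta> i p q] s ipq by (simp add: sB N_def)
qed

lemma Lambda0_val:
  assumes s: "s \<in> rep_space Q d v"
  shows "s \<in> Lambda0 Q d v \<longleftrightarrow> val s \<in> lf.X"
proof -
  obtain B \<gamma> \<delta> where sB: "s = (B, \<gamma>, \<delta>)" by (cases s)
  have "val s \<in> lf.X \<longleftrightarrow> (\<forall>e\<in>{..<neqs}. case en e of (i, p, q) \<Rightarrow> moment Q v s i $$ (p, q) = 0)"
  proof -
    have "lf.\<mu> e (val s) = 0 \<longleftrightarrow> (case en e of (i, p, q) \<Rightarrow> moment Q v s i $$ (p, q) = 0)" if "e < neqs" for e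
      using mu_moment[OF s that, of "fst (en e)" "fst (snd (en e))" "snd (snd (en e))"] by (simp add: case_prod_unfold)
    then show ?thesis by (simp add: lf.X_def Ball_def del: split_paired_All)
  qed
  also have "\<dots> \<longleftrightarrow> (\<forall>e\<in>eqs. case e of (i, p, q) \<Rightarrow> moment Q v s i $$ (p, q) = 0)"
    unfolding bij_betw_imp_surj_on[OF en, symmetric] by simp
  also have "\<dots> \<longleftrightarrow> (\<forall>i\<in>verts Q. \<forall>p<v i. \<forall>q<v i. moment Q v s i $$ (p, q) = 0)"
  proof (intro iffI ballI allI impI)
    fix i p q assume "\<forall>e\<in>eqs. case e of (i, p, q) \<Rightarrow> moment Q v s i $$ (p, q) = 0" "i \<in> verts Q" "p < v i" "q < v i"
    moreover from this have "(i, p, q) \<in> eqs" unfolding eqs_def by (intro blkI) (simp_all add: N_def)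
    ultimately show "moment Q v s i $$ (p, q) = 0" by fast
  next
    fix e assume a: "\<forall>i\<in>verts Q. \<forall>p<v i. \<forall>q<v i. moment Q v s i $$ (p, q) = 0" and "e \<in> eqs"
    then obtain i p q where "e = (i, p, q)" "i \<in> N" "p < v i" "q < v i" unfolding eqs_def by (elim blkE)
    then show "case e of (i, p, q) \<Rightarrow> moment Q v s i $$ (p, q) = 0" using a by (simp add: N_def)
  qed
  also have "\<dots> \<longleftrightarrow> (\<forall>i\<in>verts Q. moment Q v s i = 0\<^sub>m (v i) (v i))"
  proof (intro ball_cong refl iffI)
    fix i assume i: "i \<in> verts Q"
    show "moment Q v s i = 0\<^sub>m (v i) (v i)" if "\<forall>p<v i. \<forall>q<v i. moment Q v s i $$ (p, q) = 0"
      using moment_entry(1)[of B \<gamma> \<delta> i] s i that unfolding sB by (intro eq_matI) auto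
  qed auto
  finally show ?thesis using s by (simp add: Lambda0_def)
qed

lemma pt_Lambda0: assumes "x \<in> lf.X" shows "pt x \<in> Lambda0 Q d v"
proof -
  have "lf.\<mu> e (val (pt x)) = lf.\<mu> e x" if "e < neqs" for e
    by (rule polys_cong[OF homog_polys[OF lf.\<mu>_homog[OF that]]]) (rule val_pt)
  then show ?thesis using assms Lambda0_val[OF pt_rep] by (simp add: lf.X_def)
qed

theorem Lambda0_domain:
  assumes f: "f \<in> polyfuns (rep_coords Q d v)" and g: "g \<in> polyfuns (rep_coords Q d v)"
    and fg: "\<And>s. s \<in> Lambda0 Q d v \<Longrightarrow> f s * g s = 0"
  shows "(\<forall>s\<in>Lambda0 Q d v. f s = 0) \<or> (\<forall>s\<in>Lambda0 Q d v. g s = 0)"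
proof -
  obtain p where p: "p \<in> polys lf.K" "\<forall>s. f s = p (val s)" using polyfuns_val[OF f] by (elim bexE)
  obtain q where q: "q \<in> polys lf.K" "\<forall>s. g s = q (val s)" using polyfuns_val[OF g] by (elim bexE)
  have pp: "u (val (pt x)) = u x" if "u \<in> polys lf.K" for u x by (rule polys_cong[OF that val_pt])
  have "p x * q x = 0" if "x \<in> lf.X" for x using fg[OF pt_Lambda0[OF that]] p q pp[OF p(1), of x] pp[OF q(1), of x] by simp
  from lf.domain_on_X[OF p(1) q(1) this] show ?thesis using p(2) q(2) Lambda0_val by (auto simp: Lambda0_def)
qed

theorem Lambda0_integrally_closed:
  assumes a: "a \<in> polyfuns (rep_coords Q d v)" and b: "b \<in> polyfuns (rep_coords Q d v)"
    and c: "\<And>i. i < m \<Longrightarrow> c i \<in> polyfuns (rep_coords Q d v)"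
    and eq: "\<And>s. s \<in> Lambda0 Q d v \<Longrightarrow> a s ^ m + (\<Sum>i<m. c i s * a s ^ i * b s ^ (m - i)) = 0"
    and s0: "s0 \<in> Lambda0 Q d v" "b s0 \<noteq> 0"
  shows "\<exists>q\<in>polyfuns (rep_coords Q d v). \<forall>s\<in>Lambda0 Q d v. a s = b s * q s"
proof -
  obtain a' where a': "a' \<in> polys lf.K" "\<forall>s. a s = a' (val s)" using polyfuns_val[OF a] by (elim bexE)
  obtain b' where b': "b' \<in> polys lf.K" "\<forall>s. b s = b' (val s)" using polyfuns_val[OF b] by (elim bexE)
  have E: "a s = a' (val s)" "b s = b' (val s)" for s by (rule spec[OF a'(2)], rule spec[OF b'(2)])
  have "\<forall>i\<in>{..<m}. \<exists>p. p \<in> polys lf.K \<and> (\<forall>s. c i s = p (val s))"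
  proof
    fix i assume "i \<in> {..<m}"
    then show "\<exists>p. p \<in> polys lf.K \<and> (\<forall>s. c i s = p (val s))" using polyfuns_val[OF c[of i]] by (simp only: Bex_def lessThan_iff)
  qed
  from bchoice[OF this] obtain c' where c': "\<forall>i\<in>{..<m}. c' i \<in> polys lf.K \<and> (\<forall>s. c i s = c' i (val s))" by (elim exE)
  have pp: "u (val (pt x)) = u x" if "u \<in> polys lf.K" for u x by (rule polys_cong[OF that val_pt])
  have "\<exists>q\<in>polys lf.K. \<forall>x\<in>lf.X. a' x = b' x * q x"
  proof (rule lf.integrally_closed_on_X[OF a'(1) b'(1)])
    show "c' i \<in> polys lf.K" if "i < m" for i using c' that by auto
    show "a' x ^ m + (\<Sum>i<m. c' i x * a' x ^ i * b' x ^ (m - i)) = 0" if "x \<in> lf.X" for x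
    proof -
      have "(\<Sum>i<m. c i (pt x) * a (pt x) ^ i * b (pt x) ^ (m - i)) = (\<Sum>i<m. c' i x * a' x ^ i * b' x ^ (m - i))"
      proof (rule sum.cong[OF refl])
        fix i assume "i \<in> {..<m}"
        from bspec[OF c' this] have "c' i \<in> polys lf.K" "c i (pt x) = c' i (val (pt x))" by (rule conjunct1, elim conjE spec)
        then show "c i (pt x) * a (pt x) ^ i * b (pt x) ^ (m - i) = c' i x * a' x ^ i * b' x ^ (m - i)"
          using pp[OF a'(1), of x] pp[OF b'(1), of x] pp[of "c' i" x] by (simp add: E)
      qed
      then show ?thesis using eq[OF pt_Lambda0[OF that]] pp[OF a'(1), of x] by (simp add: E(1))
    qed
    show "val s0 \<in> lf.X" using s0 Lambda0_val[of s0] by (auto simp: Lambda0_def)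
    show "b' (val s0) \<noteq> 0" using s0 by (simp add: E)
  qed
  then obtain q where q: "q \<in> polys lf.K" "\<forall>x\<in>lf.X. a' x = b' x * q x" by (elim bexE)
  show ?thesis
    by (rule bexI[OF _ val_polyfuns[OF q(1)]]) (use q(2) Lambda0_val in \<open>auto simp: Lambda0_def E\<close>)
qed

end

section \<open>Normality of localizations\<close>

lemma (in ring) diff_eq_zero_iff: "a \<in> carrier R \<Longrightarrow> b \<in> carrier R \<Longrightarrow> a \<ominus> b = \<zero> \<longleftrightarrow> a = b"
  using minus_equality[of a "\<ominus> b"] by (auto simp: minus_eq r_neg)

locale domain_localization = domain R for R (structure) +
  fixes S
  assumes S: "S \<subseteq> carrier R" "\<one> \<in> S" "\<zero> \<notin> S" "\<And>s t. s \<in> S \<Longrightarrow> t \<in> S \<Longrightarrow> s \<otimes> t \<in> S"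
begin

abbreviation "fr \<equiv> fraction R S"
abbreviation "L \<equiv> localization R S"

lemma Sc[simp]: "s \<in> S \<Longrightarrow> s \<in> carrier R" using S by blast

lemma S_nonzero: "s \<in> S \<Longrightarrow> s \<noteq> \<zero>" using S by blast

lemma frac_iff:
  assumes "a \<in> carrier R" "s \<in> S"
  shows "fr a s = {(b, t). b \<in> carrier R \<and> t \<in> S \<and> a \<otimes> t = b \<otimes> s}"
proof -
  have "(\<exists>u\<in>S. u \<otimes> (a \<otimes> t \<ominus> b \<otimes> s) = \<zero>) \<longleftrightarrow> a \<otimes> t = b \<otimes> s" if "b \<in> carrier R" "t \<in> S" for b t
  proof
    assume "\<exists>u\<in>S. u \<otimes> (a \<otimes> t \<ominus> b \<otimes> s) = \<zero>"
    then obtain u where "u \<in> S" "u \<otimes> (a \<otimes> t \<ominus> b \<otimes> s) = \<zero>" by blast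
    then have "a \<otimes> t \<ominus> b \<otimes> s = \<zero>" using integral[of u "a \<otimes> t \<ominus> b \<otimes> s"] S_nonzero[of u] assms that by simp
    then show "a \<otimes> t = b \<otimes> s" using assms that by (simp add: diff_eq_zero_iff)
  next
    assume "a \<otimes> t = b \<otimes> s"
    then show "\<exists>u\<in>S. u \<otimes> (a \<otimes> t \<ominus> b \<otimes> s) = \<zero>" using S(2) assms that by (intro bexI[of _ \<one>]) (simp_all add: diff_eq_zero_iff)
  qed
  then show ?thesis unfolding fraction_def by auto
qed

lemma cancel: "s \<in> S \<Longrightarrow> x \<in> carrier R \<Longrightarrow> y \<in> carrier R \<Longrightarrow> s \<otimes> x = s \<otimes> y \<longleftrightarrow> x = y"
  using m_lcancel[of s x y] S_nonzero[of s] by simp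

lemma frac_eq:
  assumes a: "a \<in> carrier R" "s \<in> S" "b \<in> carrier R" "t \<in> S"
  shows "fr a s = fr b t \<longleftrightarrow> a \<otimes> t = b \<otimes> s"
proof
  assume "fr a s = fr b t"
  moreover have "(b, t) \<in> fr b t" using a by (simp add: frac_iff)
  ultimately have "(b, t) \<in> fr a s" by simp
  then show "a \<otimes> t = b \<otimes> s" using a by (simp add: frac_iff)
next
  assume eq: "a \<otimes> t = b \<otimes> s"
  have "a \<otimes> u = c \<otimes> s \<longleftrightarrow> b \<otimes> u = c \<otimes> t" if "c \<in> carrier R" "u \<in> S" for c u
  proof -
    have "a \<otimes> u = c \<otimes> s \<longleftrightarrow> t \<otimes> (a \<otimes> u) = t \<otimes> (c \<otimes> s)" using cancel a that by simp
    also have "t \<otimes> (a \<otimes> u) = (a \<otimes> t) \<otimes> u" using a that by (simp add: m_ac)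
    also have "\<dots> = s \<otimes> (b \<otimes> u)" unfolding eq using a that by (simp add: m_ac)
    also have "t \<otimes> (c \<otimes> s) = s \<otimes> (c \<otimes> t)" using a that by (simp add: m_ac)
    also have "s \<otimes> (b \<otimes> u) = s \<otimes> (c \<otimes> t) \<longleftrightarrow> b \<otimes> u = c \<otimes> t" using cancel a that by simp
    finally show ?thesis .
  qed
  then show "fr a s = fr b t" using a by (auto simp: frac_iff)
qed

lemma UN_const: "X \<noteq> {} \<Longrightarrow> Y \<noteq> {} \<Longrightarrow> (\<And>p q. p \<in> X \<Longrightarrow> q \<in> Y \<Longrightarrow> f p q = c) \<Longrightarrow> (\<Union>p\<in>X. \<Union>q\<in>Y. f p q) = c"
  by auto

lemma frac_self: "a \<in> carrier R \<Longrightarrow> s \<in> S \<Longrightarrow> (a, s) \<in> fr a s" by (simp add: frac_iff)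

lemma frac_nonempty: "a \<in> carrier R \<Longrightarrow> s \<in> S \<Longrightarrow> fr a s \<noteq> {}"
  using frac_self by blast

lemma frac_mult:
  assumes a: "a \<in> carrier R" "s \<in> S" "b \<in> carrier R" "t \<in> S"
  shows "fr a s \<otimes>\<^bsub>L\<^esub> fr b t = fr (a \<otimes> b) (s \<otimes> t)"
proof -
  have "(\<lambda>(a', s'). \<lambda>(b', t'). fr (a' \<otimes> b') (s' \<otimes> t')) p q = fr (a \<otimes> b) (s \<otimes> t)" if "p \<in> fr a s" "q \<in> fr b t" for p q
  proof -
    obtain a' s' b' t' where pq: "p = (a', s')" "q = (b', t')" by (cases p, cases q)
    have c: "a' \<in> carrier R" "s' \<in> S" "b' \<in> carrier R" "t' \<in> S" "a \<otimes> s' = a' \<otimes> s" "b \<otimes> t' = b' \<otimes> t"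
      using that a by (auto simp: pq frac_iff)
    have "(a' \<otimes> b') \<otimes> (s \<otimes> t) = (a' \<otimes> s) \<otimes> (b' \<otimes> t)" using a c by (simp add: m_ac)
    also have "\<dots> = (a \<otimes> s') \<otimes> (b \<otimes> t')" by (simp only: c)
    also have "\<dots> = (a \<otimes> b) \<otimes> (s' \<otimes> t')" using a c(1-4) by (simp add: m_ac)
    finally show ?thesis using a c(1-4) S(4) by (simp add: pq frac_eq)
  qed
  then have "(\<Union>p\<in>fr a s. \<Union>q\<in>fr b t. (\<lambda>(a', s'). \<lambda>(b', t'). fr (a' \<otimes> b') (s' \<otimes> t')) p q) = fr (a \<otimes> b) (s \<otimes> t)"
    by (intro UN_const frac_nonempty a)
  then show ?thesis by (simp add: localization_def case_prod_unfold)
qed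

lemma frac_add:
  assumes a: "a \<in> carrier R" "s \<in> S" "b \<in> carrier R" "t \<in> S"
  shows "fr a s \<oplus>\<^bsub>L\<^esub> fr b t = fr (a \<otimes> t \<oplus> b \<otimes> s) (s \<otimes> t)"
proof -
  have "(\<lambda>(a', s'). \<lambda>(b', t'). fr (a' \<otimes> t' \<oplus> b' \<otimes> s') (s' \<otimes> t')) p q = fr (a \<otimes> t \<oplus> b \<otimes> s) (s \<otimes> t)"
    if "p \<in> fr a s" "q \<in> fr b t" for p q
  proof -
    obtain a' s' b' t' where pq: "p = (a', s')" "q = (b', t')" by (cases p, cases q)
    have c: "a' \<in> carrier R" "s' \<in> S" "b' \<in> carrier R" "t' \<in> S" "a \<otimes> s' = a' \<otimes> s" "b \<otimes> t' = b' \<otimes> t"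
      using that a by (auto simp: pq frac_iff)
    have "(a' \<otimes> t' \<oplus> b' \<otimes> s') \<otimes> (s \<otimes> t) = (a' \<otimes> s) \<otimes> (t \<otimes> t') \<oplus> (b' \<otimes> t) \<otimes> (s \<otimes> s')" using a c(1-4) by (simp add: m_ac l_distr r_distr)
    also have "\<dots> = (a \<otimes> s') \<otimes> (t \<otimes> t') \<oplus> (b \<otimes> t') \<otimes> (s \<otimes> s')" by (simp only: c)
    also have "\<dots> = (a \<otimes> t \<oplus> b \<otimes> s) \<otimes> (s' \<otimes> t')" using a c(1-4) by (simp add: m_ac l_distr r_distr)
    finally show ?thesis using a c(1-4) S(4) by (simp add: pq frac_eq)
  qed
  then have "(\<Union>p\<in>fr a s. \<Union>q\<in>fr b t. (\<lambda>(a', s'). \<lambda>(b', t'). fr (a' \<otimes> t' \<oplus> b' \<otimes> s') (s' \<otimes> t')) p q) = fr (a \<otimes> t \<oplus> b \<otimes> s) (s \<otimes> t)"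
    by (intro UN_const frac_nonempty a)
  then show ?thesis by (simp add: localization_def case_prod_unfold)
qed

lemma L_carrier: "carrier L = {fr a s |a s. a \<in> carrier R \<and> s \<in> S}"
  and L_one: "\<one>\<^bsub>L\<^esub> = fr \<one> \<one>" and L_zero: "\<zero>\<^bsub>L\<^esub> = fr \<zero> \<one>"
  by (simp_all add: localization_def)

lemma frac_closed: "a \<in> carrier R \<Longrightarrow> s \<in> S \<Longrightarrow> fr a s \<in> carrier L"
  unfolding L_carrier by blast

lemma L_E: assumes "x \<in> carrier L" obtains a s where "x = fr a s" "a \<in> carrier R" "s \<in> S"
  using assms unfolding L_carrier by blast

lemma domain_L: "domain L"
proof -
  have cr: "cring L"
  proof (rule cringI)
    show "abelian_group L"
    proof (rule abelian_groupI)
      fix x y assume "x \<in> carrier L" "y \<in> carrier L"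
      then obtain a s b t where x: "x = fr a s" "a \<in> carrier R" "s \<in> S" and y: "y = fr b t" "b \<in> carrier R" "t \<in> S" by (elim L_E)
      show "x \<oplus>\<^bsub>L\<^esub> y \<in> carrier L" using x y S(4) by (auto simp: frac_add intro!: frac_closed)
      show "x \<oplus>\<^bsub>L\<^esub> y = y \<oplus>\<^bsub>L\<^esub> x" using x y S(4) by (simp add: frac_add frac_eq m_ac a_ac)
      fix z assume "z \<in> carrier L"
      then obtain c u where z: "z = fr c u" "c \<in> carrier R" "u \<in> S" by (elim L_E)
      show "x \<oplus>\<^bsub>L\<^esub> y \<oplus>\<^bsub>L\<^esub> z = x \<oplus>\<^bsub>L\<^esub> (y \<oplus>\<^bsub>L\<^esub> z)" using x y z S(4) by (simp add: frac_add frac_eq m_ac a_ac l_distr r_distr)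
    next
      show "\<zero>\<^bsub>L\<^esub> \<in> carrier L" using S(2) by (auto simp: L_zero intro!: frac_closed)
    next
      fix x assume "x \<in> carrier L"
      then obtain a s where x: "x = fr a s" "a \<in> carrier R" "s \<in> S" by (elim L_E)
      show "\<zero>\<^bsub>L\<^esub> \<oplus>\<^bsub>L\<^esub> x = x" using x S(2) by (simp add: L_zero frac_add)
      have "fr (\<ominus> a) s \<oplus>\<^bsub>L\<^esub> x = \<zero>\<^bsub>L\<^esub>" using x S(2,4) by (simp add: L_zero frac_add frac_eq l_distr[symmetric] l_neg)
      then show "\<exists>y\<in>carrier L. y \<oplus>\<^bsub>L\<^esub> x = \<zero>\<^bsub>L\<^esub>" using x frac_closed[of "\<ominus> a" s] by auto
    qed
    show "comm_monoid L"
    proof (rule comm_monoidI)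
      show "\<one>\<^bsub>L\<^esub> \<in> carrier L" using S(2) by (auto simp: L_one intro!: frac_closed)
      fix x y assume "x \<in> carrier L" "y \<in> carrier L"
      then obtain a s b t where x: "x = fr a s" "a \<in> carrier R" "s \<in> S" and y: "y = fr b t" "b \<in> carrier R" "t \<in> S" by (elim L_E)
      show "x \<otimes>\<^bsub>L\<^esub> y \<in> carrier L" using x y S(4) by (auto simp: frac_mult intro!: frac_closed)
      show "x \<otimes>\<^bsub>L\<^esub> y = y \<otimes>\<^bsub>L\<^esub> x" using x y S(4) by (simp add: frac_mult m_ac)
      fix z assume "z \<in> carrier L"
      then obtain c u where z: "z = fr c u" "c \<in> carrier R" "u \<in> S" by (elim L_E)
      show "x \<otimes>\<^bsub>L\<^esub> y \<otimes>\<^bsub>L\<^esub> z = x \<otimes>\<^bsub>L\<^esub> (y \<otimes>\<^bsub>L\<^esub> z)" using x y z S(4) by (simp add: frac_mult m_ac)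
    next
      fix x assume "x \<in> carrier L"
      then obtain a s where x: "x = fr a s" "a \<in> carrier R" "s \<in> S" by (elim L_E)
      show "\<one>\<^bsub>L\<^esub> \<otimes>\<^bsub>L\<^esub> x = x" using x S(2) by (simp add: L_one frac_mult)
    qed
    fix x y z assume "x \<in> carrier L" "y \<in> carrier L" "z \<in> carrier L"
    then obtain a s b t c u where x: "x = fr a s" "a \<in> carrier R" "s \<in> S" and y: "y = fr b t" "b \<in> carrier R" "t \<in> S"
      and z: "z = fr c u" "c \<in> carrier R" "u \<in> S" by (elim L_E)
    show "(x \<oplus>\<^bsub>L\<^esub> y) \<otimes>\<^bsub>L\<^esub> z = x \<otimes>\<^bsub>L\<^esub> z \<oplus>\<^bsub>L\<^esub> y \<otimes>\<^bsub>L\<^esub> z"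
      using x y z S(4) by (simp add: frac_mult frac_add frac_eq m_ac a_ac l_distr r_distr)
  qed
  show ?thesis
  proof (intro domain.intro domain_axioms.intro cr)
    show "\<one>\<^bsub>L\<^esub> \<noteq> \<zero>\<^bsub>L\<^esub>" using S(2) by (simp add: L_one L_zero frac_eq)
    fix x y assume xy: "x \<otimes>\<^bsub>L\<^esub> y = \<zero>\<^bsub>L\<^esub>" and "x \<in> carrier L" "y \<in> carrier L"
    then obtain a s b t where x: "x = fr a s" "a \<in> carrier R" "s \<in> S" and y: "y = fr b t" "b \<in> carrier R" "t \<in> S" by (elim L_E)
    have "a \<otimes> b = \<zero>" using xy x y S(2,4) by (simp add: frac_mult L_zero frac_eq)
    then have "a = \<zero> \<or> b = \<zero>" using x y integral by blast
    then show "x = \<zero>\<^bsub>L\<^esub> \<or> y = \<zero>\<^bsub>L\<^esub>" using x y S(2) by (auto simp: L_zero frac_eq)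
  qed
qed

lemma embed_hom: "(\<lambda>r. fr r \<one>) \<in> Ring.ring_hom R L"
  by (rule ring_hom_memI) (use S(2,4) in \<open>auto simp: frac_closed frac_mult frac_add L_one\<close>)

lemma embed_inj: "r \<in> carrier R \<Longrightarrow> fr r \<one> = \<zero>\<^bsub>L\<^esub> \<Longrightarrow> r = \<zero>"
  using S(2) by (simp add: L_zero frac_eq)

lemma frac_clear: "a \<in> carrier R \<Longrightarrow> s \<in> S \<Longrightarrow> fr a s \<otimes>\<^bsub>L\<^esub> fr s \<one> = fr a \<one>"
  using S(2) by (simp add: frac_mult frac_eq m_ac)

end

lemma (in ring_hom_cring) hom_nat_pow: "x \<in> carrier R \<Longrightarrow> h (x [^] (n :: nat)) = h x [^]\<^bsub>S\<^esub> n"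
  by (induction n) auto

text \<open>Multiplication by y^n turns an equation of x into one of x y.\<close>

lemma (in cring) scale_equation:
  assumes x: "x \<in> carrier R" "y \<in> carrier R" and c: "c \<in> {..<n} \<rightarrow> carrier R"
    and eq: "x [^] n \<oplus> (\<Oplus>i\<in>{..<n::nat}. c i \<otimes> x [^] i) = \<zero>"
  shows "(x \<otimes> y) [^] n \<oplus> (\<Oplus>i\<in>{..<n}. (c i \<otimes> y [^] (n - i)) \<otimes> (x \<otimes> y) [^] i) = \<zero>"
proof -
  have "\<zero> = y [^] n \<otimes> (x [^] n \<oplus> (\<Oplus>i\<in>{..<n}. c i \<otimes> x [^] i))" using eq x by simp
  also have "\<dots> = y [^] n \<otimes> x [^] n \<oplus> (\<Oplus>i\<in>{..<n}. y [^] n \<otimes> (c i \<otimes> x [^] i))"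
    using x c by (simp add: r_distr finsum_rdistr Pi_def)
  also have "y [^] n \<otimes> x [^] n = (x \<otimes> y) [^] n" using x by (simp add: nat_pow_distrib m_comm)
  also have "(\<Oplus>i\<in>{..<n}. y [^] n \<otimes> (c i \<otimes> x [^] i)) = (\<Oplus>i\<in>{..<n}. (c i \<otimes> y [^] (n - i)) \<otimes> (x \<otimes> y) [^] i)"
  proof (rule finsum_cong')
    fix i assume i: "i \<in> {..<n}"
    have ci: "c i \<in> carrier R" using c i by auto
    have "y [^] n = y [^] (n - i) \<otimes> y [^] i" using i x by (simp add: nat_pow_mult)
    then show "y [^] n \<otimes> (c i \<otimes> x [^] i) = (c i \<otimes> y [^] (n - i)) \<otimes> (x \<otimes> y) [^] i"
      using x ci by (simp add: nat_pow_distrib m_ac)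
  qed (use x c in auto)
  finally show ?thesis by simp
qed

text \<open>A fraction integral over the localization becomes integral over R after multiplication with a common
  denominator of the coefficients of its equation.\<close>

theorem (in domain) normal_spec_if_integrally_closed:
  assumes ic: "\<And>a b c n. a \<in> carrier R \<Longrightarrow> b \<in> carrier R \<Longrightarrow> b \<noteq> \<zero> \<Longrightarrow> c \<in> {..<n} \<rightarrow> carrier R \<Longrightarrow>
    a [^] n \<oplus> (\<Oplus>i\<in>{..<n::nat}. (c i \<otimes> b [^] (n - i)) \<otimes> a [^] i) = \<zero> \<Longrightarrow> \<exists>q\<in>carrier R. a = b \<otimes> q"
  shows "normal_spec R"
  unfolding normal_spec_def
proof (intro allI impI)
  fix P assume "primeideal P R"
  then interpret P: primeideal P R .
  define S where "S = carrier R - P"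
  interpret RS: domain_localization R S
  proof
    show "S \<subseteq> carrier R" "\<zero> \<notin> S" by (auto simp: S_def)
    show "\<one> \<in> S" using P.one_imp_carrier P.I_notcarr by (auto simp: S_def)
    show "s \<otimes> t \<in> S" if "s \<in> S" "t \<in> S" for s t using P.I_prime[of s t] that by (auto simp: S_def)
  qed
  define L where "L = localization R S"
  define \<iota> where "\<iota> = (\<lambda>r. fraction R S r \<one>)"
  interpret L: domain L unfolding L_def by (rule RS.domain_L)
  define T where "T = carrier L - {\<zero>\<^bsub>L\<^esub>}"
  interpret LT: domain_localization L T by unfold_locales (auto simp: T_def L.integral_iff)
  define K where "K = localization L T"
  define \<kappa> where "\<kappa> = (\<lambda>r. fraction L T r \<one>\<^bsub>L\<^esub>)"
  interpret K: domain K unfolding K_def by (rule LT.domain_L)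
  interpret h: ring_hom_cring R L \<iota>
    unfolding \<iota>_def L_def by (intro ring_hom_cring.intro ring_hom_cring_axioms.intro RS.embed_hom cring_axioms domain.axioms(1) RS.domain_L)
  interpret k: ring_hom_cring L K \<kappa>
    unfolding \<kappa>_def K_def by (intro ring_hom_cring.intro ring_hom_cring_axioms.intro LT.embed_hom L.cring_axioms domain.axioms(1) LT.domain_L)
  define j where "j = (\<lambda>r. \<kappa> (\<iota> r))"
  interpret j: ring_hom_cring R K j
    using ring_hom_trans[OF h.homh k.homh] unfolding j_def comp_def
    by (intro ring_hom_cring.intro ring_hom_cring_axioms.intro cring_axioms K.cring_axioms)
  have j0: "r = \<zero>" if "r \<in> carrier R" "j r = \<zero>\<^bsub>K\<^esub>" for r
    using LT.embed_inj[of "\<iota> r"] RS.embed_inj[of r] h.hom_closed[OF that(1)] that by (simp add: j_def \<iota>_def \<kappa>_def K_def L_def)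
  have unclear: "\<exists>u\<in>S. \<exists>c\<in>carrier R. y \<otimes>\<^bsub>K\<^esub> j u = j c" if "y \<in> \<kappa> ` carrier L" for y
  proof -
    from that obtain l where l: "y = \<kappa> l" "l \<in> carrier L" by blast
    from l(2) obtain c u where c: "l = fraction R S c u" "c \<in> carrier R" "u \<in> S" unfolding L_def by (rule RS.L_E)
    have "l \<otimes>\<^bsub>L\<^esub> \<iota> u = \<iota> c" using RS.frac_clear[OF c(2,3)] by (simp add: c(1) L_def \<iota>_def)
    then have "y \<otimes>\<^bsub>K\<^esub> j u = j c" using l k.hom_mult[OF l(2) h.hom_closed[of u]] RS.Sc[OF c(3)] by (simp add: j_def)
    then show ?thesis using c by blast
  qed
  have "x \<in> \<kappa> ` carrier L" if x: "x \<in> carrier K" and int: "integral_over K (\<kappa> ` carrier L) x" for x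
  proof -
    obtain n :: nat and \<gamma> where \<gamma>: "\<gamma> \<in> {..<n} \<rightarrow> \<kappa> ` carrier L"
      and eq: "x [^]\<^bsub>K\<^esub> n \<oplus>\<^bsub>K\<^esub> (\<Oplus>\<^bsub>K\<^esub>i\<in>{..<n}. \<gamma> i \<otimes>\<^bsub>K\<^esub> x [^]\<^bsub>K\<^esub> i) = \<zero>\<^bsub>K\<^esub>" using int unfolding integral_over_def by blast
    have \<gamma>L: "\<gamma> i \<in> \<kappa> ` carrier L" if "i < n" for i by (rule funcset_mem[OF \<gamma>]) (simp add: that)
    have \<gamma>K: "\<gamma> i \<in> carrier K" if "i < n" for i by (rule imageE[OF \<gamma>L[OF that]]) (simp add: k.hom_closed)
    \<comment> \<open>The element of the double localization is written as a fraction of elements of R.\<close>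
    obtain a b where a: "a \<in> carrier R" and b: "b \<in> carrier R" "b \<noteq> \<zero>" and xab: "x \<otimes>\<^bsub>K\<^esub> j b = j a"
    proof -
      obtain \<alpha> \<beta> where \<alpha>: "x = fraction L T \<alpha> \<beta>" "\<alpha> \<in> carrier L" "\<beta> \<in> T" using x unfolding K_def by (elim LT.L_E)
      have \<beta>: "\<beta> \<in> carrier L" "\<beta> \<noteq> \<zero>\<^bsub>L\<^esub>" using \<alpha>(3) by (auto simp: T_def)
      have xb: "x \<otimes>\<^bsub>K\<^esub> \<kappa> \<beta> = \<kappa> \<alpha>" using LT.frac_clear[OF \<alpha>(2,3)] by (simp add: \<alpha>(1) K_def \<kappa>_def)
      obtain s a where s: "s \<in> S" "a \<in> carrier R" "\<kappa> \<alpha> \<otimes>\<^bsub>K\<^esub> j s = j a" using unclear[of "\<kappa> \<alpha>"] \<alpha>(2) by blast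
      obtain t b where t: "t \<in> S" "b \<in> carrier R" "\<kappa> \<beta> \<otimes>\<^bsub>K\<^esub> j t = j b" using unclear[of "\<kappa> \<beta>"] \<beta>(1) by blast
      note cl = k.hom_closed[OF \<alpha>(2)] k.hom_closed[OF \<beta>(1)] j.hom_closed[OF RS.Sc[OF s(1)]] j.hom_closed[OF RS.Sc[OF t(1)]] x
      have "x \<otimes>\<^bsub>K\<^esub> j (b \<otimes> s) = (x \<otimes>\<^bsub>K\<^esub> \<kappa> \<beta>) \<otimes>\<^bsub>K\<^esub> (j t \<otimes>\<^bsub>K\<^esub> j s)"
        using t(2) RS.Sc[OF s(1)] cl by (simp add: t(3)[symmetric] K.m_ac)
      also have "\<dots> = (\<kappa> \<alpha> \<otimes>\<^bsub>K\<^esub> j s) \<otimes>\<^bsub>K\<^esub> j t" unfolding xb using cl by (simp add: K.m_ac)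
      also have "\<dots> = j (a \<otimes> t)" unfolding s(3) using s(2) RS.Sc[OF t(1)] by simp
      finally have "x \<otimes>\<^bsub>K\<^esub> j (b \<otimes> s) = j (a \<otimes> t)" .
      moreover have "b \<noteq> \<zero>"
      proof
        assume "b = \<zero>"
        then have "\<kappa> \<beta> = \<zero>\<^bsub>K\<^esub> \<or> j t = \<zero>\<^bsub>K\<^esub>" using t(3) cl K.integral by simp
        then show False using j0[OF RS.Sc[OF t(1)]] RS.S_nonzero[OF t(1)] LT.embed_inj[OF \<beta>(1)] \<beta>(2) by (auto simp: \<kappa>_def K_def)
      qed
      then have "b \<otimes> s \<noteq> \<zero>" using integral[of b s] t(2) RS.Sc[OF s(1)] RS.S_nonzero[OF s(1)] by blast
      ultimately show thesis using that[of "a \<otimes> t" "b \<otimes> s"] s t by simp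
    qed
    have "\<exists>u\<in>S. \<forall>i<m. \<exists>c\<in>carrier R. \<gamma> i \<otimes>\<^bsub>K\<^esub> j u = j c" if "m \<le> n" for m
      using that
    proof (induction m)
      case 0
      show ?case using RS.S(2) by auto
    next
      case (Suc m)
      then obtain u where u: "u \<in> S" "\<forall>i<m. \<exists>c\<in>carrier R. \<gamma> i \<otimes>\<^bsub>K\<^esub> j u = j c" by auto
      obtain w c where w: "w \<in> S" "c \<in> carrier R" "\<gamma> m \<otimes>\<^bsub>K\<^esub> j w = j c" using unclear[OF \<gamma>L[of m]] Suc.prems by auto
      have uw: "u \<in> carrier R" "w \<in> carrier R" using u w by auto
      have "\<exists>c\<in>carrier R. \<gamma> i \<otimes>\<^bsub>K\<^esub> j (u \<otimes> w) = j c" if i: "i < Suc m" for i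
      proof -
        have g: "\<gamma> i \<in> carrier K" using \<gamma>K i Suc.prems by simp
        show ?thesis
        proof (cases "i = m")
          case True
          have "\<gamma> i \<otimes>\<^bsub>K\<^esub> j (u \<otimes> w) = (\<gamma> i \<otimes>\<^bsub>K\<^esub> j w) \<otimes>\<^bsub>K\<^esub> j u" using uw g by (simp add: K.m_ac)
          also have "\<dots> = j (c \<otimes> u)" using True w uw by simp
          finally show ?thesis using w uw by blast
        next
          case False
          then have "i < m" using i by simp
          then obtain e where e: "e \<in> carrier R" "\<gamma> i \<otimes>\<^bsub>K\<^esub> j u = j e" using u(2) by blast
          have "\<gamma> i \<otimes>\<^bsub>K\<^esub> j (u \<otimes> w) = (\<gamma> i \<otimes>\<^bsub>K\<^esub> j u) \<otimes>\<^bsub>K\<^esub> j w" using uw g by (simp add: K.m_ac)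
          also have "\<dots> = j (e \<otimes> w)" using e uw by simp
          finally show ?thesis using e uw by blast
        qed
      qed
      then show ?case using RS.S(4)[OF u(1) w(1)] by blast
    qed
    from this[of n] obtain u where u: "u \<in> S" "\<forall>i<n. \<exists>c\<in>carrier R. \<gamma> i \<otimes>\<^bsub>K\<^esub> j u = j c" by auto
    have uR: "u \<in> carrier R" using u by simp
    have "\<forall>i. \<exists>c. i < n \<longrightarrow> c \<in> carrier R \<and> \<gamma> i \<otimes>\<^bsub>K\<^esub> j u = j c" using u(2) by blast
    from choice[OF this] obtain c where c: "\<And>i. i < n \<Longrightarrow> c i \<in> carrier R" "\<And>i. i < n \<Longrightarrow> \<gamma> i \<otimes>\<^bsub>K\<^esub> j u = j (c i)" by blast
    \<comment> \<open>Multiplication of x by the common denominator u gives the i-th coefficient a factor u^(n - i), one of which is used up.\<close>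
    define C where "C = (\<lambda>i. c i \<otimes> u [^] (n - 1 - i))"
    have C: "C \<in> {..<n} \<rightarrow> carrier R" using c(1) uR by (auto simp: C_def)
    define z where "z = u \<otimes> a"
    have zR: "z \<in> carrier R" using uR a by (simp add: z_def)
    have jz: "x \<otimes>\<^bsub>K\<^esub> j (u \<otimes> b) = j z"
    proof -
      have "x \<otimes>\<^bsub>K\<^esub> j (u \<otimes> b) = j u \<otimes>\<^bsub>K\<^esub> (x \<otimes>\<^bsub>K\<^esub> j b)" using x uR b by (simp add: K.m_ac)
      then show ?thesis using xab uR a by (simp add: z_def)
    qed
    have "j z [^]\<^bsub>K\<^esub> n \<oplus>\<^bsub>K\<^esub> (\<Oplus>\<^bsub>K\<^esub>i\<in>{..<n}. (\<gamma> i \<otimes>\<^bsub>K\<^esub> j (u \<otimes> b) [^]\<^bsub>K\<^esub> (n - i)) \<otimes>\<^bsub>K\<^esub> j z [^]\<^bsub>K\<^esub> i) = \<zero>\<^bsub>K\<^esub>"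
      using K.scale_equation[OF x _ _ eq, of "j (u \<otimes> b)"] uR b \<gamma>K unfolding jz by auto
    also have "(\<Oplus>\<^bsub>K\<^esub>i\<in>{..<n}. (\<gamma> i \<otimes>\<^bsub>K\<^esub> j (u \<otimes> b) [^]\<^bsub>K\<^esub> (n - i)) \<otimes>\<^bsub>K\<^esub> j z [^]\<^bsub>K\<^esub> i) =
      (\<Oplus>\<^bsub>K\<^esub>i\<in>{..<n}. j ((C i \<otimes> b [^] (n - i)) \<otimes> z [^] i))"
    proof (rule K.finsum_cong')
      show "(\<lambda>i. j ((C i \<otimes> b [^] (n - i)) \<otimes> z [^] i)) \<in> {..<n} \<rightarrow> carrier K" using C b zR by auto
      fix i assume "i \<in> {..<n}"
      then have i: "i < n" by simp
      have "u [^] (n - i) = u \<otimes> u [^] (n - 1 - i)"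
        using nat_pow_Suc2[OF uR, of "n - 1 - i"] i by (simp add: Suc_diff_Suc)
      then have w: "(u \<otimes> b) [^] (n - i) = u \<otimes> (u [^] (n - 1 - i) \<otimes> b [^] (n - i))"
        using uR b by (simp add: nat_pow_distrib m_assoc)
      have "j (u \<otimes> b) [^]\<^bsub>K\<^esub> (n - i) = j u \<otimes>\<^bsub>K\<^esub> j (u [^] (n - 1 - i) \<otimes> b [^] (n - i))"
        using j.hom_nat_pow[of "u \<otimes> b" "n - i"] uR b unfolding w by simp
      then have "\<gamma> i \<otimes>\<^bsub>K\<^esub> j (u \<otimes> b) [^]\<^bsub>K\<^esub> (n - i) = (\<gamma> i \<otimes>\<^bsub>K\<^esub> j u) \<otimes>\<^bsub>K\<^esub> j (u [^] (n - 1 - i) \<otimes> b [^] (n - i))"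
        using \<gamma>K[OF i] uR b by (simp only: K.m_assoc j.hom_closed m_closed nat_pow_closed)
      also have "\<dots> = j (C i \<otimes> b [^] (n - i))" unfolding c(2)[OF i] using c(1)[OF i] uR b by (simp add: C_def K.m_ac)
      finally show "\<gamma> i \<otimes>\<^bsub>K\<^esub> j (u \<otimes> b) [^]\<^bsub>K\<^esub> (n - i) \<otimes>\<^bsub>K\<^esub> j z [^]\<^bsub>K\<^esub> i = j ((C i \<otimes> b [^] (n - i)) \<otimes> z [^] i)"
        using funcset_mem[OF C, of i] b zR i by (simp add: j.hom_nat_pow)
    qed simp
    also have "\<dots> = j (\<Oplus>i\<in>{..<n}. (C i \<otimes> b [^] (n - i)) \<otimes> z [^] i)" by (subst j.hom_finsum) (use C b zR in \<open>auto simp: comp_def\<close>)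
    finally have "j (z [^] n \<oplus> (\<Oplus>i\<in>{..<n}. (C i \<otimes> b [^] (n - i)) \<otimes> z [^] i)) = \<zero>\<^bsub>K\<^esub>"
      using C b zR by (simp add: j.hom_nat_pow Pi_def)
    then have "z [^] n \<oplus> (\<Oplus>i\<in>{..<n}. (C i \<otimes> b [^] (n - i)) \<otimes> z [^] i) = \<zero>" 
    proof (rule j0[rotated])
      have "(\<lambda>i. (C i \<otimes> b [^] (n - i)) \<otimes> z [^] i) \<in> {..<n} \<rightarrow> carrier R" using C b zR by auto
      then show "z [^] n \<oplus> (\<Oplus>i\<in>{..<n}. (C i \<otimes> b [^] (n - i)) \<otimes> z [^] i) \<in> carrier R"
        using zR by (intro a_closed finsum_closed nat_pow_closed)
    qed
    from ic[OF zR b C this] obtain q where q: "q \<in> carrier R" "z = b \<otimes> q" by blast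
    define l where "l = fraction R S q u"
    have l: "l \<in> carrier L" unfolding l_def L_def by (rule RS.frac_closed[OF q(1) u(1)])
    have "\<kappa> l \<otimes>\<^bsub>K\<^esub> j u = j q"
      using RS.frac_clear[OF q(1) u(1)] k.hom_mult[OF l h.hom_closed[OF uR]] by (simp add: j_def l_def L_def \<iota>_def)
    then have "(\<kappa> l) \<otimes>\<^bsub>K\<^esub> j (u \<otimes> b) = x \<otimes>\<^bsub>K\<^esub> j (u \<otimes> b)"
      using jz q uR b k.hom_closed[OF l] by (simp add: K.m_assoc[symmetric] K.m_comm)
    moreover have "j (u \<otimes> b) \<noteq> \<zero>\<^bsub>K\<^esub>" using j0[of "u \<otimes> b"] integral[of u b] uR b RS.S_nonzero[OF u(1)] by auto
    ultimately have "\<kappa> l = x" using K.m_rcancel[of "j (u \<otimes> b)" "\<kappa> l" x] uR b x k.hom_closed[OF l] by simp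
    then show ?thesis using l by blast
  qed
  then show "integrally_closed_domain (localization R (carrier R - P))"
    unfolding integrally_closed_domain_def Let_def S_def[symmetric] L_def[symmetric] T_def[symmetric] K_def[symmetric] \<kappa>_def[symmetric]
    using L.domain_axioms by blast
qed

section \<open>The gauge action and its invariants\<close>

lemma GL_inverse:
  assumes "g \<in> carrier (GL k)"
  shows "g \<in> carrier_mat k k" "inv\<^bsub>GL k\<^esub> g \<in> carrier_mat k k" "g * inv\<^bsub>GL k\<^esub> g = 1\<^sub>m k" "inv\<^bsub>GL k\<^esub> g * g = 1\<^sub>m k"
proof -
  interpret M: ring "ring_mat TYPE(complex) k ()" by (rule ring_mat)
  interpret G: group "GL k" unfolding GL_def by (rule M.units_group)
  have U: "x \<in> carrier_mat k k" if "x \<in> carrier (GL k)" for x using that M.Units_closed[of x] by (simp add: GL_def units_of_carrier ring_mat_simps)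
  show "g \<in> carrier_mat k k" "inv\<^bsub>GL k\<^esub> g \<in> carrier_mat k k" using U assms by auto
  show "g * inv\<^bsub>GL k\<^esub> g = 1\<^sub>m k" "inv\<^bsub>GL k\<^esub> g * g = 1\<^sub>m k" using G.r_inv[OF assms] G.l_inv[OF assms]
    by (simp_all add: GL_def units_of_mult units_of_one ring_mat_simps)
qed

lemma mat_mult_entry:
  "A \<in> carrier_mat n m \<Longrightarrow> B \<in> carrier_mat m k \<Longrightarrow> i < n \<Longrightarrow> j < k \<Longrightarrow> (A * B) $$ (i, j) = (\<Sum>w<m. A $$ (i, w) * B $$ (w, j))"
  by (auto simp: scalar_prod_def atLeast0LessThan)

lemma conjugate_product:
  fixes g :: "complex mat"
  assumes c: "g \<in> carrier_mat n n" "gi \<in> carrier_mat n n" "B \<in> carrier_mat n m" "B' \<in> carrier_mat m n" "s \<in> carrier_mat m m" "si \<in> carrier_mat m m"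
    and si: "si * s = 1\<^sub>m m"
  shows "(g * B * si) * (s * B' * gi) = g * (B * B') * gi"
proof -
  have "(g * B * si) * (s * B' * gi) = ((g * B * si) * (s * B')) * gi"
    by (rule assoc_mult_mat[symmetric, of _ n m _ n _ n]) (use c in auto)
  also have "(g * B * si) * (s * B') = (g * B) * (si * (s * B'))" by (rule assoc_mult_mat[of _ n m _ m _ n]) (use c in auto)
  also have "si * (s * B') = (si * s) * B'" by (rule assoc_mult_mat[symmetric, of _ m m _ m _ n]) (use c in auto)
  also have "\<dots> = B'" using si c by simp
  also have "(g * B) * B' = g * (B * B')" by (rule assoc_mult_mat[of _ n n _ m _ n]) (use c in auto)
  finally show ?thesis .
qed

lemma finsum_conjugate:
  assumes A: "finite A" and F: "\<And>h. h \<in> A \<Longrightarrow> F h \<in> carrier_mat n n" and g: "g \<in> carrier_mat n n" "gi \<in> carrier_mat n n"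
  shows "finsum (ring_mat TYPE(complex) n ()) (\<lambda>h. g * F h * gi) A = g * finsum (ring_mat TYPE(complex) n ()) F A * gi"
proof -
  let ?sum = "finsum (ring_mat TYPE(complex) n ())"
  interpret M: ring "ring_mat TYPE(complex) n ()" by (rule ring_mat)
  have 1: "g * ?sum F A = ?sum (\<lambda>h. g * F h) A"
    using M.finsum_rdistr[of A g F] A F g by (simp add: ring_mat_simps Pi_def)
  have "?sum (\<lambda>h. g * F h) A * gi = ?sum (\<lambda>h. g * F h * gi) A"
    using M.finsum_ldistr[of A gi "\<lambda>h. g * F h"] A F g by (simp add: ring_mat_simps Pi_def)
  then show ?thesis using 1 by simp
qed

context regular_quiver begin

abbreviation "G \<equiv> gauge_group Q v"
abbreviation "act \<equiv> gauge_act Q v"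
abbreviation "\<Lambda> \<equiv> Lambda0 Q d v"
abbreviation "P \<equiv> polyfuns (rep_coords Q d v)"

lemma gauge: assumes "g \<in> G" "i \<in> verts Q"
  shows "g i \<in> carrier_mat (v i) (v i)" "inv\<^bsub>GL (v i)\<^esub> g i \<in> carrier_mat (v i) (v i)"
    "g i * inv\<^bsub>GL (v i)\<^esub> g i = 1\<^sub>m (v i)" "inv\<^bsub>GL (v i)\<^esub> g i * g i = 1\<^sub>m (v i)"
proof -
  have "g i \<in> carrier (GL (v i))" using assms by (auto simp: gauge_group_def)
  from GL_inverse[OF this] show "g i \<in> carrier_mat (v i) (v i)" "inv\<^bsub>GL (v i)\<^esub> g i \<in> carrier_mat (v i) (v i)"
    "g i * inv\<^bsub>GL (v i)\<^esub> g i = 1\<^sub>m (v i)" "inv\<^bsub>GL (v i)\<^esub> g i * g i = 1\<^sub>m (v i)" .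
qed

lemma ends: "h \<in> arrows Q \<Longrightarrow> src Q h \<in> verts Q" "h \<in> arrows Q \<Longrightarrow> tgt Q h \<in> verts Q"
  using bar(5,6) by (auto simp: N_def)

lemma rep_mats:
  assumes "(B, \<gamma>, \<delta>) \<in> rep_space Q d v"
  shows "h \<in> arrows Q \<Longrightarrow> B h \<in> carrier_mat (v (tgt Q h)) (v (src Q h))"
    and "i \<in> verts Q \<Longrightarrow> \<gamma> i \<in> carrier_mat (v i) (d i)" and "i \<in> verts Q \<Longrightarrow> \<delta> i \<in> carrier_mat (d i) (v i)"
  using assms by (auto simp: rep_space_def)

lemma act_rep: assumes g: "g \<in> G" and s: "s \<in> rep_space Q d v" shows "act g s \<in> rep_space Q d v"
proof -
  obtain B \<gamma> \<delta> where sB: "s = (B, \<gamma>, \<delta>)" by (cases s)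
  note m = rep_mats[OF s[unfolded sB]]
  show ?thesis unfolding sB gauge_act_def rep_space_def
    by (auto intro!: mult_carrier_mat m gauge(1,2)[OF g] ends)
qed

lemma moment_act:
  assumes g: "g \<in> G" and s: "s \<in> rep_space Q d v" and i: "i \<in> verts Q"
  shows "moment Q v (act g s) i = g i * moment Q v s i * inv\<^bsub>GL (v i)\<^esub> g i"
proof -
  obtain B \<gamma> \<delta> where sB: "s = (B, \<gamma>, \<delta>)" by (cases s)
  note m = rep_mats[OF s[unfolded sB]]
  note gi = gauge[OF g i]
  let ?sum = "finsum (ring_mat TYPE(complex) (v i) ())"
  let ?A = "{h \<in> arrows Q. tgt Q h = i}" and ?F = "\<lambda>h. of_int (eps Q h) \<cdot>\<^sub>m (B h * B (bar Q h))"
  let ?B = "\<lambda>h\<in>arrows Q. g (tgt Q h) * B h * inv\<^bsub>GL (v (src Q h))\<^esub> g (src Q h)" and ?i = "inv\<^bsub>GL (v i)\<^esub> g i"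
  have BB: "B h \<in> carrier_mat (v i) (v (src Q h))" "B (bar Q h) \<in> carrier_mat (v (src Q h)) (v i)" if "h \<in> ?A" for h
    using m(1)[of h] m(1)[of "bar Q h"] that bar by auto
  have F: "?F h \<in> carrier_mat (v i) (v i)" if "h \<in> ?A" for h using BB[OF that] by auto
  have "of_int (eps Q h) \<cdot>\<^sub>m (?B h * ?B (bar Q h)) = g i * ?F h * ?i" if h: "h \<in> ?A" for h
  proof -
    have hA: "h \<in> arrows Q" "tgt Q h = i" using h by auto
    note gs = gauge[OF g ends(1)[OF hA(1)]]
    have "?B h * ?B (bar Q h) = (g i * B h * inv\<^bsub>GL (v (src Q h))\<^esub> g (src Q h)) * (g (src Q h) * B (bar Q h) * ?i)"
      using hA bar(1,3,4)[OF hA(1)] by simp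
    also have "\<dots> = g i * (B h * B (bar Q h)) * ?i"
      by (rule conjugate_product[OF gi(1,2) BB[OF h] gs(1,2,4)])
    finally show ?thesis using BB[OF h] gi by (simp add: mult_smult_distrib[of _ "v i" "v i" _ "v i"] mult_smult_assoc_mat[of _ "v i" "v i" _ "v i"])
  qed
  then have "?sum (\<lambda>h. of_int (eps Q h) \<cdot>\<^sub>m (?B h * ?B (bar Q h))) ?A =
    ?sum (\<lambda>h. g i * ?F h * ?i) ?A"
  proof -
    assume eq: "\<And>h. h \<in> ?A \<Longrightarrow> of_int (eps Q h) \<cdot>\<^sub>m (?B h * ?B (bar Q h)) = g i * ?F h * ?i"
    interpret M: ring "ring_mat TYPE(complex) (v i) ()" by (rule ring_mat)
    show ?thesis by (rule M.finsum_cong'[OF refl]) (use F gi eq in \<open>auto simp: ring_mat_simps\<close>)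
  qed
  also have "\<dots> = g i * ?sum ?F ?A * ?i"
    by (rule finsum_conjugate) (use F gi finA in auto)
  finally have 1: "?sum (\<lambda>h. of_int (eps Q h) \<cdot>\<^sub>m (?B h * ?B (bar Q h))) ?A =
    g i * ?sum ?F ?A * ?i" .
  have fc: "?sum ?F ?A \<in> carrier_mat (v i) (v i)" using finsum_mat_entry[of ?A ?F "v i"] F finA by auto
  have gd: "\<gamma> i * \<delta> i \<in> carrier_mat (v i) (v i)" using m(2,3)[OF i] by auto
  have "(g i * \<gamma> i) * (\<delta> i * ?i) = ((g i * \<gamma> i) * \<delta> i) * ?i" by (rule assoc_mult_mat[symmetric]) (use m(2,3)[OF i] gi in auto)
  also have "(g i * \<gamma> i) * \<delta> i = g i * (\<gamma> i * \<delta> i)" by (rule assoc_mult_mat) (use m(2,3)[OF i] gi in auto)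
  finally have 2: "(g i * \<gamma> i) * (\<delta> i * ?i) = g i * (\<gamma> i * \<delta> i) * ?i" .
  have "moment Q v (act g s) i = g i * ?sum ?F ?A * ?i + g i * (\<gamma> i * \<delta> i) * ?i"
    using 1 2 i by (simp add: sB gauge_act_def moment_def)
  also have "\<dots> = g i * (?sum ?F ?A + \<gamma> i * \<delta> i) * ?i"
    using fc gd gi by (simp add: mult_add_distrib_mat[of _ "v i" "v i" _ "v i"] add_mult_distrib_mat[of _ "v i" "v i" _ _ "v i"])
  finally show ?thesis by (simp add: sB moment_def)
qed

lemma act_Lambda0: assumes g: "g \<in> G" and s: "s \<in> \<Lambda>" shows "act g s \<in> \<Lambda>"
proof -
  have s: "s \<in> rep_space Q d v" "\<And>i. i \<in> verts Q \<Longrightarrow> moment Q v s i = 0\<^sub>m (v i) (v i)" using s by (auto simp: Lambda0_def)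
  have "moment Q v (act g s) i = 0\<^sub>m (v i) (v i)" if i: "i \<in> verts Q" for i
    unfolding moment_act[OF g s(1) i] s(2)[OF i]
    using right_mult_zero_mat[OF gauge(1)[OF g i]] left_mult_zero_mat[OF gauge(2)[OF g i]] by simp
  then show ?thesis using act_rep[OF g s(1)] by (simp add: Lambda0_def)
qed

lemma rep_coordsI:
  "h \<in> arrows Q \<Longrightarrow> r < v (tgt Q h) \<Longrightarrow> c < v (src Q h) \<Longrightarrow> (\<lambda>(B, \<gamma>, \<delta>). B h $$ (r, c)) \<in> rep_coords Q d v"
  "i \<in> verts Q \<Longrightarrow> r < v i \<Longrightarrow> c < d i \<Longrightarrow> (\<lambda>(B, \<gamma>, \<delta>). \<gamma> i $$ (r, c)) \<in> rep_coords Q d v"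
  "i \<in> verts Q \<Longrightarrow> r < d i \<Longrightarrow> c < v i \<Longrightarrow> (\<lambda>(B, \<gamma>, \<delta>). \<delta> i $$ (r, c)) \<in> rep_coords Q d v"
  by (force simp: rep_coords_def)+

lemma act_coordinate:
  assumes g: "g \<in> G" and f: "f \<in> rep_coords Q d v"
  shows "polyon (rep_space Q d v) (rep_coords Q d v) (\<lambda>s. f (act g s))"
proof -
  consider (B) h r c where "f = (\<lambda>(B, \<gamma>, \<delta>). B h $$ (r, c))" "h \<in> arrows Q" "r < v (tgt Q h)" "c < v (src Q h)"
    | (\<gamma>) i r c where "f = (\<lambda>(B, \<gamma>, \<delta>). \<gamma> i $$ (r, c))" "i \<in> verts Q" "r < v i" "c < d i"
    | (\<delta>) i r c where "f = (\<lambda>(B, \<gamma>, \<delta>). \<delta> i $$ (r, c))" "i \<in> verts Q" "r < d i" "c < v i"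
    using f unfolding rep_coords_def by blast
  then show ?thesis
  proof cases
    case B
    let ?i = "inv\<^bsub>GL (v (src Q h))\<^esub> g (src Q h)"
    have "polyon (rep_space Q d v) (rep_coords Q d v)
        (\<lambda>s. \<Sum>u<v (src Q h). (\<Sum>w<v (tgt Q h). g (tgt Q h) $$ (r, w) * (\<lambda>(B, \<gamma>, \<delta>). B h $$ (w, u)) s) * ?i $$ (u, c))"
      using B by (intro polyon_sum polyon_mult polyon_const polyon_coord rep_coordsI) auto
    then show ?thesis
    proof (rule polyon_cong)
      fix s assume s: "s \<in> rep_space Q d v"
      obtain B' \<gamma> \<delta> where sB: "s = (B', \<gamma>, \<delta>)" by (cases s)
      note m = rep_mats(1)[OF s[unfolded sB] B(2)] and gt = gauge(1)[OF g ends(2)[OF B(2)]] and gs = gauge(2)[OF g ends(1)[OF B(2)]]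
      have "f (act g s) = (g (tgt Q h) * B' h * ?i) $$ (r, c)" using B by (simp add: sB gauge_act_def)
      also have "\<dots> = (\<Sum>u<v (src Q h). (g (tgt Q h) * B' h) $$ (r, u) * ?i $$ (u, c))"
        by (rule mat_mult_entry[OF mult_carrier_mat[OF gt m] gs B(3,4)])
      also have "\<dots> = (\<Sum>u<v (src Q h). (\<Sum>w<v (tgt Q h). g (tgt Q h) $$ (r, w) * B' h $$ (w, u)) * ?i $$ (u, c))"
        by (rule sum.cong[OF refl]) (simp add: mat_mult_entry[OF gt m B(3)] del: index_mult_mat)
      finally show "f (act g s) = (\<Sum>u<v (src Q h). (\<Sum>w<v (tgt Q h). g (tgt Q h) $$ (r, w) * (\<lambda>(B, \<gamma>, \<delta>). B h $$ (w, u)) s) * ?i $$ (u, c))"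
        by (simp add: sB)
    qed
  next
    case \<gamma>
    have "polyon (rep_space Q d v) (rep_coords Q d v) (\<lambda>s. \<Sum>w<v i. g i $$ (r, w) * (\<lambda>(B, \<gamma>, \<delta>). \<gamma> i $$ (w, c)) s)"
      using \<gamma> by (intro polyon_sum polyon_mult polyon_const polyon_coord rep_coordsI) auto
    then show ?thesis
      by (rule polyon_cong) (use \<gamma> mat_mult_entry[OF gauge(1)[OF g \<gamma>(2)] rep_mats(2)[OF _ \<gamma>(2)] \<gamma>(3,4)] in \<open>auto simp: gauge_act_def simp del: index_mult_mat\<close>)
  next
    case \<delta>
    have "polyon (rep_space Q d v) (rep_coords Q d v) (\<lambda>s. \<Sum>w<v i. (\<lambda>(B, \<gamma>, \<delta>). \<delta> i $$ (r, w)) s * (inv\<^bsub>GL (v i)\<^esub> g i) $$ (w, c))"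
      using \<delta> by (intro polyon_sum polyon_mult polyon_const polyon_coord rep_coordsI) auto
    then show ?thesis
      by (rule polyon_cong) (use \<delta> mat_mult_entry[OF rep_mats(3)[OF _ \<delta>(2)] gauge(2)[OF g \<delta>(2)] \<delta>(3,4)] in \<open>auto simp: gauge_act_def simp del: index_mult_mat\<close>)
  qed
qed

text \<open>Since the translate of a polynomial function is polynomial, irreducibility can be used to test invariance.\<close>

lemma act_polyfuns: "f \<in> P \<Longrightarrow> g \<in> G \<Longrightarrow> polyon (rep_space Q d v) (rep_coords Q d v) (\<lambda>s. f (act g s))"
  by (induction rule: polyfuns.induct) (auto intro: polyon_const polyon_add polyon_mult act_coordinate)

abbreviation "R \<equiv> invariant_ring Q d v"

lemma R_I: "f \<in> P \<Longrightarrow> (\<And>g x. g \<in> G \<Longrightarrow> x \<in> \<Lambda> \<Longrightarrow> f (act g x) = f x) \<Longrightarrow> restrict f \<Lambda> \<in> carrier R"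
  using act_Lambda0 by (auto simp: invariant_ring_def invariant_functions_def Lambda0_functions_def)

lemma R_E:
  assumes "f \<in> carrier R"
  obtains \<phi> where "\<phi> \<in> P" "f = restrict \<phi> \<Lambda>" "\<And>g x. g \<in> G \<Longrightarrow> x \<in> \<Lambda> \<Longrightarrow> \<phi> (act g x) = \<phi> x"
proof -
  obtain \<phi> where "\<phi> \<in> P" "f = restrict \<phi> \<Lambda>" using assms by (auto simp: invariant_ring_def invariant_functions_def Lambda0_functions_def)
  moreover have "\<phi> (act g x) = \<phi> x" if "g \<in> G" "x \<in> \<Lambda>" for g x
  proof -
    have "f (act g x) = f x" using assms that by (simp add: invariant_ring_def invariant_functions_def)
    then show ?thesis using act_Lambda0[OF that] that \<open>f = _\<close> by simp
  qed
  ultimately show thesis using that by blast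
qed

lemma R_ops: "f \<oplus>\<^bsub>R\<^esub> g = (\<lambda>x\<in>\<Lambda>. f x + g x)" "f \<otimes>\<^bsub>R\<^esub> g = (\<lambda>x\<in>\<Lambda>. f x * g x)"
  "\<one>\<^bsub>R\<^esub> = (\<lambda>x\<in>\<Lambda>. 1)" "\<zero>\<^bsub>R\<^esub> = (\<lambda>x\<in>\<Lambda>. 0)"
  by (simp_all add: invariant_ring_def)

lemma R_const: "(\<lambda>x\<in>\<Lambda>. c) \<in> carrier R" by (rule R_I) (auto intro: polyfuns.const)

lemma R_closed:
  assumes f: "f \<in> carrier R" and g: "g \<in> carrier R"
  shows R_add: "f \<oplus>\<^bsub>R\<^esub> g \<in> carrier R" and R_mult: "f \<otimes>\<^bsub>R\<^esub> g \<in> carrier R"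
proof -
  obtain \<phi> where f: "\<phi> \<in> P" "f = restrict \<phi> \<Lambda>" "\<And>g x. g \<in> G \<Longrightarrow> x \<in> \<Lambda> \<Longrightarrow> \<phi> (act g x) = \<phi> x" using R_E[OF f] by metis
  obtain \<psi> where g: "\<psi> \<in> P" "g = restrict \<psi> \<Lambda>" "\<And>g x. g \<in> G \<Longrightarrow> x \<in> \<Lambda> \<Longrightarrow> \<psi> (act g x) = \<psi> x" using R_E[OF g] by metis
  have "f \<oplus>\<^bsub>R\<^esub> g = restrict (\<lambda>x. \<phi> x + \<psi> x) \<Lambda>" "f \<otimes>\<^bsub>R\<^esub> g = restrict (\<lambda>x. \<phi> x * \<psi> x) \<Lambda>"
    by (auto simp: R_ops f(2) g(2) restrict_def)
  then show "f \<oplus>\<^bsub>R\<^esub> g \<in> carrier R" "f \<otimes>\<^bsub>R\<^esub> g \<in> carrier R"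
    using R_I[of "\<lambda>x. \<phi> x + \<psi> x"] R_I[of "\<lambda>x. \<phi> x * \<psi> x"] f g by (simp_all add: polyfuns.intros)
qed

lemma R_eqI: assumes "f \<in> extensional \<Lambda>" "g \<in> extensional \<Lambda>" "\<And>x. x \<in> \<Lambda> \<Longrightarrow> f x = g x" shows "f = g"
  using assms by (rule extensionalityI)

lemma R_ext: "f \<in> carrier R \<Longrightarrow> f \<in> extensional \<Lambda>" by (erule R_E) simp

lemma Lambda0_nonempty: "\<Lambda> \<noteq> {}" using pt_Lambda0[OF lf.zero_in_X] by blast

lemma domain_R: "domain R"
proof -
  have cr: "cring R"
  proof (rule cringI)
    show "abelian_group R"
    proof (rule abelian_groupI)
      fix f assume f: "f \<in> carrier R"
      have "(\<lambda>x\<in>\<Lambda>. - 1) \<otimes>\<^bsub>R\<^esub> f \<in> carrier R" by (rule R_mult[OF R_const f])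
      moreover have "((\<lambda>x\<in>\<Lambda>. - 1) \<otimes>\<^bsub>R\<^esub> f) \<oplus>\<^bsub>R\<^esub> f = \<zero>\<^bsub>R\<^esub>" by (rule R_eqI) (simp_all add: R_ops)
      ultimately show "\<exists>y\<in>carrier R. y \<oplus>\<^bsub>R\<^esub> f = \<zero>\<^bsub>R\<^esub>" by (intro bexI[of _ "(\<lambda>x\<in>\<Lambda>. - 1) \<otimes>\<^bsub>R\<^esub> f"])
      show "\<zero>\<^bsub>R\<^esub> \<oplus>\<^bsub>R\<^esub> f = f" by (rule R_eqI) (simp_all add: R_ops R_ext f)
      fix g assume g: "g \<in> carrier R"
      show "f \<oplus>\<^bsub>R\<^esub> g \<in> carrier R" by (rule R_add[OF f g])
      show "f \<oplus>\<^bsub>R\<^esub> g = g \<oplus>\<^bsub>R\<^esub> f" by (rule R_eqI) (simp_all add: R_ops add.commute)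
      show "f \<oplus>\<^bsub>R\<^esub> g \<oplus>\<^bsub>R\<^esub> h = f \<oplus>\<^bsub>R\<^esub> (g \<oplus>\<^bsub>R\<^esub> h)" for h by (rule R_eqI) (simp_all add: R_ops add.assoc)
    qed (rule R_const[of 0, folded R_ops])
    show "comm_monoid R"
    proof (rule comm_monoidI)
      fix f assume f: "f \<in> carrier R"
      show "\<one>\<^bsub>R\<^esub> \<otimes>\<^bsub>R\<^esub> f = f" by (rule R_eqI) (simp_all add: R_ops R_ext f)
      fix g assume g: "g \<in> carrier R"
      show "f \<otimes>\<^bsub>R\<^esub> g \<in> carrier R" by (rule R_mult[OF f g])
      show "f \<otimes>\<^bsub>R\<^esub> g = g \<otimes>\<^bsub>R\<^esub> f" by (rule R_eqI) (simp_all add: R_ops mult.commute)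
      show "f \<otimes>\<^bsub>R\<^esub> g \<otimes>\<^bsub>R\<^esub> h = f \<otimes>\<^bsub>R\<^esub> (g \<otimes>\<^bsub>R\<^esub> h)" for h by (rule R_eqI) (simp_all add: R_ops mult.assoc)
    qed (rule R_const[of 1, folded R_ops])
    fix f g h
    show "(f \<oplus>\<^bsub>R\<^esub> g) \<otimes>\<^bsub>R\<^esub> h = f \<otimes>\<^bsub>R\<^esub> h \<oplus>\<^bsub>R\<^esub> g \<otimes>\<^bsub>R\<^esub> h" by (rule R_eqI) (simp_all add: R_ops distrib_right)
  qed
  show ?thesis
  proof (intro domain.intro domain_axioms.intro cr)
    obtain x where "x \<in> \<Lambda>" using Lambda0_nonempty by blast
    then show "\<one>\<^bsub>R\<^esub> \<noteq> \<zero>\<^bsub>R\<^esub>" by (metis R_ops(3,4) restrict_apply' zero_neq_one)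
    fix f g assume fg: "f \<otimes>\<^bsub>R\<^esub> g = \<zero>\<^bsub>R\<^esub>" and "f \<in> carrier R" "g \<in> carrier R"
    then obtain \<phi> \<psi> where p: "\<phi> \<in> P" "f = restrict \<phi> \<Lambda>" "\<psi> \<in> P" "g = restrict \<psi> \<Lambda>" by (elim R_E)
    have "\<phi> x * \<psi> x = 0" if "x \<in> \<Lambda>" for x using fun_cong[OF fg, of x] that by (simp add: R_ops p)
    from Lambda0_domain[OF p(1,3) this] show "f = \<zero>\<^bsub>R\<^esub> \<or> g = \<zero>\<^bsub>R\<^esub>" by (auto simp: p R_ops intro!: restrict_ext)
  qed
qed

lemma R_eval:
  assumes x: "x \<in> \<Lambda>"
  shows "(f [^]\<^bsub>R\<^esub> (n :: nat)) x = f x ^ n"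
    and "finite A \<Longrightarrow> F \<in> A \<rightarrow> carrier R \<Longrightarrow> (\<Oplus>\<^bsub>R\<^esub>i\<in>A. F i) x = (\<Sum>i\<in>A. F i x)"
proof -
  interpret R: domain R by (rule domain_R)
  show "(f [^]\<^bsub>R\<^esub> n) x = f x ^ n" using x by (induction n) (simp_all add: R_ops)
  show "(\<Oplus>\<^bsub>R\<^esub>i\<in>A. F i) x = (\<Sum>i\<in>A. F i x)" if "finite A" "F \<in> A \<rightarrow> carrier R"
    using that by (induction A rule: finite_induct) (use x in \<open>simp_all add: R_ops\<close>)
qed

text \<open>A quotient q of invariants a = b q is polynomial by the integral closedness upstairs, and b (q o g - q) = 0 on \<Lambda>
  shows that it is invariant.\<close>

theorem normal_R: "normal_spec R"
proof -
  interpret R: domain R by (rule domain_R)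
  show ?thesis
  proof (rule R.normal_spec_if_integrally_closed)
    fix a b c and n :: nat
    assume a: "a \<in> carrier R" and b: "b \<in> carrier R" "b \<noteq> \<zero>\<^bsub>R\<^esub>" and c: "c \<in> {..<n} \<rightarrow> carrier R"
      and eq: "a [^]\<^bsub>R\<^esub> n \<oplus>\<^bsub>R\<^esub> (\<Oplus>\<^bsub>R\<^esub>i\<in>{..<n}. (c i \<otimes>\<^bsub>R\<^esub> b [^]\<^bsub>R\<^esub> (n - i)) \<otimes>\<^bsub>R\<^esub> a [^]\<^bsub>R\<^esub> i) = \<zero>\<^bsub>R\<^esub>"
    obtain \<alpha> where \<alpha>: "\<alpha> \<in> P" "a = restrict \<alpha> \<Lambda>" "\<And>g x. g \<in> G \<Longrightarrow> x \<in> \<Lambda> \<Longrightarrow> \<alpha> (act g x) = \<alpha> x" using R_E[OF a] by metis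
    obtain \<beta> where \<beta>: "\<beta> \<in> P" "b = restrict \<beta> \<Lambda>" "\<And>g x. g \<in> G \<Longrightarrow> x \<in> \<Lambda> \<Longrightarrow> \<beta> (act g x) = \<beta> x" using R_E[OF b(1)] by metis
    have "\<forall>i\<in>{..<n}. \<exists>\<phi>. \<phi> \<in> P \<and> c i = restrict \<phi> \<Lambda>"
    proof
      fix i assume "i \<in> {..<n}"
      then have "c i \<in> carrier R" using c by blast
      then show "\<exists>\<phi>. \<phi> \<in> P \<and> c i = restrict \<phi> \<Lambda>" by (rule R_E) blast
    qed
    from bchoice[OF this] obtain \<gamma> where \<gamma>: "\<forall>i\<in>{..<n}. \<gamma> i \<in> P \<and> c i = restrict (\<gamma> i) \<Lambda>" by (elim exE)
    obtain s0 where s0: "s0 \<in> \<Lambda>" "\<beta> s0 \<noteq> 0"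
    proof -
      have "\<exists>s\<in>\<Lambda>. \<beta> s \<noteq> 0"
      proof (rule ccontr)
        assume "\<not> ?thesis"
        then have "b = \<zero>\<^bsub>R\<^esub>" by (auto simp: \<beta>(2) R_ops intro!: restrict_ext)
        then show False using b(2) by simp
      qed
      then show thesis using that by blast
    qed
    have "\<exists>q\<in>P. \<forall>s\<in>\<Lambda>. \<alpha> s = \<beta> s * q s"
    proof (rule Lambda0_integrally_closed[OF \<alpha>(1) \<beta>(1) _ _ s0])
      show "\<gamma> i \<in> P" if "i < n" for i using \<gamma> that by blast
      fix x assume x: "x \<in> \<Lambda>"
      have F: "(\<lambda>i. (c i \<otimes>\<^bsub>R\<^esub> b [^]\<^bsub>R\<^esub> (n - i)) \<otimes>\<^bsub>R\<^esub> a [^]\<^bsub>R\<^esub> i) \<in> {..<n} \<rightarrow> carrier R" using a b(1) c by auto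
      have "(a [^]\<^bsub>R\<^esub> n \<oplus>\<^bsub>R\<^esub> (\<Oplus>\<^bsub>R\<^esub>i\<in>{..<n}. (c i \<otimes>\<^bsub>R\<^esub> b [^]\<^bsub>R\<^esub> (n - i)) \<otimes>\<^bsub>R\<^esub> a [^]\<^bsub>R\<^esub> i)) x = 0" unfolding eq using x by (simp add: R_ops)
      then have "a x ^ n + (\<Sum>i<n. ((c i \<otimes>\<^bsub>R\<^esub> b [^]\<^bsub>R\<^esub> (n - i)) \<otimes>\<^bsub>R\<^esub> a [^]\<^bsub>R\<^esub> i) x) = 0"
        using x R_eval(2)[OF x finite_lessThan F] R_eval(1)[OF x, of a n] by (simp add: R_ops(1))
      moreover have "(\<Sum>i<n. ((c i \<otimes>\<^bsub>R\<^esub> b [^]\<^bsub>R\<^esub> (n - i)) \<otimes>\<^bsub>R\<^esub> a [^]\<^bsub>R\<^esub> i) x) = (\<Sum>i<n. \<gamma> i x * \<alpha> x ^ i * \<beta> x ^ (n - i))"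
      proof (rule sum.cong[OF refl])
        fix i assume "i \<in> {..<n}"
        from bspec[OF \<gamma> this] have "c i = restrict (\<gamma> i) \<Lambda>" ..
        then show "((c i \<otimes>\<^bsub>R\<^esub> b [^]\<^bsub>R\<^esub> (n - i)) \<otimes>\<^bsub>R\<^esub> a [^]\<^bsub>R\<^esub> i) x = \<gamma> i x * \<alpha> x ^ i * \<beta> x ^ (n - i)"
          using x R_eval(1)[OF x, of a i] R_eval(1)[OF x, of b "n - i"] by (simp add: R_ops(2) \<alpha>(2) \<beta>(2))
      qed
      ultimately show "\<alpha> x ^ n + (\<Sum>i<n. \<gamma> i x * \<alpha> x ^ i * \<beta> x ^ (n - i)) = 0" using x by (simp add: \<alpha>(2))
    qed
    then obtain q where q: "q \<in> P" "\<forall>s\<in>\<Lambda>. \<alpha> s = \<beta> s * q s" by (elim bexE)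
    have "q (act g x) = q x" if g: "g \<in> G" and x: "x \<in> \<Lambda>" for g x
    proof -
      obtain q' where q': "q' \<in> P" "\<forall>s\<in>rep_space Q d v. q (act g s) = q' s" using act_polyfuns[OF q(1) g] unfolding polyon_def by (elim bexE)
      have "\<beta> s * (q' s - q s) = 0" if s: "s \<in> \<Lambda>" for s
      proof -
        have "\<beta> s * q' s = \<beta> (act g s) * q (act g s)" using \<beta>(3)[OF g s] bspec[OF q'(2), of s] s by (simp add: Lambda0_def)
        also have "\<dots> = \<alpha> (act g s)" using bspec[OF q(2) act_Lambda0[OF g s]] by simp
        also have "\<dots> = \<beta> s * q s" using \<alpha>(3)[OF g s] bspec[OF q(2) s] by simp
        finally show ?thesis by (simp add: algebra_simps)
      qed
      from Lambda0_domain[OF \<beta>(1) polyfuns_diff[OF q'(1) q(1)] this] have "\<forall>s\<in>\<Lambda>. q' s - q s = 0" using s0 by blast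
      from bspec[OF this x] show ?thesis using bspec[OF q'(2), of x] x by (simp add: Lambda0_def)
    qed
    then have "restrict q \<Lambda> \<in> carrier R" by (rule R_I[OF q(1)])
    moreover have "a = b \<otimes>\<^bsub>R\<^esub> restrict q \<Lambda>" by (rule R_eqI) (use q(2) in \<open>simp_all add: R_ops \<alpha>(2) \<beta>(2)\<close>)
    ultimately show "\<exists>q\<in>carrier R. a = b \<otimes>\<^bsub>R\<^esub> q" by (intro bexI[of _ "restrict q \<Lambda>"])
  qed
qed

text \<open>Principal open sets are closed under intersection because f g is nonzero exactly where f and g are.\<close>

lemma zariski_basis:
  assumes "openin (zariski K X) U" "x \<in> U"
  shows "\<exists>f\<in>polyfuns K. f x \<noteq> 0 \<and> {y \<in> X. f y \<noteq> 0} \<subseteq> U"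
proof -
  have "generate_topology_on {{x \<in> X. f x \<noteq> 0} |f. f \<in> polyfuns K} U"
    using assms(1) by (simp add: zariski_def openin_topology_generated_by_iff)
  then have "\<forall>x\<in>U. \<exists>f\<in>polyfuns K. f x \<noteq> 0 \<and> {y \<in> X. f y \<noteq> 0} \<subseteq> U"
  proof (induction rule: generate_topology_on.induct)
    case (Int A B)
    show ?case
    proof
      fix x assume x: "x \<in> A \<inter> B"
      obtain f where f: "f \<in> polyfuns K" "f x \<noteq> 0" "{y \<in> X. f y \<noteq> 0} \<subseteq> A" using Int.IH(1) x by blast
      obtain g where g: "g \<in> polyfuns K" "g x \<noteq> 0" "{y \<in> X. g y \<noteq> 0} \<subseteq> B" using Int.IH(2) x by blast
      show "\<exists>f\<in>polyfuns K. f x \<noteq> 0 \<and> {y \<in> X. f y \<noteq> 0} \<subseteq> A \<inter> B"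
        by (rule bexI[OF _ polyfuns.mult[OF f(1) g(1)]]) (use f g in auto)
    qed
  next
    case (UN k)
    show ?case
    proof
      fix x assume "x \<in> \<Union>k"
      then obtain A where A: "A \<in> k" "x \<in> A" by blast
      obtain f where "f \<in> polyfuns K" "f x \<noteq> 0" "{y \<in> X. f y \<noteq> 0} \<subseteq> A" using UN.IH[OF A(1)] A(2) by blast
      then show "\<exists>f\<in>polyfuns K. f x \<noteq> 0 \<and> {y \<in> X. f y \<noteq> 0} \<subseteq> \<Union>k" using A(1) by blast
    qed
  next
    case (Basis A)
    then obtain f where "f \<in> polyfuns K" "A = {x \<in> X. f x \<noteq> 0}" by blast
    then show ?case by blast
  qed simp
  then show ?thesis using assms(2) by blast
qed

lemma topspace_zariski: "topspace (zariski K X) = X"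
proof -
  have "X = {x \<in> X. (1 :: complex) \<noteq> 0}" by simp
  then have "X \<in> {{x \<in> X. f x \<noteq> 0} |f. f \<in> polyfuns K}" using polyfuns.const[of 1 K] by (intro CollectI exI[of _ "\<lambda>_. 1"] conjI)
  then have "X \<subseteq> \<Union>{{x \<in> X. f x \<noteq> 0} |f. f \<in> polyfuns K}" by (rule Union_upper)
  moreover have "\<Union>{{x \<in> X. f x \<noteq> 0} |f. f \<in> polyfuns K} \<subseteq> X" by (rule Union_least) (elim CollectE exE conjE, simp)
  ultimately show ?thesis unfolding zariski_def topology_generated_by_topspace by (intro equalityI)
qed

text \<open>The semistable locus is open in the irreducible variety, so two nonempty open subsets meet.\<close>

lemma connected_semistable: "connected_space (zariski (rep_coords Q d v) (semistable Q m d v))" (is "connected_space ?T")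
  unfolding connected_space_def
proof
  assume "\<exists>E1 E2. openin ?T E1 \<and> openin ?T E2 \<and> topspace ?T \<subseteq> E1 \<union> E2 \<and> E1 \<inter> E2 = {} \<and> E1 \<noteq> {} \<and> E2 \<noteq> {}"
  then obtain E1 E2 where E: "openin ?T E1" "openin ?T E2" "E1 \<inter> E2 = {}" "E1 \<noteq> {}" "E2 \<noteq> {}" by blast
  obtain x y where xy: "x \<in> E1" "y \<in> E2" using E by blast
  obtain f where f: "f \<in> P" "f x \<noteq> 0" "{y \<in> semistable Q m d v. f y \<noteq> 0} \<subseteq> E1" using zariski_basis[OF E(1) xy(1)] by blast
  obtain g where g: "g \<in> P" "g y \<noteq> 0" "{y \<in> semistable Q m d v. g y \<noteq> 0} \<subseteq> E2" using zariski_basis[OF E(2) xy(2)] by blast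
  have ss: "x \<in> semistable Q m d v" "y \<in> semistable Q m d v"
    using openin_subset[OF E(1)] openin_subset[OF E(2)] xy by (auto simp: topspace_zariski)
  then obtain k F where F: "k > 0" "F \<in> Lambda0_functions Q d v" "\<forall>g\<in>G. \<forall>x\<in>\<Lambda>. F (act g x) = character Q m g ^ k * F x" "F x \<noteq> 0"
    by (auto simp: semistable_def)
  obtain \<phi> where \<phi>: "\<phi> \<in> P" "F = restrict \<phi> \<Lambda>" using F(2) by (auto simp: Lambda0_functions_def)
  have x\<Lambda>: "x \<in> \<Lambda>" "y \<in> \<Lambda>" using ss by (auto simp: semistable_def)
  have "(\<phi> s * f s) * g s = 0" if s: "s \<in> \<Lambda>" for s
  proof (cases "\<phi> s = 0")
    case False
    then have "s \<in> semistable Q m d v" unfolding semistable_def mem_Collect_eq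
      using F s \<phi>(2) by (intro conjI exI[of _ k] bexI[of _ F]) auto
    then show ?thesis using f(3) g(3) E(3) by auto
  qed simp
  from Lambda0_domain[OF polyfuns.mult[OF \<phi>(1) f(1)] g(1) this] have "\<phi> x * f x = 0 \<or> g y = 0" using x\<Lambda> by blast
  then show False using f(2) g(2) F(4) \<phi>(2) x\<Lambda>(1) by simp
qed

lemma connected_quiver_variety:
  assumes "is_quiver_variety Q m d v M \<pi>"
  shows "connected_space (ftop M)"
proof -
  let ?T = "zariski (rep_coords Q d v) (semistable Q m d v)"
  have c: "continuous_map ?T (ftop M) \<pi>" "\<pi> ` topspace ?T = topspace (ftop M)"
    using assms by (simp_all add: is_quiver_variety_def good_quotient_def embedded_def)
  have "connectedin (ftop M) (\<pi> ` topspace ?T)"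
    by (rule connectedin_continuous_map_image[OF c(1)]) (simp add: connectedin_topspace connected_semistable)
  then show ?thesis by (simp add: c(2) connectedin_topspace)
qed

end

theorem mainTheorem6:
  fixes Q :: "'h dquiver" and d v :: "nat \<Rightarrow> nat"
  assumes "double_quiver Q"
    and "finite_type Q"
    and "\<forall>i\<in>verts Q. weight_pairing Q d v i > 0"
  shows "(\<forall>(M :: 'y fspace) \<pi>. is_quiver_variety Q (\<lambda>_. 1) d v M \<pi> \<longrightarrow> connected_space (ftop M)) \<and>
         normal_spec (invariant_ring Q d v)"
proof -
  interpret regular_quiver Q d v by (rule regular_quiver.intro) fact+
  show ?thesis using connected_quiver_variety normal_R by blast
qed

end
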